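(* In the errors-in-variables model described in the context, assume the following. (1) The vectors $\tilde c_i=(\tilde c_{i1},\dots,\tilde c_{i,n+d})^\top$, $i=1,2,\dots$, are independent with zero mean and finite second moments. (2) For a fixed set $J\subset\{1,\dots,n+d\}$, one has $\mathsf E\,\tilde c_{ij}^2=0$ for every $j\notin J$ and every $i\ge1$; moreover the covariance matrix of the subvector $(\tilde c_{ij},\,j\in J)$ equals $\sigma^2\Sigma_i$, $i\ge 1$, with an unknown factor $\sigma^2>0$ and known matrices $\Sigma_i$. (3) There exists $\varkappa>0$ such that $\lambda_{\min}(\Sigma_i)\ge\varkappa^2$ for every $i\ge1$. (4) $\mathrm{rank}(Z_{0J})=d$. (5) There exists $r\ge2$ with $r>d\left(|J|-\frac{d+1}{2}\right)$ such that $\sup_{i\ge1,\,j\in J}\mathsf E|\tilde c_{ij}|^{2r}<\infty$. (6) For some $\delta>0$, $\sup_{i\ge1,\,j\in J}\mathsf E|\tilde c_{ij}|^{4+2\delta}<\infty$, and for the same $\delta$, $\frac{1}{m^{1+\delta/2}}\sum_{i=1}^m\|a_{0i}\|^{2+\delta}\to0$ as $m\to\infty$. (7) $\frac1m A_0^\top A_0\to V_A$ as $m\to\infty$, where $V_A$ is a nonsingular matrix. (8) $\Sigma_i\to\Sigma_\infty$ as $i\to\infty$, for a certain matrix $\Sigma_\infty$. (9) For all $p,q,r\in J$ (not necessarily distinct) and all $i\ge1$, $\mathsf E\,\tilde c_{ip}\tilde c_{iq}\tilde c_{ir}=0$. (10) For all $p,q,r,u\in J$ (not necessarily distinct), $\frac1m\sum_{i=1}^m\mathsf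 E\,\tilde c_{ip}\tilde c_{iq}\tilde c_{ir}\tilde c_{iu}$ converges to a finite limit $\mu_4(p,q,r,u)$ as $m\to\infty$. Let $u\in\mathbb R^{d\times1}$, $u\ne0$, and define $$\hat S_u=\hat V_A^{-1}\cdot\frac1m\sum_{i=1}^m\hat s_i\,uu^\top\hat s_i^\top,\qquad \hat s_i=\tilde s(a_i,b_i,S_i;\hat X),$$ where $\hat X$ is the EW-TLS estimator and $\hat V_A$, $\tilde s$ are defined in the context. Then $\hat S_u\to S_u$ in probability as $m\to\infty$, where $S_u=\mathbf{cov}(V_A^{-1}\Gamma(X_0)u)$ with $\Gamma(X_0)$ defined in the context.
   Context: Model. Fix positive integers $n,d$. Let $X_0\in\mathbb R^{n\times d}$ be the true value of the matrix parameter, let $a_{0i}\in\mathbb R^n$, $i=1,2,\dots$, be nonrandom vectors, and put $b_{0i}=X_0^\top a_{0i}\in\mathbb R^d$. One observes $a_i=a_{0i}+\tilde a_i$, $b_i=b_{0i}+\tilde b_i$, where $\tilde a_i,\tilde b_i$ are random errors. Put $c_i=\begin{bmatrix}a_i\\ b_i\end{bmatrix}$ and $\tilde c_i=\begin{bmatrix}\tilde a_i\\\tilde b_i\end{bmatrix}=(\tilde c_{i1},\dots,\tilde c_{i,n+d})^\top$. For each $m$, the matrices $A,A_0,B$ have rows $a_i^\top,a_{0i}^\top,b_i^\top$, $i=1,\dots,m$, and $C=[A,B]=(c_{ij})$. Notation. $Z_0=\begin{bmatrix}X_0\\-\mathrm I_d\end{bmatrix}$, $Z=Z(X)=\begin{bmatrix}X\\-\mathrm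 I_d\end{bmatrix}$ for $X\in\mathbb R^{n\times d}$, where $\mathrm I_d$ is the identity matrix of size $d$; $Z_{0J}$, $Z_J$ are the submatrices of $Z_0$, $Z$ formed by the rows with indices in $J$. $S_i:=\frac1{\sigma^2}\mathbf{cov}(\tilde c_i)\in\mathbb R^{(n+d)\times(n+d)}$, where $\mathbf{cov}$ denotes the covariance matrix of a random vector. EW-TLS estimator. The EW-TLS (element-wise weighted total least squares) problem is to minimize $\sum_{i=1}^m\|\Sigma_i^{-1/2}\Delta c_i^J\|^2$ over $X\in\mathbb R^{n\times d}$, $\Delta A\in\mathbb R^{m\times n}$, $\Delta B\in\mathbb R^{m\times d}$, subject to $(A-\Delta A)X=B-\Delta B$ and $\Delta c_{ij}=0$ for $i=1,\dots,m$, $j\notin J$, where $[\Delta A,\Delta B]=(\Delta c_{ij})$ and $\Delta c_i^J=(\Delta c_{ij},\,j\in J)\in\mathbb R^{|J|}$ (column vector). The EW-TLS estimator $\hat X$ of $X_0$ is a Borel measurable mapping of the data matrix $C$ into $\mathbb R^{n\times d}\cup\{\infty\}$ which solves this problem (i.e. is the $X$-component of a minimizer) under the additional constraint $\mathrm{rank}(Z_J)=d$, if a solution exists, and $\hat X=\infty$ otherwise. Under the hypotheses $\hat X$ is finite with probability tending to one; expressions involving $\hat X$ or $\hat V_A^{-1}$ may be given arbitrary values on the events $\{\hat X=\infty\}$ and $\{\hat V_A\text{ singular}\}$. The function $\tilde s$. For $c=\begin{bmatrix}a\\ b\end{bmatrix}$ with $a\in\mathbb R^n$, $b\in\mathbb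 R^d$, and $S=\begin{bmatrix}S_a&S_{ab}\\S_{ba}&S_b\end{bmatrix}\in\mathbb R^{(n+d)\times(n+d)}$ with $S_a\in\mathbb R^{n\times n}$, $$\tilde s(a,b,S;X)=ac^\top Z-[S_a,S_{ab}]\,Z(Z^\top SZ)^{-1}Z^\top cc^\top Z.$$ Nuisance parameter estimators. With $\hat Z=\begin{pmatrix}\hat X\\-\mathrm I_d\end{pmatrix}$, $\overline{cc^\top}=\frac1m\sum_{i=1}^mc_ic_i^\top$, $\overline{aa^\top}=\frac1m\sum_{i=1}^ma_ia_i^\top$, $\bar S=\frac1m\sum_{i=1}^mS_i$ and $\bar S_a$ the upper-left $n\times n$ block of $\bar S$, $$\hat\sigma^2=\frac1d\,\mathrm{tr}\left[(\hat Z^\top\,\overline{cc^\top}\,\hat Z)(\hat Z^\top\bar S\hat Z)^{-1}\right],\qquad \hat V_A=\overline{aa^\top}-\hat\sigma^2\bar S_a.$$ The limit $\Gamma(X_0)$. Put $W_i=(a_{0i}\tilde c_i^\top,\ \tilde c_i\tilde c_i^\top-\sigma^2S_i)$. Under the hypotheses, $\frac1{\sqrt m}\sum_{i=1}^mW_i$ converges in distribution, as $m\to\infty$, to a centered Gaussian random element $\Gamma=(\Gamma_1,\Gamma_2)$ of $\mathbb R^{n\times(n+d)}\times\mathbb R^{(n+d)\times(n+d)}$ with independent components $\Gamma_1$, $\Gamma_2$. With $S_\infty=\begin{bmatrix}S_a^\infty&S_{ab}^\infty\\S_{ba}^\infty&S_b^\infty\end{bmatrix}=\lim_{i\to\infty}S_i$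 ($S_a^\infty\in\mathbb R^{n\times n}$) and $P_a\begin{bmatrix}a\\ b\end{bmatrix}=a$, $$\Gamma(X_0)=\Gamma_1Z_0+P_a\Gamma_2Z_0-[S_a^\infty,S_{ab}^\infty]\,Z_0(Z_0^\top S_\infty Z_0)^{-1}(Z_0^\top\Gamma_2Z_0).$$
   Formalization: The displayed Ŝ_u lacks a trailing factor V̂_A^{-1}, without which it tends to V_A^{-1}cov(Γ(X_0)u) rather than S_u; the formal statement uses Ŝ_u = V̂_A^{-1}·(1/m)Σ ŝ_i uu^T ŝ_i^T·V̂_A^{-1}. *)

theory Defs
  imports "HOL-Probability.Probability"
begin

section \<open>Vectors and matrices\<close>

text \<open>The index set \<open>{1..n+d}\<close> is the sum type \<open>'n + 'd\<close>. The next three operations apply to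
  vectors (entries) and to matrices (rows) alike.\<close>

definition stack :: "'x^'n \<Rightarrow> 'x^'d \<Rightarrow> 'x^('n::finite + 'd::finite)" where
  "stack a b = (\<chi> k. case k of Inl i \<Rightarrow> a $ i | Inr j \<Rightarrow> b $ j)"

definition upper :: "'x^('n::finite + 'd::finite) \<Rightarrow> 'x^'n" where
  "upper c = (\<chi> i. c $ Inl i)"

definition lower :: "'x^('n::finite + 'd::finite) \<Rightarrow> 'x^'d" where
  "lower c = (\<chi> j. c $ Inr j)"

text \<open>A subset \<open>J\<close> of the index set is enumerated by a bijection \<open>\<iota>\<close> from a finite type onto \<open>J\<close>,
  so that subvectors and submatrices indexed by \<open>J\<close> live on that type.\<close>

definition subrows :: "('j \<Rightarrow> 'k) \<Rightarrow> 'x^'k \<Rightarrow> 'x^'j" where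
  "subrows \<iota> v = (\<chi> k. v $ \<iota> k)"

definition outer :: "real^'m \<Rightarrow> real^'n \<Rightarrow> real^'n^'m" where
  "outer x y = (\<chi> i j. x $ i * y $ j)"

definition upper_left :: "real^('n::finite + 'd::finite)^('n + 'd) \<Rightarrow> real^'n^'n" where
  "upper_left S = (\<chi> i j. S $ Inl i $ Inl j)"

definition Zmat :: "real^'d^'n \<Rightarrow> real^'d^('n::finite + 'd::finite)" where
  "Zmat X = stack X (- mat 1)"

definition lambda_min :: "real^'k^'k \<Rightarrow> real" where
  "lambda_min A = Min {l. \<exists>v. v \<noteq> 0 \<and> A *v v = l *\<^sub>R v}"

text \<open>Meant for symmetric positive definite \<open>A\<close>, where the choice below is unique.\<close>

definition inv_sqrt :: "real^'k^'k \<Rightarrow> real^'k^'k" where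
  "inv_sqrt A = (SOME R. transpose R = R \<and> (\<forall>x. x \<noteq> 0 \<longrightarrow> 0 < x \<bullet> (R *v x))
                       \<and> R ** R = matrix_inv A)"

section \<open>Probabilistic notions\<close>

definition cov_mat :: "'w measure \<Rightarrow> ('w \<Rightarrow> real^'k) \<Rightarrow> real^'k^'k" where
  "cov_mat M X = (\<chi> j k. \<integral>w. (X w $ j - (\<integral>v. X v $ j \<partial>M)) * (X w $ k - (\<integral>v. X v $ k \<partial>M)) \<partial>M)"

definition conv_in_prob ::
    "'w measure \<Rightarrow> (nat \<Rightarrow> 'w \<Rightarrow> 'a::metric_space) \<Rightarrow> 'a \<Rightarrow> bool" where
  "conv_in_prob M X L \<longleftrightarrow>
     (\<forall>\<epsilon>>0. (\<lambda>m. measure M {w \<in> space M. dist (X m w) L > \<epsilon>}) \<longlonglongrightarrow> 0)"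

definition conv_in_distr ::
    "'w measure \<Rightarrow> (nat \<Rightarrow> 'w \<Rightarrow> 'a::metric_space) \<Rightarrow> 'v measure \<Rightarrow> ('v \<Rightarrow> 'a) \<Rightarrow> bool" where
  "conv_in_distr M X N Y \<longleftrightarrow>
     (\<forall>f :: 'a \<Rightarrow> real. continuous_on UNIV f \<longrightarrow> bounded (range f) \<longrightarrow>
        (\<lambda>m. \<integral>w. f (X m w) \<partial>M) \<longlonglongrightarrow> (\<integral>v. f (Y v) \<partial>N))"

text \<open>Borel sets of a space with one extra point \<open>\<infinity>\<close>, which is represented by \<^const>\<open>None\<close>.\<close>

definition option_borel :: "'a::topological_space option measure" where
  "option_borel = sigma UNIV {B. Some -` B \<in> sets borel}"

section \<open>The element-wise weighted total least squares estimator\<close>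

text \<open>A data matrix with \<open>m\<close> rows is a function giving its \<open>i\<close>-th row, \<open>i \<in> {1..m}\<close>, as a vector;
  \<open>D\<close> is the matrix \<open>[\<Delta>A, \<Delta>B]\<close>, and the matrix equation \<open>(A - \<Delta>A) X = B - \<Delta>B\<close> is written
  row by row.\<close>

definition ewtls_feasible ::
    "('j::finite \<Rightarrow> 'n::finite + 'd::finite) \<Rightarrow> nat \<Rightarrow> (nat \<Rightarrow> real^('n + 'd))
       \<Rightarrow> real^'d^'n \<Rightarrow> (nat \<Rightarrow> real^('n + 'd)) \<Rightarrow> bool" where
  "ewtls_feasible \<iota> m C X D \<longleftrightarrow>
     (\<forall>i\<in>{1..m}. upper (C i - D i) v* X = lower (C i - D i)) \<and>
     (\<forall>i\<in>{1..m}. \<forall>j. j \<notin> range \<iota> \<longrightarrow> D i $ j = 0) \<and>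
     rank (subrows \<iota> (Zmat X)) = CARD('d)"

definition ewtls_cost ::
    "('j::finite \<Rightarrow> 'n::finite + 'd::finite) \<Rightarrow> (nat \<Rightarrow> real^'j^'j) \<Rightarrow> nat
       \<Rightarrow> (nat \<Rightarrow> real^('n + 'd)) \<Rightarrow> real" where
  "ewtls_cost \<iota> \<Sigma> m D = (\<Sum>i=1..m. (norm (inv_sqrt (\<Sigma> i) *v subrows \<iota> (D i)))\<^sup>2)"

definition ewtls_solution ::
    "('j::finite \<Rightarrow> 'n::finite + 'd::finite) \<Rightarrow> (nat \<Rightarrow> real^'j^'j) \<Rightarrow> nat
       \<Rightarrow> (nat \<Rightarrow> real^('n + 'd)) \<Rightarrow> real^'d^'n \<Rightarrow> bool" where
  "ewtls_solution \<iota> \<Sigma> m C X \<longleftrightarrow>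
     (\<exists>D. ewtls_feasible \<iota> m C X D \<and>
        (\<forall>X' D'. ewtls_feasible \<iota> m C X' D' \<longrightarrow> ewtls_cost \<iota> \<Sigma> m D \<le> ewtls_cost \<iota> \<Sigma> m D'))"

definition ewtls_estimator ::
    "('j::finite \<Rightarrow> 'n::finite + 'd::finite) \<Rightarrow> (nat \<Rightarrow> real^'j^'j)
       \<Rightarrow> (nat \<Rightarrow> (nat \<Rightarrow> real^('n + 'd)) \<Rightarrow> (real^'d^'n) option) \<Rightarrow> bool" where
  "ewtls_estimator \<iota> \<Sigma> est \<longleftrightarrow>
     (\<forall>m\<ge>1. est m \<in> PiM {1..m} (\<lambda>_. borel) \<rightarrow>\<^sub>M option_borel \<and>
        (\<forall>C \<in> space (PiM {1..m} (\<lambda>_. borel)).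
           (case est m C of Some X \<Rightarrow> ewtls_solution \<iota> \<Sigma> m C X
                          | None \<Rightarrow> \<not> (\<exists>X. ewtls_solution \<iota> \<Sigma> m C X))))"

section \<open>Nuisance parameter estimators\<close>

definition s_tilde ::
    "real^'n \<Rightarrow> real^'d \<Rightarrow> real^('n::finite + 'd::finite)^('n + 'd) \<Rightarrow> real^'d^'n \<Rightarrow> real^'d^'n" where
  "s_tilde a b S X =
     (let c = stack a b; Z = Zmat X in
        outer a c ** Z
        - upper S ** Z ** matrix_inv (transpose Z ** S ** Z) ** (transpose Z ** outer c c ** Z))"

definition mean_upto :: "nat \<Rightarrow> (nat \<Rightarrow> 'x::real_vector) \<Rightarrow> 'x" where
  "mean_upto m f = (1 / real m) *\<^sub>R (\<Sum>i=1..m. f i)"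

definition sigma2_hat ::
    "nat \<Rightarrow> (nat \<Rightarrow> real^('n::finite + 'd::finite)) \<Rightarrow> (nat \<Rightarrow> real^('n + 'd)^('n + 'd))
       \<Rightarrow> real^'d^'n \<Rightarrow> real" where
  "sigma2_hat m c S X =
     (let Z = Zmat X in
        1 / real CARD('d) *
        trace ((transpose Z ** mean_upto m (\<lambda>i. outer (c i) (c i)) ** Z)
               ** matrix_inv (transpose Z ** mean_upto m S ** Z)))"

definition V_hat ::
    "nat \<Rightarrow> (nat \<Rightarrow> real^('n::finite + 'd::finite)) \<Rightarrow> (nat \<Rightarrow> real^('n + 'd)^('n + 'd)) \<Rightarrow> real^'d^'n
       \<Rightarrow> real^'n^'n" where
  "V_hat m c S X =
     mean_upto m (\<lambda>i. outer (upper (c i)) (upper (c i)))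
     - sigma2_hat m c S X *\<^sub>R upper_left (mean_upto m S)"

text \<open>The sandwich form, with the inverse on both sides, matches the covariance matrix of
  \<open>V\<^sub>A\<^sup>-\<^sup>1 \<Gamma>(X\<^sub>0) u\<close>, namely \<open>V\<^sub>A\<^sup>-\<^sup>1 cov(\<Gamma>(X\<^sub>0) u) V\<^sub>A\<^sup>-\<^sup>1\<close>.\<close>

definition S_hat ::
    "nat \<Rightarrow> (nat \<Rightarrow> real^('n::finite + 'd::finite)) \<Rightarrow> (nat \<Rightarrow> real^('n + 'd)^('n + 'd)) \<Rightarrow> real^'d
       \<Rightarrow> real^'d^'n \<Rightarrow> real^'n^'n" where
  "S_hat m c S u X =
     (let s = (\<lambda>i. s_tilde (upper (c i)) (lower (c i)) (S i) X) in
        matrix_inv (V_hat m c S X)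
        ** mean_upto m (\<lambda>i. s i ** outer u u ** transpose (s i))
        ** matrix_inv (V_hat m c S X))"

section \<open>The limit element\<close>

definition Gamma_at ::
    "real^('n::finite + 'd::finite)^('n + 'd) \<Rightarrow> real^'d^'n
       \<Rightarrow> (real^('n + 'd)^'n) \<times> (real^('n + 'd)^('n + 'd)) \<Rightarrow> real^'d^'n" where
  "Gamma_at S X G =
     (let Z = Zmat X in
        fst G ** Z + upper (snd G) ** Z
        - upper S ** Z ** matrix_inv (transpose Z ** S ** Z) ** (transpose Z ** snd G ** Z))"

end

theory Submission
  imports Defs
begin

text \<open>
  Convergence in probability is convergence along a filter on pairs \<open>(m, w)\<close>, so that limit arguments can
  be carried out pointwise. For fixed \<open>X\<close> the inner minimisation of the least squares problem is explicit
  and leaves the average \<open>Q\<^sub>m(X)\<close> of the forms \<open>c\<^sup>T Z (Z\<^sup>T S\<^sub>i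
  Z)\<^sup>-\<^sup>1 Z\<^sup>T c\<close> at \<open>c = c\<^sub>i\<close>. Comparing \<open>Q\<^sub>m(X)\<close> with
  \<open>Q\<^sub>m(X\<^sub>0)\<close> in an eigenbasis of \<open>Z\<^sup>T S\<^sub>\<infinity> Z\<close> gives
  consistency, and a second order expansion that is uniform in \<open>i\<close> gives that \<open>b\<^sub>m \<surd>m
  (X_hat - X\<^sub>0)\<close> tends to \<open>0\<close> in probability for every null sequence
  \<open>b\<^sub>m\<close>. As the convergence of \<open>A\<^sub>0\<^sup>T A\<^sub>0 / m\<close> forces \<open>max
  |a\<^sub>0\<^sub>i|\<^sup>2 = o(m)\<close>, this rate is enough to replace \<open>X_hat\<close> by
  \<open>X\<^sub>0\<close> in the average of the matrices \<open>s\<^sub>i u u\<^sup>T s\<^sub>i\<^sup>T\<close>. At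
  \<open>X\<^sub>0\<close> the vectors \<open>s\<^sub>i u\<close> are asymptotically the linear functional \<open>W
  \<mapsto> W(X\<^sub>0) u\<close> of the summands \<open>W\<^sub>i\<close>. By the weak law of large numbers the
  average of their products has the same limit as the average of the expectations; this is the covariance of the
  normalised sum, which converges to that of the limit \<open>\<Gamma>\<close> because the squares of the normalised
  sums are uniformly integrable.
\<close>

section \<open>Convergence in probability as a filter limit\<close>

text \<open>Two obstacles shape the proof. The competing parameters form a set that is unbounded and
  need not be closed, since the rank of \<open>Z_J\<close> may degenerate, so a uniform law on a
  compact set would not give consistency. Quadratic forms are therefore compared up to relative
  errors: once divided by the eigenvalues of the limit form, the estimates do not depend on how
  large or how degenerate \<open>Z\<close> is. Next, the objective contains noise with weights that
  depend on the estimator. The weights are expanded into products of a function of \<open>X\<close>,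
  which leaves the average, and a bounded sequence, which stays inside. The remainder only meets the
  average of the absolute noise, which is bounded but not small; hence it has to be cubic in
  \<open>D = |X_hat - X_0|\<close>, so that a lower bound \<open>c D^2\<close> can absorb it. That
  such a bound exists is due to a trace identity: the errors add \<open>\<sigma>^2 d\<close> to the
  expected objective at every \<open>X\<close>. The null sequences \<open>b_m\<close> are a way to
  say that \<open>sqrt m D\<close> is bounded in probability by means of a limit.\<close>

definition in_prob :: "'w measure \<Rightarrow> (nat \<times> 'w) filter" where
  "in_prob M = Abs_filter (\<lambda>P. \<forall>\<delta>>0. \<forall>\<^sub>F m in sequentially.
     \<exists>A\<in>sets M. measure M A \<ge> 1 - \<delta> \<and> (\<forall>w\<in>A. P (m, w)))"

context prob_space
begin

text \<open>The inner event \<open>A\<close> absorbs all questions of measurability: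
  \<open>P\<close> may be any predicate, in particular one that quantifies over all parameters
  \<open>X\<close>. Closure under conjunction is the union bound with \<open>\<delta> / 2\<close>
  for each part.\<close>

lemma eventually_in_prob:
  "eventually P (in_prob M) \<longleftrightarrow> (\<forall>\<delta>>0. \<forall>\<^sub>F m in sequentially.
     \<exists>A\<in>events. prob A \<ge> 1 - \<delta> \<and> (\<forall>w\<in>A. P (m, w)))"
  unfolding in_prob_def
proof (rule eventually_Abs_filter, rule is_filter.intro)
  show "\<forall>\<delta>>0. \<forall>\<^sub>F m in sequentially. \<exists>A\<in>events. prob A \<ge> 1 - \<delta> \<and> (\<forall>w\<in>A. True)"
    by (auto intro!: always_eventually bexI[of _ "space M"] simp: prob_space)
next
  fix P Q
  assume P: "\<forall>\<delta>>0. \<forall>\<^sub>F m in sequentially. \<exists>A\<in>events. prob A \<ge> 1 - \<delta> \<and> (\<forall>w\<in>A. P (m, w))"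
    and Q: "\<forall>\<delta>>0. \<forall>\<^sub>F m in sequentially. \<exists>A\<in>events. prob A \<ge> 1 - \<delta> \<and> (\<forall>w\<in>A. Q (m, w))"
  show "\<forall>\<delta>>0. \<forall>\<^sub>F m in sequentially.
     \<exists>A\<in>events. prob A \<ge> 1 - \<delta> \<and> (\<forall>w\<in>A. P (m, w) \<and> Q (m, w))"
  proof (intro allI impI)
    fix \<delta> :: real assume "\<delta> > 0"
    then have "\<delta> / 2 > 0" by simp
    with P Q have "\<forall>\<^sub>F m in sequentially. \<exists>A\<in>events. prob A \<ge> 1 - \<delta>/2 \<and> (\<forall>w\<in>A. P (m, w))"
      and "\<forall>\<^sub>F m in sequentially. \<exists>A\<in>events. prob A \<ge> 1 - \<delta>/2 \<and> (\<forall>w\<in>A. Q (m, w))" by simp_all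
    then show "\<forall>\<^sub>F m in sequentially.
       \<exists>A\<in>events. prob A \<ge> 1 - \<delta> \<and> (\<forall>w\<in>A. P (m, w) \<and> Q (m, w))"
    proof eventually_elim
      case (elim m)
      then obtain A B where A: "A \<in> events" "prob A \<ge> 1 - \<delta>/2" "\<forall>w\<in>A. P (m, w)"
        and B: "B \<in> events" "prob B \<ge> 1 - \<delta>/2" "\<forall>w\<in>B. Q (m, w)" by blast
      have "prob (space M - A \<inter> B) \<le> prob ((space M - A) \<union> (space M - B))"
        using A B by (intro finite_measure_mono) auto
      also have "\<dots> \<le> prob (space M - A) + prob (space M - B)"
        using A B by (intro measure_Un_le) auto
      also have "\<dots> \<le> \<delta>" using A B by (simp add: prob_compl)
      finally have "prob (A \<inter> B) \<ge> 1 - \<delta>" using A B by (simp add: prob_compl)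
      then show ?case using A B by (intro bexI[of _ "A \<inter> B"]) auto
    qed
  qed
next
  fix P Q :: "nat \<times> 'a \<Rightarrow> bool"
  assume "\<forall>x. P x \<longrightarrow> Q x"
    and P: "\<forall>\<delta>>0. \<forall>\<^sub>F m in sequentially. \<exists>A\<in>events. prob A \<ge> 1 - \<delta> \<and> (\<forall>w\<in>A. P (m, w))"
  then have imp: "\<exists>A\<in>events. prob A \<ge> 1 - \<delta> \<and> (\<forall>w\<in>A. Q (m, w))"
    if "\<exists>A\<in>events. prob A \<ge> 1 - \<delta> \<and> (\<forall>w\<in>A. P (m, w))" for \<delta> m using that by blast
  show "\<forall>\<delta>>0. \<forall>\<^sub>F m in sequentially. \<exists>A\<in>events. prob A \<ge> 1 - \<delta> \<and> (\<forall>w\<in>A. Q (m, w))"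
  proof (intro allI impI)
    fix \<delta> :: real assume "\<delta> > 0"
    with P have "\<forall>\<^sub>F m in sequentially. \<exists>A\<in>events. prob A \<ge> 1 - \<delta> \<and> (\<forall>w\<in>A. P (m, w))" by simp
    then show "\<forall>\<^sub>F m in sequentially. \<exists>A\<in>events. prob A \<ge> 1 - \<delta> \<and> (\<forall>w\<in>A. Q (m, w))"
      by (rule eventually_mono) (rule imp)
  qed
qed

lemma filterlim_fst_in_prob: "filterlim fst sequentially (in_prob M)"
  unfolding filterlim_iff eventually_in_prob
proof (intro allI impI)
  fix P :: "nat \<Rightarrow> bool" and \<delta> :: real assume \<delta>: "\<delta> > 0" and "eventually P sequentially"
  from this(2) show "\<forall>\<^sub>F m in sequentially. \<exists>A\<in>events. prob A \<ge> 1 - \<delta> \<and> (\<forall>w\<in>A. P (fst (m, w)))"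
    by eventually_elim (use \<delta> in \<open>auto intro!: bexI[of _ "space M"] simp: prob_space\<close>)
qed

lemma tendsto_in_prob_deterministic:
  "a \<longlonglongrightarrow> L \<Longrightarrow> ((\<lambda>p. a (fst p)) \<longlongrightarrow> L) (in_prob M)"
  by (rule filterlim_compose[OF _ filterlim_fst_in_prob])

lemma eventually_in_prob_deterministic:
  "\<forall>\<^sub>F m in sequentially. P m \<Longrightarrow> \<forall>\<^sub>F p in in_prob M. P (fst p)"
  using filterlim_fst_in_prob by (auto simp: filterlim_iff)

lemma eventually_in_prob_space: "\<forall>\<^sub>F p in in_prob M. snd p \<in> space M"
  unfolding eventually_in_prob
  by (auto intro!: always_eventually bexI[of _ "space M"] simp: prob_space)

lemma eventually_in_prob_AE:
  assumes "AE w in M. P w"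
  shows "\<forall>\<^sub>F p in in_prob M. P (snd p)"
proof -
  from assms obtain N where N: "{w\<in>space M. \<not> P w} \<subseteq> N" "N \<in> null_sets M"
    by (auto simp: eventually_ae_filter)
  then have "N \<in> events" "prob N = 0" by (auto simp: measure_def)
  then have "prob (space M - N) = 1" "N \<in> events"
    by (auto simp: prob_compl)
  then show ?thesis unfolding eventually_in_prob using N
    by (intro allI impI always_eventually bexI[of _ "space M - N"]) auto
qed

text \<open>Markov's inequality: the exceptional event has probability at most
  \<open>e * \<delta> / e\<close>.\<close>

lemma eventually_in_prob_markov:
  fixes Y :: "nat \<Rightarrow> 'a \<Rightarrow> real"
  assumes int: "\<And>m. integrable M (Y m)" and e: "e > 0"
    and lim: "\<forall>\<delta>>0. \<forall>\<^sub>F m in sequentially. expectation (\<lambda>w. \<bar>Y m w\<bar>) \<le> e * \<delta>"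
  shows "\<forall>\<^sub>F p in in_prob M. \<bar>Y (fst p) (snd p)\<bar> < e"
  unfolding eventually_in_prob
proof (intro allI impI)
  fix \<delta> :: real assume "\<delta> > 0"
  with lim have "\<forall>\<^sub>F m in sequentially. expectation (\<lambda>w. \<bar>Y m w\<bar>) \<le> e * \<delta>" by blast
  then show "\<forall>\<^sub>F m in sequentially.
    \<exists>A\<in>events. prob A \<ge> 1 - \<delta> \<and> (\<forall>w\<in>A. \<bar>Y (fst (m, w)) (snd (m, w))\<bar> < e)"
  proof eventually_elim
    case (elim m)
    let ?B = "{w\<in>space M. \<bar>Y m w\<bar> \<ge> e}"
    have [measurable]: "Y m \<in> borel_measurable M" using int by auto
    have "prob ?B \<le> expectation (\<lambda>w. \<bar>Y m w\<bar>) / e"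
      using int e by (intro integral_Markov_inequality_measure[where A="{}"]) auto
    also have "\<dots> \<le> \<delta>" using elim e by (simp add: field_simps)
    finally have "prob (space M - ?B) \<ge> 1 - \<delta>" by (subst prob_compl) auto
    then show ?case by (intro bexI[of _ "space M - ?B"]) auto
  qed
qed

lemma tendsto_in_prob_L1:
  fixes Y :: "nat \<Rightarrow> 'a \<Rightarrow> real"
  assumes int: "\<And>m. integrable M (Y m)"
    and lim: "(\<lambda>m. expectation (\<lambda>w. \<bar>Y m w\<bar>)) \<longlonglongrightarrow> 0"
  shows "((\<lambda>p. Y (fst p) (snd p)) \<longlongrightarrow> 0) (in_prob M)"
proof (rule tendstoI)
  fix e :: real assume e: "e > 0"
  have "\<forall>\<^sub>F m in sequentially. expectation (\<lambda>w. \<bar>Y m w\<bar>) \<le> e * \<delta>" if "\<delta> > 0" for \<delta>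
    using order_tendstoD(2)[OF lim, of "e * \<delta>"] e that by (auto elim: eventually_mono)
  with int e show "\<forall>\<^sub>F p in in_prob M. dist (Y (fst p) (snd p)) 0 < e"
    using eventually_in_prob_markov[of Y e] by simp
qed

lemma tendsto_in_prob_L2:
  fixes Y :: "nat \<Rightarrow> 'a \<Rightarrow> real"
  assumes "\<And>m. integrable M (\<lambda>w. (Y m w)\<^sup>2)"
    and "(\<lambda>m. expectation (\<lambda>w. (Y m w)\<^sup>2)) \<longlonglongrightarrow> 0"
  shows "((\<lambda>p. Y (fst p) (snd p)) \<longlongrightarrow> 0) (in_prob M)"
proof -
  have "((\<lambda>p. (Y (fst p) (snd p))\<^sup>2) \<longlongrightarrow> 0) (in_prob M)"
    using tendsto_in_prob_L1[of "\<lambda>m w. (Y m w)\<^sup>2"] assms by simp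
  then have "((\<lambda>p. sqrt ((Y (fst p) (snd p))\<^sup>2)) \<longlongrightarrow> sqrt 0) (in_prob M)"
    by (rule tendsto_real_sqrt)
  then show ?thesis by (simp add: tendsto_rabs_zero_iff)
qed

text \<open>A null factor times one that is bounded in probability. Markov's inequality supplies the
  boundedness of \<open>Y\<close>; the null factor is used only on the inner events of the filter,
  so \<open>f\<close> may be any function.\<close>

lemma tendsto_in_prob_mult_bounded:
  fixes Y :: "nat \<Rightarrow> 'a \<Rightarrow> real"
  assumes f: "(f \<longlongrightarrow> 0) (in_prob M)"
    and int: "\<And>m. integrable M (Y m)" and bd: "\<And>m. expectation (\<lambda>w. \<bar>Y m w\<bar>) \<le> C"
  shows "((\<lambda>p. f p * Y (fst p) (snd p)) \<longlongrightarrow> 0) (in_prob M)"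
proof (rule tendstoI)
  fix e :: real assume e: "e > 0"
  show "\<forall>\<^sub>F p in in_prob M. dist (f p * Y (fst p) (snd p)) 0 < e"
    unfolding eventually_in_prob
  proof (intro allI impI)
    fix \<delta> :: real assume \<delta>: "\<delta> > 0"
    \<comment> \<open>Markov's inequality leaves probability at most
      \<open>|C| / K <= \<delta> / 2\<close> to the event that \<open>|Y|\<close> reaches
      \<open>K\<close>; the added 1 keeps \<open>K\<close> positive.\<close>
    define K where "K = 2 * (\<bar>C\<bar> + 1) / \<delta>"
    have K: "K > 0" using \<delta> by (simp add: K_def)
    have "\<forall>\<^sub>F p in in_prob M. dist (f p) 0 < e / K" using tendstoD[OF f, of "e / K"] e K by simp
    then have "\<forall>\<^sub>F m in sequentially. \<exists>A\<in>events. prob A \<ge> 1 - \<delta>/2 \<and> (\<forall>w\<in>A. dist (f (m, w)) 0 < e / K)"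
      using \<delta> unfolding eventually_in_prob by (meson half_gt_zero)
    then show "\<forall>\<^sub>F m in sequentially. \<exists>A\<in>events. prob A \<ge> 1 - \<delta> \<and>
       (\<forall>w\<in>A. dist (f (m, w) * Y (fst (m, w)) (snd (m, w))) 0 < e)"
    proof eventually_elim
      case (elim m)
      then obtain A where A: "A \<in> events" "prob A \<ge> 1 - \<delta>/2" "\<And>w. w\<in>A \<Longrightarrow> \<bar>f (m, w)\<bar> < e / K" by auto
      let ?B = "{w\<in>space M. \<bar>Y m w\<bar> \<ge> K}"
      have [measurable]: "Y m \<in> borel_measurable M" using int by auto
      have "prob ?B \<le> expectation (\<lambda>w. \<bar>Y m w\<bar>) / K"
        using int K by (intro integral_Markov_inequality_measure[where A="{}"]) auto
      also have "\<dots> \<le> \<bar>C\<bar> / K" using bd[of m] K by (intro divide_right_mono) auto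
      also have "\<dots> \<le> \<delta> / 2" using \<delta> by (simp add: K_def field_simps)
      finally have B: "prob ?B \<le> \<delta> / 2" .
      have "prob A \<le> prob ((A - ?B) \<union> ?B)" using A by (intro finite_measure_mono) auto
      also have "\<dots> \<le> prob (A - ?B) + prob ?B" using A by (intro measure_Un_le) auto
      finally have "prob (A - ?B) \<ge> 1 - \<delta>" using A(2) B by linarith
      moreover have "\<bar>f (m, w) * Y m w\<bar> < e" if "w \<in> A - ?B" for w
      proof -
        have "w \<in> space M" using that A sets.sets_into_space by blast
        then have "\<bar>Y m w\<bar> < K" "\<bar>f (m, w)\<bar> < e / K" using that A(3) by auto
        then have "\<bar>f (m, w)\<bar> * \<bar>Y m w\<bar> < e / K * K" using K e by (intro mult_strict_mono') auto
        then show ?thesis using K by (simp add: abs_mult)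
      qed
      ultimately show ?case using A by (intro bexI[of _ "A - ?B"]) auto
    qed
  qed
qed

text \<open>The way back to the definition by probabilities: the set where the distance exceeds
  \<open>e\<close> lies in the complement of an inner event.\<close>

lemma conv_in_prob_if_tendsto:
  fixes X :: "nat \<Rightarrow> 'a \<Rightarrow> 'b::{metric_space, second_countable_topology}"
  assumes X: "\<And>m. m \<ge> 1 \<Longrightarrow> X m \<in> borel_measurable M"
    and lim: "((\<lambda>p. X (fst p) (snd p)) \<longlongrightarrow> L) (in_prob M)"
  shows "conv_in_prob M X L"
  unfolding conv_in_prob_def
proof (intro allI impI tendstoI)
  fix e \<delta> :: real assume e: "e > 0" and \<delta>: "\<delta> > 0"
  have "\<forall>\<^sub>F m in sequentially. \<exists>A\<in>events. prob A \<ge> 1 - \<delta>/2 \<and> (\<forall>w\<in>A. dist (X m w) L < e)"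
    using tendstoD[OF lim e] \<delta> unfolding eventually_in_prob fst_conv snd_conv by (meson half_gt_zero)
  with eventually_ge_at_top[of 1]
  show "\<forall>\<^sub>F m in sequentially. dist (prob {w \<in> space M. e < dist (X m w) L}) 0 < \<delta>"
  proof eventually_elim
    case (elim m)
    then obtain A where A: "A \<in> events" "prob A \<ge> 1 - \<delta>/2" "\<And>w. w\<in>A \<Longrightarrow> dist (X m w) L < e" by auto
    have [measurable]: "X m \<in> borel_measurable M" using X elim by auto
    have "prob {w \<in> space M. e < dist (X m w) L} \<le> prob (space M - A)"
      using A by (intro finite_measure_mono) (auto dest: less_asym)
    also have "\<dots> < \<delta>" using A \<delta> by (simp add: prob_compl)
    finally show ?case by simp
  qed
qed

section \<open>Sums of independent centred random variables\<close>

lemma indep_vars_measurable: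
  "indep_vars (\<lambda>_. borel) \<zeta> I \<Longrightarrow> i \<in> I \<Longrightarrow> \<zeta> i \<in> borel_measurable M"
  by (auto simp: indep_vars_def)

text \<open>Pythagoras for independent centred variables: each new summand is independent of the
  partial sum before it, so the cross term has expectation zero.\<close>

lemma indep_sum_second_moment:
  fixes \<zeta> :: "'i \<Rightarrow> 'a \<Rightarrow> real"
  assumes "finite I" "indep_vars (\<lambda>_. borel) \<zeta> I"
    and "\<And>i. i \<in> I \<Longrightarrow> integrable M (\<lambda>w. (\<zeta> i w)\<^sup>2)"
    and "\<And>i. i \<in> I \<Longrightarrow> expectation (\<zeta> i) = 0"
  shows "integrable M (\<lambda>w. (\<Sum>i\<in>I. \<zeta> i w)\<^sup>2) \<and>
    expectation (\<lambda>w. (\<Sum>i\<in>I. \<zeta> i w)\<^sup>2) = (\<Sum>i\<in>I. expectation (\<lambda>w. (\<zeta> i w)\<^sup>2))"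
  using assms
proof (induction I rule: finite_induct)
  case empty
  then show ?case by simp
next
  case (insert i I)
  let ?S = "\<lambda>w. \<Sum>j\<in>I. \<zeta> j w"
  have ind: "indep_vars (\<lambda>_. borel) \<zeta> I" using insert.prems(1) by (rule indep_vars_subset) auto
  have IH: "integrable M (\<lambda>w. (?S w)\<^sup>2)"
    "expectation (\<lambda>w. (?S w)\<^sup>2) = (\<Sum>i\<in>I. expectation (\<lambda>w. (\<zeta> i w)\<^sup>2))"
    using insert.IH[OF ind] insert.prems by auto
  have [measurable]: "\<And>j. j \<in> insert i I \<Longrightarrow> \<zeta> j \<in> borel_measurable M"
    using insert.prems(1) by (rule indep_vars_measurable)
  have sq: "\<And>j. j \<in> insert i I \<Longrightarrow> integrable M (\<zeta> j)"
    by (rule square_integrable_imp_integrable[OF indep_vars_measurable[OF insert.prems(1)] insert.prems(2)])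
  have intS: "integrable M ?S" using sq by auto
  have iv: "indep_var borel (\<zeta> i) borel ?S"
    using insert.hyps insert.prems(1) by (intro indep_vars_sum) auto
  have prod: "integrable M (\<lambda>w. \<zeta> i w * ?S w)" "expectation (\<lambda>w. \<zeta> i w * ?S w) = 0"
    using indep_var_integrable[OF iv] indep_var_lebesgue_integral[OF iv] sq intS insert.prems(3) by auto
  have eq: "(\<lambda>w. (\<Sum>j\<in>insert i I. \<zeta> j w)\<^sup>2) = (\<lambda>w. ((\<zeta> i w)\<^sup>2 + 2 * (\<zeta> i w * ?S w)) + (?S w)\<^sup>2)"
    unfolding sum.insert[OF insert.hyps] power2_sum by (intro ext) (simp add: algebra_simps)
  have i1: "integrable M (\<lambda>w. (\<zeta> i w)\<^sup>2)" by (rule insert.prems(2)) simp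
  have i2: "integrable M (\<lambda>w. 2 * (\<zeta> i w * ?S w))" using prod(1) by simp
  have i12: "integrable M (\<lambda>w. (\<zeta> i w)\<^sup>2 + 2 * (\<zeta> i w * ?S w))"
    using i1 i2 by (rule Bochner_Integration.integrable_add)
  show ?case unfolding eq
    unfolding sum.insert[OF insert.hyps] Bochner_Integration.integral_add[OF i12 IH(1)]
      Bochner_Integration.integral_add[OF i1 i2] IH(2)
    using Bochner_Integration.integrable_add[OF i12 IH(1)] prod(2) by simp
qed

text \<open>In the binomial expansion both terms with a cube vanish, each having a centred factor to
  the first power. The mixed term \<open>6 * b * A\<close> is matched by the cross term of
  \<open>3 * (A + b)^2\<close>. Boundedness makes all powers integrable.\<close>

lemma indep_sum_fourth_moment:
  fixes \<zeta> :: "'i \<Rightarrow> 'a \<Rightarrow> real"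
  assumes "finite I" "indep_vars (\<lambda>_. borel) \<zeta> I"
    and "\<And>i w. i \<in> I \<Longrightarrow> w \<in> space M \<Longrightarrow> \<bar>\<zeta> i w\<bar> \<le> B"
    and "\<And>i. i \<in> I \<Longrightarrow> expectation (\<zeta> i) = 0"
  shows "expectation (\<lambda>w. (\<Sum>i\<in>I. \<zeta> i w) ^ 4)
    \<le> (\<Sum>i\<in>I. expectation (\<lambda>w. (\<zeta> i w) ^ 4)) + 3 * (\<Sum>i\<in>I. expectation (\<lambda>w. (\<zeta> i w)\<^sup>2))\<^sup>2"
  using assms
proof (induction I rule: finite_induct)
  case empty
  then show ?case by simp
next
  case (insert i I)
  let ?S = "\<lambda>w. \<Sum>j\<in>I. \<zeta> j w"
  let ?b = "expectation (\<lambda>w. (\<zeta> i w)\<^sup>2)" and ?A = "\<Sum>i\<in>I. expectation (\<lambda>w. (\<zeta> i w)\<^sup>2)"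
  have ind: "indep_vars (\<lambda>_. borel) \<zeta> I" using insert.prems(1) by (rule indep_vars_subset) auto
  have IH: "expectation (\<lambda>w. (?S w) ^ 4) \<le> (\<Sum>i\<in>I. expectation (\<lambda>w. (\<zeta> i w) ^ 4)) + 3 * ?A\<^sup>2"
    using insert.IH[OF ind] insert.prems by auto
  have [measurable]: "\<And>j. j \<in> insert i I \<Longrightarrow> \<zeta> j \<in> borel_measurable M"
    using insert.prems(1) by (rule indep_vars_measurable)
  then have [measurable]: "\<zeta> i \<in> borel_measurable M" "?S \<in> borel_measurable M" by auto
  have bS: "\<bar>?S w\<bar> \<le> real (card I) * B" if "w \<in> space M" for w
  proof -
    have "\<bar>?S w\<bar> \<le> (\<Sum>j\<in>I. \<bar>\<zeta> j w\<bar>)" by (rule sum_abs)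
    also have "\<dots> \<le> (\<Sum>j\<in>I. B)" using insert.prems(2) that by (intro sum_mono) auto
    finally show ?thesis by simp
  qed
  have bz: "\<bar>\<zeta> i w\<bar> \<le> B" if "w \<in> space M" for w using insert.prems(2) that by simp
  have int0: "integrable M (\<lambda>w. (\<zeta> j w) ^ k)" if "j \<in> insert i I" for j k
    using that insert.prems(2)
    by (intro integrable_const_bound[where B="B ^ k"]) (auto intro!: AE_I2 power_mono simp: power_abs)
  note int1 = int0[OF insertI1]
  have int2: "integrable M (\<lambda>w. (?S w) ^ k)" for k
    by (rule integrable_const_bound[where B="(real (card I) * B) ^ k"])
       (auto intro!: AE_I2 power_mono bS simp: power_abs)
  have iv: "indep_var borel (\<zeta> i) borel ?S"
    using insert.hyps insert.prems(1) by (intro indep_vars_sum) auto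
  have iv2: "indep_var borel (\<lambda>w. (\<zeta> i w) ^ k) borel (\<lambda>w. (?S w) ^ l)" for k l
    using indep_var_compose[OF iv, of "\<lambda>x. x ^ k" borel "\<lambda>x. x ^ l" borel] by (simp add: o_def)
  note prod = indep_var_integrable[OF iv2 int1 int2] indep_var_lebesgue_integral[OF iv2 int1 int2]
  have second: "expectation (\<lambda>w. (?S w)\<^sup>2) = ?A"
    using indep_sum_second_moment[OF insert.hyps(1) ind] int0 insert.prems(3) by auto
  have binom: "(x + y) ^ 4 = x ^ 4 + 4 * (x ^ 3 * y ^ 1) + 6 * (x ^ 2 * y ^ 2) + 4 * (x ^ 1 * y ^ 3) + y ^ 4"
    for x y :: real by algebra
  have eq: "(\<lambda>w. (\<Sum>j\<in>insert i I. \<zeta> j w) ^ 4) = (\<lambda>w. (\<zeta> i w) ^ 4 + 4 * ((\<zeta> i w) ^ 3 * (?S w) ^ 1)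
      + 6 * ((\<zeta> i w) ^ 2 * (?S w) ^ 2) + 4 * ((\<zeta> i w) ^ 1 * (?S w) ^ 3) + (?S w) ^ 4)"
    unfolding sum.insert[OF insert.hyps] binom by (rule refl)
  have zero: "expectation (\<lambda>w. \<zeta> i w ^ 1) = 0" "expectation (\<lambda>w. ?S w ^ 1) = 0"
    using insert.prems(3) int0[of _ 1] by auto
  have alg: "a + 6 * (b * A) + x \<le> a + y + 6 * (b * A) + 3 * A\<^sup>2 + 3 * b\<^sup>2"
    if "x \<le> y + 3 * A\<^sup>2" for a b A x y :: real
  proof -
    have "0 \<le> b\<^sup>2" by simp
    with that show ?thesis by linarith
  qed
  have "expectation (\<lambda>w. (\<Sum>j\<in>insert i I. \<zeta> j w) ^ 4) =
     expectation (\<lambda>w. (\<zeta> i w) ^ 4) + 6 * (?b * ?A) + expectation (\<lambda>w. (?S w) ^ 4)"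
    unfolding eq using prod[of 3 1] prod[of 2 2] prod[of 1 3] int1 int2 zero second by simp
  also have "\<dots> \<le> (\<Sum>i\<in>insert i I. expectation (\<lambda>w. (\<zeta> i w) ^ 4)) + 6 * (?b * ?A) + 3 * ?A\<^sup>2 + 3 * ?b\<^sup>2"
    unfolding sum.insert[OF insert.hyps] by (rule alg[OF IH])
  also have "\<dots> = (\<Sum>i\<in>insert i I. expectation (\<lambda>w. (\<zeta> i w) ^ 4)) +
       3 * (\<Sum>i\<in>insert i I. expectation (\<lambda>w. (\<zeta> i w)\<^sup>2))\<^sup>2"
    unfolding sum.insert[OF insert.hyps] by (simp add: power2_sum)
  finally show ?case .
qed

section \<open>Consequences of the Lindeberg condition\<close>

lemma expectation_centred_square_le:
  fixes X :: "'a \<Rightarrow> real"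
  assumes "X \<in> borel_measurable M" "integrable M (\<lambda>w. (X w)\<^sup>2)"
  shows "integrable M (\<lambda>w. (X w - expectation X)\<^sup>2)"
    "expectation (\<lambda>w. (X w - expectation X)\<^sup>2) \<le> expectation (\<lambda>w. (X w)\<^sup>2)"
proof -
  have X: "integrable M X" using assms by (rule square_integrable_imp_integrable)
  have "(\<lambda>w. (X w - expectation X)\<^sup>2) = (\<lambda>w. (X w)\<^sup>2 - 2 * expectation X * X w + (expectation X)\<^sup>2)"
    by (simp add: power2_diff algebra_simps)
  then show "integrable M (\<lambda>w. (X w - expectation X)\<^sup>2)" using X assms by simp
  show "expectation (\<lambda>w. (X w - expectation X)\<^sup>2) \<le> expectation (\<lambda>w. (X w)\<^sup>2)"
    using variance_eq[OF X assms(2)] by simp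
qed

lemma sum_centred_square:
  fixes \<eta> :: "'i \<Rightarrow> 'a \<Rightarrow> real"
  assumes fin: "finite I" and ind: "indep_vars (\<lambda>_. borel) \<eta> I"
    and int: "\<And>i. i \<in> I \<Longrightarrow> integrable M (\<lambda>w. (\<eta> i w)\<^sup>2)"
  defines "\<zeta> \<equiv> \<lambda>i w. \<eta> i w - expectation (\<eta> i)"
  shows "integrable M (\<lambda>w. (\<Sum>i\<in>I. \<zeta> i w)\<^sup>2)"
    "expectation (\<lambda>w. (\<Sum>i\<in>I. \<zeta> i w)\<^sup>2) \<le> (\<Sum>i\<in>I. expectation (\<lambda>w. (\<eta> i w)\<^sup>2))"
proof -
  have m: "\<eta> i \<in> borel_measurable M" if "i \<in> I" for i using indep_vars_measurable[OF ind that] .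
  have i1: "integrable M (\<eta> i)" if "i \<in> I" for i
    using m[OF that] int[OF that] by (rule square_integrable_imp_integrable)
  have ind': "indep_vars (\<lambda>_. borel) \<zeta> I"
    unfolding \<zeta>_def by (rule indep_vars_compose2[OF ind]) auto
  have sq: "integrable M (\<lambda>w. (\<zeta> i w)\<^sup>2)"
     "expectation (\<lambda>w. (\<zeta> i w)\<^sup>2) \<le> expectation (\<lambda>w. (\<eta> i w)\<^sup>2)" if "i \<in> I" for i
    unfolding \<zeta>_def using expectation_centred_square_le[OF m int] that by auto
  have z: "expectation (\<zeta> i) = 0" if "i \<in> I" for i
    unfolding \<zeta>_def using i1[OF that] by (simp add: prob_space)
  note * = indep_sum_second_moment[OF fin ind' sq(1) z]
  then show "integrable M (\<lambda>w. (\<Sum>i\<in>I. \<zeta> i w)\<^sup>2)" by blast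
  show "expectation (\<lambda>w. (\<Sum>i\<in>I. \<zeta> i w)\<^sup>2) \<le> (\<Sum>i\<in>I. expectation (\<lambda>w. (\<eta> i w)\<^sup>2))"
    using * sq(2) by (simp add: sum_mono)
qed

end

section \<open>Weak law for squares under a Lindeberg condition\<close>

context prob_space
begin

text \<open>Truncation at level \<open>\<epsilon> m\<close> makes the variance of the average at most \<open>\<epsilon> C\<close>.\<close>

lemma weak_law_squares:
  fixes \<xi> :: "nat \<Rightarrow> 'a \<Rightarrow> real"
  assumes ind: "indep_vars (\<lambda>_. borel) \<xi> {1..}"
    and int: "\<And>i. i \<ge> 1 \<Longrightarrow> integrable M (\<lambda>w. (\<xi> i w)\<^sup>2)"
    and bd: "\<And>m. mean_upto m (\<lambda>i. expectation (\<lambda>w. (\<xi> i w)\<^sup>2)) \<le> C"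
    and lind: "\<And>\<epsilon>. \<epsilon> > 0 \<Longrightarrow> (\<lambda>m. mean_upto m (\<lambda>i. expectation (\<lambda>w. (\<xi> i w)\<^sup>2 *
        indicator {w. (\<xi> i w)\<^sup>2 > \<epsilon> * real m} w))) \<longlonglongrightarrow> 0"
  shows "((\<lambda>p. mean_upto (fst p) (\<lambda>i. (\<xi> i (snd p))\<^sup>2)
            - mean_upto (fst p) (\<lambda>i. expectation (\<lambda>w. (\<xi> i w)\<^sup>2))) \<longlongrightarrow> 0) (in_prob M)"
proof -
  define Y where "Y m w = mean_upto m (\<lambda>i. (\<xi> i w)\<^sup>2) - mean_upto m (\<lambda>i. expectation (\<lambda>w. (\<xi> i w)\<^sup>2))" for m w
  have meas[measurable]: "\<xi> i \<in> borel_measurable M" if "i \<ge> 1" for i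
    using indep_vars_measurable[OF ind] that by auto
  have intY: "integrable M (Y m)" for m
    unfolding Y_def mean_upto_def
    by (intro Bochner_Integration.integrable_diff integrable_scaleR_right
        Bochner_Integration.integrable_sum integrable_const int) auto
  have C: "C \<ge> 0" using bd[of 0] by (simp add: mean_upto_def)
  have "(\<lambda>m. expectation (\<lambda>w. \<bar>Y m w\<bar>)) \<longlonglongrightarrow> 0"
  proof (rule tendstoI)
    fix e :: real assume e: "e > 0"
    \<comment> \<open>The second moment of the centred truncated part will contribute at most
      \<open>\<epsilon> * C / \<eta> <= \<eta>\<close>, and the total
      \<open>2 * \<eta> + 2 * L m\<close> stays below \<open>3 * \<eta> < e\<close>.\<close>
    define \<eta> where "\<eta> = e / 4"
    define \<epsilon> where "\<epsilon> = \<eta>\<^sup>2 / (C + 1)"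
    have \<eta>: "\<eta> > 0" using e by (simp add: \<eta>_def)
    have \<epsilon>: "\<epsilon> > 0" "\<epsilon> * C \<le> \<eta>\<^sup>2" using C \<eta> by (auto simp: \<epsilon>_def field_simps)
    define L where "L m = mean_upto m (\<lambda>i. expectation (\<lambda>w. (\<xi> i w)\<^sup>2 *
        indicator {w. (\<xi> i w)\<^sup>2 > \<epsilon> * real m} w))" for m
    have "L \<longlonglongrightarrow> 0" unfolding L_def using lind[OF \<epsilon>(1)] .
    then have "\<forall>\<^sub>F m in sequentially. L m < \<eta> / 2" using \<eta> by (intro order_tendstoD(2)) auto
    moreover have "\<forall>\<^sub>F m in sequentially. m \<ge> (1::nat)" by (rule eventually_ge_at_top)
    ultimately show "\<forall>\<^sub>F m in sequentially. dist (expectation (\<lambda>w. \<bar>Y m w\<bar>)) 0 < e"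
    proof eventually_elim
      case (elim m)
      define A where "A i w = (\<xi> i w)\<^sup>2 * indicator {w. \<not> (\<xi> i w)\<^sup>2 > \<epsilon> * real m} w" for i w
      define B where "B i w = (\<xi> i w)\<^sup>2 * indicator {w. (\<xi> i w)\<^sup>2 > \<epsilon> * real m} w" for i w
      have AB: "(\<xi> i w)\<^sup>2 = A i w + B i w" for i w
        by (auto simp: A_def B_def indicator_def)
      have A0: "0 \<le> A i w" "A i w \<le> \<epsilon> * real m" "A i w \<le> (\<xi> i w)\<^sup>2" for i w
        using \<epsilon> by (auto simp: A_def indicator_def)
      have B0: "0 \<le> B i w" "B i w \<le> (\<xi> i w)\<^sup>2" for i w
        by (auto simp: B_def indicator_def)
      have indA: "indep_vars (\<lambda>_. borel) A {1..m}"
        unfolding A_def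
        using indep_vars_compose2[OF indep_vars_subset[OF ind, of "{1..m}"],
            of "\<lambda>_ x. x\<^sup>2 * indicator {x. \<not> x\<^sup>2 > \<epsilon> * real m} x" "\<lambda>_. borel"]
        by (auto simp: indicator_def)
      have mA[measurable]: "A i \<in> borel_measurable M" if "i \<ge> 1" for i
        using that unfolding A_def by measurable
      have mB[measurable]: "B i \<in> borel_measurable M" if "i \<ge> 1" for i
        using that unfolding B_def by measurable
      have iA: "integrable M (A i)" if "i \<ge> 1" for i
        using A0 by (intro Bochner_Integration.integrable_bound[OF int[OF that]]) (auto simp: mA[OF that])
      have iB: "integrable M (B i)" if "i \<ge> 1" for i
        using B0 by (intro Bochner_Integration.integrable_bound[OF int[OF that]]) (auto simp: mB[OF that])
      have iA2: "integrable M (\<lambda>w. (A i w)\<^sup>2)" if "i \<ge> 1" for i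
        using A0 that by (intro integrable_const_bound[where B="(\<epsilon> * real m)\<^sup>2"])
          (auto intro!: AE_I2 power_mono)
      \<comment> \<open>One factor \<open>A i w\<close> is bounded by the truncation level, the
        other one by the untruncated square.\<close>
      have eA2: "expectation (\<lambda>w. (A i w)\<^sup>2) \<le> \<epsilon> * real m * expectation (\<lambda>w. (\<xi> i w)\<^sup>2)" if "i \<ge> 1" for i
      proof -
        have "expectation (\<lambda>w. (A i w)\<^sup>2) \<le> expectation (\<lambda>w. \<epsilon> * real m * (\<xi> i w)\<^sup>2)"
          using int[OF that] iA2[OF that] A0 \<epsilon>
          by (intro integral_mono) (auto simp: power2_eq_square[of "A i _"] intro!: mult_mono)
        then show ?thesis by simp
      qed
      let ?U = "\<lambda>w. (\<Sum>i\<in>{1..m}. A i w - expectation (A i))"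
      note U = sum_centred_square[OF _ indA iA2]
      have U1: "integrable M (\<lambda>w. (?U w)\<^sup>2)" by (rule U) auto
      have "expectation (\<lambda>w. (?U w)\<^sup>2) \<le> (\<Sum>i\<in>{1..m}. expectation (\<lambda>w. (A i w)\<^sup>2))" by (rule U) auto
      also have "\<dots> \<le> (\<Sum>i\<in>{1..m}. \<epsilon> * real m * expectation (\<lambda>w. (\<xi> i w)\<^sup>2))"
        by (intro sum_mono eA2) auto
      also have "\<dots> = \<epsilon> * real m * (real m * mean_upto m (\<lambda>i. expectation (\<lambda>w. (\<xi> i w)\<^sup>2)))"
        using elim by (simp add: sum_distrib_left mean_upto_def)
      also have "\<dots> \<le> \<epsilon> * real m * (real m * C)"
        using bd \<epsilon> by (intro mult_left_mono) auto
      also have "\<dots> \<le> \<eta>\<^sup>2 * (real m)\<^sup>2" using mult_right_mono[OF \<epsilon>(2), of "(real m)\<^sup>2"]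
        by (simp add: power2_eq_square mult_ac)
      finally have U2: "expectation (\<lambda>w. (?U w)\<^sup>2) \<le> \<eta>\<^sup>2 * (real m)\<^sup>2" .
      let ?D = "\<lambda>w. (\<Sum>i\<in>{1..m}. B i w + expectation (B i))"
      have D1: "integrable M ?D" using iB by auto
      have "expectation ?D = (\<Sum>i\<in>{1..m}. 2 * expectation (B i))"
        using iB by (simp add: prob_space)
      also have "\<dots> = 2 * (real m * L m)" using elim
        by (simp add: L_def B_def[abs_def] mean_upto_def sum_distrib_left)
      finally have D2: "expectation ?D = 2 * real m * L m" by simp
      have Yb: "\<bar>Y m w\<bar> \<le> \<eta> + (?U w)\<^sup>2 / (\<eta> * (real m)\<^sup>2) + ?D w / real m" for w
      proof -
        have ee: "expectation (\<lambda>w. (\<xi> i w)\<^sup>2) = expectation (A i) + expectation (B i)" if "i \<ge> 1" for i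
          unfolding AB using iA[OF that] iB[OF that] by simp
        have "Y m w = (1 / real m) * (\<Sum>i\<in>{1..m}. (\<xi> i w)\<^sup>2 - expectation (\<lambda>w. (\<xi> i w)\<^sup>2))"
          by (simp add: Y_def mean_upto_def right_diff_distrib sum_subtractf)
        also have "(\<Sum>i\<in>{1..m}. (\<xi> i w)\<^sup>2 - expectation (\<lambda>w. (\<xi> i w)\<^sup>2))
           = (\<Sum>i\<in>{1..m}. (A i w + B i w) - (expectation (A i) + expectation (B i)))"
          using ee AB by (intro sum.cong) auto
        also have "\<dots> = ?U w + (\<Sum>i\<in>{1..m}. B i w - expectation (B i))"
          by (simp add: sum.distrib sum_subtractf algebra_simps)
        finally have "\<bar>Y m w\<bar> \<le> \<bar>?U w\<bar> / real m + \<bar>\<Sum>i\<in>{1..m}. B i w - expectation (B i)\<bar> / real m"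
          by (simp add: abs_mult abs_divide add_divide_distrib[symmetric] divide_right_mono abs_triangle_ineq)
        moreover have "\<bar>\<Sum>i\<in>{1..m}. B i w - expectation (B i)\<bar> \<le> ?D w"
        proof (rule order_trans[OF sum_abs], rule sum_mono)
          fix i
          have "expectation (B i) \<ge> 0" using B0 by (intro Bochner_Integration.integral_nonneg) auto
          then show "\<bar>B i w - expectation (B i)\<bar> \<le> B i w + expectation (B i)"
            using B0(1)[of i w] by (simp add: abs_le_iff)
        qed
        moreover have "\<bar>?U w\<bar> / real m \<le> \<eta> + (?U w)\<^sup>2 / (\<eta> * (real m)\<^sup>2)"
        proof -
          \<comment> \<open>A linear bound by a square, which turns the second moment of
            \<open>?U\<close> into a bound for its first absolute moment.\<close>
          have "x \<le> \<eta> + x\<^sup>2 / \<eta>" if "x \<ge> 0" for x :: real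
          proof -
            have "0 \<le> (x - \<eta>)\<^sup>2 + x * \<eta>" using that \<eta> by simp
            then show ?thesis using \<eta> by (simp add: field_simps power2_eq_square)
          qed
          from this[of "\<bar>?U w\<bar> / real m"] show ?thesis
            by (simp add: power_divide mult.commute)
        qed
        ultimately show ?thesis
          by (smt (verit) divide_right_mono of_nat_0_le_iff)
      qed
      have "expectation (\<lambda>w. \<bar>Y m w\<bar>) \<le>
          expectation (\<lambda>w. \<eta> + (?U w)\<^sup>2 / (\<eta> * (real m)\<^sup>2) + ?D w / real m)"
        using intY U1 D1 Yb by (intro integral_mono) auto
      also have "\<dots> = \<eta> + expectation (\<lambda>w. (?U w)\<^sup>2) / (\<eta> * (real m)\<^sup>2) + expectation ?D / real m"
        using U1 D1 by (simp add: prob_space)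
      also have "\<dots> \<le> \<eta> + \<eta>\<^sup>2 * (real m)\<^sup>2 / (\<eta> * (real m)\<^sup>2) + 2 * real m * L m / real m"
        unfolding D2 using U2 \<eta> by (intro add_mono divide_right_mono) auto
      also have "\<dots> = 2 * \<eta> + 2 * L m" using \<eta> elim by (simp add: power2_eq_square)
      also have "\<dots> < e" using elim e by (simp add: \<eta>_def)
      finally show ?case by simp
    qed
  qed
  from tendsto_in_prob_L1[of Y, OF intY this] show ?thesis by (simp add: Y_def)
qed

end

section \<open>Second moments of a limit in distribution\<close>

context prob_space
begin

text \<open>\<open>T = U + V\<close> with bounded fourth moments of \<open>U\<close> and \<open>V\<close> small in mean square gives
  uniform integrability of \<open>T\<^sup>2\<close>.\<close>

lemma second_moment_of_limit:
  fixes T U V :: "nat \<Rightarrow> 'a \<Rightarrow> real" and Y :: "'b \<Rightarrow> real"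
  assumes N: "prob_space N" and Y: "Y \<in> borel_measurable N"
    and T: "\<And>m. m \<ge> 1 \<Longrightarrow> T m \<in> borel_measurable M" "\<And>m. m \<ge> 1 \<Longrightarrow> integrable M (\<lambda>w. (T m w)\<^sup>2)"
    and T0: "\<And>m. m \<ge> 1 \<Longrightarrow> expectation (T m) = 0"
    and T2: "\<And>m. m \<ge> 1 \<Longrightarrow> expectation (\<lambda>w. (T m w)\<^sup>2) \<le> C"
    and UV: "\<And>m w. m \<ge> 1 \<Longrightarrow> w \<in> space M \<Longrightarrow> T m w = U m w + V m w"
    and U: "\<And>m. m \<ge> 1 \<Longrightarrow> integrable M (\<lambda>w. (U m w) ^ 4)"
      "\<And>m. m \<ge> 1 \<Longrightarrow> expectation (\<lambda>w. (U m w) ^ 4) \<le> K"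
    and V: "\<And>m. m \<ge> 1 \<Longrightarrow> integrable M (\<lambda>w. (V m w)\<^sup>2)"
      "(\<lambda>m. expectation (\<lambda>w. (V m w)\<^sup>2)) \<longlonglongrightarrow> 0"
    and conv: "\<And>f :: real \<Rightarrow> real. continuous_on UNIV f \<Longrightarrow> bounded (range f) \<Longrightarrow>
        (\<lambda>m. expectation (\<lambda>w. f (T m w))) \<longlonglongrightarrow> (\<integral>v. f (Y v) \<partial>N)"
  shows "integrable N (\<lambda>v. (Y v)\<^sup>2)" "(\<integral>v. Y v \<partial>N) = 0"
    "(\<lambda>m. expectation (\<lambda>w. (T m w)\<^sup>2)) \<longlonglongrightarrow> (\<integral>v. (Y v)\<^sup>2 \<partial>N)"
proof -
  interpret N: prob_space N by (rule N)
  note [measurable] = Y T(1)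
  have C: "C \<ge> 0" using T2[of 1] by (rule order_trans[rotated]) auto
  have K: "K \<ge> 0" using U(2)[of 1] by (rule order_trans[rotated]) (auto simp: zero_le_even_power)
  \<comment> \<open>Bounded continuous minorants of the square. They are admissible test functions
    and increase to it, so integrability of \<open>Y^2\<close> and the value of its integral follow
    by monotone convergence.\<close>
  define q where "q k x = min (x\<^sup>2) (real k)" for k and x :: real
  have q: "continuous_on UNIV (q k)" "bounded (range (q k))" for k
    by (auto simp: q_def intro!: continuous_intros boundedI[of _ "real k"])
  have [measurable]: "q k \<in> borel_measurable borel" for k unfolding q_def by measurable
  have iq: "integrable N (\<lambda>v. q k (Y v))" for k
    by (rule N.integrable_const_bound[where B="real k"]) (auto simp: q_def)
  have iqT: "integrable M (\<lambda>w. q k (T m w))" if "m \<ge> 1" for k m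
    using that by (intro integrable_const_bound[where B="real k"]) (auto simp: q_def)
  note qlim = conv[OF q]
  have qC: "(\<integral>v. q k (Y v) \<partial>N) \<le> C" for k
  proof (rule LIMSEQ_le_const2[OF qlim], intro exI[of _ 1] allI impI)
    fix m :: nat assume m: "1 \<le> m"
    have "expectation (\<lambda>w. q k (T m w)) \<le> expectation (\<lambda>w. (T m w)\<^sup>2)"
      using iqT[OF m] T(2)[OF m] by (intro integral_mono) (auto simp: q_def)
    then show "expectation (\<lambda>w. q k (T m w)) \<le> C" using T2[OF m] by simp
  qed
  have mono: "AE v in N. mono (\<lambda>k. q k (Y v))"
    by (auto simp: mono_def q_def)
  have lims: "AE v in N. (\<lambda>k. q k (Y v)) \<longlonglongrightarrow> (Y v)\<^sup>2"
  proof (rule AE_I2)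
    fix v
    obtain k0 where "(Y v)\<^sup>2 \<le> real k0" using real_arch_simple by blast
    then have "q k (Y v) = (Y v)\<^sup>2" if "k \<ge> k0" for k
      using that by (auto simp: q_def min_def)
    then have "\<forall>\<^sub>F k in sequentially. q k (Y v) = (Y v)\<^sup>2"
      by (rule eventually_sequentiallyI)
    then show "(\<lambda>k. q k (Y v)) \<longlonglongrightarrow> (Y v)\<^sup>2" by (rule tendsto_eventually)
  qed
  have inc: "incseq (\<lambda>k. \<integral>v. q k (Y v) \<partial>N)"
    unfolding incseq_def using iq by (auto intro!: integral_mono simp: q_def)
  obtain l where l: "(\<lambda>k. \<integral>v. q k (Y v) \<partial>N) \<longlonglongrightarrow> l"
    using incseq_convergent[OF inc, of C] qC by blast
  show iY2: "integrable N (\<lambda>v. (Y v)\<^sup>2)"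
    by (rule integrable_monotone_convergence[OF iq mono lims l]) auto
  have lY: "(\<lambda>k. \<integral>v. q k (Y v) \<partial>N) \<longlonglongrightarrow> (\<integral>v. (Y v)\<^sup>2 \<partial>N)"
    using integral_monotone_convergence[OF iq mono lims l] l by auto
  have iY: "integrable N Y" using Y iY2 by (rule N.square_integrable_imp_integrable)
  have YC: "(\<integral>v. (Y v)\<^sup>2 \<partial>N) \<le> C" by (rule LIMSEQ_le_const2[OF lY]) (use qC in auto)
  \<comment> \<open>Uniform integrability in quantitative form: cutting \<open>T^2\<close> off at
    \<open>k\<close> costs a term that vanishes with \<open>m\<close> plus
    \<open>4 * K / k\<close>.\<close>
  have defect: "expectation (\<lambda>w. (T m w)\<^sup>2) - expectation (\<lambda>w. q k (T m w))
       \<le> 2 * expectation (\<lambda>w. (V m w)\<^sup>2) + 4 * K / real k" if m: "m \<ge> 1" and k: "k \<ge> 1" for m k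
  proof -
    have "expectation (\<lambda>w. (T m w)\<^sup>2) - expectation (\<lambda>w. q k (T m w))
       = expectation (\<lambda>w. (T m w)\<^sup>2 - q k (T m w))"
      using T(2)[OF m] iqT[OF m] by simp
    also have "\<dots> \<le> expectation (\<lambda>w. 2 * (V m w)\<^sup>2 + 4 / real k * (U m w) ^ 4)"
    proof (rule integral_mono)
      fix w assume w: "w \<in> space M"
      define u v where "u = U m w" and "v = V m w"
      have "(T m w)\<^sup>2 \<le> 2 * u\<^sup>2 + 2 * v\<^sup>2"
        unfolding UV[OF m w] u_def v_def by (smt (verit) power2_diff power2_sum zero_le_power2)
      moreover have "2 * u\<^sup>2 - real k \<le> 4 / real k * u ^ 4"
      proof -
        \<comment> \<open>The right side equals \<open>4 * u^4 - 2 * k * u^2 + k^2\<close>; dividing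
          by \<open>k\<close> gives the claim.\<close>
        have "0 \<le> (2 * u\<^sup>2 - real k)\<^sup>2 + 2 * u\<^sup>2 * real k" by simp
        then show ?thesis using k by (simp add: field_simps power2_eq_square power4_eq_xxxx)
      qed
      moreover have "0 \<le> 4 / real k * u ^ 4" by (simp add: zero_le_even_power)
      ultimately show "(T m w)\<^sup>2 - q k (T m w) \<le> 2 * (V m w)\<^sup>2 + 4 / real k * (U m w) ^ 4"
        unfolding q_def u_def[symmetric] v_def[symmetric]
        by (smt (verit, best) zero_le_power2)
    qed (use T(2)[OF m] iqT[OF m] U(1)[OF m] V(1)[OF m] in auto)
    also have "\<dots> = 2 * expectation (\<lambda>w. (V m w)\<^sup>2) + 4 / real k * expectation (\<lambda>w. (U m w) ^ 4)"
      using U(1)[OF m] V(1)[OF m] by simp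
    also have "\<dots> \<le> 2 * expectation (\<lambda>w. (V m w)\<^sup>2) + 4 / real k * K"
      using U(2)[OF m] by (intro add_left_mono mult_left_mono) auto
    finally show ?thesis by simp
  qed
  show "(\<lambda>m. expectation (\<lambda>w. (T m w)\<^sup>2)) \<longlonglongrightarrow> (\<integral>v. (Y v)\<^sup>2 \<partial>N)"
  proof (rule tendstoI)
    fix e :: real assume e: "e > 0"
    have "(\<lambda>k. 4 * K * (1 / real k)) \<longlonglongrightarrow> 4 * K * 0"
      by (intro tendsto_intros lim_1_over_n)
    then have "\<forall>\<^sub>F k in sequentially. 4 * K * (1 / real k) < e / 4"
      using e by (intro order_tendstoD(2)) auto
    moreover have "\<forall>\<^sub>F k in sequentially. (\<integral>v. q k (Y v) \<partial>N) > (\<integral>v. (Y v)\<^sup>2 \<partial>N) - e / 4"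
      using e lY by (intro order_tendstoD(1)) auto
    ultimately have "\<forall>\<^sub>F k in sequentially. k \<ge> 1 \<and> 4 * K * (1 / real k) < e / 4 \<and>
       (\<integral>v. q k (Y v) \<partial>N) > (\<integral>v. (Y v)\<^sup>2 \<partial>N) - e / 4"
      using eventually_ge_at_top[of 1] by eventually_elim auto
    then obtain k where k: "k \<ge> 1" "4 * K / real k < e / 4"
       "(\<integral>v. q k (Y v) \<partial>N) > (\<integral>v. (Y v)\<^sup>2 \<partial>N) - e / 4"
      unfolding eventually_sequentially by force
    have qY: "(\<integral>v. q k (Y v) \<partial>N) \<le> (\<integral>v. (Y v)\<^sup>2 \<partial>N)"
      using iq iY2 by (intro integral_mono) (auto simp: q_def)
    have "\<forall>\<^sub>F m in sequentially. dist (expectation (\<lambda>w. q k (T m w))) (\<integral>v. q k (Y v) \<partial>N) < e / 4"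
      using e by (intro tendstoD[OF qlim]) auto
    moreover have "\<forall>\<^sub>F m in sequentially. expectation (\<lambda>w. (V m w)\<^sup>2) < e / 8"
      using e by (intro order_tendstoD(2)[OF V(2)]) auto
    moreover have "\<forall>\<^sub>F m in sequentially. m \<ge> (1::nat)" by (rule eventually_ge_at_top)
    ultimately show "\<forall>\<^sub>F m in sequentially. dist (expectation (\<lambda>w. (T m w)\<^sup>2)) (\<integral>v. (Y v)\<^sup>2 \<partial>N) < e"
    proof eventually_elim
      case (elim m)
      have "expectation (\<lambda>w. q k (T m w)) \<le> expectation (\<lambda>w. (T m w)\<^sup>2)"
        using iqT[OF elim(3)] T(2)[OF elim(3)] by (intro integral_mono) (auto simp: q_def)
      with defect[OF elim(3) k(1)] elim k qY e show ?case
        unfolding dist_real_def by argo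
    qed
  qed
  \<comment> \<open>Clipping at level \<open>k\<close> changes \<open>x\<close> by at most
    \<open>x^2 / k\<close>. The clipped variables are test functions whose means are within
    \<open>C / k\<close> of zero, and the same loss on the side of the limit bounds the mean of
    \<open>Y\<close> by \<open>2 * C / k\<close>.\<close>
  define c where "c k x = max (- real k) (min x (real k))" for k and x :: real
  have c: "continuous_on UNIV (c k)" "bounded (range (c k))" for k
    by (auto simp: c_def intro!: continuous_intros boundedI[of _ "real k"])
  have [measurable]: "c k \<in> borel_measurable borel" for k unfolding c_def by measurable
  have cb: "\<bar>x - c k x\<bar> \<le> x\<^sup>2 / real k" if "k \<ge> 1" for k x
  proof (cases "\<bar>x\<bar> \<le> real k")
    case True then show ?thesis by (auto simp: c_def)
  next
    case False
    then have "\<bar>x - c k x\<bar> \<le> \<bar>x\<bar>" by (auto simp: c_def)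
    also have "\<dots> \<le> \<bar>x\<bar> * \<bar>x\<bar> / real k" using False that
      using mult_left_mono[of "real k" "\<bar>x\<bar>" "\<bar>x\<bar>"] by (simp add: field_simps)
    finally show ?thesis by (simp add: power2_eq_square)
  qed
  have icN: "integrable N (\<lambda>v. c k (Y v))" for k
    by (rule N.integrable_const_bound[where B="real k"]) (auto simp: c_def)
  have icM: "integrable M (\<lambda>v. c k (T m v))" if "m \<ge> 1" for k m
    using that by (intro integrable_const_bound[where B="real k"]) (auto simp: c_def)
  have "\<bar>\<integral>v. Y v \<partial>N\<bar> \<le> 2 * C / real k" if k: "k \<ge> 1" for k
  proof -
    have "\<bar>\<integral>v. Y v \<partial>N - \<integral>v. c k (Y v) \<partial>N\<bar> = \<bar>\<integral>v. Y v - c k (Y v) \<partial>N\<bar>" using iY icN by simp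
    also have "\<dots> \<le> (\<integral>v. \<bar>Y v - c k (Y v)\<bar> \<partial>N)" by (rule integral_abs_bound)
    also have "\<dots> \<le> (\<integral>v. (Y v)\<^sup>2 / real k \<partial>N)"
      using iY icN iY2 cb[OF k] by (intro integral_mono) auto
    also have "\<dots> \<le> C / real k" using YC by (simp add: divide_right_mono)
    finally have 1: "\<bar>\<integral>v. Y v \<partial>N - \<integral>v. c k (Y v) \<partial>N\<bar> \<le> C / real k" .
    have "\<bar>expectation (\<lambda>w. c k (T m w))\<bar> \<le> C / real k" if m: "m \<ge> 1" for m
    proof -
      have iT: "integrable M (T m)" using T(1)[OF m] T(2)[OF m] by (rule square_integrable_imp_integrable)
      have "\<bar>expectation (\<lambda>w. c k (T m w))\<bar> = \<bar>expectation (\<lambda>w. T m w - c k (T m w))\<bar>"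
        using iT icM[OF m] T0[OF m] by simp
      also have "\<dots> \<le> expectation (\<lambda>w. \<bar>T m w - c k (T m w)\<bar>)" by (rule integral_abs_bound)
      also have "\<dots> \<le> expectation (\<lambda>w. (T m w)\<^sup>2 / real k)"
        using iT icM[OF m] T(2)[OF m] cb[OF k] by (intro integral_mono) auto
      also have "\<dots> \<le> C / real k" using T2[OF m] by (simp add: divide_right_mono)
      finally show ?thesis .
    qed
    then have "\<bar>\<integral>v. c k (Y v) \<partial>N\<bar> \<le> C / real k"
      by (intro LIMSEQ_le_const2[OF tendsto_rabs[OF conv[OF c]]]) auto
    then show ?thesis using 1 by simp
  qed
  then have "\<bar>\<integral>v. Y v \<partial>N\<bar> \<le> 0"
    by (intro LIMSEQ_le_const[OF tendsto_mult_right_zero[OF lim_1_over_n, of "2 * C"]]) auto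
  then show "(\<integral>v. Y v \<partial>N) = 0" by simp
qed

end

section \<open>Real symmetric matrices\<close>

lemma inner_matrix_vector_transpose:
  fixes A :: "real^'n^'m"
  shows "x \<bullet> (A *v y) = (transpose A *v x) \<bullet> y"
  by (metis dot_lmul_matrix transpose_matrix_vector)

lemma inner_symmetric_matrix:
  fixes A :: "real^'n^'n"
  assumes "transpose A = A"
  shows "x \<bullet> (A *v y) = (A *v x) \<bullet> y"
  using inner_matrix_vector_transpose[of x A y] assms by simp

text \<open>The first order condition at a minimum without derivatives: at
  \<open>t = - b / s\<close> with \<open>s > 0\<close> and \<open>s >= q\<close> the expression is
  at most \<open>- b^2 / s\<close>.\<close>

lemma quadratic_linear_term_zero:
  fixes b q :: real
  assumes "\<And>t. 0 \<le> 2 * t * b + t\<^sup>2 * q"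
  shows "b = 0"
proof (rule ccontr)
  assume b: "b \<noteq> 0"
  define s where "s = \<bar>q\<bar> + 1"
  have s: "s > 0" "q \<le> s" by (auto simp: s_def)
  have "0 \<le> 2 * (- b / s) * b + (- b / s)\<^sup>2 * q" by (rule assms)
  also have "\<dots> \<le> 2 * (- b / s) * b + (- b / s)\<^sup>2 * s"
    using s by (intro add_left_mono mult_left_mono) auto
  also have "\<dots> = - (b\<^sup>2 / s)" using s by (simp add: field_simps power2_eq_square)
  finally show False using b s by (simp add: field_simps)
qed

text \<open>The Rayleigh quotient on an invariant subspace attains its minimum at an eigenvector.\<close>

lemma symmetric_eigenvector_in_subspace:
  fixes A :: "real^'n^'n"
  assumes A: "transpose A = A" and W: "subspace W" "W \<noteq> {0}" "\<And>x. x \<in> W \<Longrightarrow> A *v x \<in> W"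
  obtains v l where "v \<in> W" "norm v = 1" "A *v v = l *\<^sub>R v"
    "\<And>x. x \<in> W \<Longrightarrow> l * (norm x)\<^sup>2 \<le> x \<bullet> (A *v x)"
proof -
  let ?K = "W \<inter> sphere 0 1"
  obtain z where z: "z \<in> W" "z \<noteq> 0" using W subspace_0 by blast
  then have "(1 / norm z) *\<^sub>R z \<in> ?K" using W(1) by (auto intro: subspace_scale)
  then have "?K \<noteq> {}" by blast
  moreover have "compact ?K"
    using closed_subspace[OF W(1)] by (intro closed_Int_compact) auto
  moreover have "continuous_on ?K (\<lambda>x. x \<bullet> (A *v x))"
    by (intro continuous_intros matrix_vector_mult_linear_continuous_on)
  ultimately obtain v where v: "v \<in> ?K" "\<And>x. x \<in> ?K \<Longrightarrow> v \<bullet> (A *v v) \<le> x \<bullet> (A *v x)"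
    using continuous_attains_inf[of ?K "\<lambda>x. x \<bullet> (A *v x)"] by blast
  define l where "l = v \<bullet> (A *v v)"
  have low: "l * (norm x)\<^sup>2 \<le> x \<bullet> (A *v x)" if x: "x \<in> W" for x
  proof (cases "x = 0")
    case False
    have "(1 / norm x) *\<^sub>R x \<in> ?K" using W(1) x False by (auto intro: subspace_scale)
    then have "l \<le> ((1 / norm x) *\<^sub>R x) \<bullet> (A *v ((1 / norm x) *\<^sub>R x))"
      unfolding l_def by (rule v(2))
    also have "\<dots> = (x \<bullet> (A *v x)) / (norm x)\<^sup>2"
      by (simp add: matrix_vector_mult_scaleR power2_eq_square)
    finally show ?thesis using False by (simp add: field_simps)
  qed simp
  have vW: "v \<in> W" "norm v = 1" using v(1) by auto
  \<comment> \<open>The Rayleigh bound along \<open>v + t h\<close> is a polynomial in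
    \<open>t\<close> with vanishing constant term, so its linear coefficient must vanish.\<close>
  have "h \<bullet> (A *v v - l *\<^sub>R v) = 0" if h: "h \<in> W" for h
  proof (rule quadratic_linear_term_zero)
    fix t :: real
    have "v + t *\<^sub>R h \<in> W" using vW h W(1) by (simp add: subspace_add subspace_scale)
    from low[OF this]
    have "0 \<le> (v + t *\<^sub>R h) \<bullet> (A *v (v + t *\<^sub>R h)) - l * ((v + t *\<^sub>R h) \<bullet> (v + t *\<^sub>R h))"
      by (simp add: power2_norm_eq_inner)
    also have "\<dots> = (v \<bullet> (A *v v) - l * (v \<bullet> v)) + t * (h \<bullet> (A *v v) + v \<bullet> (A *v h) - 2 * l * (h \<bullet> v))
       + t\<^sup>2 * (h \<bullet> (A *v h) - l * (h \<bullet> h))"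
      unfolding matrix_vector_right_distrib matrix_vector_mult_scaleR inner_add_left inner_add_right
        inner_scaleR_left inner_scaleR_right inner_commute[of v h] power2_eq_square
      by (simp add: algebra_simps)
    also have "v \<bullet> (A *v h) = h \<bullet> (A *v v)"
      using inner_symmetric_matrix[OF A, of v h] by (simp add: inner_commute)
    also have "v \<bullet> v = 1" using vW by (simp add: dot_square_norm)
    finally show "0 \<le> 2 * t * (h \<bullet> (A *v v - l *\<^sub>R v)) + t\<^sup>2 * (h \<bullet> (A *v h) - l * (h \<bullet> h))"
      by (simp add: l_def inner_diff_right algebra_simps)
  qed
  moreover have "A *v v - l *\<^sub>R v \<in> W" using vW W by (simp add: subspace_diff subspace_scale)
  ultimately have "(A *v v - l *\<^sub>R v) \<bullet> (A *v v - l *\<^sub>R v) = 0" by blast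
  then have "A *v v = l *\<^sub>R v" by simp
  with vW low that show ?thesis by blast
qed

text \<open>Take a maximal orthonormal family of eigenvectors: its orthogonal complement is
  invariant under \<open>A\<close>, hence would contain a further eigenvector if it were
  nonzero.\<close>

lemma symmetric_eigenbasis:
  fixes A :: "real^'n^'n"
  assumes A: "transpose A = A"
  obtains B l where "finite B" "card B = CARD('n)" "pairwise orthogonal B" "span B = UNIV"
    "\<And>v. v \<in> B \<Longrightarrow> norm v = 1" "\<And>v. v \<in> B \<Longrightarrow> A *v v = l v *\<^sub>R v"
proof -
  define P where "P B \<longleftrightarrow> pairwise orthogonal B \<and> (\<forall>v\<in>B. norm v = 1 \<and> (\<exists>l. A *v v = l *\<^sub>R v))" for B
  have ind: "independent B" if "P B" for B
    using that unfolding P_def by (intro pairwise_orthogonal_independent) force+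
  have bnd: "finite B \<and> card B \<le> CARD('n)" if "P B" for B
    using independent_bound[OF ind[OF that]] by simp
  have "P {}" by (simp add: P_def)
  then obtain B where B: "P B" and max: "\<And>C. P C \<Longrightarrow> card C \<le> card B"
    using ex_has_greatest_nat[of P "{}" card "Suc CARD('n)"] bnd by (auto simp: less_Suc_eq_le)
  have fB: "finite B" using bnd B by blast
  let ?W = "{x. \<forall>v\<in>B. orthogonal v x}"
  have W: "subspace ?W" by (auto simp: subspace_def orthogonal_clauses)
  have W0: "?W = {0}"
  proof (rule ccontr)
    assume W1: "?W \<noteq> {0}"
    have W2: "A *v x \<in> ?W" if "x \<in> ?W" for x
    proof safe
      fix v assume v: "v \<in> B"
      then obtain l where l: "A *v v = l *\<^sub>R v" using B by (auto simp: P_def)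
      have "v \<bullet> (A *v x) = l * (v \<bullet> x)" by (simp add: inner_symmetric_matrix[OF A] l)
      then show "orthogonal v (A *v x)" using that v by (simp add: orthogonal_def)
    qed
    obtain v l where v: "v \<in> ?W" "norm v = 1" "A *v v = l *\<^sub>R v"
      by (rule symmetric_eigenvector_in_subspace[OF A W W1 W2])
    have "v \<notin> B" using v by (auto simp: orthogonal_def)
    moreover have "P (insert v B)"
      using B v by (auto simp: P_def pairwise_insert orthogonal_commute)
    ultimately show False using max[of "insert v B"] fB by simp
  qed
  have "span B = UNIV"
  proof (rule ccontr)
    assume "span B \<noteq> UNIV"
    then obtain a where "a \<noteq> 0" "\<forall>x\<in>span B. a \<bullet> x = 0"
      using span_not_UNIV_orthogonal by blast
    then have "a \<in> ?W" by (auto simp: orthogonal_def inner_commute span_base)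
    with W0 \<open>a \<noteq> 0\<close> show False by blast
  qed
  then have sp: "span B = UNIV" by simp
  have card: "card B = CARD('n)"
    using dim_span_eq_card_independent[OF ind[OF B]] by (simp add: sp dim_UNIV)
  have "\<forall>v\<in>B. \<exists>l. A *v v = l *\<^sub>R v" using B by (simp add: P_def)
  from bchoice[OF this] obtain l where l: "\<forall>v\<in>B. A *v v = l v *\<^sub>R v" by blast
  have "pairwise orthogonal B" "\<And>v. v \<in> B \<Longrightarrow> norm v = 1" using B by (simp_all add: P_def)
  with fB card sp l show ?thesis by (intro that[of B l]) simp_all
qed

lemma orthonormal_expansion:
  fixes B :: "'a::euclidean_space set"
  assumes "finite B" "pairwise orthogonal B" "span B = UNIV" "\<And>v. v \<in> B \<Longrightarrow> norm v = 1"
  shows "(\<Sum>v\<in>B. (v \<bullet> x) *\<^sub>R v) = x"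
proof -
  let ?y = "\<Sum>v\<in>B. (v \<bullet> x) *\<^sub>R v"
  have "w \<bullet> (x - ?y) = 0" if "w \<in> B" for w
  proof -
    have "w \<bullet> ?y = (\<Sum>v\<in>B. (v \<bullet> x) * (w \<bullet> v))" by (simp add: inner_sum_right)
    also have "\<dots> = (\<Sum>v\<in>B. if v = w then w \<bullet> x else 0)"
      using assms that by (intro sum.cong refl)
        (auto simp: pairwise_def orthogonal_def dot_square_norm)
    also have "\<dots> = w \<bullet> x" using assms(1) that by simp
    finally show ?thesis by (simp add: inner_diff_right)
  qed
  then have "\<forall>w\<in>span B. orthogonal (x - ?y) w"
    by (intro ballI) (rule orthogonal_to_span[OF _ ], auto simp: orthogonal_def inner_commute)
  then have "(x - ?y) \<bullet> (x - ?y) = 0" using assms(3) by (simp add: orthogonal_def)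
  then show ?thesis by simp
qed

text \<open>\<open>Min\<close> in \<open>lambda_min\<close> is informative only for a finite set of
  eigenvalues. Eigenvectors chosen for distinct eigenvalues are orthogonal, hence independent, which
  gives finiteness; and the minimum of the Rayleigh quotient is one of the eigenvalues.\<close>

lemma lambda_min_le:
  fixes A :: "real^'k^'k"
  assumes A: "transpose A = A"
  shows "lambda_min A * (norm x)\<^sup>2 \<le> x \<bullet> (A *v x)"
proof -
  let ?E = "{l. \<exists>v. v \<noteq> 0 \<and> A *v v = l *\<^sub>R v}"
  have U: "(UNIV :: (real^'k) set) \<noteq> {0}"
    by (metis UNIV_I axis_eq_0_iff singletonD zero_neq_one)
  obtain v l where v: "norm v = 1" "A *v v = l *\<^sub>R v" and low: "\<And>x. l * (norm x)\<^sup>2 \<le> x \<bullet> (A *v x)"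
    using symmetric_eigenvector_in_subspace[OF A subspace_UNIV U UNIV_I] by (metis UNIV_I)
  have "finite ?E"
  proof -
    define f where "f l = (SOME v. v \<noteq> 0 \<and> A *v v = l *\<^sub>R v)" for l
    have f: "f l \<noteq> 0" "A *v f l = l *\<^sub>R f l" if "l \<in> ?E" for l
      using that someI_ex[of "\<lambda>v. v \<noteq> 0 \<and> A *v v = l *\<^sub>R v"] by (auto simp: f_def)
    have orth: "f l \<bullet> f k = 0" if "l \<in> ?E" "k \<in> ?E" "l \<noteq> k" for l k
      using inner_symmetric_matrix[OF A, of "f l" "f k"] f that by simp
    have "inj_on f ?E"
    proof (rule inj_onI, rule ccontr)
      fix l k assume lk: "l \<in> ?E" "k \<in> ?E" "f l = f k" "l \<noteq> k"
      from orth[OF lk(1,2,4)] f(1)[OF lk(1)] lk(3) show False by simp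
    qed
    moreover have "independent (f ` ?E)"
    proof (rule pairwise_orthogonal_independent)
      show "pairwise orthogonal (f ` ?E)" unfolding pairwise_def orthogonal_def using orth by blast
      show "0 \<notin> f ` ?E" using f(1) by force
    qed
    ultimately show ?thesis using finite_imageD independent_imp_finite by blast
  qed
  moreover have "l \<in> ?E" using v by (intro CollectI exI[of _ v]) auto
  ultimately have "lambda_min A \<le> l" unfolding lambda_min_def by (rule Min_le)
  then have "lambda_min A * (norm x)\<^sup>2 \<le> l * (norm x)\<^sup>2" by (rule mult_right_mono) simp
  with low[of x] show ?thesis by linarith
qed

lemma invertible_if_positive:
  fixes A :: "real^'n^'n"
  assumes "\<And>x. x \<noteq> 0 \<Longrightarrow> 0 < x \<bullet> (A *v x)"
  shows "invertible A"
proof -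
  have "inj ((*v) A)"
    unfolding linear_injective_0[OF matrix_vector_mul_linear] using assms by (metis inner_zero_right less_irrefl)
  then show ?thesis by (simp add: invertible_left_inverse matrix_left_invertible_injective)
qed

lemma
  fixes A :: "real^'n^'n"
  assumes "invertible A"
  shows matrix_inv_right: "A ** matrix_inv A = mat 1"
    and matrix_inv_left: "matrix_inv A ** A = mat 1"
  using someI_ex[of "\<lambda>A'. A ** A' = mat 1 \<and> A' ** A = mat 1"] assms
  unfolding invertible_def matrix_inv_def by blast+

lemma matrix_inv_unique:
  fixes A :: "real^'n^'n"
  assumes "A ** B = mat 1"
  shows "matrix_inv A = B"
proof -
  have "invertible A" using assms by (meson invertible_def matrix_left_right_inverse)
  then have "matrix_inv A ** (A ** B) = B" by (simp add: matrix_mul_assoc matrix_inv_left)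
  then show ?thesis by (simp add: assms)
qed

lemma transpose_matrix_inv:
  fixes A :: "real^'n^'n"
  assumes "invertible A"
  shows "transpose (matrix_inv A) = matrix_inv (transpose A)"
proof -
  have "transpose A ** transpose (matrix_inv A) = mat 1"
    by (simp add: matrix_inv_left[OF assms] transpose_mat flip: matrix_transpose_mul)
  from matrix_inv_unique[OF this] show ?thesis by simp
qed

text \<open>The chosen root enters the norm only through its symmetry and its square, so it is
  enough that some root exists. One is built from an eigenbasis of the inverse as the sum of
  \<open>sqrt (l v) v v^T\<close>.\<close>

lemma inv_sqrt_square:
  fixes A :: "real^'n^'n"
  assumes A: "transpose A = A" and pos: "\<And>x. x \<noteq> 0 \<Longrightarrow> 0 < x \<bullet> (A *v x)"
  shows "(norm (inv_sqrt A *v x))\<^sup>2 = x \<bullet> (matrix_inv A *v x)"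
proof -
  define C where "C = matrix_inv A"
  have inv: "invertible A" using pos by (rule invertible_if_positive)
  have C: "transpose C = C" "A ** C = mat 1"
    using transpose_matrix_inv[OF inv] A matrix_inv_right[OF inv] by (auto simp: C_def)
  have Cpos: "0 < x \<bullet> (C *v x)" if "x \<noteq> 0" for x
  proof -
    have x: "A *v (C *v x) = x" by (simp add: matrix_vector_mul_assoc C)
    then have "C *v x \<noteq> 0" using that by auto
    from pos[OF this] show ?thesis by (simp add: x inner_commute)
  qed
  obtain B l where B: "finite B" "pairwise orthogonal B" "span B = UNIV"
    "\<And>v. v \<in> B \<Longrightarrow> norm v = 1" "\<And>v. v \<in> B \<Longrightarrow> C *v v = l v *\<^sub>R v"
    using symmetric_eigenbasis[OF C(1)] by metis
  note ex = orthonormal_expansion[OF B(1-4)]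
  have l: "l v > 0" if "v \<in> B" for v
    using Cpos[of v] B(4,5)[OF that] by (cases "v = 0") (auto simp: dot_square_norm)
  define R :: "real^'n^'n" where "R = (\<chi> i j. \<Sum>v\<in>B. sqrt (l v) * (v $ i * v $ j))"
  have R: "R *v x = (\<Sum>v\<in>B. (sqrt (l v) * (v \<bullet> x)) *\<^sub>R v)" for x
    unfolding vec_eq_iff
  proof
    fix i
    have "(R *v x) $ i = (\<Sum>j\<in>UNIV. \<Sum>v\<in>B. sqrt (l v) * (v $ i * v $ j) * x $ j)"
      by (simp add: R_def matrix_vector_mult_def sum_distrib_right)
    also have "\<dots> = (\<Sum>v\<in>B. \<Sum>j\<in>UNIV. sqrt (l v) * (v $ i * v $ j) * x $ j)" by (rule sum.swap)
    also have "\<dots> = (\<Sum>v\<in>B. (sqrt (l v) * (v \<bullet> x)) *\<^sub>R v) $ i"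
      by (simp add: inner_vec_def sum_distrib_left sum_distrib_right mult_ac)
    finally show "(R *v x) $ i = (\<Sum>v\<in>B. (sqrt (l v) * (v \<bullet> x)) *\<^sub>R v) $ i" .
  qed
  have vR: "w \<bullet> (R *v x) = sqrt (l w) * (w \<bullet> x)" if "w \<in> B" for w x
  proof -
    have "w \<bullet> (R *v x) = (\<Sum>v\<in>B. sqrt (l v) * (v \<bullet> x) * (w \<bullet> v))" by (simp add: R inner_sum_right)
    also have "\<dots> = (\<Sum>v\<in>B. if v = w then sqrt (l w) * (w \<bullet> x) else 0)"
      using B that by (intro sum.cong refl) (auto simp: pairwise_def orthogonal_def dot_square_norm)
    also have "\<dots> = sqrt (l w) * (w \<bullet> x)" using B(1) that by simp
    finally show ?thesis .
  qed
  have "R *v (R *v x) = C *v x" for x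
  proof -
    have "R *v (R *v x) = (\<Sum>v\<in>B. (sqrt (l v) * (v \<bullet> (R *v x))) *\<^sub>R v)" by (rule R)
    also have "\<dots> = (\<Sum>v\<in>B. (v \<bullet> x) *\<^sub>R (C *v v))"
    proof (rule sum.cong[OF refl])
      fix v assume v: "v \<in> B"
      have "sqrt (l v) * (v \<bullet> (R *v x)) = (sqrt (l v) * sqrt (l v)) * (v \<bullet> x)" by (simp add: vR[OF v])
      also have "\<dots> = l v * (v \<bullet> x)" using l[OF v] by simp
      finally show "(sqrt (l v) * (v \<bullet> (R *v x))) *\<^sub>R v = (v \<bullet> x) *\<^sub>R (C *v v)"
        by (simp add: B(5)[OF v] mult.commute)
    qed
    also have "\<dots> = C *v (\<Sum>v\<in>B. (v \<bullet> x) *\<^sub>R v)"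
      unfolding linear_sum[OF matrix_vector_mul_linear] matrix_vector_mult_scaleR by (rule refl)
    finally show ?thesis by (simp add: ex)
  qed
  then have "R ** R = C" by (simp add: matrix_eq flip: matrix_vector_mul_assoc)
  moreover have "transpose R = R" by (simp add: R_def transpose_def mult_ac vec_eq_iff)
  moreover have "0 < x \<bullet> (R *v x)" if "x \<noteq> 0" for x
  proof -
    have eq: "x \<bullet> (R *v x) = (\<Sum>v\<in>B. sqrt (l v) * (v \<bullet> x)\<^sup>2)"
      by (simp add: R inner_sum_right power2_eq_square inner_commute mult_ac)
    obtain v where v: "v \<in> B" "v \<bullet> x \<noteq> 0"
    proof (rule ccontr)
      assume "\<not> thesis"
      then have "(\<Sum>v\<in>B. (v \<bullet> x) *\<^sub>R v) = 0" using that by (intro sum.neutral) auto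
      with ex[of x] \<open>x \<noteq> 0\<close> show False by simp
    qed
    show ?thesis unfolding eq using B(1) v l by (intro sum_pos2[OF _ v(1)]) (auto simp: less_imp_le)
  qed
  ultimately have "\<exists>R. transpose R = R \<and> (\<forall>x. x \<noteq> 0 \<longrightarrow> 0 < x \<bullet> (R *v x)) \<and> R ** R = matrix_inv A"
    unfolding C_def by blast
  from someI_ex[OF this] have "transpose (inv_sqrt A) = inv_sqrt A" "inv_sqrt A ** inv_sqrt A = matrix_inv A"
    unfolding inv_sqrt_def by blast+
  then have "x \<bullet> (matrix_inv A *v x) = (inv_sqrt A *v x) \<bullet> (inv_sqrt A *v x)"
    by (subst inner_symmetric_matrix[symmetric]) (simp_all add: matrix_vector_mul_assoc)
  then show ?thesis by (simp add: power2_norm_eq_inner)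
qed

section \<open>Limits of matrix expressions\<close>

lemma tendsto_matrix_mult [tendsto_intros]:
  fixes f :: "'z \<Rightarrow> real^'n^'m" and g :: "'z \<Rightarrow> real^'k^'n"
  shows "(f \<longlongrightarrow> A) F \<Longrightarrow> (g \<longlongrightarrow> B) F \<Longrightarrow> ((\<lambda>x. f x ** g x) \<longlongrightarrow> A ** B) F"
  unfolding matrix_matrix_mult_def by (intro tendsto_intros)

lemma tendsto_matrix_vector_mult [tendsto_intros]:
  fixes f :: "'z \<Rightarrow> real^'n^'m"
  shows "(f \<longlongrightarrow> A) F \<Longrightarrow> (g \<longlongrightarrow> b) F \<Longrightarrow> ((\<lambda>x. f x *v g x) \<longlongrightarrow> A *v b) F"
  unfolding matrix_vector_mult_def by (intro tendsto_intros)

lemma tendsto_transpose [tendsto_intros]: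
  fixes f :: "'z \<Rightarrow> real^'n^'m"
  shows "(f \<longlongrightarrow> A) F \<Longrightarrow> ((\<lambda>x. transpose (f x)) \<longlongrightarrow> transpose A) F"
  unfolding transpose_def by (intro tendsto_intros)

lemma tendsto_det:
  fixes f :: "'z \<Rightarrow> real^'n^'n"
  shows "(f \<longlongrightarrow> A) F \<Longrightarrow> ((\<lambda>x. det (f x)) \<longlongrightarrow> det A) F"
  unfolding det_def by (intro tendsto_intros)

lemma tendsto_trace:
  fixes f :: "'z \<Rightarrow> real^'n^'n"
  shows "(f \<longlongrightarrow> A) F \<Longrightarrow> ((\<lambda>x. trace (f x)) \<longlongrightarrow> trace A) F"
  unfolding trace_def by (intro tendsto_intros)

lemma matrix_tendstoI:
  fixes f :: "'z \<Rightarrow> real^'n^'m"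
  assumes "\<And>i j. ((\<lambda>x. f x $ i $ j) \<longlongrightarrow> A $ i $ j) F"
  shows "(f \<longlongrightarrow> A) F"
  using assms by (intro vec_tendstoI) auto

text \<open>Cramer's rule makes every entry of the inverse a quotient of determinants, hence a
  rational function of the entries. Continuity of the inverse and its uniform expansions both rest
  on this form.\<close>

lemma matrix_inv_cramer:
  fixes A :: "real^'n^'n"
  assumes "invertible A"
  shows "matrix_inv A $ k $ l =
    det (\<chi> i j. if j = k then (if i = l then 1 else 0) else A $ i $ j) / det A"
proof -
  have "A *v (matrix_inv A *v axis l 1) = axis l 1"
    by (simp add: matrix_vector_mul_assoc matrix_inv_right[OF assms])
  moreover have "det A \<noteq> 0" using assms by (simp add: invertible_det_nz)
  ultimately have "matrix_inv A *v axis l 1 =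
      (\<chi> k. det (\<chi> i j. if j = k then axis l 1 $ i else A $ i $ j) / det A)"
    using cramer by blast
  then have "(matrix_inv A *v axis l 1) $ k = det (\<chi> i j. if j = k then axis l 1 $ i else A $ i $ j) / det A"
    by simp
  moreover have "(matrix_inv A *v axis l 1) $ k = matrix_inv A $ k $ l"
    by (simp add: matrix_vector_mult_basis column_def)
  moreover have "axis l (1::real) $ i = (if i = l then 1 else 0)" for i by (simp add: axis_def)
  ultimately show ?thesis by (simp cong: if_cong)
qed

lemma eventually_invertible:
  fixes f :: "'z \<Rightarrow> real^'n^'n"
  assumes "(f \<longlongrightarrow> A) F" "invertible A"
  shows "\<forall>\<^sub>F x in F. invertible (f x)"
  using tendsto_imp_eventually_ne[OF tendsto_det[OF assms(1)], of 0] assms(2)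
  by (simp add: invertible_det_nz)

lemma tendsto_matrix_inv:
  fixes f :: "'z \<Rightarrow> real^'n^'n"
  assumes f: "(f \<longlongrightarrow> A) F" and A: "invertible A"
  shows "((\<lambda>x. matrix_inv (f x)) \<longlongrightarrow> matrix_inv A) F"
proof (rule matrix_tendstoI)
  fix k l
  have "((\<lambda>x. (\<chi> i j. if j = k then (if i = l then 1 else 0) else f x $ i $ j) :: real^'n^'n) \<longlongrightarrow>
     (\<chi> i j. if j = k then (if i = l then 1 else 0) else A $ i $ j)) F"
    using f by (intro matrix_tendstoI) (auto intro!: tendsto_intros)
  then have lim: "((\<lambda>x. det (\<chi> i j. if j = k then (if i = l then 1 else 0) else f x $ i $ j) / det (f x)) \<longlongrightarrow>
     det (\<chi> i j. if j = k then (if i = l then 1 else 0) else A $ i $ j) / det A) F"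
    using A f by (intro tendsto_divide tendsto_det) (simp_all add: invertible_det_nz)
  have "\<forall>\<^sub>F x in F. det (\<chi> i j. if j = k then (if i = l then 1 else 0) else f x $ i $ j) / det (f x)
     = matrix_inv (f x) $ k $ l"
    using eventually_invertible[OF f A] by eventually_elim (simp add: matrix_inv_cramer)
  from Lim_transform_eventually[OF lim this]
  show "((\<lambda>x. matrix_inv (f x) $ k $ l) \<longlongrightarrow> matrix_inv A $ k $ l) F"
    unfolding matrix_inv_cramer[OF A] .
qed

section \<open>Averages\<close>

lemma mean_upto_add: "mean_upto m (\<lambda>i. f i + g i) = mean_upto m f + mean_upto m g"
  by (simp add: mean_upto_def sum.distrib scaleR_add_right)

lemma mean_upto_diff: "mean_upto m (\<lambda>i. f i - g i) = mean_upto m f - mean_upto m g"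
  by (simp add: mean_upto_def sum_subtractf scaleR_diff_right)

lemma mean_upto_scale: "mean_upto m (\<lambda>i. c * f i) = c * mean_upto m f" for f :: "nat \<Rightarrow> real"
  by (simp add: mean_upto_def sum_distrib_left mult_ac)

lemma mean_upto_mono:
  fixes f g :: "nat \<Rightarrow> real"
  assumes "\<And>i. 1 \<le> i \<Longrightarrow> i \<le> m \<Longrightarrow> f i \<le> g i"
  shows "mean_upto m f \<le> mean_upto m g"
proof -
  have "(\<Sum>i=1..m. f i) \<le> (\<Sum>i=1..m. g i)" using assms by (intro sum_mono) auto
  then show ?thesis by (simp add: mean_upto_def divide_right_mono)
qed

lemma mean_upto_cong:
  "(\<And>i. 1 \<le> i \<Longrightarrow> i \<le> m \<Longrightarrow> f i = g i) \<Longrightarrow> mean_upto m f = mean_upto m g"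
  unfolding mean_upto_def by (intro arg_cong2[where f=scaleR] sum.cong) auto

lemma mean_upto_nonneg:
  fixes f :: "nat \<Rightarrow> real"
  assumes "\<And>i. 1 \<le> i \<Longrightarrow> i \<le> m \<Longrightarrow> 0 \<le> f i"
  shows "0 \<le> mean_upto m f"
  using mean_upto_mono[of m "\<lambda>_. 0" f] assms by (simp add: mean_upto_def)

lemma mean_upto_const: "m \<ge> 1 \<Longrightarrow> mean_upto m (\<lambda>_. x) = x"
  by (simp add: mean_upto_def sum_constant_scaleR)

lemma mean_upto_const_le: "c \<ge> 0 \<Longrightarrow> mean_upto m (\<lambda>_. c) \<le> c" for c :: real
  by (cases "m = 0") (auto simp: mean_upto_def)

lemma norm_mean_upto_le: "norm (mean_upto m f) \<le> mean_upto m (\<lambda>i. norm (f i))"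
  by (simp add: mean_upto_def divide_right_mono norm_sum)

lemma mean_upto_nth: "mean_upto m f $ k = mean_upto m (\<lambda>i. f i $ k)" for f :: "nat \<Rightarrow> 'a::real_vector^'k"
  by (simp add: mean_upto_def)

lemma mean_upto_linear: "linear L \<Longrightarrow> mean_upto m (\<lambda>i. L (f i)) = L (mean_upto m f)"
  by (simp add: mean_upto_def linear_cmul linear_sum)

text \<open>An argument of Toeplitz type: the indices up to \<open>N\<close> contribute at most a
  fixed total \<open>D\<close>, which the division by \<open>m\<close> removes, and beyond
  \<open>N\<close> the weights are below \<open>e'\<close>.\<close>

lemma mean_upto_null_weights:
  fixes \<epsilon> x :: "nat \<Rightarrow> real"
  assumes \<epsilon>: "\<epsilon> \<longlonglongrightarrow> 0" and x: "\<And>i. i \<ge> 1 \<Longrightarrow> x i \<ge> 0" and C: "\<And>m. mean_upto m x \<le> C"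
  shows "(\<lambda>m. mean_upto m (\<lambda>i. \<bar>\<epsilon> i\<bar> * x i)) \<longlonglongrightarrow> 0"
proof (rule tendstoI)
  fix e :: real assume e: "e > 0"
  have C0: "C \<ge> 0" using C[of 0] by (simp add: mean_upto_def)
  define e' where "e' = e / (2 * (C + 1))"
  have e': "e' > 0" "e' * C \<le> e / 2" using e C0 by (auto simp: e'_def field_simps)
  obtain N where N: "\<And>i. i \<ge> N \<Longrightarrow> \<bar>\<epsilon> i\<bar> < e'"
    using tendstoD[OF \<epsilon> e'(1)] by (auto simp: eventually_sequentially)
  define D where "D = (\<Sum>i\<in>{1..N}. \<bar>\<epsilon> i\<bar> * x i)"
  have "(\<lambda>m. D * (1 / real m)) \<longlonglongrightarrow> D * 0" by (intro tendsto_intros lim_1_over_n)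
  then have "\<forall>\<^sub>F m in sequentially. D * (1 / real m) < e / 2"
    using e by (intro order_tendstoD(2)) auto
  then show "\<forall>\<^sub>F m in sequentially. dist (mean_upto m (\<lambda>i. \<bar>\<epsilon> i\<bar> * x i)) 0 < e"
  proof eventually_elim
    case (elim m)
    have "(\<Sum>i=1..m. \<bar>\<epsilon> i\<bar> * x i) \<le> (\<Sum>i=1..m. (if i \<in> {1..N} then \<bar>\<epsilon> i\<bar> * x i else 0) + e' * x i)"
    proof (rule sum_mono)
      fix i assume i: "i \<in> {1..m}"
      show "\<bar>\<epsilon> i\<bar> * x i \<le> (if i \<in> {1..N} then \<bar>\<epsilon> i\<bar> * x i else 0) + e' * x i"
      proof (cases "i \<in> {1..N}")
        case True
        have "0 \<le> e' * x i" using i x[of i] e' by simp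
        then show ?thesis using True by simp
      next
        case False
        then have "\<bar>\<epsilon> i\<bar> * x i \<le> e' * x i" using i x[of i] N[of i] by (intro mult_right_mono) auto
        then show ?thesis by (simp only: False if_False add_0)
      qed
    qed
    also have "\<dots> = (\<Sum>i\<in>{1..m} \<inter> {1..N}. \<bar>\<epsilon> i\<bar> * x i) + e' * (\<Sum>i=1..m. x i)"
      by (simp only: sum.distrib sum_distrib_left sum.inter_restrict[OF finite_atLeastAtMost])
    also have "\<dots> \<le> D + e' * (\<Sum>i=1..m. x i)"
      unfolding D_def using x by (intro add_right_mono sum_mono2) auto
    finally have "mean_upto m (\<lambda>i. \<bar>\<epsilon> i\<bar> * x i) \<le> (D + e' * (\<Sum>i=1..m. x i)) / real m"
      by (simp add: mean_upto_def divide_right_mono)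
    also have "\<dots> = D * (1 / real m) + e' * mean_upto m x"
      by (simp add: mean_upto_def add_divide_distrib)
    also have "\<dots> < e / 2 + e / 2"
      using elim e' mult_left_mono[OF C[of m], of e'] by linarith
    finally have "mean_upto m (\<lambda>i. \<bar>\<epsilon> i\<bar> * x i) < e" by simp
    moreover have "mean_upto m (\<lambda>i. \<bar>\<epsilon> i\<bar> * x i) \<ge> 0" using x by (intro mean_upto_nonneg) auto
    ultimately show ?case by simp
  qed
qed

lemma mean_upto_tendsto:
  fixes f :: "nat \<Rightarrow> 'a::real_normed_vector"
  assumes "f \<longlonglongrightarrow> L"
  shows "(\<lambda>m. mean_upto m f) \<longlonglongrightarrow> L"
proof -
  have "(\<lambda>i. norm (f i - L)) \<longlonglongrightarrow> 0" using assms by (simp add: LIM_zero tendsto_norm_zero)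
  from mean_upto_null_weights[OF this, of "\<lambda>_. 1" 1]
  have lim: "(\<lambda>m. mean_upto m (\<lambda>i. norm (f i - L))) \<longlonglongrightarrow> 0"
    using mean_upto_const_le[of 1] by simp
  have "\<forall>\<^sub>F m in sequentially. norm (mean_upto m f - L) \<le> mean_upto m (\<lambda>i. norm (f i - L))"
    using eventually_ge_at_top[of 1]
  proof eventually_elim
    case (elim m)
    then have "mean_upto m f - L = mean_upto m (\<lambda>i. f i - L)"
      by (simp add: mean_upto_diff mean_upto_const)
    then show ?case using norm_mean_upto_le[of m "\<lambda>i. f i - L"] by simp
  qed
  from Lim_null_comparison[OF this lim] show ?thesis by (simp add: LIM_zero_cancel)
qed

text \<open>Each \<open>x n / n\<close> is a difference of consecutive means, up to the factor
  \<open>(n - 1) / n\<close>, so it tends to zero as soon as the means converge. The running maximum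
  inherits this: finitely many early terms are bounded by a constant, and later ones are at most
  \<open>e / 2\<close> times their index.\<close>

lemma max_term_of_convergent_mean:
  fixes x :: "nat \<Rightarrow> real"
  assumes x: "\<And>i. i \<ge> 1 \<Longrightarrow> x i \<ge> 0" and L: "(\<lambda>m. mean_upto m x) \<longlonglongrightarrow> L"
  obtains A where "\<And>i m. 1 \<le> i \<Longrightarrow> i \<le> m \<Longrightarrow> x i \<le> A m" "\<And>m. A m \<ge> 0" "(\<lambda>m. A m / real m) \<longlonglongrightarrow> 0"
proof -
  \<comment> \<open>Inserting 0 keeps \<open>Max\<close> meaningful for \<open>m = 0\<close> and
    yields nonnegativity.\<close>
  define A where "A m = Max (insert 0 (x ` {1..m}))" for m
  have A1: "x i \<le> A m" if "1 \<le> i" "i \<le> m" for i m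
    unfolding A_def using that by (intro Max_ge) auto
  have A0: "A m \<ge> 0" for m unfolding A_def by (intro Max_ge) auto
  have LS: "(\<lambda>n. mean_upto (Suc n) x) \<longlonglongrightarrow> L" using L by (rule LIMSEQ_Suc)
  have "(\<lambda>n. mean_upto (Suc n) x - (real n / real (Suc n)) * mean_upto n x) \<longlonglongrightarrow> L - 1 * L"
    by (intro tendsto_diff tendsto_mult LS L LIMSEQ_n_over_Suc_n)
  moreover have "mean_upto (Suc n) x - (real n / real (Suc n)) * mean_upto n x = x (Suc n) / real (Suc n)" for n
  proof -
    have "(real n / real (Suc n)) * mean_upto n x = (\<Sum>i=1..n. x i) / real (Suc n)"
      by (cases "n = 0") (auto simp: mean_upto_def)
    then show ?thesis by (simp add: mean_upto_def add_divide_distrib)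
  qed
  ultimately have "(\<lambda>n. x (Suc n) / real (Suc n)) \<longlonglongrightarrow> 0" by simp
  then have lim: "(\<lambda>n. x n / real n) \<longlonglongrightarrow> 0" by (rule LIMSEQ_imp_Suc)
  have "(\<lambda>m. A m / real m) \<longlonglongrightarrow> 0"
  proof (rule tendstoI)
    fix e :: real assume e: "e > 0"
    obtain N where N: "\<And>i. i \<ge> N \<Longrightarrow> \<bar>x i / real i\<bar> < e / 2"
      using tendstoD[OF lim, of "e / 2"] e by (auto simp: eventually_sequentially)
    define D where "D = (\<Sum>i\<in>{1..N}. x i)"
    have D0: "D \<ge> 0" unfolding D_def using x by (intro sum_nonneg) auto
    have "(\<lambda>m. D * (1 / real m)) \<longlonglongrightarrow> D * 0" by (intro tendsto_intros lim_1_over_n)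
    then have "\<forall>\<^sub>F m in sequentially. D * (1 / real m) < e / 2"
      using e by (intro order_tendstoD(2)) auto
    then show "\<forall>\<^sub>F m in sequentially. dist (A m / real m) 0 < e"
      using eventually_ge_at_top[of 1]
    proof eventually_elim
      case (elim m)
      have "x i \<le> D + e / 2 * real m" if i: "1 \<le> i" "i \<le> m" for i
      proof (cases "i \<le> N")
        case True
        have "x i \<le> D" unfolding D_def using True i x by (intro member_le_sum) auto
        moreover have "0 \<le> e / 2 * real m" using e by simp
        ultimately show ?thesis by linarith
      next
        case False
        then have "x i \<le> e / 2 * real i" using N[of i] x[of i] i by (simp add: field_simps)
        also have "\<dots> \<le> e / 2 * real m" using e i by (intro mult_left_mono) auto
        finally show ?thesis using D0 by simp
      qed
      then have "A m \<le> D + e / 2 * real m"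
        unfolding A_def using D0 e by (intro Max.boundedI) auto
      then have "A m / real m \<le> (D + e / 2 * real m) / real m" by (rule divide_right_mono) simp
      also have "\<dots> = D * (1 / real m) + e / 2" using elim by (simp add: field_simps)
      finally have "A m / real m < e" using elim(1) by linarith
      then show ?case using A0[of m] by simp
    qed
  qed
  with A1 A0 show ?thesis by (rule that)
qed

section \<open>Families with uniform second order expansions\<close>

text \<open>A family of functions is expanded at \<open>x0\<close> into finitely many products of a function of the
  point and a bounded function of the index, up to a uniform cubic remainder. For the weighted sums
  of noise below only these bounded weights matter, so no convergence of the family is needed.\<close>

inductive separable :: "'a::metric_space \<Rightarrow> (nat \<Rightarrow> 'a \<Rightarrow> real) \<Rightarrow> bool" for x0 where
  separable_zero: "separable x0 (\<lambda>i x. 0)"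
| separable_add: "separable x0 h \<Longrightarrow> \<forall>\<^sub>F x in nhds x0. \<bar>\<phi> x\<bar> \<le> C * dist x x0 \<Longrightarrow>
    (\<And>i. i \<ge> 1 \<Longrightarrow> \<bar>g i\<bar> \<le> D) \<Longrightarrow> separable x0 (\<lambda>i x. h i x + \<phi> x * g i)"

text \<open>No derivatives occur: terms of first and second order are both collected in
  \<open>h\<close>, whose factors are merely bounded by a multiple of the distance. This keeps the
  class closed under sums, products, and inverses of families bounded away from zero.\<close>

definition taylor2 :: "'a::metric_space \<Rightarrow> (nat \<Rightarrow> 'a \<Rightarrow> real) \<Rightarrow> bool" where
  "taylor2 x0 f \<longleftrightarrow> (\<exists>B. \<forall>i\<ge>1. \<bar>f i x0\<bar> \<le> B) \<and>
     (\<exists>h C. separable x0 h \<and>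
        (\<forall>\<^sub>F x in nhds x0. \<forall>i\<ge>1. \<bar>f i x - f i x0 - h i x\<bar> \<le> C * dist x x0 ^ 3))"

lemma separable_plus:
  assumes "separable x0 k" "separable x0 h"
  shows "separable x0 (\<lambda>i x. h i x + k i x)"
  using assms
proof (induction rule: separable.induct)
  case (separable_add k \<phi> C g D)
  have "separable x0 (\<lambda>i x. (h i x + k i x) + \<phi> x * g i)"
    by (rule separable.separable_add[OF separable_add.IH[OF separable_add.prems] separable_add.hyps(2,3)])
  then show ?case by (simp add: add.assoc)
qed simp

lemma separable_single:
  assumes "\<forall>\<^sub>F x in nhds x0. \<bar>\<phi> x\<bar> \<le> C * dist x x0" "\<And>i. i \<ge> 1 \<Longrightarrow> \<bar>g i\<bar> \<le> D"
  shows "separable x0 (\<lambda>i x. \<phi> x * g i)"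
  using separable_add[OF separable_zero assms] by simp

lemma abs_le_abs_mult: "x \<le> C * d \<Longrightarrow> d \<ge> 0 \<Longrightarrow> x \<le> \<bar>C\<bar> * d" for x C d :: real
  by (meson abs_ge_self mult_right_mono order_trans)

lemma separable_bound:
  assumes "separable x0 h"
  shows "\<exists>C\<ge>0. \<forall>\<^sub>F x in nhds x0. \<forall>i\<ge>1. \<bar>h i x\<bar> \<le> C * dist x x0"
  using assms
proof (induction rule: separable.induct)
  case separable_zero
  then show ?case by (intro exI[of _ 0]) auto
next
  case (separable_add h \<phi> C g D)
  then obtain E where E: "E \<ge> 0" "\<forall>\<^sub>F x in nhds x0. \<forall>i\<ge>1. \<bar>h i x\<bar> \<le> E * dist x x0" by blast
  have D: "D \<ge> 0" using separable_add.hyps(3)[of 1] by simp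
  have "\<forall>\<^sub>F x in nhds x0. \<forall>i\<ge>1. \<bar>h i x + \<phi> x * g i\<bar> \<le> (E + \<bar>C\<bar> * D) * dist x x0"
    using E(2) separable_add.hyps(2)
  proof eventually_elim
    case (elim x)
    show ?case
    proof (intro allI impI)
      fix i :: nat assume i: "i \<ge> 1"
      have "\<bar>\<phi> x\<bar> \<le> \<bar>C\<bar> * dist x x0" using elim(2) by (rule abs_le_abs_mult) simp
      then have 1: "\<bar>\<phi> x * g i\<bar> \<le> (\<bar>C\<bar> * dist x x0) * D"
        unfolding abs_mult using separable_add.hyps(3)[OF i] by (intro mult_mono) auto
      have 2: "\<bar>h i x\<bar> \<le> E * dist x x0" using elim(1) i by blast
      have "\<bar>h i x + \<phi> x * g i\<bar> \<le> \<bar>h i x\<bar> + \<bar>\<phi> x * g i\<bar>" by (rule abs_triangle_ineq)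
      also have "\<dots> \<le> E * dist x x0 + (\<bar>C\<bar> * dist x x0) * D" using 1 2 by (rule add_mono[rotated])
      also have "\<dots> = (E + \<bar>C\<bar> * D) * dist x x0" by (simp add: algebra_simps)
      finally show "\<bar>h i x + \<phi> x * g i\<bar> \<le> (E + \<bar>C\<bar> * D) * dist x x0" .
    qed
  qed
  then show ?case using E D by (intro exI[of _ "E + \<bar>C\<bar> * D"]) auto
qed

lemma separable_scale:
  assumes "separable x0 h" and k: "\<And>i. i \<ge> 1 \<Longrightarrow> \<bar>k i\<bar> \<le> B"
  shows "separable x0 (\<lambda>i x. h i x * k i)"
  using assms(1)
proof (induction rule: separable.induct)
  case separable_zero
  then show ?case using separable.separable_zero by simp
next
  case (separable_add h \<phi> C g D)
  have "separable x0 (\<lambda>i x. h i x * k i + \<phi> x * (g i * k i))"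
    using separable_add.IH separable_add.hyps(2)
  proof (rule separable.separable_add)
    fix i :: nat assume i: "i \<ge> 1"
    show "\<bar>g i * k i\<bar> \<le> D * B" unfolding abs_mult
      using separable_add.hyps(3)[OF i] k[OF i] by (intro mult_mono) auto
  qed
  then show ?case by (simp add: algebra_simps)
qed

lemma eventually_nhds_dist: "e > 0 \<Longrightarrow> \<forall>\<^sub>F x in nhds x0. dist x x0 < e"
  by (auto simp: eventually_nhds_metric)

text \<open>Only a bound by the distance is recorded for each factor, so a product stays in the
  class as soon as one factor is at most 1 near \<open>x0\<close>; its extra smallness is given
  away.\<close>

lemma separable_mult_fun:
  assumes "separable x0 h" and \<psi>: "\<forall>\<^sub>F x in nhds x0. \<bar>\<psi> x\<bar> \<le> B * dist x x0"
  shows "separable x0 (\<lambda>i x. h i x * \<psi> x)"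
  using assms(1)
proof (induction rule: separable.induct)
  case separable_zero
  then show ?case using separable.separable_zero by simp
next
  case (separable_add h \<phi> C g D)
  have small: "\<forall>\<^sub>F x in nhds x0. dist x x0 < 1 / (\<bar>B\<bar> + 1)" by (rule eventually_nhds_dist) simp
  have "\<forall>\<^sub>F x in nhds x0. \<bar>\<phi> x * \<psi> x\<bar> \<le> \<bar>C\<bar> * dist x x0"
    using separable_add.hyps(2) \<psi> small
  proof eventually_elim
    case (elim x)
    have "\<bar>\<psi> x\<bar> \<le> \<bar>B\<bar> * dist x x0" using elim(2) by (rule abs_le_abs_mult) simp
    also have "\<dots> \<le> (\<bar>B\<bar> + 1) * (1 / (\<bar>B\<bar> + 1))" using elim(3) by (intro mult_mono) auto
    also have "\<dots> = 1" by (simp add: field_simps)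
    finally have "\<bar>\<psi> x\<bar> \<le> 1" .
    moreover have "\<bar>\<phi> x\<bar> \<le> \<bar>C\<bar> * dist x x0" using elim(1) by (rule abs_le_abs_mult) simp
    ultimately have "\<bar>\<phi> x\<bar> * \<bar>\<psi> x\<bar> \<le> \<bar>C\<bar> * dist x x0 * 1" by (intro mult_mono) auto
    then show ?case by (simp add: abs_mult)
  qed
  from separable.separable_add[OF separable_add.IH this separable_add.hyps(3)]
  have "separable x0 (\<lambda>i x. h i x * \<psi> x + (\<phi> x * \<psi> x) * g i)" .
  then show ?case by (simp add: algebra_simps)
qed

lemma separable_times:
  assumes "separable x0 k" "separable x0 h"
  shows "separable x0 (\<lambda>i x. h i x * k i x)"
  using assms(1)
proof (induction rule: separable.induct)
  case separable_zero
  then show ?case using separable.separable_zero by simp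
next
  case (separable_add k \<phi> C g D)
  have "separable x0 (\<lambda>i x. h i x * \<phi> x * g i)"
    by (rule separable_scale[OF separable_mult_fun[OF assms(2) separable_add.hyps(2)] separable_add.hyps(3)])
  from separable_plus[OF this separable_add.IH] show ?case by (simp add: algebra_simps)
qed

lemma taylor2I:
  assumes "\<And>i. i \<ge> 1 \<Longrightarrow> \<bar>f i x0\<bar> \<le> B" "separable x0 h"
    "\<forall>\<^sub>F x in nhds x0. \<forall>i\<ge>1. \<bar>f i x - f i x0 - h i x\<bar> \<le> C * dist x x0 ^ 3"
  shows "taylor2 x0 f"
  unfolding taylor2_def using assms by blast

lemma taylor2_expansion:
  assumes "taylor2 x0 f"
  obtains B h C where "B \<ge> 0" "\<And>i. i \<ge> 1 \<Longrightarrow> \<bar>f i x0\<bar> \<le> B" "separable x0 h" "C \<ge> 0"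
    "\<forall>\<^sub>F x in nhds x0. \<forall>i\<ge>1. \<bar>f i x - f i x0 - h i x\<bar> \<le> C * dist x x0 ^ 3"
proof -
  from assms obtain B h C where 1: "\<forall>i\<ge>1. \<bar>f i x0\<bar> \<le> B" and 2: "separable x0 h"
    and 3: "\<forall>\<^sub>F x in nhds x0. \<forall>i\<ge>1. \<bar>f i x - f i x0 - h i x\<bar> \<le> C * dist x x0 ^ 3"
    unfolding taylor2_def by blast
  have "B \<ge> 0" using 1[rule_format, of 1] by simp
  moreover have "\<forall>\<^sub>F x in nhds x0. \<forall>i\<ge>1. \<bar>f i x - f i x0 - h i x\<bar> \<le> \<bar>C\<bar> * dist x x0 ^ 3"
    using 3 by eventually_elim (auto intro: abs_le_abs_mult)
  ultimately show ?thesis using that[of B h "\<bar>C\<bar>"] 1 2 by simp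
qed

lemma taylor2_const:
  assumes "\<And>i. i \<ge> 1 \<Longrightarrow> \<bar>g i\<bar> \<le> B"
  shows "taylor2 x0 (\<lambda>i x. g i)"
  by (rule taylor2I[where h="\<lambda>i x. 0" and B=B and C=0]) (auto simp: assms separable_zero)

lemma taylor2_fun:
  assumes "\<forall>\<^sub>F x in nhds x0. \<bar>\<phi> x - \<phi> x0\<bar> \<le> C * dist x x0"
  shows "taylor2 x0 (\<lambda>i. \<phi>)"
proof (rule taylor2I)
  show "separable x0 (\<lambda>i x. (\<phi> x - \<phi> x0) * 1)" by (rule separable_single[OF assms, of _ 1]) simp
  show "\<forall>\<^sub>F x in nhds x0. \<forall>i\<ge>1. \<bar>\<phi> x - \<phi> x0 - (\<phi> x - \<phi> x0) * 1\<bar> \<le> 0 * dist x x0 ^ 3" by simp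
qed (rule order_refl)

text \<open>Increments that agree up to a cubic error share an expansion. This is how an inverse
  inherits the expansion of its polynomial approximation.\<close>

lemma taylor2_perturb:
  assumes f: "taylor2 x0 f" and g: "\<And>i. i \<ge> 1 \<Longrightarrow> \<bar>g i x0\<bar> \<le> B"
    and r: "\<forall>\<^sub>F x in nhds x0. \<forall>i\<ge>1. \<bar>(g i x - g i x0) - (f i x - f i x0)\<bar> \<le> D * dist x x0 ^ 3"
  shows "taylor2 x0 g"
proof -
  from f obtain h C where h: "separable x0 h"
    "\<forall>\<^sub>F x in nhds x0. \<forall>i\<ge>1. \<bar>f i x - f i x0 - h i x\<bar> \<le> C * dist x x0 ^ 3"
    by (rule taylor2_expansion) (rule that; assumption)
  have "\<forall>\<^sub>F x in nhds x0. \<forall>i\<ge>1. \<bar>g i x - g i x0 - h i x\<bar> \<le> (C + D) * dist x x0 ^ 3"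
    using h(2) r
  proof eventually_elim
    case (elim x)
    show ?case
    proof (intro allI impI)
      fix i :: nat assume "i \<ge> 1"
      then have "\<bar>f i x - f i x0 - h i x\<bar> \<le> C * dist x x0 ^ 3"
        "\<bar>(g i x - g i x0) - (f i x - f i x0)\<bar> \<le> D * dist x x0 ^ 3" using elim by blast+
      then show "\<bar>g i x - g i x0 - h i x\<bar> \<le> (C + D) * dist x x0 ^ 3"
        unfolding distrib_right by linarith
    qed
  qed
  with g h(1) show ?thesis by (rule taylor2I)
qed

lemma taylor2_add:
  assumes f: "taylor2 x0 f" and g: "taylor2 x0 g"
  shows "taylor2 x0 (\<lambda>i x. f i x + g i x)"
proof -
  from f obtain A h C where h: "\<And>i. i \<ge> 1 \<Longrightarrow> \<bar>f i x0\<bar> \<le> A" "separable x0 h"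
    "\<forall>\<^sub>F x in nhds x0. \<forall>i\<ge>1. \<bar>f i x - f i x0 - h i x\<bar> \<le> C * dist x x0 ^ 3"
    by (rule taylor2_expansion) (rule that; assumption)
  from g obtain B k D where k: "\<And>i. i \<ge> 1 \<Longrightarrow> \<bar>g i x0\<bar> \<le> B" "separable x0 k"
    "\<forall>\<^sub>F x in nhds x0. \<forall>i\<ge>1. \<bar>g i x - g i x0 - k i x\<bar> \<le> D * dist x x0 ^ 3"
    by (rule taylor2_expansion) (rule that; assumption)
  show ?thesis
  proof (rule taylor2I)
    show "\<bar>f i x0 + g i x0\<bar> \<le> A + B" if "i \<ge> 1" for i using h(1)[OF that] k(1)[OF that] by linarith
    show "separable x0 (\<lambda>i x. h i x + k i x)" by (rule separable_plus[OF k(2) h(2)])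
    show "\<forall>\<^sub>F x in nhds x0. \<forall>i\<ge>1. \<bar>f i x + g i x - (f i x0 + g i x0) - (h i x + k i x)\<bar>
      \<le> (C + D) * dist x x0 ^ 3"
      using h(3) k(3)
    proof eventually_elim
      case (elim x)
      show ?case
      proof (intro allI impI)
        fix i :: nat assume "i \<ge> 1"
        then have "\<bar>f i x - f i x0 - h i x\<bar> \<le> C * dist x x0 ^ 3"
          "\<bar>g i x - g i x0 - k i x\<bar> \<le> D * dist x x0 ^ 3" using elim by blast+
        then show "\<bar>f i x + g i x - (f i x0 + g i x0) - (h i x + k i x)\<bar> \<le> (C + D) * dist x x0 ^ 3"
          unfolding distrib_right by linarith
      qed
    qed
  qed
qed

lemma taylor2_mult:
  assumes f: "taylor2 x0 f" and g: "taylor2 x0 g"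
  shows "taylor2 x0 (\<lambda>i x. f i x * g i x)"
proof -
  from f obtain A h C where h: "A \<ge> 0" "\<And>i. i \<ge> 1 \<Longrightarrow> \<bar>f i x0\<bar> \<le> A" "separable x0 h" "C \<ge> 0"
    "\<forall>\<^sub>F x in nhds x0. \<forall>i\<ge>1. \<bar>f i x - f i x0 - h i x\<bar> \<le> C * dist x x0 ^ 3"
    by (rule taylor2_expansion) (rule that; assumption)
  from g obtain B k D where k: "B \<ge> 0" "\<And>i. i \<ge> 1 \<Longrightarrow> \<bar>g i x0\<bar> \<le> B" "separable x0 k" "D \<ge> 0"
    "\<forall>\<^sub>F x in nhds x0. \<forall>i\<ge>1. \<bar>g i x - g i x0 - k i x\<bar> \<le> D * dist x x0 ^ 3"
    by (rule taylor2_expansion) (rule that; assumption)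
  obtain E where E: "E \<ge> 0" "\<forall>\<^sub>F x in nhds x0. \<forall>i\<ge>1. \<bar>h i x\<bar> \<le> E * dist x x0"
    using separable_bound[OF h(3)] by blast
  obtain F where F: "F \<ge> 0" "\<forall>\<^sub>F x in nhds x0. \<forall>i\<ge>1. \<bar>k i x\<bar> \<le> F * dist x x0"
    using separable_bound[OF k(3)] by blast
  \<comment> \<open>Writing \<open>f = f0 + h + r\<close> and \<open>g = g0 + k + s\<close>, these
    are the increments free of remainders; what is left is
    \<open>r * (g0 + k + s) + s * (f0 + h)\<close>, in each term a cubic factor times a bounded
    one.\<close>
  let ?l = "\<lambda>i x. h i x * g i x0 + (k i x * f i x0 + h i x * k i x)"
  show ?thesis
  proof (rule taylor2I)
    show "\<bar>f i x0 * g i x0\<bar> \<le> A * B" if "i \<ge> 1" for i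
      unfolding abs_mult using h(1) k(1) h(2)[OF that] k(2)[OF that] by (intro mult_mono) auto
    show "separable x0 ?l"
      by (intro separable_plus separable_times h(3) k(3)
        separable_scale[OF h(3) k(2)] separable_scale[OF k(3) h(2)])
    show "\<forall>\<^sub>F x in nhds x0. \<forall>i\<ge>1. \<bar>f i x * g i x - f i x0 * g i x0 - ?l i x\<bar>
      \<le> (C * (B + F + D) + D * (A + E)) * dist x x0 ^ 3"
      using h(5) k(5) E(2) F(2) eventually_nhds_dist[of 1 x0, OF zero_less_one]
    proof eventually_elim
      case (elim x)
      let ?d = "dist x x0"
      show ?case
      proof (intro allI impI)
        fix i :: nat assume i: "i \<ge> 1"
        define r where "r = f i x - f i x0 - h i x"
        define s where "s = g i x - g i x0 - k i x"
        have d3: "?d ^ 3 \<le> 1" "0 \<le> ?d ^ 3" using elim(5) by (auto intro: power_le_one)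
        have r: "\<bar>r\<bar> \<le> C * ?d ^ 3" and s: "\<bar>s\<bar> \<le> D * ?d ^ 3"
          using elim(1,2) i by (simp_all add: r_def s_def)
        have "D * ?d ^ 3 \<le> D" using d3 k(4) by (intro mult_left_le) auto
        with s have sD: "\<bar>s\<bar> \<le> D" by linarith
        have "E * ?d \<le> E" "F * ?d \<le> F" using elim(5) E(1) F(1) by (auto intro!: mult_left_le)
        moreover have "\<bar>h i x\<bar> \<le> E * ?d" "\<bar>k i x\<bar> \<le> F * ?d" using elim(3,4) i by blast+
        ultimately have hE: "\<bar>h i x\<bar> \<le> E" and kF: "\<bar>k i x\<bar> \<le> F" by linarith+
        have "f i x * g i x - f i x0 * g i x0 - ?l i x = r * (g i x0 + k i x + s) + s * (f i x0 + h i x)"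
          by (simp add: r_def s_def algebra_simps)
        then have "\<bar>f i x * g i x - f i x0 * g i x0 - ?l i x\<bar>
            \<le> \<bar>r\<bar> * \<bar>g i x0 + k i x + s\<bar> + \<bar>s\<bar> * \<bar>f i x0 + h i x\<bar>"
          by (simp add: abs_mult[symmetric] abs_triangle_ineq)
        also have "\<dots> \<le> (C * ?d ^ 3) * (B + F + D) + (D * ?d ^ 3) * (A + E)"
        proof (intro add_mono mult_mono r s)
          show "\<bar>g i x0 + k i x + s\<bar> \<le> B + F + D" using k(2)[OF i] kF sD by linarith
          show "\<bar>f i x0 + h i x\<bar> \<le> A + E" using h(2)[OF i] hE by linarith
        qed (use h(4) k(4) d3 in auto)
        finally show "\<bar>f i x * g i x - f i x0 * g i x0 - ?l i x\<bar>
            \<le> (C * (B + F + D) + D * (A + E)) * ?d ^ 3"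
          by (simp add: algebra_simps)
      qed
    qed
  qed
qed

lemma taylor2_cmult: "taylor2 x0 f \<Longrightarrow> taylor2 x0 (\<lambda>i x. c * f i x)"
  by (rule taylor2_mult[OF taylor2_const[where g="\<lambda>_. c"]]) auto

lemma taylor2_sum:
  "(\<And>k. k \<in> K \<Longrightarrow> taylor2 x0 (f k)) \<Longrightarrow> taylor2 x0 (\<lambda>i x. \<Sum>k\<in>K. f k i x)"
  by (induction K rule: infinite_finite_induct) (auto intro: taylor2_add taylor2_const[where B=0])

lemma taylor2_prod:
  "(\<And>k. k \<in> K \<Longrightarrow> taylor2 x0 (f k)) \<Longrightarrow> taylor2 x0 (\<lambda>i x. \<Prod>k\<in>K. f k i x)"
  by (induction K rule: infinite_finite_induct) (auto intro: taylor2_mult taylor2_const[where B=1])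

lemma taylor2_lipschitz:
  assumes "taylor2 x0 f"
  shows "\<exists>C\<ge>0. \<forall>\<^sub>F x in nhds x0. \<forall>i\<ge>1. \<bar>f i x - f i x0\<bar> \<le> C * dist x x0"
proof -
  from assms obtain h C where h: "separable x0 h" "C \<ge> 0"
    "\<forall>\<^sub>F x in nhds x0. \<forall>i\<ge>1. \<bar>f i x - f i x0 - h i x\<bar> \<le> C * dist x x0 ^ 3"
    by (rule taylor2_expansion) (rule that; assumption)
  from separable_bound[OF h(1)] obtain E where E: "E \<ge> 0"
    "\<forall>\<^sub>F x in nhds x0. \<forall>i\<ge>1. \<bar>h i x\<bar> \<le> E * dist x x0" by blast
  have "\<forall>\<^sub>F x in nhds x0. \<forall>i\<ge>1. \<bar>f i x - f i x0\<bar> \<le> (C + E) * dist x x0"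
    using h(3) E(2) eventually_nhds_dist[of 1 x0, OF zero_less_one]
  proof eventually_elim
    case (elim x)
    have "dist x x0 ^ 3 \<le> dist x x0 ^ 1" using elim(3) by (intro power_decreasing) auto
    then have d: "C * dist x x0 ^ 3 \<le> C * dist x x0" using h(2) by (intro mult_left_mono) auto
    show ?case
    proof (intro allI impI)
      fix i :: nat assume "i \<ge> 1"
      then have "\<bar>f i x - f i x0 - h i x\<bar> \<le> C * dist x x0 ^ 3" "\<bar>h i x\<bar> \<le> E * dist x x0"
        using elim by blast+
      with d show "\<bar>f i x - f i x0\<bar> \<le> (C + E) * dist x x0" unfolding distrib_right by linarith
    qed
  qed
  then show ?thesis using E(1) h(2) by (intro exI[of _ "C + E"]) auto
qed

text \<open>A truncated geometric series: with \<open>e = f - f0\<close> and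
  \<open>g = 1 / f0\<close> the inverse equals \<open>g - e g^2 + e^2 g^3\<close> up to exactly
  \<open>- e^3 g^3 / f\<close>, and the lower bound \<open>c\<close> controls this remainder
  uniformly in the index. \<open>?p\<close> has no constant term because only increments are
  compared.\<close>

lemma taylor2_inverse:
  assumes f: "taylor2 x0 f" and c: "c > 0"
    and low: "\<forall>\<^sub>F x in nhds x0. \<forall>i\<ge>1. c \<le> \<bar>f i x\<bar>"
  shows "taylor2 x0 (\<lambda>i x. 1 / f i x)"
proof -
  define e where "e i x = f i x - f i x0" for i x
  define g where "g i = 1 / f i x0" for i
  have c0: "c \<le> \<bar>f i x0\<bar>" if "i \<ge> 1" for i using eventually_nhds_x_imp_x[OF low] that by blast
  have g: "\<bar>g i\<bar> \<le> 1 / c" if "i \<ge> 1" for i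
    using c0[OF that] c by (simp add: g_def frac_le)
  have tg: "taylor2 x0 (\<lambda>i x. g i)" using g by (rule taylor2_const)
  have te: "taylor2 x0 e"
  proof -
    obtain B where "\<And>i. i \<ge> 1 \<Longrightarrow> \<bar>f i x0\<bar> \<le> B" using f by (rule taylor2_expansion) (rule that; assumption)
    then have "taylor2 x0 (\<lambda>i x. f i x0)" by (rule taylor2_const)
    from taylor2_add[OF f taylor2_cmult[OF this, of "-1"]] show ?thesis by (simp add: e_def[abs_def])
  qed
  let ?p = "\<lambda>i x. (-1) * (e i x * (g i * g i)) + (e i x * e i x) * (g i * (g i * g i))"
  have tp: "taylor2 x0 ?p" by (intro taylor2_add taylor2_cmult taylor2_mult te tg)
  obtain C where C: "C \<ge> 0" "\<forall>\<^sub>F x in nhds x0. \<forall>i\<ge>1. \<bar>e i x\<bar> \<le> C * dist x x0"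
    using taylor2_lipschitz[OF f] unfolding e_def by blast
  show ?thesis
  proof (rule taylor2_perturb[OF tp])
    show "\<bar>1 / f i x0\<bar> \<le> 1 / c" if "i \<ge> 1" for i using g[OF that] by (simp add: g_def)
    show "\<forall>\<^sub>F x in nhds x0. \<forall>i\<ge>1. \<bar>1 / f i x - 1 / f i x0 - (?p i x - ?p i x0)\<bar>
        \<le> C ^ 3 * (1 / c) ^ 4 * dist x x0 ^ 3"
      using low C(2)
    proof eventually_elim
      case (elim x)
      show ?case
      proof (intro allI impI)
        fix i :: nat assume i: "i \<ge> 1"
        have "c \<le> \<bar>f i x\<bar>" using elim(1) i by blast
        then have nz: "f i x \<noteq> 0" "f i x0 \<noteq> 0" using c0[OF i] c by auto
        have alg: "1 / y - 1 / z - ((-1) * ((y - z) * (1 / z * (1 / z))) + ((y - z) * (y - z)) * (1 / z * (1 / z * (1 / z))) -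
             ((-1) * ((z - z) * (1 / z * (1 / z))) + ((z - z) * (z - z)) * (1 / z * (1 / z * (1 / z)))))
          = - ((y - z) ^ 3 * ((1 / z) ^ 3 * (1 / y)))" if "y \<noteq> 0" "z \<noteq> 0" for y z :: real
          using that by (simp add: field_simps power3_eq_cube)
        have "\<bar>1 / f i x - 1 / f i x0 - (?p i x - ?p i x0)\<bar> = \<bar>e i x\<bar> ^ 3 * (\<bar>g i\<bar> ^ 3 * \<bar>1 / f i x\<bar>)"
          unfolding e_def g_def alg[OF nz] by (simp add: abs_mult power_abs)
        also have "\<dots> \<le> (C * dist x x0) ^ 3 * ((1 / c) ^ 3 * (1 / c))"
        proof (intro mult_mono power_mono)
          show "\<bar>e i x\<bar> \<le> C * dist x x0" using elim(2) i by blast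
          show "\<bar>1 / f i x\<bar> \<le> 1 / c" using \<open>c \<le> \<bar>f i x\<bar>\<close> c by (simp add: frac_le)
        qed (use g[OF i] c C(1) in auto)
        also have "\<dots> = C ^ 3 * (1 / c) ^ 4 * dist x x0 ^ 3"
          by (simp add: power_mult_distrib power4_eq_xxxx power3_eq_cube)
        finally show "\<bar>1 / f i x - 1 / f i x0 - (?p i x - ?p i x0)\<bar> \<le> C ^ 3 * (1 / c) ^ 4 * dist x x0 ^ 3" .
      qed
    qed
  qed
qed

lemma taylor2_det:
  fixes A :: "nat \<Rightarrow> 'a::metric_space \<Rightarrow> real^'n^'n"
  assumes "\<And>k l. taylor2 x0 (\<lambda>i x. A i x $ k $ l)"
  shows "taylor2 x0 (\<lambda>i x. det (A i x))"
  unfolding det_def by (intro taylor2_sum taylor2_cmult taylor2_prod assms)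

lemma taylor2_matrix_mult:
  fixes A :: "nat \<Rightarrow> 'a::metric_space \<Rightarrow> real^'n^'m" and B :: "nat \<Rightarrow> 'a \<Rightarrow> real^'k^'n"
  assumes "\<And>k l. taylor2 x0 (\<lambda>i x. A i x $ k $ l)" "\<And>k l. taylor2 x0 (\<lambda>i x. B i x $ k $ l)"
  shows "taylor2 x0 (\<lambda>i x. (A i x ** B i x) $ k $ l)"
  unfolding matrix_matrix_mult_def by (simp, intro taylor2_sum taylor2_mult assms)

text \<open>Cramer's formula is available where the determinant is bounded below, that is, near
  \<open>x0\<close>. There the agreement is exact, so the perturbation lemma applies with cubic
  constant 0.\<close>

lemma taylor2_matrix_inv:
  fixes A :: "nat \<Rightarrow> 'a::metric_space \<Rightarrow> real^'n^'n"
  assumes A: "\<And>k l. taylor2 x0 (\<lambda>i x. A i x $ k $ l)" and c: "c > 0"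
    and low: "\<forall>\<^sub>F x in nhds x0. \<forall>i\<ge>1. c \<le> \<bar>det (A i x)\<bar>"
  shows "taylor2 x0 (\<lambda>i x. matrix_inv (A i x) $ k $ l)"
proof -
  let ?B = "\<lambda>i x. (\<chi> a b. if b = k then (if a = l then 1 else 0) else A i x $ a $ b) :: real^'n^'n"
  have "taylor2 x0 (\<lambda>i x. ?B i x $ a $ b)" for a b
    using taylor2_const[of "\<lambda>_. 1" 1 x0] taylor2_const[of "\<lambda>_. 0" 0 x0] A by (cases "b = k"; cases "a = l") simp_all
  then have t: "taylor2 x0 (\<lambda>i x. det (?B i x) * (1 / det (A i x)))"
    by (intro taylor2_mult taylor2_det taylor2_inverse[OF _ c low] A)
  have ev: "\<forall>\<^sub>F x in nhds x0. \<forall>i\<ge>1. matrix_inv (A i x) $ k $ l = det (?B i x) * (1 / det (A i x))"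
    using low
  proof eventually_elim
    case (elim x)
    have "invertible (A i x)" if "i \<ge> 1" for i
    proof -
      have "c \<le> \<bar>det (A i x)\<bar>" using elim that by blast
      then show ?thesis using c by (auto simp: invertible_det_nz)
    qed
    then show ?case by (simp add: matrix_inv_cramer)
  qed
  have e0: "matrix_inv (A i x0) $ k $ l = det (?B i x0) * (1 / det (A i x0))" if "i \<ge> 1" for i
    using eventually_nhds_x_imp_x[OF ev] that by blast
  obtain B where B: "\<And>i. i \<ge> 1 \<Longrightarrow> \<bar>det (?B i x0) * (1 / det (A i x0))\<bar> \<le> B"
    using t by (rule taylor2_expansion) (rule that; assumption)
  show ?thesis
  proof (rule taylor2_perturb[OF t])
    show "\<bar>matrix_inv (A i x0) $ k $ l\<bar> \<le> B" if "i \<ge> 1" for i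
      unfolding e0[OF that] by (rule B[OF that])
    show "\<forall>\<^sub>F x in nhds x0. \<forall>i\<ge>1. \<bar>(matrix_inv (A i x) $ k $ l - matrix_inv (A i x0) $ k $ l)
     - (det (?B i x) * (1 / det (A i x)) - det (?B i x0) * (1 / det (A i x0)))\<bar> \<le> 0 * dist x x0 ^ 3"
      using ev by eventually_elim (simp add: e0)
  qed
qed

section \<open>The weighted total least squares problem as a minimisation over \<open>X\<close>\<close>

text \<open>Keeps products with a transposed matrix in that form instead of turning them into row
  vector products, since many steps below move a transpose across an inner product.\<close>

declare transpose_matrix_vector [simp del]

lemma sum_UNIV_plus:
  fixes f :: "'n::finite + 'd::finite \<Rightarrow> 'b::comm_monoid_add"
  shows "(\<Sum>p\<in>UNIV. f p) = (\<Sum>i\<in>UNIV. f (Inl i)) + (\<Sum>j\<in>UNIV. f (Inr j))"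
  by (simp add: UNIV_Plus_UNIV[symmetric] sum.Plus del: UNIV_Plus_UNIV)

lemma inner_matrix_mult_left: "(A *v x) \<bullet> y = x \<bullet> (transpose A *v y)" for A :: "real^'n^'m"
  using inner_matrix_vector_transpose[of x "transpose A" y] by simp

lemma Zmat_vec:
  fixes X :: "real^'d::finite^'n::finite"
  shows "Zmat X *v t = stack (X *v t) (- t)"
proof -
  have "(- mat 1 *v t) $ j = - t $ j" for j :: 'd
    by (simp add: matrix_vector_mult_def mat_def sum_negf if_distrib[of "\<lambda>x. x * _"] cong: if_cong)
  then show ?thesis
    by (auto simp: Zmat_def stack_def vec_eq_iff matrix_vector_mult_def split: sum.splits)
qed

lemma transpose_Zmat_vec:
  fixes X :: "real^'d::finite^'n::finite"
  shows "transpose (Zmat X) *v c = transpose X *v upper c - lower c"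
proof (rule vector_eq_ldot[THEN iffD1], intro allI)
  fix t :: "real^'d"
  have "t \<bullet> (transpose (Zmat X) *v c) = (Zmat X *v t) \<bullet> c" by (simp add: inner_matrix_mult_left)
  also have "\<dots> = (X *v t) \<bullet> upper c - t \<bullet> lower c"
    by (simp add: Zmat_vec inner_vec_def sum_UNIV_plus stack_def upper_def lower_def sum_negf)
  also have "\<dots> = t \<bullet> (transpose X *v upper c - lower c)"
    by (simp add: inner_matrix_mult_left inner_diff_right)
  finally show "t \<bullet> (transpose (Zmat X) *v c) = t \<bullet> (transpose X *v upper c - lower c)" .
qed

lemma subrows_matrix_vec: "subrows \<iota> A *v t = subrows \<iota> (A *v t)" for A :: "real^'d^'k"
  by (simp add: subrows_def matrix_vector_mult_def vec_eq_iff)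

text \<open>Full column rank is used as injectivity, which is what positivity of
  \<open>Z^T S Z\<close> requires.\<close>

lemma full_rank_iff:
  fixes X :: "real^'d::finite^'n::finite"
  shows "rank (subrows \<iota> (Zmat X)) = CARD('d) \<longleftrightarrow> (\<forall>t. t \<noteq> 0 \<longrightarrow> subrows \<iota> (Zmat X *v t) \<noteq> 0)"
  unfolding full_rank_injective linear_injective_0[OF matrix_vector_mul_linear] subrows_matrix_vec by blast

text \<open>The covariance of a full error vector carries \<open>\<Sigma>\<close> on the rows and
  columns in the range of \<open>\<iota>\<close> and is zero elsewhere, as the other coordinates are
  error free. The relation lets quadratic forms move between the two sizes.\<close>

definition padded :: "('j \<Rightarrow> 'k) \<Rightarrow> real^'j^'j \<Rightarrow> real^'k^'k \<Rightarrow> bool" where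
  "padded \<iota> \<Sigma> S \<longleftrightarrow> (\<forall>k l. S $ \<iota> k $ \<iota> l = \<Sigma> $ k $ l) \<and>
     (\<forall>p q. p \<notin> range \<iota> \<or> q \<notin> range \<iota> \<longrightarrow> S $ p $ q = 0)"

lemma sum_supported:
  fixes \<iota> :: "'j::finite \<Rightarrow> 'k::finite" and f :: "'k \<Rightarrow> real"
  assumes "inj \<iota>" "\<And>p. p \<notin> range \<iota> \<Longrightarrow> f p = 0"
  shows "(\<Sum>p\<in>UNIV. f p) = (\<Sum>k\<in>UNIV. f (\<iota> k))"
proof -
  have "(\<Sum>p\<in>UNIV. f p) = (\<Sum>p\<in>range \<iota>. f p)"
    using assms(2) by (intro sum.mono_neutral_right) auto
  also have "\<dots> = (\<Sum>k\<in>UNIV. f (\<iota> k))" using assms(1) by (simp add: sum.reindex)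
  finally show ?thesis .
qed

lemma inner_supported:
  fixes \<iota> :: "'j::finite \<Rightarrow> 'k::finite"
  assumes "inj \<iota>" "\<And>p. p \<notin> range \<iota> \<Longrightarrow> v $ p = 0"
  shows "(y :: real^'k) \<bullet> v = subrows \<iota> y \<bullet> subrows \<iota> v"
  using sum_supported[OF assms(1), of "\<lambda>p. y $ p * v $ p"] assms(2) by (simp add: inner_vec_def subrows_def)

lemma padded_vec:
  fixes \<iota> :: "'j::finite \<Rightarrow> 'k::finite"
  assumes "inj \<iota>" "padded \<iota> \<Sigma> S"
  shows "subrows \<iota> (S *v z) = \<Sigma> *v subrows \<iota> z" "p \<notin> range \<iota> \<Longrightarrow> (S *v z) $ p = 0"
proof -
  have "(\<Sum>q\<in>UNIV. S $ \<iota> k $ q * z $ q) = (\<Sum>l\<in>UNIV. S $ \<iota> k $ \<iota> l * z $ \<iota> l)" for k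
    using assms(2) by (intro sum_supported[OF assms(1)]) (simp add: padded_def)
  then show "subrows \<iota> (S *v z) = \<Sigma> *v subrows \<iota> z"
    using assms(2) by (simp add: subrows_def matrix_vector_mult_def vec_eq_iff padded_def)
  show "(S *v z) $ p = 0" if "p \<notin> range \<iota>"
    using assms(2) that by (simp add: matrix_vector_mult_def padded_def)
qed

lemma padded_form:
  fixes \<iota> :: "'j::finite \<Rightarrow> 'k::finite"
  assumes "inj \<iota>" "padded \<iota> \<Sigma> S"
  shows "y \<bullet> (S *v z) = subrows \<iota> y \<bullet> (\<Sigma> *v subrows \<iota> z)"
  using inner_supported[OF assms(1) padded_vec(2)[OF assms], of y] by (simp add: padded_vec(1)[OF assms])

definition Mmat :: "real^('n::finite + 'd::finite)^('n + 'd) \<Rightarrow> real^'d^'n \<Rightarrow> real^'d^'d" where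
  "Mmat S X = transpose (Zmat X) ** S ** Zmat X"

text \<open>When \<open>S\<close> pads \<open>\<Sigma>\<close> and \<open>X\<close> has full rank,
  this is the minimal cost of correcting a single row \<open>c\<close> so that it satisfies the
  model with parameter \<open>X\<close>: the squared Mahalanobis length of the residual
  \<open>Z^T c\<close>.\<close>

definition qform :: "real^('n::finite + 'd::finite)^('n + 'd) \<Rightarrow> real^'d^'n \<Rightarrow> real^('n + 'd) \<Rightarrow> real" where
  "qform S X c = (transpose (Zmat X) *v c) \<bullet> (matrix_inv (Mmat S X) *v (transpose (Zmat X) *v c))"

lemma Mmat_form: "s \<bullet> (Mmat S X *v t) = (Zmat X *v s) \<bullet> (S *v (Zmat X *v t))"
  by (simp add: Mmat_def inner_matrix_mult_left flip: matrix_vector_mul_assoc)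

lemma transpose_padded:
  assumes "inj \<iota>" "padded \<iota> \<Sigma> S" "transpose \<Sigma> = \<Sigma>"
  shows "transpose S = S"
proof -
  have sym: "\<Sigma> $ k $ l = \<Sigma> $ l $ k" for k l
  proof -
    have "\<Sigma> $ k $ l = transpose \<Sigma> $ l $ k" by (simp add: transpose_def)
    then show ?thesis by (simp only: assms(3))
  qed
  have "S $ p $ q = S $ q $ p" for p q
  proof (cases "p \<in> range \<iota> \<and> q \<in> range \<iota>")
    case True
    then obtain k l where kl: "p = \<iota> k" "q = \<iota> l" by blast
    have "S $ p $ q = \<Sigma> $ k $ l" "S $ q $ p = \<Sigma> $ l $ k" using assms(2) by (simp_all add: kl padded_def)
    then show ?thesis using sym[of k l] by simp
  next
    case False
    then have "S $ p $ q = 0" "S $ q $ p = 0" using assms(2) unfolding padded_def by blast+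
    then show ?thesis by simp
  qed
  then show ?thesis by (simp add: transpose_def vec_eq_iff)
qed

lemma transpose_Mmat:
  assumes "transpose S = S"
  shows "transpose (Mmat S X) = Mmat S X"
  by (simp add: Mmat_def matrix_transpose_mul assms matrix_mul_assoc)

lemma Mmat_positive:
  fixes \<iota> :: "'j::finite \<Rightarrow> 'n::finite + 'd::finite" and X :: "real^'d^'n"
  assumes "inj \<iota>" "padded \<iota> \<Sigma> S" "\<And>x. x \<noteq> 0 \<Longrightarrow> 0 < x \<bullet> (\<Sigma> *v x)"
    and "rank (subrows \<iota> (Zmat X)) = CARD('d)" "t \<noteq> 0"
  shows "0 < t \<bullet> (Mmat S X *v t)"
  using assms(3,4,5) unfolding Mmat_form padded_form[OF assms(1,2)] full_rank_iff by blast

lemma qform_alt: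
  assumes "invertible (Mmat S X)" "l = matrix_inv (Mmat S X) *v (transpose (Zmat X) *v c)"
  shows "Mmat S X *v l = transpose (Zmat X) *v c" "qform S X c = (transpose (Zmat X) *v c) \<bullet> l"
proof -
  have "Mmat S X *v (matrix_inv (Mmat S X) *v y) = y" for y
    by (simp add: matrix_vector_mul_assoc matrix_inv_right[OF assms(1)])
  then show "Mmat S X *v l = transpose (Zmat X) *v c" by (simp only: assms(2))
  show "qform S X c = (transpose (Zmat X) *v c) \<bullet> l" by (simp only: assms(2) qform_def)
qed

text \<open>Every multiplier \<open>l\<close> gives a lower bound for the minimal cost, the optimal one gives \<open>qform\<close>.\<close>

lemma qform_ge:
  assumes sym: "transpose S = S" and pos: "\<And>t. t \<noteq> 0 \<Longrightarrow> 0 < t \<bullet> (Mmat S X *v t)"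
  shows "2 * (l \<bullet> (transpose (Zmat X) *v c)) - l \<bullet> (Mmat S X *v l) \<le> qform S X c"
proof -
  define k where "k = matrix_inv (Mmat S X) *v (transpose (Zmat X) *v c)"
  note k = qform_alt[OF invertible_if_positive[OF pos] k_def]
  have "0 \<le> (l - k) \<bullet> (Mmat S X *v (l - k))" using pos[of "l - k"] by (cases "l = k") auto
  also have "\<dots> = l \<bullet> (Mmat S X *v l) - l \<bullet> (Mmat S X *v k) - (k \<bullet> (Mmat S X *v l) - k \<bullet> (Mmat S X *v k))"
    by (simp add: matrix_vector_mult_diff_distrib inner_diff_left inner_diff_right)
  also have "k \<bullet> (Mmat S X *v l) = l \<bullet> (Mmat S X *v k)"
    using inner_symmetric_matrix[OF transpose_Mmat[OF sym], of k X l] by (simp add: inner_commute)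
  finally show ?thesis using k by (simp add: inner_commute)
qed

lemma ewtls_feasible_iff:
  "ewtls_feasible \<iota> m C X D \<longleftrightarrow>
     (\<forall>i\<in>{1..m}. transpose (Zmat X) *v D i = transpose (Zmat X) *v C i) \<and>
     (\<forall>i\<in>{1..m}. \<forall>j. j \<notin> range \<iota> \<longrightarrow> D i $ j = 0) \<and>
     rank (subrows \<iota> (Zmat X)) = CARD('d)"
  for X :: "real^'d::finite^'n::finite"
proof -
  have "upper e v* X = lower e \<longleftrightarrow> transpose (Zmat X) *v e = 0" for e :: "real^('n + 'd)"
    unfolding transpose_Zmat_vec by (simp add: transpose_matrix_vector)
  moreover have "transpose (Zmat X) *v (C i - D i) = 0 \<longleftrightarrow>
      transpose (Zmat X) *v D i = transpose (Zmat X) *v C i" for i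
    by (auto simp: matrix_vector_mult_diff_distrib)
  ultimately show ?thesis unfolding ewtls_feasible_def by simp
qed

text \<open>The corrections decouple into rows, and in each row a Lagrange multiplier
  \<open>l\<close> solves the inner problem. Nonnegativity of a square gives the lower bound and
  \<open>D i = S i Z l\<close> attains it, so only the minimisation over \<open>X\<close> with its
  rank constraint remains.\<close>

lemma ewtls_solution_iff:
  fixes \<iota> :: "'j::finite \<Rightarrow> 'n::finite + 'd::finite" and X :: "real^'d^'n"
  assumes inj: "inj \<iota>" and pad: "\<And>i. i \<ge> 1 \<Longrightarrow> padded \<iota> (\<Sigma> i) (S i)"
    and sym: "\<And>i. i \<ge> 1 \<Longrightarrow> transpose (\<Sigma> i) = \<Sigma> i"
    and pos: "\<And>i x. i \<ge> 1 \<Longrightarrow> x \<noteq> 0 \<Longrightarrow> 0 < x \<bullet> (\<Sigma> i *v x)"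
  shows "ewtls_solution \<iota> \<Sigma> m C X \<longleftrightarrow> rank (subrows \<iota> (Zmat X)) = CARD('d) \<and>
    (\<forall>X' :: real^'d^'n. rank (subrows \<iota> (Zmat X')) = CARD('d) \<longrightarrow>
       (\<Sum>i=1..m. qform (S i) X (C i)) \<le> (\<Sum>i=1..m. qform (S i) X' (C i)))"
proof -
  have Spos: "\<And>t. t \<noteq> 0 \<Longrightarrow> 0 < t \<bullet> (Mmat (S i) X *v t)"
    if "i \<ge> 1" "rank (subrows \<iota> (Zmat X)) = CARD('d)" for i and X :: "real^'d^'n"
    by (rule Mmat_positive[OF inj pad[OF that(1)] pos[OF that(1)] that(2)])
  have cost: "ewtls_cost \<iota> \<Sigma> m D = (\<Sum>i=1..m. subrows \<iota> (D i) \<bullet> (matrix_inv (\<Sigma> i) *v subrows \<iota> (D i)))" for D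
    unfolding ewtls_cost_def by (intro sum.cong refl inv_sqrt_square sym pos) auto
  have lower: "(\<Sum>i=1..m. qform (S i) X (C i)) \<le> ewtls_cost \<iota> \<Sigma> m D"
    if feas: "ewtls_feasible \<iota> m C X D" for X :: "real^'d^'n" and D
    unfolding cost
  proof (rule sum_mono)
    fix i assume i': "i \<in> {1..m}"
    then have i: "i \<ge> 1" by simp
    have full: "rank (subrows \<iota> (Zmat X)) = CARD('d)" and D: "transpose (Zmat X) *v D i = transpose (Zmat X) *v C i"
      and D0: "\<And>j. j \<notin> range \<iota> \<Longrightarrow> D i $ j = 0"
      using feas i' by (auto simp: ewtls_feasible_iff)
    define l where "l = matrix_inv (Mmat (S i) X) *v (transpose (Zmat X) *v C i)"
    note l = qform_alt[OF invertible_if_positive[OF Spos[OF i full]] l_def]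
    define x z where "x = subrows \<iota> (D i)" and "z = subrows \<iota> (Zmat X *v l)"
    have inv: "\<Sigma> i ** matrix_inv (\<Sigma> i) = mat 1" "matrix_inv (\<Sigma> i) ** \<Sigma> i = mat 1"
      using invertible_if_positive[OF pos[OF i]] by (auto intro: matrix_inv_right matrix_inv_left)
    have isym: "transpose (matrix_inv (\<Sigma> i)) = matrix_inv (\<Sigma> i)"
      using transpose_matrix_inv[OF invertible_if_positive[OF pos[OF i]]] sym[OF i] by simp
    have invz: "matrix_inv (\<Sigma> i) *v (\<Sigma> i *v z) = z" by (simp add: matrix_vector_mul_assoc inv)
    \<comment> \<open>The optimal subvector is \<open>x = \<Sigma> z\<close>. Expanding the cost
      around it gives the lower bound, because the constraint fixes the value of
      \<open>x . z\<close>.\<close>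
    have "0 \<le> (x - \<Sigma> i *v z) \<bullet> (matrix_inv (\<Sigma> i) *v (x - \<Sigma> i *v z))"
    proof -
      have "(norm (inv_sqrt (\<Sigma> i) *v y))\<^sup>2 = y \<bullet> (matrix_inv (\<Sigma> i) *v y)" for y
        by (rule inv_sqrt_square[OF sym[OF i]]) (rule pos[OF i])
      from this[symmetric] show ?thesis by simp
    qed
    also have "\<dots> = x \<bullet> (matrix_inv (\<Sigma> i) *v x) - x \<bullet> z - ((\<Sigma> i *v z) \<bullet> (matrix_inv (\<Sigma> i) *v x) - (\<Sigma> i *v z) \<bullet> z)"
      by (simp add: matrix_vector_mult_diff_distrib inner_diff_left inner_diff_right invz)
    also have "(\<Sigma> i *v z) \<bullet> (matrix_inv (\<Sigma> i) *v x) = x \<bullet> z"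
      using inner_symmetric_matrix[OF isym, of "\<Sigma> i *v z" x] by (simp add: invz inner_commute)
    also have "(\<Sigma> i *v z) \<bullet> z = l \<bullet> (Mmat (S i) X *v l)"
      unfolding Mmat_form padded_form[OF inj pad[OF i]] z_def by (rule inner_commute)
    also have "x \<bullet> z = (transpose (Zmat X) *v C i) \<bullet> l"
      using inner_supported[OF inj D0, of "Zmat X *v l"] inner_matrix_mult_left[of "Zmat X" l "D i"] D
      by (simp add: x_def z_def inner_commute)
    finally show "qform (S i) X (C i) \<le> subrows \<iota> (D i) \<bullet> (matrix_inv (\<Sigma> i) *v subrows \<iota> (D i))"
      using l by (simp add: x_def inner_commute)
  qed
  have attained: "\<exists>D. ewtls_feasible \<iota> m C X D \<and> ewtls_cost \<iota> \<Sigma> m D = (\<Sum>i=1..m. qform (S i) X (C i))"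
    if full: "rank (subrows \<iota> (Zmat X)) = CARD('d)" for X :: "real^'d^'n"
  proof -
    define l where "l i = matrix_inv (Mmat (S i) X) *v (transpose (Zmat X) *v C i)" for i
    have l: "Mmat (S i) X *v l i = transpose (Zmat X) *v C i" "qform (S i) X (C i) = (transpose (Zmat X) *v C i) \<bullet> l i"
      if "i \<ge> 1" for i
      using qform_alt[OF invertible_if_positive[OF Spos[OF that full]] l_def] by auto
    \<comment> \<open>The stationary correction. The equation for \<open>l i\<close> makes it
      satisfy the row constraint, and the padding makes it vanish outside the range of
      \<open>\<iota>\<close>.\<close>
    define D where "D i = S i *v (Zmat X *v l i)" for i
    have "ewtls_feasible \<iota> m C X D"
      unfolding ewtls_feasible_iff
    proof (intro conjI ballI allI impI)
      fix i assume i: "i \<in> {1..m}"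
      have "transpose (Zmat X) *v D i = Mmat (S i) X *v l i"
        by (simp add: D_def Mmat_def matrix_vector_mul_assoc matrix_mul_assoc)
      then show "transpose (Zmat X) *v D i = transpose (Zmat X) *v C i" using l i by simp
      show "D i $ j = 0" if "j \<notin> range \<iota>" for j
        using padded_vec(2)[OF inj pad that] i by (simp add: D_def)
    qed (rule full)
    moreover have "ewtls_cost \<iota> \<Sigma> m D = (\<Sum>i=1..m. qform (S i) X (C i))"
      unfolding cost
    proof (rule sum.cong[OF refl])
      fix i assume "i \<in> {1..m}"
      then have i: "i \<ge> 1" by simp
      let ?z = "subrows \<iota> (Zmat X *v l i)"
      have inv: "matrix_inv (\<Sigma> i) ** \<Sigma> i = mat 1"
        using invertible_if_positive[OF pos[OF i]] by (rule matrix_inv_left)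
      have "subrows \<iota> (D i) \<bullet> (matrix_inv (\<Sigma> i) *v subrows \<iota> (D i)) = (\<Sigma> i *v ?z) \<bullet> ?z"
        unfolding D_def padded_vec(1)[OF inj pad[OF i]] by (simp add: matrix_vector_mul_assoc inv)
      also have "\<dots> = l i \<bullet> (Mmat (S i) X *v l i)"
        unfolding Mmat_form padded_form[OF inj pad[OF i]] by (rule inner_commute)
      also have "\<dots> = qform (S i) X (C i)" using l[OF i] by (simp add: inner_commute)
      finally show "subrows \<iota> (D i) \<bullet> (matrix_inv (\<Sigma> i) *v subrows \<iota> (D i)) = qform (S i) X (C i)" .
    qed
    ultimately show ?thesis by blast
  qed
  show ?thesis
  proof
    assume "ewtls_solution \<iota> \<Sigma> m C X"
    then obtain D where D: "ewtls_feasible \<iota> m C X D"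
      and min: "\<And>X' D'. ewtls_feasible \<iota> m C X' D' \<Longrightarrow> ewtls_cost \<iota> \<Sigma> m D \<le> ewtls_cost \<iota> \<Sigma> m D'"
      unfolding ewtls_solution_def by blast
    have "(\<Sum>i=1..m. qform (S i) X (C i)) \<le> (\<Sum>i=1..m. qform (S i) X' (C i))"
      if X': "rank (subrows \<iota> (Zmat X')) = CARD('d)" for X' :: "real^'d^'n"
    proof -
      from attained[OF X'] obtain D' where D': "ewtls_feasible \<iota> m C X' D'"
        "ewtls_cost \<iota> \<Sigma> m D' = (\<Sum>i=1..m. qform (S i) X' (C i))" by blast
      show ?thesis using lower[OF D] min[OF D'(1)] D'(2) by linarith
    qed
    with D show "rank (subrows \<iota> (Zmat X)) = CARD('d) \<and>
      (\<forall>X' :: real^'d^'n. rank (subrows \<iota> (Zmat X')) = CARD('d) \<longrightarrow>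
       (\<Sum>i=1..m. qform (S i) X (C i)) \<le> (\<Sum>i=1..m. qform (S i) X' (C i)))"
      unfolding ewtls_feasible_iff by blast
  next
    assume R: "rank (subrows \<iota> (Zmat X)) = CARD('d) \<and>
      (\<forall>X' :: real^'d^'n. rank (subrows \<iota> (Zmat X')) = CARD('d) \<longrightarrow>
       (\<Sum>i=1..m. qform (S i) X (C i)) \<le> (\<Sum>i=1..m. qform (S i) X' (C i)))"
    then obtain D where D: "ewtls_feasible \<iota> m C X D"
      "ewtls_cost \<iota> \<Sigma> m D = (\<Sum>i=1..m. qform (S i) X (C i))" using attained by blast
    have "ewtls_cost \<iota> \<Sigma> m D \<le> ewtls_cost \<iota> \<Sigma> m D'" if F: "ewtls_feasible \<iota> m C X' D'"
      for X' :: "real^'d^'n" and D'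
    proof -
      have "rank (subrows \<iota> (Zmat X')) = CARD('d)" using F by (simp add: ewtls_feasible_iff)
      with R have "(\<Sum>i=1..m. qform (S i) X (C i)) \<le> (\<Sum>i=1..m. qform (S i) X' (C i))" by blast
      then show ?thesis using lower[OF F] D(2) by linarith
    qed
    with D(1) show "ewtls_solution \<iota> \<Sigma> m C X" unfolding ewtls_solution_def by blast
  qed
qed

section \<open>The errors-in-variables model\<close>

text \<open>The higher moments are encoded as integrability of the fourth powers of the error norms,
  uniform in \<open>i\<close> through \<open>tail\<close>. \<open>\<kappa>\<close> bounds the
  quadratic forms of the matrices \<open>\<Sigma> i\<close> directly, so it stands for the square of
  the constant in the theorem.\<close>

locale eiv = prob_space M for M :: "'w measure" +
  fixes X0 :: "real^'d::finite^'n::finite" and a0 :: "nat \<Rightarrow> real^'n"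
    and ctil :: "nat \<Rightarrow> 'w \<Rightarrow> real^('n + 'd)"
    and \<iota> :: "'j::finite \<Rightarrow> 'n + 'd" and \<sigma> \<kappa> :: real
    and \<Sigma> :: "nat \<Rightarrow> real^'j^'j" and \<Sigma>inf :: "real^'j^'j"
    and S :: "nat \<Rightarrow> real^('n + 'd)^('n + 'd)" and Sinf :: "real^('n + 'd)^('n + 'd)"
    and V :: "real^'n^'n"
  assumes inj: "inj \<iota>"
    and indep: "indep_vars (\<lambda>_. borel) ctil {1..}"
    and fourth: "i \<ge> 1 \<Longrightarrow> integrable M (\<lambda>w. norm (ctil i w) ^ 4)"
    and tail: "e > 0 \<Longrightarrow> \<exists>t. \<forall>i\<ge>1. expectation (\<lambda>w. norm (ctil i w) ^ 4 *
          indicator {w. norm (ctil i w) ^ 4 > t} w) \<le> e"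
    and mean0: "i \<ge> 1 \<Longrightarrow> expectation (\<lambda>w. ctil i w $ p) = 0"
    and second: "i \<ge> 1 \<Longrightarrow> expectation (\<lambda>w. ctil i w $ p * ctil i w $ q) = \<sigma>\<^sup>2 * S i $ p $ q"
    and outside: "i \<ge> 1 \<Longrightarrow> p \<notin> range \<iota> \<Longrightarrow> AE w in M. ctil i w $ p = 0"
    and \<sigma>: "\<sigma> > 0"
    and pad: "i \<ge> 1 \<Longrightarrow> padded \<iota> (\<Sigma> i) (S i)"
    and \<Sigma>_sym: "i \<ge> 1 \<Longrightarrow> transpose (\<Sigma> i) = \<Sigma> i"
    and \<kappa>: "\<kappa> > 0"
    and \<Sigma>_low: "i \<ge> 1 \<Longrightarrow> \<kappa> * (norm x)\<^sup>2 \<le> x \<bullet> (\<Sigma> i *v x)"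
    and \<Sigma>_lim: "\<Sigma> \<longlonglongrightarrow> \<Sigma>inf" and S_lim: "S \<longlonglongrightarrow> Sinf"
    and full0: "rank (subrows \<iota> (Zmat X0)) = CARD('d)"
    and V_lim: "(\<lambda>m. mean_upto m (\<lambda>i. outer (a0 i) (a0 i))) \<longlonglongrightarrow> V"
    and V_inv: "invertible V"
begin

lemma ctil_measurable [measurable]: "i \<ge> 1 \<Longrightarrow> ctil i \<in> borel_measurable M"
  using indep by (auto simp: indep_vars_def)

text \<open>\<open>psi\<close> and \<open>err4\<close> are dominating factors: up to a constant, the
  product \<open>psi i * err4 i\<close> bounds the squares of all entries of \<open>W_i\<close>,
  those linear as well as those quadratic in the errors. The added 1 in each allows a factor to be
  inserted freely.\<close>

definition psi :: "nat \<Rightarrow> real" where "psi i = 1 + (norm (a0 i))\<^sup>2"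

definition err4 :: "nat \<Rightarrow> 'w \<Rightarrow> real" where "err4 i w = 1 + norm (ctil i w) ^ 4"

lemma psi_ge1: "psi i \<ge> 1" by (simp add: psi_def)

lemma err4_ge1: "err4 i w \<ge> 1" by (simp add: err4_def)

lemma V_lim_nth: "(\<lambda>m. mean_upto m (\<lambda>i. a0 i $ p * a0 i $ q)) \<longlonglongrightarrow> V $ p $ q"
proof -
  have "(\<lambda>m. mean_upto m (\<lambda>i. outer (a0 i) (a0 i)) $ p $ q) \<longlonglongrightarrow> V $ p $ q"
    by (intro tendsto_intros V_lim)
  then show ?thesis by (simp add: mean_upto_nth outer_def)
qed

lemma psi_lim: "(\<lambda>m. mean_upto m psi) \<longlonglongrightarrow> 1 + trace V"
proof -
  have "(\<lambda>m. mean_upto m (\<lambda>i. 1) + (\<Sum>p\<in>UNIV. mean_upto m (\<lambda>i. a0 i $ p * a0 i $ p))) \<longlonglongrightarrow> 1 + (\<Sum>p\<in>UNIV. V $ p $ p)"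
    by (intro tendsto_add tendsto_sum V_lim_nth mean_upto_tendsto[OF tendsto_const])
  moreover have "mean_upto m (\<lambda>i. 1) + (\<Sum>p\<in>UNIV. mean_upto m (\<lambda>i. a0 i $ p * a0 i $ p)) = mean_upto m psi" for m
  proof -
    have "(norm (a0 i))\<^sup>2 = (\<Sum>p\<in>UNIV. a0 i $ p * a0 i $ p)" for i
      by (simp add: power2_norm_eq_inner inner_vec_def)
    then have "psi = (\<lambda>i. 1 + (\<Sum>p\<in>UNIV. a0 i $ p * a0 i $ p))" by (simp add: psi_def fun_eq_iff)
    moreover have "(\<Sum>i = 1..m. \<Sum>p\<in>UNIV. a0 i $ p * a0 i $ p) = (\<Sum>p\<in>UNIV. \<Sum>i = 1..m. a0 i $ p * a0 i $ p)"
      by (rule sum.swap)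
    ultimately show ?thesis by (simp add: mean_upto_add) (simp add: mean_upto_def sum_divide_distrib)
  qed
  ultimately show ?thesis by (simp add: trace_def)
qed

lemma psi_bound: obtains C where "C \<ge> 0" "\<And>m. mean_upto m psi \<le> C"
proof -
  have "Bseq (\<lambda>m. mean_upto m psi)" using psi_lim by (intro convergent_imp_Bseq convergentI)
  then obtain C where "C > 0" "\<And>m. norm (mean_upto m psi) \<le> C" by (rule BseqE) blast
  then show ?thesis using that[of C] by (simp add: abs_le_iff)
qed

lemma psi_max: obtains A where "\<And>i m. 1 \<le> i \<Longrightarrow> i \<le> m \<Longrightarrow> psi i \<le> A m" "\<And>m. A m \<ge> 0" "(\<lambda>m. A m / real m) \<longlonglongrightarrow> 0"
  by (rule max_term_of_convergent_mean[OF order_trans[OF zero_le_one psi_ge1] psi_lim]) (rule that; assumption)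

lemma err4_integrable: "i \<ge> 1 \<Longrightarrow> integrable M (err4 i)"
  unfolding err4_def by (intro Bochner_Integration.integrable_add fourth) auto

lemma err4_tail:
  assumes "e > 0"
  shows "\<exists>t>0. \<forall>i\<ge>1. expectation (\<lambda>w. err4 i w * indicator {w. err4 i w > t} w) \<le> e"
proof -
  from tail[of "e / 2"] assms obtain t where
    t: "\<And>i. i \<ge> 1 \<Longrightarrow> expectation (\<lambda>w. norm (ctil i w) ^ 4 * indicator {w. norm (ctil i w) ^ 4 > t} w) \<le> e / 2"
    by auto
  \<comment> \<open>Above this threshold \<open>norm (ctil i w) ^ 4\<close> exceeds both
    \<open>t\<close> and 1, so \<open>err4 i w\<close> is at most twice as large.\<close>
  have "expectation (\<lambda>w. err4 i w * indicator {w. err4 i w > \<bar>t\<bar> + 2} w) \<le> e" if i: "i \<ge> 1" for i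
  proof -
    have "expectation (\<lambda>w. err4 i w * indicator {w. err4 i w > \<bar>t\<bar> + 2} w)
       \<le> expectation (\<lambda>w. 2 * (norm (ctil i w) ^ 4 * indicator {w. norm (ctil i w) ^ 4 > t} w))"
    proof (rule integral_mono)
      show "integrable M (\<lambda>w. err4 i w * indicator {w. err4 i w > \<bar>t\<bar> + 2} w)"
        by (rule Bochner_Integration.integrable_bound[OF err4_integrable[OF i]])
          (use i in \<open>auto simp: err4_def indicator_def\<close>)
      show "integrable M (\<lambda>w. 2 * (norm (ctil i w) ^ 4 * indicator {w. norm (ctil i w) ^ 4 > t} w))"
        by (rule Bochner_Integration.integrable_bound[OF integrable_mult_right[OF fourth[OF i], of 2]])
          (use i in \<open>auto simp: indicator_def\<close>)
      show "err4 i w * indicator {w. err4 i w > \<bar>t\<bar> + 2} w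
         \<le> 2 * (norm (ctil i w) ^ 4 * indicator {w. norm (ctil i w) ^ 4 > t} w)" for w
        by (auto simp: err4_def indicator_def)
    qed
    also have "\<dots> \<le> e" using t[OF i] by simp
    finally show ?thesis .
  qed
  then show ?thesis by (intro exI[of _ "\<bar>t\<bar> + 2"]) auto
qed

lemma err4_bound: obtains K where "K \<ge> 1" "\<And>i. i \<ge> 1 \<Longrightarrow> expectation (err4 i) \<le> K"
proof -
  obtain t where t: "t > 0" "\<And>i. i \<ge> 1 \<Longrightarrow> expectation (\<lambda>w. err4 i w * indicator {w. err4 i w > t} w) \<le> 1"
    using err4_tail[of 1] by auto
  have "expectation (err4 i) \<le> t + 1" if i: "i \<ge> 1" for i
  proof -
    have int: "integrable M (\<lambda>w. err4 i w * indicator {w. err4 i w > t} w)"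
      by (rule Bochner_Integration.integrable_bound[OF err4_integrable[OF i]])
          (use i in \<open>auto simp: err4_def indicator_def\<close>)
    have "expectation (err4 i) \<le> expectation (\<lambda>w. t + err4 i w * indicator {w. err4 i w > t} w)"
      using err4_integrable[OF i] int t(1) by (intro integral_mono) (auto simp: indicator_def)
    also have "\<dots> \<le> t + 1" using int t(2)[OF i] by (simp add: prob_space)
    finally show ?thesis .
  qed
  then show ?thesis using that[of "t + 1"] t(1) by simp
qed

text \<open>The bound is one shared by all entries of \<open>W\<^sub>i\<close>.\<close>

definition noise :: "(nat \<Rightarrow> 'w \<Rightarrow> real) \<Rightarrow> bool" where
  "noise n \<longleftrightarrow> (\<forall>i\<ge>1. \<exists>G\<in>borel_measurable borel. n i = (\<lambda>w. G (ctil i w))) \<and>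
     (\<forall>i\<ge>1. expectation (n i) = 0) \<and>
     (\<exists>K\<ge>0. \<forall>i\<ge>1. \<forall>w. (n i w)\<^sup>2 \<le> K * (psi i * err4 i w))"

lemma noise_measurable: "noise n \<Longrightarrow> i \<ge> 1 \<Longrightarrow> n i \<in> borel_measurable M"
  unfolding noise_def using measurable_compose[OF ctil_measurable] by fastforce

lemma noise_bound:
  assumes "noise n" obtains K where "K \<ge> 1" "\<And>i w. i \<ge> 1 \<Longrightarrow> (n i w)\<^sup>2 \<le> K * (psi i * err4 i w)"
proof -
  from assms obtain K where K: "K \<ge> 0" "\<And>i w. i \<ge> 1 \<Longrightarrow> (n i w)\<^sup>2 \<le> K * (psi i * err4 i w)"
    unfolding noise_def by blast
  have "(n i w)\<^sup>2 \<le> (K + 1) * (psi i * err4 i w)" if "i \<ge> 1" for i w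
  proof -
    have "0 \<le> psi i * err4 i w" using psi_ge1[of i] err4_ge1[of i w] by simp
    with K(2)[OF that, of w] show ?thesis by (simp add: distrib_right)
  qed
  with K(1) that[of "K + 1"] show ?thesis by simp
qed

text \<open>Independence is inherited because each \<open>n i\<close> is a function of
  \<open>ctil i\<close>. Asking for this rather than for independence itself keeps the class closed
  under sums, whose summands are driven by the same errors.\<close>

lemma noise_indep:
  assumes "noise n" shows "indep_vars (\<lambda>_. borel) n {1..}"
proof -
  from assms have "\<forall>i\<in>{1..}. \<exists>G. G \<in> borel_measurable borel \<and> n i = (\<lambda>w. G (ctil i w))"
    unfolding noise_def by auto
  from bchoice[OF this] obtain G where
    G: "\<And>i. i \<in> {1..} \<Longrightarrow> G i \<in> borel_measurable borel \<and> n i = (\<lambda>w. G i (ctil i w))" by blast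
  have "indep_vars (\<lambda>_. borel) (\<lambda>i w. G i (ctil i w)) {1..}"
    using G by (intro indep_vars_compose2[OF indep]) auto
  also have "?this \<longleftrightarrow> indep_vars (\<lambda>_. borel) n {1..}"
    using G by (intro indep_vars_cong) auto
  finally show ?thesis .
qed

lemma noise_mean: "noise n \<Longrightarrow> i \<ge> 1 \<Longrightarrow> expectation (n i) = 0"
  by (simp add: noise_def)

lemma noise_integrable_sq:
  assumes "noise n" "i \<ge> 1" shows "integrable M (\<lambda>w. (n i w)\<^sup>2)"
proof -
  obtain K where K: "K \<ge> 1" "\<And>i w. i \<ge> 1 \<Longrightarrow> (n i w)\<^sup>2 \<le> K * (psi i * err4 i w)"
    using assms(1) by (rule noise_bound) (rule that; assumption)
  have "integrable M (\<lambda>w. K * psi i * err4 i w)" using err4_integrable[OF assms(2)] by simp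
  then show ?thesis
  proof (rule Bochner_Integration.integrable_bound)
    show "AE w in M. norm ((n i w)\<^sup>2) \<le> norm (K * psi i * err4 i w)"
      using K assms(2) psi_ge1[of i] by (intro AE_I2) (auto simp: abs_mult mult.assoc err4_def)
  qed (use noise_measurable[OF assms] in measurable)
qed

lemma noise_second_moment:
  assumes "noise n"
  obtains K where "K \<ge> 0" "\<And>i. i \<ge> 1 \<Longrightarrow> expectation (\<lambda>w. (n i w)\<^sup>2) \<le> K * psi i"
    "\<And>m. mean_upto m (\<lambda>i. expectation (\<lambda>w. (n i w)\<^sup>2)) \<le> K"
proof -
  obtain K where K: "K \<ge> 1" "\<And>i w. i \<ge> 1 \<Longrightarrow> (n i w)\<^sup>2 \<le> K * (psi i * err4 i w)"
    using assms(1) by (rule noise_bound) (rule that; assumption)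
  obtain B where B: "B \<ge> 1" "\<And>i. i \<ge> 1 \<Longrightarrow> expectation (err4 i) \<le> B"
    by (rule err4_bound) (rule that; assumption)
  obtain C where C: "C \<ge> 0" "\<And>m. mean_upto m psi \<le> C"
    by (rule psi_bound) (rule that; assumption)
  have e: "expectation (\<lambda>w. (n i w)\<^sup>2) \<le> (K * B) * psi i" if i: "i \<ge> 1" for i
  proof -
    have "expectation (\<lambda>w. (n i w)\<^sup>2) \<le> expectation (\<lambda>w. K * psi i * err4 i w)"
      using noise_integrable_sq[OF assms i] err4_integrable[OF i] K(2)[OF i]
      by (intro integral_mono) (auto simp: mult.assoc)
    also have "\<dots> = K * psi i * expectation (err4 i)" by simp
    also have "\<dots> \<le> K * psi i * B" using B(2)[OF i] K psi_ge1[of i] by (intro mult_left_mono) auto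
    finally show ?thesis by (simp add: mult_ac)
  qed
  have KB: "0 \<le> K * B" using K(1) B(1) by simp
  have "mean_upto m (\<lambda>i. expectation (\<lambda>w. (n i w)\<^sup>2)) \<le> K * B * (C + 1)" for m
  proof -
    have "mean_upto m (\<lambda>i. expectation (\<lambda>w. (n i w)\<^sup>2)) \<le> mean_upto m (\<lambda>i. (K * B) * psi i)"
      by (rule mean_upto_mono) (rule e)
    also have "\<dots> = K * B * mean_upto m psi" by (rule mean_upto_scale)
    also have "\<dots> \<le> K * B * (C + 1)" using C(2)[of m] KB by (intro mult_left_mono) auto
    finally show ?thesis .
  qed
  moreover have "expectation (\<lambda>w. (n i w)\<^sup>2) \<le> K * B * (C + 1) * psi i" if i: "i \<ge> 1" for i
  proof -
    have "0 \<le> K * B * C * psi i" using KB C(1) psi_ge1[of i] by simp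
    with e[OF i] show ?thesis by (simp add: algebra_simps)
  qed
  moreover have "0 \<le> K * B * (C + 1)" using KB C(1) by simp
  ultimately show ?thesis using that by blast
qed

text \<open>By orthogonality of the summands and bounded means of \<open>psi\<close>, the average
  times \<open>sqrt m\<close> has bounded second moment. The null factor \<open>b\<close> expresses
  this boundedness as a limit along the filter.\<close>

lemma noise_lim:
  assumes n: "noise n" and b: "b \<longlonglongrightarrow> (0::real)"
  shows "((\<lambda>p. b (fst p) * (sqrt (real (fst p)) * mean_upto (fst p) (\<lambda>i. n i (snd p)))) \<longlongrightarrow> 0) (in_prob M)"
proof -
  obtain K where K: "K \<ge> 0" "\<And>m. mean_upto m (\<lambda>i. expectation (\<lambda>w. (n i w)\<^sup>2)) \<le> K"
    using n by (rule noise_second_moment) (rule that; assumption)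
  have "integrable M (\<lambda>w. (\<Sum>i\<in>{1..m}. n i w)\<^sup>2) \<and>
    expectation (\<lambda>w. (\<Sum>i\<in>{1..m}. n i w)\<^sup>2) = (\<Sum>i\<in>{1..m}. expectation (\<lambda>w. (n i w)\<^sup>2))" for m
    using noise_integrable_sq[OF n] noise_mean[OF n]
    by (intro indep_sum_second_moment indep_vars_subset[OF noise_indep[OF n]]) auto
  then have I: "integrable M (\<lambda>w. (\<Sum>i\<in>{1..m}. n i w)\<^sup>2)"
    "expectation (\<lambda>w. (\<Sum>i\<in>{1..m}. n i w)\<^sup>2) = (\<Sum>i\<in>{1..m}. expectation (\<lambda>w. (n i w)\<^sup>2))" for m by blast+
  have eq: "(b m * (sqrt (real m) * mean_upto m (\<lambda>i. n i w)))\<^sup>2 = (b m)\<^sup>2 / real m * (\<Sum>i\<in>{1..m}. n i w)\<^sup>2" for m w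
  proof -
    have "sqrt (real m) * mean_upto m (\<lambda>i. n i w) = (sqrt (real m) / real m) * (\<Sum>i\<in>{1..m}. n i w)"
      by (simp add: mean_upto_def)
    also have "sqrt (real m) / real m = inverse (sqrt (real m))" by (rule sqrt_divide_self_eq) simp
    finally show ?thesis by (simp add: power_mult_distrib power_inverse divide_inverse mult.assoc)
  qed
  have "(\<lambda>m. (b m)\<^sup>2 * K) \<longlonglongrightarrow> 0\<^sup>2 * K" by (intro tendsto_intros b)
  then have lim: "(\<lambda>m. (b m)\<^sup>2 * K) \<longlonglongrightarrow> 0" by simp
  show ?thesis
  proof (rule tendsto_in_prob_L2[of "\<lambda>m w. b m * (sqrt (real m) * mean_upto m (\<lambda>i. n i w))"])
    show "integrable M (\<lambda>w. (b m * (sqrt (real m) * mean_upto m (\<lambda>i. n i w)))\<^sup>2)" for m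
      unfolding eq using I by simp
    show "(\<lambda>m. expectation (\<lambda>w. (b m * (sqrt (real m) * mean_upto m (\<lambda>i. n i w)))\<^sup>2)) \<longlonglongrightarrow> 0"
    proof (rule tendsto_sandwich[OF always_eventually always_eventually tendsto_const lim]; intro allI)
      fix m
      show "0 \<le> expectation (\<lambda>w. (b m * (sqrt (real m) * mean_upto m (\<lambda>i. n i w)))\<^sup>2)" by simp
      have "expectation (\<lambda>w. (b m * (sqrt (real m) * mean_upto m (\<lambda>i. n i w)))\<^sup>2)
         = (b m)\<^sup>2 * mean_upto m (\<lambda>i. expectation (\<lambda>w. (n i w)\<^sup>2))"
        unfolding eq using I by (simp add: mean_upto_def)
      also have "\<dots> \<le> (b m)\<^sup>2 * K" by (intro mult_left_mono K) simp
      finally show "expectation (\<lambda>w. (b m * (sqrt (real m) * mean_upto m (\<lambda>i. n i w)))\<^sup>2) \<le> (b m)\<^sup>2 * K" .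
    qed
  qed
qed

lemma noise_avg:
  assumes n: "noise n"
  shows "((\<lambda>p. mean_upto (fst p) (\<lambda>i. n i (snd p))) \<longlongrightarrow> 0) (in_prob M)"
proof -
  have "(\<lambda>m. 1 / sqrt (real m)) \<longlonglongrightarrow> 0" by real_asymp
  from noise_lim[OF n this] show ?thesis
  proof (rule Lim_transform_eventually)
    show "\<forall>\<^sub>F p in in_prob M. 1 / sqrt (real (fst p)) * (sqrt (real (fst p)) * mean_upto (fst p) (\<lambda>i. n i (snd p)))
        = mean_upto (fst p) (\<lambda>i. n i (snd p))"
      using eventually_in_prob_deterministic[OF eventually_ge_at_top[of 1]]
      by eventually_elim (simp flip: mult.assoc)
  qed
qed

text \<open>A large noise term must come from a large \<open>err4\<close>: since
  \<open>psi i\<close> is at most \<open>A m\<close>, which is \<open>o(m)\<close>, the condition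
  \<open>n^2 > \<epsilon> m\<close> forces \<open>err4 > t\<close> once \<open>m\<close> is large,
  and the tails of \<open>err4\<close> are uniformly small.\<close>

lemma noise_lindeberg:
  assumes n: "noise n" and e: "\<epsilon> > 0"
  shows "(\<lambda>m. mean_upto m (\<lambda>i. expectation (\<lambda>w. (n i w)\<^sup>2 *
        indicator {w. (n i w)\<^sup>2 > \<epsilon> * real m} w))) \<longlonglongrightarrow> 0"
proof (rule tendstoI)
  fix e :: real assume e0: "e > 0"
  obtain K where K: "K \<ge> 1" "\<And>i w. i \<ge> 1 \<Longrightarrow> (n i w)\<^sup>2 \<le> K * (psi i * err4 i w)"
    using assms(1) by (rule noise_bound) (rule that; assumption)
  obtain A where A: "\<And>i m. 1 \<le> i \<Longrightarrow> i \<le> m \<Longrightarrow> psi i \<le> A m" "\<And>m. A m \<ge> 0" "(\<lambda>m. A m / real m) \<longlonglongrightarrow> 0"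
    by (rule psi_max) (rule that; assumption)
  obtain C where C: "C \<ge> 0" "\<And>m. mean_upto m psi \<le> C"
    by (rule psi_bound) (rule that; assumption)
  \<comment> \<open>Calibrated so that the final bound \<open>K * \<eta> * (C + 1)\<close> equals
    \<open>e / 2\<close>.\<close>
  define \<eta> where "\<eta> = e / (2 * (K * (C + 1)))"
  have KC: "K * (C + 1) > 0" using K(1) C(1) by simp
  have \<eta>: "\<eta> > 0" using e0 KC by (simp add: \<eta>_def)
  obtain t where t: "t > 0" "\<And>i. i \<ge> 1 \<Longrightarrow> expectation (\<lambda>w. err4 i w * indicator {w. err4 i w > t} w) \<le> \<eta>"
    using err4_tail[OF \<eta>] by auto
  have "\<forall>\<^sub>F m in sequentially. A m / real m < \<epsilon> / (K * t)"
    using e K(1) t(1) by (intro order_tendstoD(2)[OF A(3)]) auto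
  then show "\<forall>\<^sub>F m in sequentially. dist (mean_upto m (\<lambda>i. expectation (\<lambda>w. (n i w)\<^sup>2 *
        indicator {w. (n i w)\<^sup>2 > \<epsilon> * real m} w))) 0 < e"
    using eventually_ge_at_top[of 1]
  proof eventually_elim
    case (elim m)
    have Am: "K * A m * t \<le> \<epsilon> * real m"
      using elim K(1) t(1) by (simp add: field_simps)
    have "expectation (\<lambda>w. (n i w)\<^sup>2 * indicator {w. (n i w)\<^sup>2 > \<epsilon> * real m} w) \<le> (K * \<eta>) * psi i"
      if i: "1 \<le> i" "i \<le> m" for i
    proof -
      note [measurable] = noise_measurable[OF n i(1)]
      have "expectation (\<lambda>w. (n i w)\<^sup>2 * indicator {w. (n i w)\<^sup>2 > \<epsilon> * real m} w)
        \<le> expectation (\<lambda>w. K * psi i * (err4 i w * indicator {w. err4 i w > t} w))"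
      proof (rule integral_mono)
        show "integrable M (\<lambda>w. (n i w)\<^sup>2 * indicator {w. (n i w)\<^sup>2 > \<epsilon> * real m} w)"
          by (rule Bochner_Integration.integrable_bound[OF noise_integrable_sq[OF n i(1)]])
            (auto simp: indicator_def)
        have "integrable M (\<lambda>w. err4 i w * indicator {w. err4 i w > t} w)"
          by (rule Bochner_Integration.integrable_bound[OF err4_integrable[OF i(1)]])
            (use i in \<open>auto simp: err4_def indicator_def\<close>)
        then show "integrable M (\<lambda>w. K * psi i * (err4 i w * indicator {w. err4 i w > t} w))" by simp
        fix w
        have nb: "(n i w)\<^sup>2 \<le> K * psi i * err4 i w" using K(2)[OF i(1), of w] by (simp add: mult.assoc)
        have p0: "0 \<le> K * psi i * err4 i w" using order_trans[OF zero_le_power2 nb] .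
        show "(n i w)\<^sup>2 * indicator {w. (n i w)\<^sup>2 > \<epsilon> * real m} w
          \<le> K * psi i * (err4 i w * indicator {w. err4 i w > t} w)"
        proof (cases "(n i w)\<^sup>2 > \<epsilon> * real m")
          case True
          have "err4 i w > t"
          proof (rule ccontr)
            assume "\<not> err4 i w > t"
            then have "K * psi i * err4 i w \<le> K * A m * t"
              using K(1) A(1)[OF i] A(2)[of m] err4_ge1[of i w] psi_ge1[of i] by (intro mult_mono) auto
            with nb Am True show False by linarith
          qed
          then show ?thesis using nb True by simp
        qed (use p0 in \<open>simp add: indicator_def\<close>)
      qed
      also have "\<dots> = K * psi i * expectation (\<lambda>w. err4 i w * indicator {w. err4 i w > t} w)" by simp
      also have "\<dots> \<le> K * psi i * \<eta>" using K(1) psi_ge1[of i] t(2)[OF i(1)] by (intro mult_left_mono) auto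
      finally show ?thesis by (simp add: mult_ac)
    qed
    then have "mean_upto m (\<lambda>i. expectation (\<lambda>w. (n i w)\<^sup>2 * indicator {w. (n i w)\<^sup>2 > \<epsilon> * real m} w))
      \<le> mean_upto m (\<lambda>i. (K * \<eta>) * psi i)" by (rule mean_upto_mono)
    also have "\<dots> = K * \<eta> * mean_upto m psi" by (rule mean_upto_scale)
    also have "\<dots> \<le> K * \<eta> * (C + 1)" using C(2)[of m] K(1) \<eta> by (intro mult_left_mono) auto
    also have "K * \<eta> * (C + 1) = (K * (C + 1)) * \<eta>" by simp
    also have "\<dots> = e / 2" unfolding \<eta>_def using less_imp_neq[OF KC] by (simp only: times_divide_eq_right) simp
    also have "\<dots> < e" using e0 by simp
    finally have "mean_upto m (\<lambda>i. expectation (\<lambda>w. (n i w)\<^sup>2 * indicator {w. (n i w)\<^sup>2 > \<epsilon> * real m} w)) < e" .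
    moreover have "0 \<le> mean_upto m (\<lambda>i. expectation (\<lambda>w. (n i w)\<^sup>2 * indicator {w. (n i w)\<^sup>2 > \<epsilon> * real m} w))"
      by (intro mean_upto_nonneg Bochner_Integration.integral_nonneg) auto
    ultimately show ?case by simp
  qed
qed

lemma noise_squares:
  assumes n: "noise n"
  shows "((\<lambda>p. mean_upto (fst p) (\<lambda>i. (n i (snd p))\<^sup>2)
            - mean_upto (fst p) (\<lambda>i. expectation (\<lambda>w. (n i w)\<^sup>2))) \<longlongrightarrow> 0) (in_prob M)"
proof -
  obtain K where K: "\<And>m. mean_upto m (\<lambda>i. expectation (\<lambda>w. (n i w)\<^sup>2)) \<le> K"
    using n by (rule noise_second_moment) (rule that; assumption)
  show ?thesis
    by (rule weak_law_squares[OF noise_indep[OF n] noise_integrable_sq[OF n] K noise_lindeberg[OF n]])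
qed

text \<open>These averages will multiply quantities that already tend to zero, so a bound on their
  expectation is enough; it comes from \<open>|x| <= x^2 + 1\<close>.\<close>

lemma noise_abs_mean:
  assumes n: "noise n"
  obtains C where "\<And>m. integrable M (\<lambda>w. mean_upto m (\<lambda>i. \<bar>n i w\<bar>))"
    "\<And>m. expectation (\<lambda>w. \<bar>mean_upto m (\<lambda>i. \<bar>n i w\<bar>)\<bar>) \<le> C"
proof -
  obtain K where K: "K \<ge> 0" "\<And>m. mean_upto m (\<lambda>i. expectation (\<lambda>w. (n i w)\<^sup>2)) \<le> K"
    using n by (rule noise_second_moment) (rule that; assumption)
  have int: "integrable M (n i)" if "i \<ge> 1" for i
    using noise_measurable[OF n that] noise_integrable_sq[OF n that] by (rule square_integrable_imp_integrable)
  have int2: "integrable M (\<lambda>w. mean_upto m (\<lambda>i. \<bar>n i w\<bar>))" for m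
    unfolding mean_upto_def
    by (intro integrable_scaleR_right Bochner_Integration.integrable_sum integrable_abs int) auto
  have "expectation (\<lambda>w. \<bar>mean_upto m (\<lambda>i. \<bar>n i w\<bar>)\<bar>) \<le> K + 1" for m
  proof -
    have "\<bar>mean_upto m (\<lambda>i. \<bar>n i w\<bar>)\<bar> = mean_upto m (\<lambda>i. \<bar>n i w\<bar>)" for w
      by (intro abs_of_nonneg mean_upto_nonneg) auto
    then have "expectation (\<lambda>w. \<bar>mean_upto m (\<lambda>i. \<bar>n i w\<bar>)\<bar>) = mean_upto m (\<lambda>i. expectation (\<lambda>w. \<bar>n i w\<bar>))"
      using int by (simp add: mean_upto_def)
    also have "\<dots> \<le> mean_upto m (\<lambda>i. expectation (\<lambda>w. (n i w)\<^sup>2) + 1)"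
    proof (rule mean_upto_mono)
      fix i assume i: "1 \<le> i" "i \<le> m"
      have "expectation (\<lambda>w. \<bar>n i w\<bar>) \<le> expectation (\<lambda>w. (n i w)\<^sup>2 + 1)"
      proof (rule integral_mono)
        fix w
        have "0 \<le> (\<bar>n i w\<bar> - 1)\<^sup>2 + \<bar>n i w\<bar>" by simp
        then show "\<bar>n i w\<bar> \<le> (n i w)\<^sup>2 + 1" by (simp add: power2_diff)
      qed (use int[OF i(1)] noise_integrable_sq[OF n i(1)] in auto)
      also have "\<dots> = expectation (\<lambda>w. (n i w)\<^sup>2) + 1"
        using noise_integrable_sq[OF n i(1)] by (simp add: prob_space)
      finally show "expectation (\<lambda>w. \<bar>n i w\<bar>) \<le> expectation (\<lambda>w. (n i w)\<^sup>2) + 1" .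
    qed
    also have "\<dots> \<le> K + 1" unfolding mean_upto_add using K(2)[of m] mean_upto_const_le[of 1 m] by simp
    finally show ?thesis .
  qed
  with int2 show ?thesis by (rule that)
qed

lemma noise_weight:
  assumes n: "noise n" and g: "\<And>i. i \<ge> 1 \<Longrightarrow> \<bar>g i\<bar> \<le> B"
  shows "noise (\<lambda>i w. g i * n i w)"
proof -
  obtain K where K: "K \<ge> 1" "\<And>i w. i \<ge> 1 \<Longrightarrow> (n i w)\<^sup>2 \<le> K * (psi i * err4 i w)"
    using n by (rule noise_bound) (rule that; assumption)
  have "(g i * n i w)\<^sup>2 \<le> (B\<^sup>2 * K) * (psi i * err4 i w)" if "i \<ge> 1" for i w
  proof -
    have "(g i)\<^sup>2 \<le> B\<^sup>2" using g[OF that] by (metis abs_ge_zero power2_abs power_mono)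
    then have "(g i)\<^sup>2 * (n i w)\<^sup>2 \<le> B\<^sup>2 * (K * (psi i * err4 i w))"
      using K(2)[OF that] by (intro mult_mono) auto
    then show ?thesis by (simp add: power_mult_distrib mult.assoc)
  qed
  moreover have "\<exists>G\<in>borel_measurable borel. (\<lambda>w. g i * n i w) = (\<lambda>w. G (ctil i w))" if "i \<ge> 1" for i
  proof -
    from n that obtain G where G: "G \<in> borel_measurable borel" "n i = (\<lambda>w. G (ctil i w))"
      unfolding noise_def by blast
    then show ?thesis by (intro bexI[of _ "\<lambda>x. g i * G x"]) auto
  qed
  moreover have "0 \<le> B\<^sup>2 * K" using K(1) by simp
  ultimately show ?thesis unfolding noise_def using noise_mean[OF n]
    by (intro conjI allI impI exI[of _ "B\<^sup>2 * K"]) auto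
qed

lemma noise_add:
  assumes n: "noise n" and k: "noise k"
  shows "noise (\<lambda>i w. n i w + k i w)"
proof -
  obtain K where K: "K \<ge> 1" "\<And>i w. i \<ge> 1 \<Longrightarrow> (n i w)\<^sup>2 \<le> K * (psi i * err4 i w)"
    using n by (rule noise_bound) (rule that; assumption)
  obtain L where L: "L \<ge> 1" "\<And>i w. i \<ge> 1 \<Longrightarrow> (k i w)\<^sup>2 \<le> L * (psi i * err4 i w)"
    using k by (rule noise_bound) (rule that; assumption)
  have "(n i w + k i w)\<^sup>2 \<le> (2 * K + 2 * L) * (psi i * err4 i w)" if "i \<ge> 1" for i w
  proof -
    have "0 \<le> (n i w - k i w)\<^sup>2" by simp
    then have "(n i w + k i w)\<^sup>2 \<le> 2 * (n i w)\<^sup>2 + 2 * (k i w)\<^sup>2" by (simp add: power2_sum power2_diff)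
    with K(2)[OF that, of w] L(2)[OF that, of w] show ?thesis by (simp add: distrib_right)
  qed
  moreover have "\<exists>G\<in>borel_measurable borel. (\<lambda>w. n i w + k i w) = (\<lambda>w. G (ctil i w))" if "i \<ge> 1" for i
  proof -
    from n that obtain G where G: "G \<in> borel_measurable borel" "n i = (\<lambda>w. G (ctil i w))"
      unfolding noise_def by blast
    from k that obtain H where H: "H \<in> borel_measurable borel" "k i = (\<lambda>w. H (ctil i w))"
      unfolding noise_def by blast
    show ?thesis using G H by (intro bexI[of _ "\<lambda>x. G x + H x"]) auto
  qed
  moreover have "expectation (\<lambda>w. n i w + k i w) = 0" if "i \<ge> 1" for i
    using square_integrable_imp_integrable[OF noise_measurable[OF n that] noise_integrable_sq[OF n that]]
      square_integrable_imp_integrable[OF noise_measurable[OF k that] noise_integrable_sq[OF k that]]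
      noise_mean[OF n that] noise_mean[OF k that] by simp
  moreover have "0 \<le> 2 * K + 2 * L" using K(1) L(1) by simp
  ultimately show ?thesis unfolding noise_def
    by (intro conjI allI impI exI[of _ "2 * K + 2 * L"]) auto
qed

lemma noise_zero: "noise (\<lambda>i w. 0)"
  unfolding noise_def by (auto intro!: bexI[of _ "\<lambda>_. 0"] exI[of _ 0])

lemma noise_sum:
  "(\<And>k. k \<in> K \<Longrightarrow> noise (n k)) \<Longrightarrow> noise (\<lambda>i w. \<Sum>k\<in>K. n k i w)"
  by (induction K rule: infinite_finite_induct) (auto intro: noise_add noise_zero)

text \<open>Polarisation: sums and differences of noises are noises, and their squares obey the weak
  law.\<close>

lemma noise_products:
  assumes n: "noise n" and k: "noise k"
  shows "((\<lambda>p. mean_upto (fst p) (\<lambda>i. n i (snd p) * k i (snd p))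
            - mean_upto (fst p) (\<lambda>i. expectation (\<lambda>w. n i w * k i w))) \<longlongrightarrow> 0) (in_prob M)"
proof -
  have k': "noise (\<lambda>i w. - 1 * k i w)" using k by (rule noise_weight[where g="\<lambda>_. - 1" and B=1]) simp
  have 1: "noise (\<lambda>i w. n i w + k i w)" using n k by (rule noise_add)
  have 2: "noise (\<lambda>i w. n i w - k i w)" using noise_add[OF n k'] by simp
  have pol: "n i w * k i w = (1 / 4) * ((n i w + k i w)\<^sup>2 - (n i w - k i w)\<^sup>2)" for i w
    by (simp add: power2_eq_square algebra_simps)
  define a where "a p = mean_upto (fst p) (\<lambda>i. (n i (snd p) + k i (snd p))\<^sup>2)" for p
  define b where "b p = mean_upto (fst p) (\<lambda>i. expectation (\<lambda>w. (n i w + k i w)\<^sup>2))" for p :: "nat \<times> 'w"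
  define c where "c p = mean_upto (fst p) (\<lambda>i. (n i (snd p) - k i (snd p))\<^sup>2)" for p
  define d where "d p = mean_upto (fst p) (\<lambda>i. expectation (\<lambda>w. (n i w - k i w)\<^sup>2))" for p :: "nat \<times> 'w"
  have lim: "((\<lambda>p. (1 / 4) * ((a p - b p) - (c p - d p))) \<longlongrightarrow> (1 / 4) * (0 - 0)) (in_prob M)"
    unfolding a_def b_def c_def d_def by (intro tendsto_intros noise_squares 1 2)
  have pe: "mean_upto (fst p) (\<lambda>i. n i (snd p) * k i (snd p)) = (1 / 4) * (a p - c p)" for p
    unfolding pol mean_upto_scale mean_upto_diff a_def c_def by (rule refl)
  have ee: "mean_upto (fst p) (\<lambda>i. expectation (\<lambda>w. n i w * k i w)) = (1 / 4) * (b p - d p)" for p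
  proof -
    have "expectation (\<lambda>w. n i w * k i w) = (1 / 4) * (expectation (\<lambda>w. (n i w + k i w)\<^sup>2) - expectation (\<lambda>w. (n i w - k i w)\<^sup>2))"
      if "i \<ge> 1" for i
      unfolding pol using noise_integrable_sq[OF 1 that] noise_integrable_sq[OF 2 that] by simp
    then have "mean_upto m (\<lambda>i. expectation (\<lambda>w. n i w * k i w)) = mean_upto m (\<lambda>i. (1 / 4) *
        (expectation (\<lambda>w. (n i w + k i w)\<^sup>2) - expectation (\<lambda>w. (n i w - k i w)\<^sup>2)))" for m
      by (intro mean_upto_cong) auto
    then show ?thesis unfolding mean_upto_scale mean_upto_diff b_def d_def .
  qed
  have "(\<lambda>p. mean_upto (fst p) (\<lambda>i. n i (snd p) * k i (snd p))
            - mean_upto (fst p) (\<lambda>i. expectation (\<lambda>w. n i w * k i w))) = (\<lambda>p. (1 / 4) * ((a p - b p) - (c p - d p)))"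
    unfolding pe ee by (intro ext) (simp add: field_simps)
  then show ?thesis using lim by (simp only: diff_self mult_zero_right)
qed

text \<open>Truncation at \<open>n^2 <= m\<close> provides the decomposition required for uniform
  integrability. The centred truncated terms are at most \<open>2 sqrt m\<close>, so their fourth
  moments are at most \<open>4 m\<close> times their variances, which leads to the bound
  \<open>4 K + 3 K^2\<close>. The rest vanishes in mean square by the Lindeberg condition at level
  1.\<close>

lemma noise_limit_moments:
  fixes Y :: "'v \<Rightarrow> real"
  assumes n: "noise n" and N: "prob_space N" and Y: "Y \<in> borel_measurable N"
    and conv: "\<And>f :: real \<Rightarrow> real. continuous_on UNIV f \<Longrightarrow> bounded (range f) \<Longrightarrow>
        (\<lambda>m. expectation (\<lambda>w. f ((1 / sqrt (real m)) * (\<Sum>i=1..m. n i w)))) \<longlonglongrightarrow> (\<integral>v. f (Y v) \<partial>N)"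
  shows "integrable N (\<lambda>v. (Y v)\<^sup>2)" "(\<integral>v. Y v \<partial>N) = 0"
    "(\<lambda>m. mean_upto m (\<lambda>i. expectation (\<lambda>w. (n i w)\<^sup>2))) \<longlonglongrightarrow> (\<integral>v. (Y v)\<^sup>2 \<partial>N)"
proof -
  obtain K where K: "K \<ge> 0" "\<And>m. mean_upto m (\<lambda>i. expectation (\<lambda>w. (n i w)\<^sup>2)) \<le> K"
    using n by (rule noise_second_moment) (rule that; assumption)
  define T where "T m w = (1 / sqrt (real m)) * (\<Sum>i=1..m. n i w)" for m w
  define A where "A m i w = n i w * indicator {w. \<not> (n i w)\<^sup>2 > real m} w" for m i w
  define B where "B m i w = n i w * indicator {w. (n i w)\<^sup>2 > real m} w" for m i w
  define U where "U m w = (1 / sqrt (real m)) * (\<Sum>i=1..m. A m i w - expectation (A m i))" for m w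
  define R where "R m w = (1 / sqrt (real m)) * (\<Sum>i=1..m. B m i w - expectation (B m i))" for m w
  have nm [measurable]: "n i \<in> borel_measurable M" if "i \<ge> 1" for i using noise_measurable[OF n that] .
  have sq: "integrable M (\<lambda>w. (n i w)\<^sup>2)" if "i \<ge> 1" for i using noise_integrable_sq[OF n that] .
  have int: "integrable M (n i)" if "i \<ge> 1" for i
    using nm[OF that] sq[OF that] by (rule square_integrable_imp_integrable)
  have indn: "indep_vars (\<lambda>_. borel) n {1..m}" for m
    by (rule indep_vars_subset[OF noise_indep[OF n]]) auto
  have indA: "indep_vars (\<lambda>_. borel) (A m) {1..m}" for m
    unfolding A_def using indep_vars_compose2[OF indn[of m], of "\<lambda>_ x. x * indicator {x. \<not> x\<^sup>2 > real m} x" "\<lambda>_. borel"]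
    by (auto simp: indicator_def)
  have indB: "indep_vars (\<lambda>_. borel) (B m) {1..m}" for m
    unfolding B_def using indep_vars_compose2[OF indn[of m], of "\<lambda>_ x. x * indicator {x. x\<^sup>2 > real m} x" "\<lambda>_. borel"]
    by (auto simp: indicator_def)
  have mA [measurable]: "A m i \<in> borel_measurable M" if "i \<ge> 1" for m i
    using that unfolding A_def by measurable
  have mB [measurable]: "B m i \<in> borel_measurable M" if "i \<ge> 1" for m i
    using that unfolding B_def by measurable
  have Aabs: "\<bar>A m i w\<bar> \<le> sqrt (real m)" for m i w
    by (auto simp: A_def indicator_def intro: real_le_rsqrt)
  have A2: "(A m i w)\<^sup>2 \<le> (n i w)\<^sup>2" and B2: "(B m i w)\<^sup>2 \<le> (n i w)\<^sup>2" for m i w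
    by (auto simp: A_def B_def indicator_def)
  have iA: "integrable M (\<lambda>w. (A m i w)\<^sup>2)" if "i \<ge> 1" for m i
    using A2 by (intro Bochner_Integration.integrable_bound[OF sq[OF that]])
      (auto intro: borel_measurable_power[OF mA[OF that]])
  have iB: "integrable M (\<lambda>w. (B m i w)\<^sup>2)" if "i \<ge> 1" for m i
    using B2 by (intro Bochner_Integration.integrable_bound[OF sq[OF that]])
      (auto intro: borel_measurable_power[OF mB[OF that]])
  have iA1: "integrable M (A m i)" if "i \<ge> 1" for m i
    using mA[OF that] iA[OF that] by (rule square_integrable_imp_integrable)
  have iB1: "integrable M (B m i)" if "i \<ge> 1" for m i
    using mB[OF that] iB[OF that] by (rule square_integrable_imp_integrable)
  have TT: "(T m w)\<^sup>2 = (1 / real m) * (\<Sum>i\<in>{1..m}. n i w)\<^sup>2" for m w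
    by (simp add: T_def power_divide power_mult_distrib)
  have sumT: "integrable M (\<lambda>w. (\<Sum>i\<in>{1..m}. n i w)\<^sup>2) \<and>
    expectation (\<lambda>w. (\<Sum>i\<in>{1..m}. n i w)\<^sup>2) = (\<Sum>i\<in>{1..m}. expectation (\<lambda>w. (n i w)\<^sup>2))" for m
    using sq noise_mean[OF n] by (intro indep_sum_second_moment indn) auto
  have T2: "integrable M (\<lambda>w. (T m w)\<^sup>2)" "expectation (\<lambda>w. (T m w)\<^sup>2) = mean_upto m (\<lambda>i. expectation (\<lambda>w. (n i w)\<^sup>2))" for m
    unfolding TT using sumT[of m] by (auto simp: mean_upto_def)
  have blk: "T m \<in> borel_measurable M" "expectation (T m) = 0" "expectation (\<lambda>w. (T m w)\<^sup>2) \<le> K"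
    "T m w = U m w + R m w" "integrable M (\<lambda>w. (U m w) ^ 4)" "expectation (\<lambda>w. (U m w) ^ 4) \<le> 4 * K + 3 * K\<^sup>2"
    if m: "m \<ge> 1" for m w
  proof -
    show "T m \<in> borel_measurable M" unfolding T_def
      by (intro borel_measurable_times borel_measurable_sum nm) auto
    show "expectation (T m) = 0" unfolding T_def using int noise_mean[OF n] by simp
    show "expectation (\<lambda>w. (T m w)\<^sup>2) \<le> K" unfolding T2 by (rule K)
    show "T m w = U m w + R m w"
    proof -
      have "n i w = (A m i w - expectation (A m i)) + (B m i w - expectation (B m i))" if "i \<in> {1..m}" for i
      proof -
        have "(\<lambda>w. A m i w + B m i w) = n i" by (auto simp: A_def B_def indicator_def)
        moreover have "expectation (\<lambda>w. A m i w + B m i w) = expectation (A m i) + expectation (B m i)"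
          using iA1 iB1 that by simp
        ultimately have "expectation (A m i) + expectation (B m i) = 0" using noise_mean[OF n] that by simp
        moreover have "n i w = A m i w + B m i w" by (auto simp: A_def B_def indicator_def)
        ultimately show ?thesis by linarith
      qed
      then have "(\<Sum>i=1..m. n i w) = (\<Sum>i=1..m. (A m i w - expectation (A m i)) + (B m i w - expectation (B m i)))"
        by (rule sum.cong[OF refl])
      then show ?thesis by (simp add: T_def U_def R_def sum.distrib add_divide_distrib)
    qed
    have Ub: "\<bar>A m i w - expectation (A m i)\<bar> \<le> 2 * sqrt (real m)" if "i \<in> {1..m}" for i w
    proof -
      have "\<bar>expectation (A m i)\<bar> \<le> expectation (\<lambda>w. \<bar>A m i w\<bar>)" by (rule integral_abs_bound)
      also have "\<dots> \<le> expectation (\<lambda>w. sqrt (real m))" using iA1 that Aabs by (intro integral_mono) auto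
      finally show ?thesis using Aabs[of m i w] by (simp add: prob_space)
    qed
    have ind': "indep_vars (\<lambda>_. borel) (\<lambda>i w. A m i w - expectation (A m i)) {1..m}"
      by (rule indep_vars_compose2[OF indA]) auto
    have U4: "(U m w) ^ 4 = (1 / (real m)\<^sup>2) * (\<Sum>i=1..m. A m i w - expectation (A m i)) ^ 4" for w
    proof -
      have "sqrt (real m) ^ 4 = (real m)\<^sup>2" by (simp add: power4_eq_xxxx power2_eq_square flip: mult.assoc) 
      then show ?thesis by (simp add: U_def power_divide power_mult_distrib)
    qed
    have "integrable M (\<lambda>w. (\<Sum>i=1..m. A m i w - expectation (A m i)) ^ 4)"
    proof (rule integrable_const_bound[where B="(\<Sum>i=1..m. 2 * sqrt (real m)) ^ 4"])
      show "AE w in M. norm ((\<Sum>i=1..m. A m i w - expectation (A m i)) ^ 4) \<le> (\<Sum>i=1..m. 2 * sqrt (real m)) ^ 4"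
      proof (rule AE_I2)
        fix w
        have "\<bar>\<Sum>i=1..m. A m i w - expectation (A m i)\<bar> \<le> (\<Sum>i=1..m. 2 * sqrt (real m))"
          by (rule order_trans[OF sum_abs sum_mono]) (rule Ub)
        then show "norm ((\<Sum>i=1..m. A m i w - expectation (A m i)) ^ 4) \<le> (\<Sum>i=1..m. 2 * sqrt (real m)) ^ 4"
          unfolding real_norm_def power_abs by (rule power_mono) simp
      qed
      show "(\<lambda>w. (\<Sum>i=1..m. A m i w - expectation (A m i)) ^ 4) \<in> borel_measurable M"
        by (intro borel_measurable_power borel_measurable_sum borel_measurable_diff borel_measurable_const mA) auto
    qed
    then show "integrable M (\<lambda>w. (U m w) ^ 4)" unfolding U4 by simp
    have c: "expectation (\<lambda>w. A m i w - expectation (A m i)) = 0" if "i \<in> {1..m}" for i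
      using iA1 that by (simp add: prob_space)
    have s2: "integrable M (\<lambda>w. (A m i w - expectation (A m i))\<^sup>2)"
      "expectation (\<lambda>w. (A m i w - expectation (A m i))\<^sup>2) \<le> expectation (\<lambda>w. (n i w)\<^sup>2)" if i: "i \<in> {1..m}" for i
    proof -
      have i1: "i \<ge> 1" using i by simp
      note e = expectation_centred_square_le[OF mA[OF i1, of m] iA[OF i1, of m]]
      show "integrable M (\<lambda>w. (A m i w - expectation (A m i))\<^sup>2)" by (rule e(1))
      have "expectation (\<lambda>w. (A m i w)\<^sup>2) \<le> expectation (\<lambda>w. (n i w)\<^sup>2)"
        using iA[OF i1] sq[OF i1] A2 by (intro integral_mono) auto
      with e(2) show "expectation (\<lambda>w. (A m i w - expectation (A m i))\<^sup>2) \<le> expectation (\<lambda>w. (n i w)\<^sup>2)" by linarith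
    qed
    have sumn: "(\<Sum>i=1..m. expectation (\<lambda>w. (n i w)\<^sup>2)) \<le> real m * K"
      using K(2)[of m] m by (simp add: mean_upto_def field_simps)
    have sA: "(\<Sum>i=1..m. expectation (\<lambda>w. (A m i w - expectation (A m i))\<^sup>2)) \<le> real m * K"
      using sumn by (rule order_trans[rotated]) (rule sum_mono, rule s2)
    have sA4: "(\<Sum>i=1..m. expectation (\<lambda>w. (A m i w - expectation (A m i)) ^ 4)) \<le> 4 * real m * (real m * K)"
    proof -
      have "(\<Sum>i=1..m. expectation (\<lambda>w. (A m i w - expectation (A m i)) ^ 4))
        \<le> (\<Sum>i=1..m. 4 * real m * expectation (\<lambda>w. (A m i w - expectation (A m i))\<^sup>2))"
      proof (rule sum_mono)
        fix i assume i: "i \<in> {1..m}"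
        have "(A m i w - expectation (A m i)) ^ 4 \<le> 4 * real m * (A m i w - expectation (A m i))\<^sup>2" for w
        proof -
          have "(A m i w - expectation (A m i))\<^sup>2 \<le> (2 * sqrt (real m))\<^sup>2"
            using Ub[OF i, of w] by (rule power2_le_iff_abs_le[THEN iffD2, rotated]) simp
          then have "(A m i w - expectation (A m i))\<^sup>2 * (A m i w - expectation (A m i))\<^sup>2 \<le> 4 * real m * (A m i w - expectation (A m i))\<^sup>2"
            by (intro mult_right_mono) (auto simp: power_mult_distrib)
          then show ?thesis by (simp add: power2_eq_square power4_eq_xxxx mult.assoc)
        qed
        then have "expectation (\<lambda>w. (A m i w - expectation (A m i)) ^ 4) \<le> expectation (\<lambda>w. 4 * real m * (A m i w - expectation (A m i))\<^sup>2)"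
          using s2(1)[OF i] by (intro integral_mono_AE') (auto simp: zero_le_even_power)
        then show "expectation (\<lambda>w. (A m i w - expectation (A m i)) ^ 4) \<le> 4 * real m * expectation (\<lambda>w. (A m i w - expectation (A m i))\<^sup>2)"
          by simp
      qed
      also have "\<dots> = 4 * real m * (\<Sum>i=1..m. expectation (\<lambda>w. (A m i w - expectation (A m i))\<^sup>2))"
        by (simp add: sum_distrib_left)
      also have "\<dots> \<le> 4 * real m * (real m * K)" using sA by (intro mult_left_mono) auto
      finally show ?thesis .
    qed
    have "expectation (\<lambda>w. (U m w) ^ 4) = (1 / (real m)\<^sup>2) * expectation (\<lambda>w. (\<Sum>i=1..m. A m i w - expectation (A m i)) ^ 4)"
      unfolding U4 by simp
    also have "\<dots> \<le> (1 / (real m)\<^sup>2) * (4 * real m * (real m * K) + 3 * (real m * K)\<^sup>2)"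
    proof (rule mult_left_mono)
      have "expectation (\<lambda>w. (\<Sum>i=1..m. A m i w - expectation (A m i)) ^ 4)
        \<le> (\<Sum>i=1..m. expectation (\<lambda>w. (A m i w - expectation (A m i)) ^ 4))
          + 3 * (\<Sum>i=1..m. expectation (\<lambda>w. (A m i w - expectation (A m i))\<^sup>2))\<^sup>2"
        by (rule indep_sum_fourth_moment[OF _ ind' Ub c]) auto
      also have "\<dots> \<le> 4 * real m * (real m * K) + 3 * (real m * K)\<^sup>2"
        using sA by (intro add_mono sA4 mult_left_mono power_mono sum_nonneg) auto
      finally show "expectation (\<lambda>w. (\<Sum>i=1..m. A m i w - expectation (A m i)) ^ 4)
        \<le> 4 * real m * (real m * K) + 3 * (real m * K)\<^sup>2" .
    qed simp
    also have "\<dots> = 4 * K + 3 * K\<^sup>2" using m by (simp add: field_simps power2_eq_square)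
    finally show "expectation (\<lambda>w. (U m w) ^ 4) \<le> 4 * K + 3 * K\<^sup>2" .
  qed
  have RR: "integrable M (\<lambda>w. (R m w)\<^sup>2)" "(\<lambda>m. expectation (\<lambda>w. (R m w)\<^sup>2)) \<longlonglongrightarrow> 0" for m
  proof -
    have R2: "(R m w)\<^sup>2 = (1 / real m) * (\<Sum>i\<in>{1..m}. B m i w - expectation (B m i))\<^sup>2" for m w
      by (simp add: R_def power_divide power_mult_distrib)
    have sB: "integrable M (\<lambda>w. (\<Sum>i\<in>{1..m}. B m i w - expectation (B m i))\<^sup>2)"
      "expectation (\<lambda>w. (\<Sum>i\<in>{1..m}. B m i w - expectation (B m i))\<^sup>2) \<le> (\<Sum>i\<in>{1..m}. expectation (\<lambda>w. (B m i w)\<^sup>2))" for m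
      using sum_centred_square[OF _ indB iB] by auto
    show "integrable M (\<lambda>w. (R m w)\<^sup>2)" unfolding R2 using sB by simp
    have B2eq: "(\<lambda>w. (B m i w)\<^sup>2) = (\<lambda>w. (n i w)\<^sup>2 * indicator {w. (n i w)\<^sup>2 > 1 * real m} w)" for m i
      by (auto simp: B_def indicator_def)
    have le: "expectation (\<lambda>w. (R m w)\<^sup>2) \<le> mean_upto m (\<lambda>i. expectation (\<lambda>w. (n i w)\<^sup>2 * indicator {w. (n i w)\<^sup>2 > 1 * real m} w))" for m
    proof -
      have "expectation (\<lambda>w. (R m w)\<^sup>2) \<le> (1 / real m) * (\<Sum>i\<in>{1..m}. expectation (\<lambda>w. (B m i w)\<^sup>2))"
        unfolding R2 using sB by (simp add: divide_right_mono)
      then show ?thesis unfolding B2eq mean_upto_def by simp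
    qed
    show "(\<lambda>m. expectation (\<lambda>w. (R m w)\<^sup>2)) \<longlonglongrightarrow> 0"
      by (rule tendsto_sandwich[OF always_eventually always_eventually tendsto_const noise_lindeberg[OF n zero_less_one]];
          intro allI; (rule le | simp))
  qed
  have conv': "(\<lambda>m. expectation (\<lambda>w. f (T m w))) \<longlonglongrightarrow> (\<integral>v. f (Y v) \<partial>N)"
    if "continuous_on UNIV f" "bounded (range f)" for f :: "real \<Rightarrow> real"
    unfolding T_def by (rule conv[OF that])
  note smol = second_moment_of_limit[OF N Y, where T=T and U=U and V=R and C=K and K="4 * K + 3 * K\<^sup>2"]
  show "integrable N (\<lambda>v. (Y v)\<^sup>2)"
    by (rule smol(1)) (rule blk T2(1) RR conv'; assumption)+
  show "(\<integral>v. Y v \<partial>N) = 0"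
    by (rule smol(2)) (rule blk T2(1) RR conv'; assumption)+
  show "(\<lambda>m. mean_upto m (\<lambda>i. expectation (\<lambda>w. (n i w)\<^sup>2))) \<longlonglongrightarrow> (\<integral>v. (Y v)\<^sup>2 \<partial>N)"
    unfolding T2(2)[symmetric] by (rule smol(3)) (rule blk T2(1) RR conv'; assumption)+
qed

end

section \<open>The objective function near the true parameter\<close>

text \<open>The matrix of \<open>qform\<close> as a quadratic form in \<open>c\<close>. It makes the
  objective linear in the products \<open>c_p c_q\<close>, so that the parameter appears only in the
  weights of averages.\<close>

definition Hmat :: "real^('n::finite + 'd::finite)^('n + 'd) \<Rightarrow> real^'d^'n \<Rightarrow> real^('n + 'd)^('n + 'd)" where
  "Hmat S X = Zmat X ** matrix_inv (Mmat S X) ** transpose (Zmat X)"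

lemma inner_matrix_sum: "x \<bullet> (A *v y) = (\<Sum>p\<in>UNIV. \<Sum>q\<in>UNIV. A $ p $ q * (x $ p * y $ q))" for A :: "real^'n^'m"
  by (simp add: inner_vec_def matrix_vector_mult_def sum_distrib_left mult_ac)

lemma qform_Hmat: "qform S X c = (\<Sum>p\<in>UNIV. \<Sum>q\<in>UNIV. Hmat S X $ p $ q * (c $ p * c $ q))"
proof -
  have "qform S X c = c \<bullet> (Hmat S X *v c)"
    unfolding qform_def Hmat_def
    by (simp add: inner_matrix_mult_left matrix_vector_mul_assoc[symmetric])
  then show ?thesis by (simp add: inner_matrix_sum)
qed

text \<open>By cyclicity this is the trace of \<open>M^-1 M\<close>. Consequently the errors add
  \<open>\<sigma>^2 d\<close> to the expected objective whatever \<open>X\<close> and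
  \<open>i\<close> are, so they do not shift its minimum.\<close>

lemma trace_Hmat:
  fixes X :: "real^'d::finite^'n::finite"
  assumes "transpose S = S" "invertible (Mmat S X)"
  shows "(\<Sum>p\<in>UNIV. \<Sum>q\<in>UNIV. Hmat S X $ p $ q * S $ p $ q) = real CARD('d)"
proof -
  have "S $ p $ q = S $ q $ p" for p q
  proof -
    have "S $ p $ q = transpose S $ q $ p" by (simp add: transpose_def)
    then show ?thesis by (simp only: assms(1))
  qed
  then have "(\<Sum>p\<in>UNIV. \<Sum>q\<in>UNIV. Hmat S X $ p $ q * S $ p $ q) = (\<Sum>p\<in>UNIV. \<Sum>q\<in>UNIV. Hmat S X $ p $ q * S $ q $ p)"
    by (intro sum.cong refl) metis
  also have "\<dots> = trace (Hmat S X ** S)"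
    by (simp add: trace_def matrix_matrix_mult_def)
  also have "Hmat S X ** S = Zmat X ** (matrix_inv (Mmat S X) ** (transpose (Zmat X) ** S))"
    by (simp add: Hmat_def matrix_mul_assoc)
  also have "trace \<dots> = trace ((matrix_inv (Mmat S X) ** (transpose (Zmat X) ** S)) ** Zmat X)"
    by (rule trace_mul_sym)
  also have "(matrix_inv (Mmat S X) ** (transpose (Zmat X) ** S)) ** Zmat X = matrix_inv (Mmat S X) ** Mmat S X"
    by (simp add: Mmat_def matrix_mul_assoc)
  also have "trace \<dots> = real CARD('d)" by (simp add: matrix_inv_left[OF assms(2)] trace_I)
  finally show ?thesis .
qed

lemma Zmat_diff: "Zmat X *v t = Zmat X0 *v t + stack ((X - X0) *v t) 0"
  by (simp add: Zmat_vec stack_def vec_eq_iff matrix_vector_mult_diff_rdistrib split: sum.split)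

lemma norm_stack_0: "norm (stack x 0 :: real^('n::finite + 'd::finite)) = norm (x :: real^'n)"
proof -
  have "(norm (stack x 0 :: real^('n + 'd)))\<^sup>2 = (norm x)\<^sup>2"
    by (simp add: power2_norm_eq_inner inner_vec_def sum_UNIV_plus stack_def)
  then show ?thesis by simp
qed

lemma norm_matrix_sq: "(norm A)\<^sup>2 = (\<Sum>k\<in>UNIV. (norm (A *v axis k 1))\<^sup>2)" for A :: "real^'d^'n"
proof -
  have "(norm A)\<^sup>2 = (\<Sum>i\<in>UNIV. \<Sum>k\<in>UNIV. A $ i $ k * A $ i $ k)"
    by (simp add: power2_norm_eq_inner inner_vec_def)
  also have "\<dots> = (\<Sum>k\<in>UNIV. \<Sum>i\<in>UNIV. A $ i $ k * A $ i $ k)" by (rule sum.swap)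
  also have "\<dots> = (\<Sum>k\<in>UNIV. (norm (A *v axis k 1))\<^sup>2)"
    by (simp add: power2_norm_eq_inner inner_vec_def matrix_vector_mult_basis column_def)
  finally show ?thesis .
qed

lemma norm_matrix_vector_le: "norm (A *v x) \<le> norm A * norm x" for A :: "real^'d^'n"
proof (rule power2_le_imp_le)
  have "(norm (A *v x))\<^sup>2 = (\<Sum>i\<in>UNIV. (A $ i \<bullet> x)\<^sup>2)"
    unfolding power2_norm_eq_inner inner_vec_def[of "A *v x"]
    by (simp add: matrix_vector_mult_def inner_vec_def[of "A $ _"] power2_eq_square)
  also have "\<dots> \<le> (\<Sum>i\<in>UNIV. (norm (A $ i))\<^sup>2 * (norm x)\<^sup>2)"
    by (intro sum_mono) (metis Cauchy_Schwarz_ineq2 abs_ge_zero power2_abs power_mono power_mult_distrib)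
  also have "\<dots> = (norm A)\<^sup>2 * (norm x)\<^sup>2"
    by (simp add: power2_norm_eq_inner inner_vec_def[of A] sum_distrib_right)
  finally show "(norm (A *v x))\<^sup>2 \<le> (norm A * norm x)\<^sup>2" by (simp add: power_mult_distrib)
qed simp

lemma norm_subrows_le:
  fixes \<iota> :: "'j::finite \<Rightarrow> 'k::finite" and x :: "real^'k"
  assumes "inj \<iota>" shows "norm (subrows \<iota> x) \<le> norm x"
proof (rule power2_le_imp_le)
  have "(norm (subrows \<iota> x))\<^sup>2 = (\<Sum>k\<in>UNIV. (x $ \<iota> k)\<^sup>2)"
    unfolding power2_norm_eq_inner inner_vec_def by (simp add: subrows_def power2_eq_square)
  also have "\<dots> = (\<Sum>p\<in>range \<iota>. (x $ p)\<^sup>2)" using assms by (simp add: sum.reindex)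
  also have "\<dots> \<le> (\<Sum>p\<in>UNIV. (x $ p)\<^sup>2)" by (intro sum_mono2) auto
  also have "\<dots> = (norm x)\<^sup>2" unfolding power2_norm_eq_inner inner_vec_def by (simp add: power2_eq_square)
  finally show "(norm (subrows \<iota> x))\<^sup>2 \<le> (norm x)\<^sup>2" .
qed simp

lemma subrows_add: "subrows \<iota> (x + y) = subrows \<iota> x + subrows \<iota> y"
  by (simp add: subrows_def vec_eq_iff)

text \<open>Only the upper block of \<open>Zmat\<close> depends on the parameter, so rows selected
  from it move by at most the norm of \<open>X - X0\<close>.\<close>

lemma subrows_Zmat_diff_le:
  assumes "inj \<iota>"
  shows "norm (subrows \<iota> (Zmat X0 *v t)) - norm (X - X0) * norm t \<le> norm (subrows \<iota> (Zmat X *v t))"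
proof -
  have "norm (subrows \<iota> (stack ((X - X0) *v t) 0)) \<le> norm (X - X0) * norm t"
    using norm_subrows_le[OF assms, of "stack ((X - X0) *v t) 0"] norm_matrix_vector_le[of "X - X0" t]
    by (simp add: norm_stack_0)
  then show ?thesis unfolding Zmat_diff[of X t X0] subrows_add
    using norm_triangle_ineq4[of "subrows \<iota> (Zmat X0 *v t) + subrows \<iota> (stack ((X - X0) *v t) 0)"
        "subrows \<iota> (stack ((X - X0) *v t) 0)"] by simp
qed

text \<open>Compactness: bounded matrices with a common coercivity constant form a compact set on
  which the determinant does not vanish. The empty set has to be treated apart, since there is no
  minimum to take.\<close>

lemma det_bounded_below:
  fixes \<gamma> R :: real
  assumes "\<gamma> > 0"
  shows "\<exists>c>0. \<forall>A :: real^'d^'d. norm A \<le> R \<longrightarrow> (\<forall>t. \<gamma> * (norm t)\<^sup>2 \<le> t \<bullet> (A *v t)) \<longrightarrow> c \<le> \<bar>det A\<bar>"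
proof -
  define K where "K = cball 0 R \<inter> {A :: real^'d^'d. \<forall>t. \<gamma> * (norm t)\<^sup>2 \<le> t \<bullet> (A *v t)}"
  have cont: "continuous_on UNIV (\<lambda>A :: real^'d^'d. t \<bullet> (A *v t))" for t
    unfolding continuous_on_def by (intro ballI tendsto_intros)
  have "closed {A :: real^'d^'d. \<forall>t. \<gamma> * (norm t)\<^sup>2 \<le> t \<bullet> (A *v t)}"
    unfolding Collect_all_eq by (intro closed_INT ballI closed_Collect_le continuous_on_const cont)
  then have K: "compact K" unfolding K_def by (intro compact_Int_closed) auto
  have contdet: "continuous_on K (\<lambda>A. \<bar>det A\<bar>)"
    unfolding continuous_on_def by (intro ballI tendsto_intros tendsto_det)
  have nz: "\<bar>det A\<bar> > 0" if "A \<in> K" for A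
  proof -
    have "0 < t \<bullet> (A *v t)" if "t \<noteq> 0" for t
    proof -
      have "0 < \<gamma> * (norm t)\<^sup>2" using assms that by simp
      also have "\<dots> \<le> t \<bullet> (A *v t)" using \<open>A \<in> K\<close> by (simp add: K_def)
      finally show ?thesis .
    qed
    then show ?thesis using invertible_if_positive[of A] by (simp add: invertible_det_nz)
  qed
  show ?thesis
  proof (cases "K = {}")
    case True
    then show ?thesis unfolding K_def by (intro exI[of _ 1]) auto
  next
    case False
    obtain A where A: "A \<in> K" "\<And>B. B \<in> K \<Longrightarrow> \<bar>det A\<bar> \<le> \<bar>det B\<bar>"
      using continuous_attains_inf[OF K False contdet] by blast
    then show ?thesis using nz[OF A(1)] unfolding K_def by (intro exI[of _ "\<bar>det A\<bar>"]) auto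
  qed
qed

section \<open>Uniform expansion of the weights near the true parameter\<close>

context eiv
begin

lemma ctil_nth_measurable [measurable]: "i \<ge> 1 \<Longrightarrow> (\<lambda>w. ctil i w $ p) \<in> borel_measurable M"
  by (rule measurable_compose[OF ctil_measurable]) auto

lemma padded_inf: "padded \<iota> \<Sigma>inf Sinf"
  unfolding padded_def
proof (intro conjI allI impI)
  fix k l
  have 1: "(\<lambda>i. S i $ \<iota> k $ \<iota> l) \<longlonglongrightarrow> Sinf $ \<iota> k $ \<iota> l" by (intro tendsto_intros S_lim)
  have "(\<lambda>i. \<Sigma> i $ k $ l) \<longlonglongrightarrow> \<Sigma>inf $ k $ l" by (intro tendsto_intros \<Sigma>_lim)
  moreover have "\<forall>\<^sub>F i in sequentially. \<Sigma> i $ k $ l = S i $ \<iota> k $ \<iota> l"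
    using eventually_ge_at_top[of 1] by eventually_elim (use pad in \<open>simp add: padded_def\<close>)
  ultimately have "(\<lambda>i. S i $ \<iota> k $ \<iota> l) \<longlonglongrightarrow> \<Sigma>inf $ k $ l" by (rule Lim_transform_eventually)
  with 1 show "Sinf $ \<iota> k $ \<iota> l = \<Sigma>inf $ k $ l" by (rule LIMSEQ_unique)
next
  fix p q assume pq: "p \<notin> range \<iota> \<or> q \<notin> range \<iota>"
  have "(\<lambda>i. S i $ p $ q) \<longlonglongrightarrow> Sinf $ p $ q" by (intro tendsto_intros S_lim)
  moreover have "S i $ p $ q = 0" if "i \<ge> 1" for i using pad[OF that] pq unfolding padded_def by blast
  then have "\<forall>\<^sub>F i in sequentially. S i $ p $ q = 0" by (rule eventually_sequentiallyI)
  then have "(\<lambda>i. S i $ p $ q) \<longlonglongrightarrow> 0" by (rule tendsto_eventually)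
  ultimately show "Sinf $ p $ q = 0" by (rule LIMSEQ_unique)
qed

lemma \<Sigma>inf_sym: "transpose \<Sigma>inf = \<Sigma>inf"
proof -
  have "(\<lambda>i. transpose (\<Sigma> i)) \<longlonglongrightarrow> transpose \<Sigma>inf" by (intro tendsto_intros \<Sigma>_lim)
  moreover have "(\<lambda>i. transpose (\<Sigma> i)) \<longlonglongrightarrow> \<Sigma>inf"
    by (rule Lim_transform_eventually[OF \<Sigma>_lim eventually_sequentiallyI[of 1]]) (simp add: \<Sigma>_sym)
  ultimately show ?thesis by (rule LIMSEQ_unique)
qed

lemma \<Sigma>inf_low: "\<kappa> * (norm x)\<^sup>2 \<le> x \<bullet> (\<Sigma>inf *v x)"
proof (rule LIMSEQ_le_const)
  show "(\<lambda>i. x \<bullet> (\<Sigma> i *v x)) \<longlonglongrightarrow> x \<bullet> (\<Sigma>inf *v x)" by (intro tendsto_intros \<Sigma>_lim)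
  show "\<exists>N. \<forall>n\<ge>N. \<kappa> * (norm x)\<^sup>2 \<le> x \<bullet> (\<Sigma> n *v x)" using \<Sigma>_low by blast
qed

lemma S_sym: "i \<ge> 1 \<Longrightarrow> transpose (S i) = S i"
  by (rule transpose_padded[OF inj pad \<Sigma>_sym])

lemma Sinf_sym: "transpose Sinf = Sinf"
  by (rule transpose_padded[OF inj padded_inf \<Sigma>inf_sym])

lemma \<Sigma>_pos: "i \<ge> 1 \<Longrightarrow> x \<noteq> 0 \<Longrightarrow> 0 < x \<bullet> (\<Sigma> i *v x)"
  using mult_pos_pos[OF \<kappa>, of "(norm x)\<^sup>2"] by (auto intro: less_le_trans[OF _ \<Sigma>_low])

lemma \<Sigma>inf_pos: "x \<noteq> 0 \<Longrightarrow> 0 < x \<bullet> (\<Sigma>inf *v x)"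
  using mult_pos_pos[OF \<kappa>, of "(norm x)\<^sup>2"] by (auto intro: less_le_trans[OF _ \<Sigma>inf_low])

abbreviation full :: "real^'d^'n \<Rightarrow> bool" where
  "full X \<equiv> rank (subrows \<iota> (Zmat X)) = CARD('d)"

lemma Mmat_pos: "i \<ge> 1 \<Longrightarrow> full X \<Longrightarrow> t \<noteq> 0 \<Longrightarrow> 0 < t \<bullet> (Mmat (S i) X *v t)"
  by (rule Mmat_positive[OF inj pad \<Sigma>_pos])

lemma Mmat_invertible: "i \<ge> 1 \<Longrightarrow> full X \<Longrightarrow> invertible (Mmat (S i) X)"
  by (rule invertible_if_positive) (rule Mmat_pos)

lemma Mmat_inf_invertible: "full X \<Longrightarrow> invertible (Mmat Sinf X)"
  by (rule invertible_if_positive) (rule Mmat_positive[OF inj padded_inf \<Sigma>inf_pos])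

text \<open>\<open>\<beta>\<close> bounds from below the stretching of the injective map given by
  the selected rows of \<open>Z_0\<close>. Within distance \<open>\<beta> / 2\<close> half of it
  survives, which gives full rank and the constant \<open>\<kappa> * (\<beta> / 2)^2\<close> for all
  \<open>i\<close>.\<close>

lemma Mmat_low:
  obtains \<gamma> where "\<gamma> > 0" "\<forall>\<^sub>F X in nhds X0. full X \<and> (\<forall>i\<ge>1. \<forall>t. \<gamma> * (norm t)\<^sup>2 \<le> t \<bullet> (Mmat (S i) X *v t))"
proof -
  have lin: "linear (\<lambda>t. subrows \<iota> (Zmat X0 *v t))"
    unfolding subrows_matrix_vec[symmetric] by (rule matrix_vector_mul_linear)
  have "inj (\<lambda>t. subrows \<iota> (Zmat X0 *v t))"
    unfolding linear_injective_0[OF lin] using full0 full_rank_iff[of \<iota> X0] by blast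
  then obtain \<beta> where \<beta>: "\<beta> > 0" "\<And>t. \<beta> * norm t \<le> norm (subrows \<iota> (Zmat X0 *v t))"
    using linear_inj_bounded_below_pos[OF lin] by blast
  have "full X \<and> (\<forall>i\<ge>1. \<forall>t. (\<kappa> * (\<beta> / 2)\<^sup>2) * (norm t)\<^sup>2 \<le> t \<bullet> (Mmat (S i) X *v t))" if "dist X X0 < \<beta> / 2" for X
  proof -
    have low: "\<beta> / 2 * norm t \<le> norm (subrows \<iota> (Zmat X *v t))" for t
    proof -
      have "norm (X - X0) * norm t \<le> \<beta> / 2 * norm t" using that by (intro mult_right_mono) (auto simp: dist_norm)
      then show ?thesis using subrows_Zmat_diff_le[OF inj, of X0 t X] \<beta>(2)[of t] by (simp add: field_simps)
    qed
    have "full X" unfolding full_rank_iff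
    proof (intro allI impI notI)
      fix t :: "real^'d" assume "t \<noteq> 0" "subrows \<iota> (Zmat X *v t) = 0"
      then show False using low[of t] \<beta>(1) by (simp add: mult_le_0_iff)
    qed
    moreover have "(\<kappa> * (\<beta> / 2)\<^sup>2) * (norm t)\<^sup>2 \<le> t \<bullet> (Mmat (S i) X *v t)" if "i \<ge> 1" for i t
    proof -
      have "(\<beta> / 2 * norm t)\<^sup>2 \<le> (norm (subrows \<iota> (Zmat X *v t)))\<^sup>2"
        using low[of t] \<beta>(1) by (intro power_mono) auto
      then have "\<kappa> * (\<beta> / 2 * norm t)\<^sup>2 \<le> \<kappa> * (norm (subrows \<iota> (Zmat X *v t)))\<^sup>2"
        using \<kappa> by (intro mult_left_mono) auto
      also have "\<dots> \<le> t \<bullet> (Mmat (S i) X *v t)"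
        unfolding Mmat_form padded_form[OF inj pad[OF that]] by (rule \<Sigma>_low[OF that])
      finally show ?thesis unfolding power_mult_distrib mult.assoc .
    qed
    ultimately show ?thesis by blast
  qed
  then have "\<forall>\<^sub>F X in nhds X0. full X \<and> (\<forall>i\<ge>1. \<forall>t. (\<kappa> * (\<beta> / 2)\<^sup>2) * (norm t)\<^sup>2 \<le> t \<bullet> (Mmat (S i) X *v t))"
    using \<beta>(1) unfolding eventually_nhds_metric by (intro exI[of _ "\<beta> / 2"]) auto
  moreover have "\<kappa> * (\<beta> / 2)\<^sup>2 > 0" using \<kappa> \<beta>(1) by simp
  ultimately show ?thesis using that by blast
qed

lemma S_bound: obtains B where "\<And>i p q. \<bar>S i $ p $ q\<bar> \<le> B"
proof -
  have "Bseq S" using S_lim by (intro convergent_imp_Bseq convergentI)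
  then obtain B where B: "\<And>i. norm (S i) \<le> B" by (rule BseqE) blast
  have "\<bar>S i $ p $ q\<bar> \<le> norm (S i)" for i p q
    using order_trans[OF component_le_norm_cart Finite_Cartesian_Product.norm_nth_le] .
  then have "\<bar>S i $ p $ q\<bar> \<le> B" for i p q using B[of i] by (rule order_trans)
  then show ?thesis by (rule that)
qed

lemma taylor2_S: "taylor2 X0 (\<lambda>i X. S i $ p $ q)"
proof -
  obtain B where "\<And>i p q. \<bar>S i $ p $ q\<bar> \<le> B" by (rule S_bound) (rule that; assumption)
  then show ?thesis by (intro taylor2_const)
qed

lemma taylor2_Zmat: "taylor2 X0 (\<lambda>i X. Zmat X $ p $ k)" "taylor2 X0 (\<lambda>i X. transpose (Zmat X) $ k $ p)"
proof -
  have "\<bar>Zmat X $ p $ k - Zmat X0 $ p $ k\<bar> \<le> 1 * dist X X0" for X :: "real^'d^'n"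
  proof (cases p)
    case (Inl i)
    have "\<bar>(X - X0) $ i $ k\<bar> \<le> norm (X - X0)"
      using order_trans[OF component_le_norm_cart Finite_Cartesian_Product.norm_nth_le] .
    then show ?thesis by (simp add: Inl Zmat_def stack_def dist_norm)
  qed (simp add: Zmat_def stack_def)
  then show "taylor2 X0 (\<lambda>i X. Zmat X $ p $ k)" by (intro taylor2_fun[where C=1] always_eventually allI)
  then show "taylor2 X0 (\<lambda>i X. transpose (Zmat X) $ k $ p)" by (simp add: transpose_def)
qed

lemma taylor2_Mmat: "taylor2 X0 (\<lambda>i X. Mmat (S i) X $ k $ l)"
  unfolding Mmat_def by (intro taylor2_matrix_mult taylor2_Zmat taylor2_S)

lemma Mmat_bounded: obtains R where "R > 0" "\<forall>\<^sub>F X in nhds X0. \<forall>i\<ge>1. norm (Mmat (S i) X) \<le> R"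
proof -
  have "\<exists>B. \<forall>\<^sub>F X in nhds X0. \<forall>i\<ge>1. \<bar>Mmat (S i) X $ k $ l\<bar> \<le> B" for k l
  proof -
    obtain B where B: "\<And>i. i \<ge> 1 \<Longrightarrow> \<bar>Mmat (S i) X0 $ k $ l\<bar> \<le> B"
      using taylor2_Mmat by (rule taylor2_expansion) (rule that; assumption)
    obtain C where C: "C \<ge> 0" "\<forall>\<^sub>F X in nhds X0. \<forall>i\<ge>1. \<bar>Mmat (S i) X $ k $ l - Mmat (S i) X0 $ k $ l\<bar> \<le> C * dist X X0"
      using taylor2_lipschitz[OF taylor2_Mmat] by blast
    have "\<forall>\<^sub>F X in nhds X0. \<forall>i\<ge>1. \<bar>Mmat (S i) X $ k $ l\<bar> \<le> B + C"
      using C(2) eventually_nhds_dist[of 1 X0, OF zero_less_one]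
    proof eventually_elim
      case (elim X)
      have "C * dist X X0 \<le> C" using C(1) elim(2) by (intro mult_left_le) auto
      then show ?case using elim(1) B by (smt (verit))
    qed
    then show ?thesis by blast
  qed
  then have "\<forall>k. \<forall>l. \<exists>B. \<forall>\<^sub>F X in nhds X0. \<forall>i\<ge>1. \<bar>Mmat (S i) X $ k $ l\<bar> \<le> B" by blast
  then obtain B where B: "\<And>k l. \<forall>\<^sub>F X in nhds X0. \<forall>i\<ge>1. \<bar>Mmat (S i) X $ k $ l\<bar> \<le> B k l"
    unfolding choice_iff by blast
  define R where "R = 1 + (\<Sum>k\<in>UNIV. \<Sum>l\<in>UNIV. \<bar>B k l\<bar>)"
  have "\<forall>\<^sub>F X in nhds X0. \<forall>k. \<forall>l. \<forall>i\<ge>1. \<bar>Mmat (S i) X $ k $ l\<bar> \<le> B k l"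
    by (intro eventually_all_finite B)
  then have "\<forall>\<^sub>F X in nhds X0. \<forall>i\<ge>1. norm (Mmat (S i) X) \<le> R"
  proof eventually_elim
    case (elim X)
    show ?case
    proof (intro allI impI)
      fix i :: nat assume i: "i \<ge> 1"
      have "norm (Mmat (S i) X) \<le> (\<Sum>k\<in>UNIV. norm (Mmat (S i) X $ k))"
        unfolding norm_vec_def[of "Mmat (S i) X"] by (intro L2_set_le_sum) auto
      also have "\<dots> \<le> (\<Sum>k\<in>UNIV. \<Sum>l\<in>UNIV. \<bar>Mmat (S i) X $ k $ l\<bar>)" by (intro sum_mono norm_le_l1_cart)
      also have "\<dots> \<le> (\<Sum>k\<in>UNIV. \<Sum>l\<in>UNIV. \<bar>B k l\<bar>)"
        using elim i by (intro sum_mono order_trans[OF _ abs_ge_self]) blast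
      finally show "norm (Mmat (S i) X) \<le> R" by (simp add: R_def)
    qed
  qed
  moreover have "R > 0" unfolding R_def by (intro add_pos_nonneg sum_nonneg) auto
  ultimately show ?thesis using that by blast
qed

text \<open>Coercivity and boundedness place all the matrices \<open>Mmat (S i) X\<close> with
  \<open>X\<close> near \<open>X0\<close> in one compact set of invertible matrices; this is the
  uniform lower bound on determinants that the inverse asks for.\<close>

lemma taylor2_Minv: "taylor2 X0 (\<lambda>i X. matrix_inv (Mmat (S i) X) $ k $ l)"
proof -
  obtain \<gamma> where \<gamma>: "\<gamma> > 0" "\<forall>\<^sub>F X in nhds X0. full X \<and> (\<forall>i\<ge>1. \<forall>t. \<gamma> * (norm t)\<^sup>2 \<le> t \<bullet> (Mmat (S i) X *v t))"
    by (rule Mmat_low) (rule that; assumption)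
  obtain R where R: "R > 0" "\<forall>\<^sub>F X in nhds X0. \<forall>i\<ge>1. norm (Mmat (S i) X) \<le> R"
    by (rule Mmat_bounded) (rule that; assumption)
  obtain c where c: "c > 0" "\<And>A :: real^'d^'d. norm A \<le> R \<Longrightarrow> (\<And>t. \<gamma> * (norm t)\<^sup>2 \<le> t \<bullet> (A *v t)) \<Longrightarrow> c \<le> \<bar>det A\<bar>"
    using det_bounded_below[OF \<gamma>(1), of R] by blast
  have "\<forall>\<^sub>F X in nhds X0. \<forall>i\<ge>1. c \<le> \<bar>det (Mmat (S i) X)\<bar>"
    using \<gamma>(2) R(2) by eventually_elim (simp add: c(2))
  then show ?thesis by (rule taylor2_matrix_inv[OF taylor2_Mmat c(1)])
qed

lemma taylor2_Hmat: "taylor2 X0 (\<lambda>i X. Hmat (S i) X $ p $ q)"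
  unfolding Hmat_def by (intro taylor2_matrix_mult taylor2_Zmat taylor2_Minv)

section \<open>Noise averages with weights at a random parameter\<close>

lemma mean_abs_noise_mult:
  assumes n: "noise n" and f: "(f \<longlongrightarrow> 0) (in_prob M)"
  shows "((\<lambda>z. f z * mean_upto (fst z) (\<lambda>i. \<bar>n i (snd z)\<bar>)) \<longlongrightarrow> 0) (in_prob M)"
proof -
  obtain C where C: "\<And>m. integrable M (\<lambda>w. mean_upto m (\<lambda>i. \<bar>n i w\<bar>))"
    "\<And>m. expectation (\<lambda>w. \<bar>mean_upto m (\<lambda>i. \<bar>n i w\<bar>)\<bar>) \<le> C"
    using n by (rule noise_abs_mean) (rule that; assumption)
  show ?thesis by (rule tendsto_in_prob_mult_bounded[OF f C])
qed

text \<open>In each product of the expansion the random parameter sits in the factor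
  \<open>\<phi>\<close>, which leaves the average and is bounded by a multiple of the distance. What
  stays inside is noise with bounded deterministic weights, and \<open>noise_lim\<close> applies to
  it.\<close>

lemma separable_noise:
  assumes h: "separable x0 h" and n: "noise n" and b: "b \<longlonglongrightarrow> (0::real)" "\<And>m. b m \<ge> 0"
    and Xh: "(Xh \<longlongrightarrow> x0) (in_prob M)"
  shows "\<exists>Y. (Y \<longlongrightarrow> 0) (in_prob M) \<and> (\<forall>\<^sub>F z in in_prob M.
    b (fst z) * (sqrt (real (fst z)) * \<bar>mean_upto (fst z) (\<lambda>i. h i (Xh z) * n i (snd z))\<bar>) \<le> dist (Xh z) x0 * Y z)"
  using h
proof (induction rule: separable.induct)
  case separable_zero
  show ?case by (intro exI[of _ "\<lambda>_. 0"]) (simp add: mean_upto_def)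
next
  case (separable_add h \<phi> C g D)
  from separable_add.IH obtain Y where Y: "(Y \<longlongrightarrow> 0) (in_prob M)"
    "\<forall>\<^sub>F z in in_prob M. b (fst z) * (sqrt (real (fst z)) * \<bar>mean_upto (fst z) (\<lambda>i. h i (Xh z) * n i (snd z))\<bar>) \<le> dist (Xh z) x0 * Y z"
    by blast
  have gn: "noise (\<lambda>i w. g i * n i w)" by (rule noise_weight[OF n separable_add.hyps(3)])
  let ?G = "\<lambda>z. b (fst z) * (sqrt (real (fst z)) * mean_upto (fst z) (\<lambda>i. g i * n i (snd z)))"
  have "((\<lambda>z. Y z + \<bar>C\<bar> * \<bar>?G z\<bar>) \<longlongrightarrow> 0 + \<bar>C\<bar> * \<bar>0\<bar>) (in_prob M)"
    by (intro tendsto_intros Y noise_lim[OF gn b(1)])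
  moreover have "\<forall>\<^sub>F z in in_prob M. \<bar>\<phi> (Xh z)\<bar> \<le> C * dist (Xh z) x0"
    using Xh separable_add.hyps(2) by (auto simp: filterlim_iff)
  with Y(2) have "\<forall>\<^sub>F z in in_prob M. b (fst z) * (sqrt (real (fst z)) *
     \<bar>mean_upto (fst z) (\<lambda>i. (h i (Xh z) + \<phi> (Xh z) * g i) * n i (snd z))\<bar>) \<le> dist (Xh z) x0 * (Y z + \<bar>C\<bar> * \<bar>?G z\<bar>)"
  proof eventually_elim
    case (elim z)
    let ?s = "b (fst z) * sqrt (real (fst z))"
    have s0: "?s \<ge> 0" using b(2) by simp
    let ?H = "mean_upto (fst z) (\<lambda>i. h i (Xh z) * n i (snd z))" and ?g = "mean_upto (fst z) (\<lambda>i. g i * n i (snd z))"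
    have "mean_upto (fst z) (\<lambda>i. (h i (Xh z) + \<phi> (Xh z) * g i) * n i (snd z)) = ?H + \<phi> (Xh z) * ?g"
      by (simp add: distrib_right mean_upto_add mult.assoc mean_upto_scale)
    then have "?s * \<bar>mean_upto (fst z) (\<lambda>i. (h i (Xh z) + \<phi> (Xh z) * g i) * n i (snd z))\<bar>
       \<le> ?s * (\<bar>?H\<bar> + \<bar>\<phi> (Xh z)\<bar> * \<bar>?g\<bar>)"
      using s0 by (intro mult_left_mono) (auto simp: abs_mult[symmetric] abs_triangle_ineq)
    also have "\<dots> = ?s * \<bar>?H\<bar> + \<bar>\<phi> (Xh z)\<bar> * (?s * \<bar>?g\<bar>)" by (simp add: algebra_simps)
    also have "\<dots> \<le> dist (Xh z) x0 * Y z + (\<bar>C\<bar> * dist (Xh z) x0) * (?s * \<bar>?g\<bar>)"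
    proof (intro add_mono mult_right_mono)
      show "?s * \<bar>?H\<bar> \<le> dist (Xh z) x0 * Y z" using elim(1) by (simp add: mult.assoc)
      show "\<bar>\<phi> (Xh z)\<bar> \<le> \<bar>C\<bar> * dist (Xh z) x0" using abs_le_abs_mult[OF elim(2)] by simp
      show "0 \<le> ?s * \<bar>?g\<bar>" using s0 by (rule mult_nonneg_nonneg) simp
    qed
    also have "?s * \<bar>?g\<bar> = \<bar>?G z\<bar>" using s0 b(2)[of "fst z"] by (simp add: abs_mult mult.assoc)
    finally show ?case by (simp add: algebra_simps)
  qed
  ultimately show ?case by (intro exI[of _ "\<lambda>z. Y z + \<bar>C\<bar> * \<bar>?G z\<bar>"]) auto
qed

text \<open>The remainder can only be estimated against the average of \<open>|n i|\<close>. One of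
  its three powers of the distance makes \<open>Y2\<close> tend to zero; the other two stay visible,
  to be compared later with a quadratic lower bound.\<close>

lemma taylor2_noise:
  assumes f: "taylor2 x0 f" and n: "noise n" and b: "b \<longlonglongrightarrow> (0::real)" "\<And>m. b m \<ge> 0"
    and Xh: "(Xh \<longlongrightarrow> x0) (in_prob M)"
  shows "\<exists>Y1 Y2. (Y1 \<longlongrightarrow> 0) (in_prob M) \<and> (Y2 \<longlongrightarrow> 0) (in_prob M) \<and> (\<forall>\<^sub>F z in in_prob M.
    b (fst z) * (sqrt (real (fst z)) * \<bar>mean_upto (fst z) (\<lambda>i. (f i (Xh z) - f i x0) * n i (snd z))\<bar>)
      \<le> dist (Xh z) x0 * (Y1 z + b (fst z) * (sqrt (real (fst z)) * dist (Xh z) x0) * Y2 z))"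
proof -
  from f obtain h C where h: "separable x0 h" "C \<ge> 0"
    "\<forall>\<^sub>F x in nhds x0. \<forall>i\<ge>1. \<bar>f i x - f i x0 - h i x\<bar> \<le> C * dist x x0 ^ 3"
    by (rule taylor2_expansion) (rule that; assumption)
  from separable_noise[OF h(1) n b Xh] obtain Y where Y: "(Y \<longlongrightarrow> 0) (in_prob M)"
    "\<forall>\<^sub>F z in in_prob M. b (fst z) * (sqrt (real (fst z)) * \<bar>mean_upto (fst z) (\<lambda>i. h i (Xh z) * n i (snd z))\<bar>) \<le> dist (Xh z) x0 * Y z"
    by blast
  let ?N = "\<lambda>z. mean_upto (fst z) (\<lambda>i. \<bar>n i (snd z)\<bar>)"
  define Y2 where "Y2 z = C * dist (Xh z) x0 * ?N z" for z
  have "((\<lambda>z. C * dist (Xh z) x0) \<longlongrightarrow> C * dist x0 x0) (in_prob M)" by (intro tendsto_intros Xh)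
  then have Y2: "(Y2 \<longlongrightarrow> 0) (in_prob M)" unfolding Y2_def by (intro mean_abs_noise_mult[OF n]) simp
  have "\<forall>\<^sub>F z in in_prob M. \<forall>i\<ge>1. \<bar>f i (Xh z) - f i x0 - h i (Xh z)\<bar> \<le> C * dist (Xh z) x0 ^ 3"
    using Xh h(3) by (auto simp: filterlim_iff)
  with Y(2) have "\<forall>\<^sub>F z in in_prob M.
    b (fst z) * (sqrt (real (fst z)) * \<bar>mean_upto (fst z) (\<lambda>i. (f i (Xh z) - f i x0) * n i (snd z))\<bar>)
      \<le> dist (Xh z) x0 * (Y z + b (fst z) * (sqrt (real (fst z)) * dist (Xh z) x0) * Y2 z)"
  proof eventually_elim
    case (elim z)
    let ?s = "b (fst z) * sqrt (real (fst z))" and ?D = "dist (Xh z) x0"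
    have s0: "?s \<ge> 0" using b(2) by simp
    let ?H = "mean_upto (fst z) (\<lambda>i. h i (Xh z) * n i (snd z))"
    let ?r = "mean_upto (fst z) (\<lambda>i. (f i (Xh z) - f i x0 - h i (Xh z)) * n i (snd z))"
    have "\<bar>?r\<bar> \<le> mean_upto (fst z) (\<lambda>i. \<bar>(f i (Xh z) - f i x0 - h i (Xh z)) * n i (snd z)\<bar>)"
      using norm_mean_upto_le[of "fst z" "\<lambda>i. (f i (Xh z) - f i x0 - h i (Xh z)) * n i (snd z)"] by simp
    also have "\<dots> \<le> mean_upto (fst z) (\<lambda>i. (C * ?D ^ 3) * \<bar>n i (snd z)\<bar>)"
      using elim(2) by (intro mean_upto_mono) (auto simp: abs_mult intro!: mult_right_mono)
    also have "\<dots> = C * ?D ^ 3 * ?N z" by (rule mean_upto_scale)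
    finally have r: "\<bar>?r\<bar> \<le> C * ?D ^ 3 * ?N z" .
    have "mean_upto (fst z) (\<lambda>i. (f i (Xh z) - f i x0) * n i (snd z)) = ?H + ?r"
      unfolding mean_upto_add[symmetric] by (simp add: algebra_simps)
    then have "?s * \<bar>mean_upto (fst z) (\<lambda>i. (f i (Xh z) - f i x0) * n i (snd z))\<bar> \<le> ?s * (\<bar>?H\<bar> + \<bar>?r\<bar>)"
      using s0 by (intro mult_left_mono) (auto simp: abs_triangle_ineq)
    also have "\<dots> \<le> ?D * Y z + ?s * (C * ?D ^ 3 * ?N z)"
      unfolding distrib_left using elim(1) s0 r by (intro add_mono mult_left_mono) (auto simp: mult.assoc)
    also have "\<dots> = ?D * (Y z + b (fst z) * (sqrt (real (fst z)) * ?D) * Y2 z)"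
      by (simp add: Y2_def power3_eq_cube algebra_simps)
    finally show ?case by (simp add: mult.assoc)
  qed
  with Y(1) Y2 show ?thesis by blast
qed

section \<open>The entries of the summands as noise\<close>

lemma noise_linear:
  assumes h: "\<And>i. i \<ge> 1 \<Longrightarrow> (h i)\<^sup>2 \<le> C * psi i"
  shows "noise (\<lambda>i w. h i * ctil i w $ q)"
  unfolding noise_def
proof (intro conjI allI impI exI[of _ "\<bar>C\<bar>"])
  fix i :: nat assume i: "i \<ge> 1"
  show "\<exists>G\<in>borel_measurable borel. (\<lambda>w. h i * ctil i w $ q) = (\<lambda>w. G (ctil i w))"
    by (intro bexI[of _ "\<lambda>x. h i * x $ q"]) auto
  show "expectation (\<lambda>w. h i * ctil i w $ q) = 0" using mean0[OF i] by simp
  fix w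
  have "(ctil i w $ q)\<^sup>2 \<le> (norm (ctil i w))\<^sup>2" using component_le_norm_cart[of "ctil i w" q]
    by (metis abs_ge_zero power2_abs power_mono)
  also have "\<dots> \<le> err4 i w"
  proof -
    have "0 \<le> ((norm (ctil i w))\<^sup>2 - 1)\<^sup>2 + (norm (ctil i w))\<^sup>2" by simp
    then show ?thesis by (simp add: err4_def power2_eq_square power4_eq_xxxx algebra_simps)
  qed
  finally have 1: "(ctil i w $ q)\<^sup>2 \<le> err4 i w" .
  have "(h i)\<^sup>2 \<le> \<bar>C\<bar> * psi i" using h[OF i] abs_le_abs_mult psi_ge1[of i] by fastforce
  then have "(h i)\<^sup>2 * (ctil i w $ q)\<^sup>2 \<le> (\<bar>C\<bar> * psi i) * err4 i w"
    using 1 psi_ge1[of i] by (intro mult_mono) auto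
  then show "(h i * ctil i w $ q)\<^sup>2 \<le> \<bar>C\<bar> * (psi i * err4 i w)" by (simp add: power_mult_distrib mult.assoc)
qed simp

lemma noise_W1: "noise (\<lambda>i w. a0 i $ p * ctil i w $ q)"
proof (rule noise_linear[where C=1])
  show "(a0 i $ p)\<^sup>2 \<le> 1 * psi i" for i
    using power_mono[OF component_le_norm_cart[of "a0 i" p], of 2] by (simp add: psi_def)
qed

lemma noise_W2: "noise (\<lambda>i w. ctil i w $ p * ctil i w $ q - \<sigma>\<^sup>2 * S i $ p $ q)"
proof -
  obtain B where B: "\<And>i p q. \<bar>S i $ p $ q\<bar> \<le> B" by (rule S_bound) (rule that; assumption)
  let ?K = "2 + 2 * (\<sigma>\<^sup>2 * B)\<^sup>2"
  show ?thesis
  unfolding noise_def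
  proof (intro conjI allI impI exI[of _ ?K])
    fix i :: nat assume i: "i \<ge> 1"
    note [measurable] = ctil_measurable[OF i]
    show "\<exists>G\<in>borel_measurable borel. (\<lambda>w. ctil i w $ p * ctil i w $ q - \<sigma>\<^sup>2 * S i $ p $ q) = (\<lambda>w. G (ctil i w))"
      by (intro bexI[of _ "\<lambda>x. x $ p * x $ q - \<sigma>\<^sup>2 * S i $ p $ q"]) auto
    have pb: "\<bar>ctil i w $ p * ctil i w $ q\<bar> \<le> norm (ctil i w) * norm (ctil i w)" for w
      unfolding abs_mult by (intro mult_mono component_le_norm_cart) auto
    have sq: "(ctil i w $ p * ctil i w $ q)\<^sup>2 \<le> err4 i w" for w
    proof -
      have "(ctil i w $ p * ctil i w $ q)\<^sup>2 \<le> (norm (ctil i w) * norm (ctil i w))\<^sup>2"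
        using pb[of w] by (metis abs_ge_zero power2_abs power_mono)
      also have "\<dots> \<le> err4 i w" by (simp add: err4_def power2_eq_square power4_eq_xxxx mult.assoc)
      finally show ?thesis .
    qed
    have "integrable M (\<lambda>w. ctil i w $ p * ctil i w $ q)"
    proof (rule square_integrable_imp_integrable)
      show "integrable M (\<lambda>w. (ctil i w $ p * ctil i w $ q)\<^sup>2)"
        by (rule Bochner_Integration.integrable_bound[OF err4_integrable[OF i]])
          (use sq err4_ge1[of i] in \<open>auto simp: abs_of_nonneg order_trans[OF zero_le_one]
            intro!: borel_measurable_power borel_measurable_times ctil_nth_measurable i\<close>)
    qed (intro borel_measurable_times ctil_nth_measurable i)
    then show "expectation (\<lambda>w. ctil i w $ p * ctil i w $ q - \<sigma>\<^sup>2 * S i $ p $ q) = 0"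
      using second[OF i] by (simp add: prob_space)
    fix w
    let ?x = "ctil i w $ p * ctil i w $ q" and ?y = "\<sigma>\<^sup>2 * S i $ p $ q"
    have "0 \<le> (?x + ?y)\<^sup>2" by simp
    then have "(?x - ?y)\<^sup>2 \<le> 2 * ?x\<^sup>2 + 2 * ?y\<^sup>2" unfolding power2_sum power2_diff by linarith
    also have "\<dots> \<le> 2 * err4 i w + 2 * (\<sigma>\<^sup>2 * B)\<^sup>2"
    proof -
      have "\<bar>?y\<bar> \<le> \<sigma>\<^sup>2 * B" using B[of i p q] by (simp add: abs_mult mult_left_mono)
      then have "?y\<^sup>2 \<le> (\<sigma>\<^sup>2 * B)\<^sup>2" by (metis abs_ge_zero power2_abs power_mono)
      then show ?thesis using sq[of w] by linarith
    qed
    also have "\<dots> \<le> ?K * err4 i w"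
    proof -
      have "(\<sigma>\<^sup>2 * B)\<^sup>2 * 1 \<le> (\<sigma>\<^sup>2 * B)\<^sup>2 * err4 i w" using err4_ge1[of i w] by (intro mult_left_mono) auto
      then show ?thesis by (simp add: distrib_right)
    qed
    also have "\<dots> \<le> ?K * (psi i * err4 i w)"
    proof -
      have "1 * err4 i w \<le> psi i * err4 i w" using psi_ge1[of i] err4_ge1[of i w] by (intro mult_right_mono) auto
      then show ?thesis by (intro mult_left_mono) auto
    qed
    finally show "(?x - ?y)\<^sup>2 \<le> ?K * (psi i * err4 i w)" .
  qed simp
qed

end

section \<open>Consistency\<close>

lemma mean_upto_sum: "mean_upto m (\<lambda>i. \<Sum>k\<in>K. f k i) = (\<Sum>k\<in>K. mean_upto m (f k))"
proof -
  have "(\<Sum>i=1..m. \<Sum>k\<in>K. f k i) = (\<Sum>k\<in>K. \<Sum>i=1..m. f k i)" by (rule sum.swap)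
  then show ?thesis by (simp add: mean_upto_def scaleR_sum_right)
qed

text \<open>Separates the vectors \<open>x\<close> and \<open>y\<close>, which will depend on the
  competing parameter, from averages that do not. Convergence of finitely many averages then serves
  all parameters at once.\<close>

lemma mean_bilinear:
  fixes x :: "real^'a" and y :: "real^'b"
  shows "mean_upto m (\<lambda>i. g i * ((x \<bullet> u i) * (y \<bullet> v i)))
    = (\<Sum>p\<in>UNIV. \<Sum>q\<in>UNIV. x $ p * y $ q * mean_upto m (\<lambda>i. g i * (u i $ p * v i $ q)))"
proof -
  have "g i * ((x \<bullet> u i) * (y \<bullet> v i)) = (\<Sum>p\<in>UNIV. \<Sum>q\<in>UNIV. (x $ p * y $ q) * (g i * (u i $ p * v i $ q)))" for i
  proof -
    have "(x \<bullet> u i) * (y \<bullet> v i) = (\<Sum>p\<in>UNIV. \<Sum>q\<in>UNIV. (x $ p * u i $ p) * (y $ q * v i $ q))"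
      unfolding inner_vec_def inner_real_def by (rule sum_product)
    then show ?thesis by (simp add: sum_distrib_left mult_ac)
  qed
  then show ?thesis by (simp only: mean_upto_sum mean_upto_scale)
qed

lemma bilinear_bound:
  fixes x :: "real^'a" and y :: "real^'b"
  shows "\<bar>\<Sum>p\<in>UNIV. \<Sum>q\<in>UNIV. x $ p * y $ q * D p q\<bar> \<le> norm x * norm y * (\<Sum>p\<in>UNIV. \<Sum>q\<in>UNIV. \<bar>D p q\<bar>)"
proof -
  have "\<bar>\<Sum>p\<in>UNIV. \<Sum>q\<in>UNIV. x $ p * y $ q * D p q\<bar> \<le> (\<Sum>p\<in>UNIV. \<Sum>q\<in>UNIV. \<bar>x $ p * y $ q * D p q\<bar>)"
    by (intro order_trans[OF sum_abs] sum_mono sum_abs)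
  also have "\<dots> \<le> (\<Sum>p\<in>UNIV. \<Sum>q\<in>UNIV. norm x * norm y * \<bar>D p q\<bar>)"
    unfolding abs_mult by (intro sum_mono mult_right_mono mult_mono component_le_norm_cart) auto
  finally show ?thesis by (simp add: sum_distrib_left)
qed

lemma stack_sel [simp]: "upper (stack a b) = a" "lower (stack a b) = b"
  by (simp_all add: upper_def lower_def stack_def vec_eq_iff)

context eiv
begin

definition c0 :: "nat \<Rightarrow> real^('n + 'd)" where "c0 i = stack (a0 i) (transpose X0 *v a0 i)"

definition cobs :: "nat \<Rightarrow> 'w \<Rightarrow> real^('n + 'd)" where "cobs i w = c0 i + ctil i w"

text \<open>The true rows satisfy the model with \<open>X0\<close>, hence their residual at
  \<open>X\<close> is linear in \<open>X - X0\<close>.\<close>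

lemma Zmat_c0: "transpose (Zmat X) *v c0 i = transpose (X - X0) *v a0 i"
proof -
  have "transpose (X - X0) = transpose X - transpose X0" by (simp add: transpose_def vec_eq_iff)
  then show ?thesis by (simp add: transpose_Zmat_vec c0_def matrix_vector_mult_diff_rdistrib)
qed

lemma Zmat_cobs: "transpose (Zmat X) *v cobs i w = transpose (X - X0) *v a0 i + transpose (Zmat X) *v ctil i w"
  by (simp add: cobs_def matrix_vector_right_distrib Zmat_c0)

text \<open>Weights tending to 1 leave the limit unchanged, because the products of entries are
  dominated by \<open>psi\<close>, whose means are bounded.\<close>

lemma weighted_design_lim:
  assumes g: "g \<longlonglongrightarrow> 1"
  shows "(\<lambda>m. mean_upto m (\<lambda>i. g i * (a0 i $ p * a0 i $ q))) \<longlonglongrightarrow> V $ p $ q"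
proof -
  obtain C where C: "C \<ge> 0" "\<And>m. mean_upto m psi \<le> C" by (rule psi_bound) (rule that; assumption)
  have "(\<lambda>i. g i - 1) \<longlonglongrightarrow> 1 - 1" by (intro tendsto_intros g)
  then have lim: "(\<lambda>m. mean_upto m (\<lambda>i. \<bar>g i - 1\<bar> * psi i)) \<longlonglongrightarrow> 0"
    using psi_ge1 C(2) by (intro mean_upto_null_weights) (auto intro: order_trans[OF zero_le_one])
  have bd: "norm (mean_upto m (\<lambda>i. (g i - 1) * (a0 i $ p * a0 i $ q))) \<le> mean_upto m (\<lambda>i. \<bar>g i - 1\<bar> * psi i)" for m
  proof -
    have pq: "\<bar>a0 i $ p * a0 i $ q\<bar> \<le> psi i" for i
    proof -
      have "\<bar>a0 i $ p * a0 i $ q\<bar> \<le> norm (a0 i) * norm (a0 i)"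
        unfolding abs_mult by (intro mult_mono component_le_norm_cart) auto
      then show ?thesis by (simp add: psi_def power2_eq_square)
    qed
    have "norm (mean_upto m (\<lambda>i. (g i - 1) * (a0 i $ p * a0 i $ q))) \<le> mean_upto m (\<lambda>i. norm ((g i - 1) * (a0 i $ p * a0 i $ q)))"
      by (rule norm_mean_upto_le)
    also have "\<dots> \<le> mean_upto m (\<lambda>i. \<bar>g i - 1\<bar> * psi i)"
      unfolding real_norm_def abs_mult[of "g _ - 1"] by (intro mean_upto_mono mult_left_mono pq) auto
    finally show "norm (mean_upto m (\<lambda>i. (g i - 1) * (a0 i $ p * a0 i $ q))) \<le> mean_upto m (\<lambda>i. \<bar>g i - 1\<bar> * psi i)" .
  qed
  from tendsto_add[OF V_lim_nth[of p q] Lim_null_comparison[OF always_eventually[OF allI[OF bd]] lim]] show ?thesis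
    unfolding mean_upto_add[symmetric] by (simp add: algebra_simps)
qed

lemma V_form: "(\<lambda>m. mean_upto m (\<lambda>i. (x \<bullet> a0 i) * (y \<bullet> a0 i))) \<longlonglongrightarrow> x \<bullet> (V *v y)"
proof -
  have "(\<lambda>m. \<Sum>p\<in>UNIV. \<Sum>q\<in>UNIV. x $ p * y $ q * mean_upto m (\<lambda>i. 1 * (a0 i $ p * a0 i $ q)))
      \<longlonglongrightarrow> (\<Sum>p\<in>UNIV. \<Sum>q\<in>UNIV. x $ p * y $ q * V $ p $ q)"
    by (intro tendsto_sum tendsto_mult tendsto_const weighted_design_lim)
  then show ?thesis unfolding mean_bilinear[symmetric] inner_matrix_sum by (simp add: mult_ac)
qed

lemma V_sym: "transpose V = V"
proof -
  have "V $ p $ q = V $ q $ p" for p q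
    by (rule LIMSEQ_unique[OF V_lim_nth[of p q]]) (use V_lim_nth[of q p] in \<open>simp add: mult.commute\<close>)
  then show ?thesis by (simp add: transpose_def vec_eq_iff)
qed

text \<open>\<open>V\<close> is a limit of averages of Gram matrices, so its smallest eigenvalue is
  nonnegative; invertibility makes it positive.\<close>

lemma V_pos: obtains \<alpha> where "\<alpha> > 0" "\<And>x. \<alpha> * (norm x)\<^sup>2 \<le> x \<bullet> (V *v x)"
proof -
  have U: "(UNIV :: (real^'n) set) \<noteq> {0}"
    by (metis UNIV_I axis_eq_0_iff singletonD zero_neq_one)
  obtain v \<alpha> where v: "norm v = 1" "V *v v = \<alpha> *\<^sub>R v" and low: "\<And>x. x \<in> UNIV \<Longrightarrow> \<alpha> * (norm x)\<^sup>2 \<le> x \<bullet> (V *v x)"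
    by (rule symmetric_eigenvector_in_subspace[OF V_sym subspace_UNIV U UNIV_I]) (rule that; assumption)
  have "0 \<le> v \<bullet> (V *v v)"
    by (rule LIMSEQ_le_const[OF V_form]) (auto intro!: exI[of _ 0] mean_upto_nonneg)
  then have "\<alpha> \<ge> 0" using v by (simp add: dot_square_norm)
  moreover have "\<alpha> \<noteq> 0"
  proof
    assume "\<alpha> = 0"
    then have "matrix_inv V *v (V *v v) = 0" using v by simp
    then show False using v(1) by (simp add: matrix_vector_mul_assoc matrix_inv_left[OF V_inv])
  qed
  ultimately show ?thesis using that[of \<alpha>] low by simp
qed

lemma weighted_noise_avg:
  assumes "noise n" "g \<longlonglongrightarrow> (L::real)"
  shows "((\<lambda>z. mean_upto (fst z) (\<lambda>i. g i * n i (snd z))) \<longlongrightarrow> 0) (in_prob M)"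
proof -
  have "Bseq g" using assms(2) by (intro convergent_imp_Bseq convergentI)
  then obtain B where "\<And>i. norm (g i) \<le> B" by (rule BseqE) blast
  then show ?thesis by (intro noise_avg noise_weight[OF assms(1)]) auto
qed

lemma weighted_error_lim:
  assumes g: "g \<longlonglongrightarrow> 1"
  shows "((\<lambda>z. mean_upto (fst z) (\<lambda>i. g i * (ctil i (snd z) $ p * ctil i (snd z) $ q))) \<longlongrightarrow> \<sigma>\<^sup>2 * Sinf $ p $ q) (in_prob M)"
proof -
  have "(\<lambda>m. mean_upto m (\<lambda>i. g i * (\<sigma>\<^sup>2 * S i $ p $ q))) \<longlonglongrightarrow> 1 * (\<sigma>\<^sup>2 * Sinf $ p $ q)"
    by (intro mean_upto_tendsto tendsto_intros g S_lim)
  from tendsto_add[OF weighted_noise_avg[OF noise_W2[of p q] g] tendsto_in_prob_deterministic[OF this]]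
  show ?thesis unfolding mean_upto_add[symmetric] by (simp add: algebra_simps)
qed

text \<open>Division by \<open>\<kappa>\<close> turns the deviation of \<open>\<Sigma> i\<close>
  from its limit into a relative one. The comparison of forms that results holds with one factor for
  every vector, however small the form is there.\<close>

definition eps :: "nat \<Rightarrow> real" where
  "eps i = (\<Sum>k\<in>UNIV. \<Sum>l\<in>UNIV. \<bar>\<Sigma> i $ k $ l - \<Sigma>inf $ k $ l\<bar>) / \<kappa>"

lemma eps_lim: "eps \<longlonglongrightarrow> 0"
proof -
  have "eps \<longlonglongrightarrow> (\<Sum>k\<in>UNIV. \<Sum>l\<in>UNIV. \<bar>\<Sigma>inf $ k $ l - \<Sigma>inf $ k $ l\<bar>) / \<kappa>"
    unfolding eps_def[abs_def] using \<kappa> by (intro tendsto_intros \<Sigma>_lim) auto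
  then show ?thesis by simp
qed

lemma S_le_Sinf:
  assumes "i \<ge> 1"
  shows "x \<bullet> (S i *v x) \<le> (1 + eps i) * (x \<bullet> (Sinf *v x))"
proof -
  let ?x = "subrows \<iota> x"
  let ?D = "\<lambda>k l. \<Sigma> i $ k $ l - \<Sigma>inf $ k $ l"
  have "?x \<bullet> (\<Sigma> i *v ?x) - ?x \<bullet> (\<Sigma>inf *v ?x) = (\<Sum>k\<in>UNIV. \<Sum>l\<in>UNIV. ?x $ k * ?x $ l * ?D k l)"
    unfolding inner_matrix_sum sum_subtractf[symmetric] by (simp add: algebra_simps)
  also have "\<dots> \<le> norm ?x * norm ?x * (\<Sum>k\<in>UNIV. \<Sum>l\<in>UNIV. \<bar>?D k l\<bar>)"
    using bilinear_bound[of ?x ?x ?D] by (rule abs_le_D1)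
  also have "\<dots> = eps i * (\<kappa> * (norm ?x)\<^sup>2)" using \<kappa> by (simp add: eps_def power2_eq_square)
  also have "\<dots> \<le> eps i * (?x \<bullet> (\<Sigma>inf *v ?x))"
    using \<kappa> by (intro mult_left_mono \<Sigma>inf_low) (auto simp: eps_def intro!: divide_nonneg_pos sum_nonneg)
  finally show ?thesis
    unfolding padded_form[OF inj pad[OF assms]] padded_form[OF inj padded_inf] by (simp add: algebra_simps)
qed

text \<open>The multiplier \<open>k\<close>, optimal for the limit matrix, is inserted into the
  lower bound for \<open>S i\<close>. The loss is a factor \<open>1 - eps i\<close>; in return the
  bound uses the same basis and the same eigenvalues for every \<open>i\<close>, and averaging over
  \<open>i\<close> only meets squares of linear forms.\<close>

lemma qform_lower:
  assumes i: "i \<ge> 1" and X: "full X"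
    and B: "finite B" "pairwise orthogonal B" "span B = UNIV" "\<And>v. v \<in> B \<Longrightarrow> norm v = 1"
    and l: "\<And>v. v \<in> B \<Longrightarrow> Mmat Sinf X *v v = l v *\<^sub>R v" "\<And>v. v \<in> B \<Longrightarrow> l v > 0"
  shows "(1 - eps i) * (\<Sum>v\<in>B. (v \<bullet> (transpose (Zmat X) *v c))\<^sup>2 / l v) \<le> qform (S i) X c"
proof -
  define y where "y = transpose (Zmat X) *v c"
  define k where "k = (\<Sum>v\<in>B. ((v \<bullet> y) / l v) *\<^sub>R v)"
  define q where "q = (\<Sum>v\<in>B. (v \<bullet> y)\<^sup>2 / l v)"
  have ky: "k \<bullet> y = q"
    by (simp add: k_def q_def inner_sum_left power2_eq_square)
  have "Mmat Sinf X *v k = (\<Sum>v\<in>B. Mmat Sinf X *v (((v \<bullet> y) / l v) *\<^sub>R v))"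
    unfolding k_def by (rule linear_sum[OF matrix_vector_mul_linear])
  also have "\<dots> = (\<Sum>v\<in>B. (v \<bullet> y) *\<^sub>R v)"
    using l by (intro sum.cong refl) (simp add: matrix_vector_mult_scaleR less_imp_neq[symmetric])
  also have "\<dots> = y" by (rule orthonormal_expansion[OF B])
  finally have kq: "k \<bullet> (Mmat Sinf X *v k) = q" by (simp add: ky)
  have "k \<bullet> (Mmat (S i) X *v k) \<le> (1 + eps i) * (k \<bullet> (Mmat Sinf X *v k))"
    unfolding Mmat_form by (rule S_le_Sinf[OF i])
  moreover have "2 * (k \<bullet> y) - k \<bullet> (Mmat (S i) X *v k) \<le> qform (S i) X c"
    unfolding y_def by (rule qform_ge[OF S_sym[OF i]]) (rule Mmat_pos[OF i X])
  ultimately have "2 * q - (1 + eps i) * q \<le> qform (S i) X c" unfolding kq ky by linarith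
  then show ?thesis by (simp add: q_def y_def algebra_simps)
qed

definition Qmean :: "nat \<Rightarrow> real^'d^'n \<Rightarrow> 'w \<Rightarrow> real" where
  "Qmean m X w = mean_upto m (\<lambda>i. qform (S i) X (cobs i w))"

lemma qform_split:
  assumes i: "i \<ge> 1" and X: "full X"
  shows "qform (S i) X c = (\<Sum>p\<in>UNIV. \<Sum>q\<in>UNIV. Hmat (S i) X $ p $ q * (c $ p * c $ q - \<sigma>\<^sup>2 * S i $ p $ q)) + \<sigma>\<^sup>2 * real CARD('d)"
proof -
  have "qform (S i) X c = (\<Sum>p\<in>UNIV. \<Sum>q\<in>UNIV. Hmat (S i) X $ p $ q * (c $ p * c $ q - \<sigma>\<^sup>2 * S i $ p $ q)
      + \<sigma>\<^sup>2 * (Hmat (S i) X $ p $ q * S i $ p $ q))"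
    unfolding qform_Hmat by (simp add: algebra_simps)
  then show ?thesis
    using trace_Hmat[OF S_sym[OF i] Mmat_invertible[OF i X]]
    by (simp add: sum.distrib sum_distrib_left[symmetric])
qed

lemma Hmat_bound: obtains B where "\<And>i p q. i \<ge> 1 \<Longrightarrow> \<bar>Hmat (S i) X0 $ p $ q\<bar> \<le> B"
proof -
  have "\<exists>B. \<forall>i\<ge>1. \<bar>Hmat (S i) X0 $ p $ q\<bar> \<le> B" for p q
    using taylor2_Hmat[of p q] unfolding taylor2_def by blast
  then have "\<forall>p. \<forall>q. \<exists>B. \<forall>i\<ge>1. \<bar>Hmat (S i) X0 $ p $ q\<bar> \<le> B" by blast
  then obtain B where B: "\<And>p q i. i \<ge> 1 \<Longrightarrow> \<bar>Hmat (S i) X0 $ p $ q\<bar> \<le> B p q"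
    unfolding choice_iff by blast
  have "\<bar>Hmat (S i) X0 $ p $ q\<bar> \<le> (\<Sum>p\<in>UNIV. \<Sum>q\<in>UNIV. \<bar>B p q\<bar>)" if "i \<ge> 1" for i p q
  proof -
    have "\<bar>Hmat (S i) X0 $ p $ q\<bar> \<le> \<bar>B p q\<bar>" using B[OF that, of p q] by (rule order_trans[OF _ abs_ge_self])
    also have "\<dots> \<le> (\<Sum>q\<in>UNIV. \<bar>B p q\<bar>)" by (rule member_le_sum) auto
    also have "\<dots> \<le> (\<Sum>p\<in>UNIV. \<Sum>q\<in>UNIV. \<bar>B p q\<bar>)" by (rule member_le_sum) (auto intro: sum_nonneg)
    finally show ?thesis .
  qed
  then show ?thesis by (rule that)
qed

text \<open>At the true parameter the residual has no design part, and the trace identity leaves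
  \<open>\<sigma>^2 d\<close> plus noise with bounded weights.\<close>

lemma Qmean_true_lim: "((\<lambda>z. Qmean (fst z) X0 (snd z)) \<longlongrightarrow> \<sigma>\<^sup>2 * real CARD('d)) (in_prob M)"
proof -
  obtain B where B: "\<And>i p q. i \<ge> 1 \<Longrightarrow> \<bar>Hmat (S i) X0 $ p $ q\<bar> \<le> B" by (rule Hmat_bound) (rule that; assumption)
  have "((\<lambda>z. (\<Sum>p\<in>UNIV. \<Sum>q\<in>UNIV. mean_upto (fst z) (\<lambda>i. Hmat (S i) X0 $ p $ q * (ctil i (snd z) $ p * ctil i (snd z) $ q - \<sigma>\<^sup>2 * S i $ p $ q)))
      + \<sigma>\<^sup>2 * real CARD('d)) \<longlongrightarrow> (\<Sum>p\<in>(UNIV::('n + 'd) set). \<Sum>q\<in>(UNIV::('n + 'd) set). 0) + \<sigma>\<^sup>2 * real CARD('d)) (in_prob M)"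
    by (intro tendsto_add tendsto_sum noise_avg noise_weight[OF noise_W2 B] tendsto_const)
  then show ?thesis
    unfolding sum.neutral_const add_0
  proof (rule Lim_transform_eventually)
    show "\<forall>\<^sub>F z in in_prob M. (\<Sum>p\<in>UNIV. \<Sum>q\<in>UNIV. mean_upto (fst z) (\<lambda>i. Hmat (S i) X0 $ p $ q * (ctil i (snd z) $ p * ctil i (snd z) $ q - \<sigma>\<^sup>2 * S i $ p $ q)))
      + \<sigma>\<^sup>2 * real CARD('d) = Qmean (fst z) X0 (snd z)"
      using eventually_in_prob_deterministic[OF eventually_ge_at_top[of 1]]
    proof eventually_elim
      case (elim z)
      have "qform (S i) X0 (cobs i (snd z)) = (\<Sum>p\<in>UNIV. \<Sum>q\<in>UNIV. Hmat (S i) X0 $ p $ q *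
          (ctil i (snd z) $ p * ctil i (snd z) $ q - \<sigma>\<^sup>2 * S i $ p $ q)) + \<sigma>\<^sup>2 * real CARD('d)" if "i \<ge> 1" for i
      proof -
        have "transpose (X0 - X0) *v a0 i = 0" by (simp add: transpose_def matrix_vector_mult_def vec_eq_iff)
        then show ?thesis unfolding qform_split[OF that full0, symmetric] qform_def Zmat_cobs by simp
      qed
      then have "Qmean (fst z) X0 (snd z) = mean_upto (fst z) (\<lambda>i. (\<Sum>p\<in>UNIV. \<Sum>q\<in>UNIV. Hmat (S i) X0 $ p $ q *
          (ctil i (snd z) $ p * ctil i (snd z) $ q - \<sigma>\<^sup>2 * S i $ p $ q)) + \<sigma>\<^sup>2 * real CARD('d))"
        unfolding Qmean_def by (intro mean_upto_cong) auto
      then show ?case using elim by (simp add: mean_upto_add mean_upto_sum mean_upto_const)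
    qed
  qed
qed

text \<open>Countably many null sets are discarded at once, so that inner products with the error
  vectors can be computed on the selected coordinates for all \<open>i\<close>
  simultaneously.\<close>

lemma eventually_supported: "\<forall>\<^sub>F z in in_prob M. \<forall>i\<ge>1. \<forall>p. p \<notin> range \<iota> \<longrightarrow> ctil i (snd z) $ p = 0"
proof (rule eventually_in_prob_AE)
  have "AE w in M. p \<notin> range \<iota> \<longrightarrow> ctil (Suc i) w $ p = 0" for i p
    using outside[of "Suc i" p] by (cases "p \<in> range \<iota>") auto
  then have "AE w in M. \<forall>i. \<forall>p. p \<notin> range \<iota> \<longrightarrow> ctil (Suc i) w $ p = 0"
    by (simp add: AE_all_countable)
  then show "AE w in M. \<forall>i\<ge>1. \<forall>p. p \<notin> range \<iota> \<longrightarrow> ctil i w $ p = 0"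
    by eventually_elim (metis One_nat_def Suc_le_D)
qed

text \<open>Expanding each standard basis vector in \<open>B\<close> bounds a column by
  \<open>d s\<close>, and the norm is at most the sum of the column norms. The crude factor is
  harmless because \<open>d\<close> is fixed.\<close>

lemma norm_matrix_le_basis:
  fixes A :: "real^'d^'n"
  assumes B: "finite B" "card B = CARD('d)" "pairwise orthogonal B" "span B = UNIV" "\<And>v. v \<in> B \<Longrightarrow> norm v = 1"
    and s: "\<And>v. v \<in> B \<Longrightarrow> norm (A *v v) \<le> s" and s0: "s \<ge> 0"
  shows "norm A \<le> real CARD('d) * (real CARD('d) * s)"
proof -
  have col: "norm (A *v axis k 1) \<le> real CARD('d) * s" for k
  proof -
    have "A *v axis k 1 = A *v (\<Sum>v\<in>B. (v \<bullet> axis k 1) *\<^sub>R v)"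
      by (simp only: orthonormal_expansion[OF B(1,3,4,5)])
    also have "\<dots> = (\<Sum>v\<in>B. A *v ((v \<bullet> axis k 1) *\<^sub>R v))" by (rule linear_sum[OF matrix_vector_mul_linear])
    also have "norm \<dots> \<le> (\<Sum>v\<in>B. s)"
    proof (rule order_trans[OF norm_sum sum_mono])
      fix v assume v: "v \<in> B"
      have "\<bar>v \<bullet> axis k 1\<bar> \<le> 1"
        using Cauchy_Schwarz_ineq2[of v "axis k 1"] B(5)[OF v] by simp
      then have "\<bar>v \<bullet> axis k 1\<bar> * norm (A *v v) \<le> 1 * s" using s[OF v] by (intro mult_mono) auto
      then show "norm (A *v ((v \<bullet> axis k 1) *\<^sub>R v)) \<le> s" by (simp add: matrix_vector_mult_scaleR)
    qed
    finally show ?thesis using B(2) by simp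
  qed
  have "(norm A)\<^sup>2 \<le> (\<Sum>k\<in>(UNIV::'d set). norm (A *v axis k 1))\<^sup>2"
  proof -
    have "norm A = L2_set (\<lambda>k. norm (A *v axis k 1)) UNIV"
      unfolding L2_set_def norm_matrix_sq[symmetric] by simp
    also have "\<dots> \<le> (\<Sum>k\<in>(UNIV::'d set). norm (A *v axis k 1))" by (rule L2_set_le_sum) auto
    finally show ?thesis by (rule power_mono) simp
  qed
  then have "norm A \<le> (\<Sum>k\<in>(UNIV::'d set). norm (A *v axis k 1))"
    by (rule power2_le_imp_le) (auto intro: sum_nonneg)
  also have "\<dots> \<le> (\<Sum>k\<in>(UNIV::'d set). real CARD('d) * s)" by (intro sum_mono col)
  finally show ?thesis by simp
qed

text \<open>In an eigenbasis of the limit form each \<open>v\<close> contributes a design term of at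
  least \<open>\<alpha> |\<omega> v|^2\<close> and an error term \<open>\<sigma>^2 l v\<close>, up
  to small multiples of \<open>|\<omega> v|^2\<close> and \<open>l v\<close>. After division by
  \<open>l v\<close> the error terms add up to \<open>\<sigma>^2 d\<close>, the limit of the
  objective at \<open>X0\<close>, so the ratios \<open>|\<omega> v|^2 / l v\<close> must be small.
  As \<open>l v\<close> is at most \<open>L (z0 + |\<omega> v|)^2\<close>, this bounds
  \<open>\<omega> v\<close> itself, without any restriction on the size of \<open>X\<close>.\<close>

lemma consistency:
  assumes e: "e > 0"
  shows "\<forall>\<^sub>F z in in_prob M. \<forall>X. full X \<longrightarrow> Qmean (fst z) X (snd z) \<le> Qmean (fst z) X0 (snd z) \<longrightarrow> norm (X - X0) \<le> e"
proof -
  obtain \<alpha> where \<alpha>: "\<alpha> > 0" "\<And>x. \<alpha> * (norm x)\<^sup>2 \<le> x \<bullet> (V *v x)" by (rule V_pos) (rule that; assumption)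
  define g where "g i = 1 - eps i" for i
  have "g \<longlonglongrightarrow> 1 - 0" unfolding g_def by (intro tendsto_intros eps_lim)
  then have g: "g \<longlonglongrightarrow> 1" by simp
  define u where "u i w = subrows \<iota> (ctil i w)" for i w
  define EA where "EA z p q = mean_upto (fst z) (\<lambda>i. g i * (a0 i $ p * a0 i $ q)) - V $ p $ q" for z :: "nat \<times> 'w" and p q
  define EB where "EB z p k = mean_upto (fst z) (\<lambda>i. g i * (a0 i $ p * u i (snd z) $ k))" for z p k
  define EG where "EG z k l = mean_upto (fst z) (\<lambda>i. g i * (u i (snd z) $ k * u i (snd z) $ l)) - \<sigma>\<^sup>2 * \<Sigma>inf $ k $ l" for z k l
  \<comment> \<open>Total deviation of the averages from their limits; it does not involve
    \<open>X\<close>, which makes everything below uniform.\<close>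
  define \<eta> where "\<eta> z = (\<Sum>p\<in>UNIV. \<Sum>q\<in>UNIV. \<bar>EA z p q\<bar>) + (\<Sum>p\<in>UNIV. \<Sum>k\<in>UNIV. \<bar>EB z p k\<bar>) + (\<Sum>k\<in>UNIV. \<Sum>l\<in>UNIV. \<bar>EG z k l\<bar>)" for z
  have EA: "((\<lambda>z. EA z p q) \<longlongrightarrow> V $ p $ q - V $ p $ q) (in_prob M)" for p q
    unfolding EA_def by (intro tendsto_diff tendsto_const tendsto_in_prob_deterministic weighted_design_lim g)
  have EB: "((\<lambda>z. EB z p k) \<longlongrightarrow> 0) (in_prob M)" for p k
    unfolding EB_def u_def using weighted_noise_avg[OF noise_W1 g] by (simp add: subrows_def)
  have "((\<lambda>z. EG z k l) \<longlongrightarrow> \<sigma>\<^sup>2 * Sinf $ \<iota> k $ \<iota> l - \<sigma>\<^sup>2 * \<Sigma>inf $ k $ l) (in_prob M)" for k l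
    unfolding EG_def u_def subrows_def vec_lambda_beta by (intro tendsto_diff tendsto_const weighted_error_lim g)
  then have EG: "((\<lambda>z. EG z k l) \<longlongrightarrow> 0) (in_prob M)" for k l using padded_inf by (simp add: padded_def)
  have "(\<eta> \<longlongrightarrow> (\<Sum>p\<in>(UNIV::'n set). \<Sum>q\<in>(UNIV::'n set). \<bar>V $ p $ q - V $ p $ q\<bar>) + (\<Sum>p\<in>(UNIV::'n set). \<Sum>k\<in>(UNIV::'j set). \<bar>0\<bar>) + (\<Sum>k\<in>(UNIV::'j set). \<Sum>l\<in>(UNIV::'j set). \<bar>0\<bar>)) (in_prob M)"
    unfolding \<eta>_def by (intro tendsto_add tendsto_sum tendsto_rabs EA EB EG)
  then have \<eta>: "(\<eta> \<longlongrightarrow> 0) (in_prob M)" by simp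
  define d where "d = real CARD('d)"
  have d: "d > 0" by (simp add: d_def)
  define z0 where "z0 = norm (Zmat X0 :: real^'d^('n + 'd)) + 1"
  have z0: "norm (Zmat X0 *v v) \<le> z0" if "norm v = 1" for v
    using norm_matrix_vector_le[of "Zmat X0" v] that unfolding z0_def by simp
  have z0': "z0 > 0" unfolding z0_def by (rule add_nonneg_pos) auto
  define L where "L = norm \<Sigma>inf + 1"
  have L: "L > 0" "x \<bullet> (\<Sigma>inf *v x) \<le> L * (norm x)\<^sup>2" for x
  proof -
    show "L > 0" unfolding L_def by (rule add_nonneg_pos) auto
    have "x \<bullet> (\<Sigma>inf *v x) \<le> norm x * norm (\<Sigma>inf *v x)" by (rule norm_cauchy_schwarz)
    also have "\<dots> \<le> norm x * (norm \<Sigma>inf * norm x)" by (intro mult_left_mono norm_matrix_vector_le) auto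
    also have "\<dots> \<le> L * (norm x)\<^sup>2" by (simp add: L_def power2_eq_square algebra_simps)
    finally show "x \<bullet> (\<Sigma>inf *v x) \<le> L * (norm x)\<^sup>2" .
  qed
  \<comment> \<open>The value 1/2 allows \<open>r * |\<omega> v|\<close> to be absorbed at the end;
    the other bound compensates the factor \<open>d * d\<close> lost in passing from basis vectors
    to the matrix norm.\<close>
  define r where "r = min (1 / 2) (e / (2 * z0 * d * d))"
  have r: "r > 0" "r \<le> 1 / 2" "d * (d * (2 * r * z0)) \<le> e"
  proof -
    show "r > 0" using e z0' d by (simp add: r_def)
    show "r \<le> 1 / 2" by (simp add: r_def)
    have "r \<le> e / (2 * z0 * d * d)" by (simp add: r_def)
    then have "r * (2 * z0 * d * d) \<le> e" using z0' d by (simp add: pos_le_divide_eq)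
    then show "d * (d * (2 * r * z0)) \<le> e" by (simp add: mult_ac)
  qed
  \<comment> \<open>An upper bound for \<open>\<Omega>\<close>: once
    \<open>\<eta> z < \<alpha> / 4\<close> the coefficient \<open>\<alpha> - 2 * \<eta> z\<close> is
    at least \<open>\<alpha> / 2\<close>, whence the factor \<open>2 / \<alpha>\<close>.\<close>
  define \<theta> where "\<theta> z = (2 / \<alpha>) * ((Qmean (fst z) X0 (snd z) - \<sigma>\<^sup>2 * d) + 2 * d * \<eta> z / \<kappa>)" for z
  have "(\<theta> \<longlongrightarrow> (2 / \<alpha>) * ((\<sigma>\<^sup>2 * d - \<sigma>\<^sup>2 * d) + 2 * d * 0 / \<kappa>)) (in_prob M)"
    unfolding \<theta>_def d_def using \<kappa> by (intro tendsto_intros \<eta> Qmean_true_lim) auto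
  then have \<theta>: "(\<theta> \<longlongrightarrow> 0) (in_prob M)" by simp
  have "\<forall>\<^sub>F z in in_prob M. \<theta> z < r\<^sup>2 / L" using r L by (intro order_tendstoD(2)[OF \<theta>]) auto
  moreover have "\<forall>\<^sub>F z in in_prob M. \<eta> z < \<alpha> / 4" using \<alpha> by (intro order_tendstoD(2)[OF \<eta>]) auto
  ultimately show ?thesis using eventually_supported eventually_in_prob_deterministic[OF eventually_ge_at_top[of 1]]
  proof eventually_elim
    case (elim z)
    have \<eta>0: "\<eta> z \<ge> 0" unfolding \<eta>_def by (intro add_nonneg_nonneg sum_nonneg) auto
    show ?case
    proof (intro allI impI)
      fix X assume X: "full X" and le: "Qmean (fst z) X (snd z) \<le> Qmean (fst z) X0 (snd z)"
      obtain B l where B: "finite B" "card B = CARD('d)" "pairwise orthogonal B" "span B = UNIV"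
        "\<And>v. v \<in> B \<Longrightarrow> norm v = 1" "\<And>v. v \<in> B \<Longrightarrow> Mmat Sinf X *v v = l v *\<^sub>R v"
        by (rule symmetric_eigenbasis[OF transpose_Mmat[OF Sinf_sym]]) (rule that; assumption)
      define s where "s v = subrows \<iota> (Zmat X *v v)" for v
      define \<omega> where "\<omega> v = (X - X0) *v v" for v
      have l_eq: "l v = s v \<bullet> (\<Sigma>inf *v s v)" if "v \<in> B" for v
      proof -
        have "l v = v \<bullet> (Mmat Sinf X *v v)" using B(5,6)[OF that] by (simp add: dot_square_norm)
        then show ?thesis unfolding Mmat_form padded_form[OF inj padded_inf] s_def .
      qed
      have l_pos: "l v > 0" if "v \<in> B" for v
      proof -
        have "v \<noteq> 0" using B(5)[OF that] by auto
        then have "0 < v \<bullet> (Mmat Sinf X *v v)"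
          by (intro Mmat_positive[OF inj padded_inf \<Sigma>inf_pos X])
        then show ?thesis using B(5,6)[OF that] by (simp add: dot_square_norm)
      qed
      have s_le: "(norm (s v))\<^sup>2 \<le> l v / \<kappa>" if "v \<in> B" for v
        using \<Sigma>inf_low[of "s v"] l_eq[OF that] \<kappa> by (simp add: field_simps)
      have per: "(\<alpha> - 2 * \<eta> z) * (norm (\<omega> v))\<^sup>2 + \<sigma>\<^sup>2 * l v - 2 * \<eta> z * (l v / \<kappa>)
          \<le> mean_upto (fst z) (\<lambda>i. g i * (v \<bullet> (transpose (Zmat X) *v cobs i (snd z)))\<^sup>2)" if v: "v \<in> B" for v
      proof -
        have vy: "v \<bullet> (transpose (Zmat X) *v cobs i (snd z)) = \<omega> v \<bullet> a0 i + s v \<bullet> u i (snd z)" if "i \<ge> 1" for i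
        proof -
          have "(Zmat X *v v) \<bullet> ctil i (snd z) = s v \<bullet> u i (snd z)"
            unfolding s_def u_def using elim(3) that by (intro inner_supported[OF inj]) blast
          then show ?thesis
            unfolding Zmat_cobs inner_add_right \<omega>_def by (simp add: inner_matrix_mult_left)
        qed
        let ?A = "\<Sum>p\<in>UNIV. \<Sum>q\<in>UNIV. \<omega> v $ p * \<omega> v $ q * EA z p q"
        let ?B = "\<Sum>p\<in>UNIV. \<Sum>q\<in>UNIV. \<omega> v $ p * s v $ q * EB z p q"
        let ?G = "\<Sum>p\<in>UNIV. \<Sum>q\<in>UNIV. s v $ p * s v $ q * EG z p q"
        have "mean_upto (fst z) (\<lambda>i. g i * (v \<bullet> (transpose (Zmat X) *v cobs i (snd z)))\<^sup>2)
          = mean_upto (fst z) (\<lambda>i. g i * ((\<omega> v \<bullet> a0 i) * (\<omega> v \<bullet> a0 i)) + (2 * (g i * ((\<omega> v \<bullet> a0 i) * (s v \<bullet> u i (snd z))))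
             + g i * ((s v \<bullet> u i (snd z)) * (s v \<bullet> u i (snd z)))))"
          by (intro mean_upto_cong) (simp add: vy power2_eq_square algebra_simps)
        also have "\<dots> = (\<Sum>p\<in>UNIV. \<Sum>q\<in>UNIV. \<omega> v $ p * \<omega> v $ q * (V $ p $ q + EA z p q)) + (2 * ?B
           + (\<Sum>p\<in>UNIV. \<Sum>q\<in>UNIV. s v $ p * s v $ q * (\<sigma>\<^sup>2 * \<Sigma>inf $ p $ q + EG z p q)))"
          unfolding mean_upto_add mean_upto_scale mean_bilinear EA_def EB_def EG_def by simp
        also have "\<dots> = (\<omega> v \<bullet> (V *v \<omega> v) + ?A) + (2 * ?B + (\<sigma>\<^sup>2 * (s v \<bullet> (\<Sigma>inf *v s v)) + ?G))"
          unfolding inner_matrix_sum by (simp add: distrib_left sum.distrib sum_distrib_left mult_ac)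
        finally have eq: "mean_upto (fst z) (\<lambda>i. g i * (v \<bullet> (transpose (Zmat X) *v cobs i (snd z)))\<^sup>2) =
          (\<omega> v \<bullet> (V *v \<omega> v) + ?A) + (2 * ?B + (\<sigma>\<^sup>2 * l v + ?G))" unfolding l_eq[OF v] .
        have bA: "\<bar>?A\<bar> \<le> norm (\<omega> v) * norm (\<omega> v) * \<eta> z"
          by (rule order_trans[OF bilinear_bound mult_left_mono]) (auto simp: \<eta>_def sum_nonneg)
        have bB: "\<bar>?B\<bar> \<le> norm (\<omega> v) * norm (s v) * \<eta> z"
          by (rule order_trans[OF bilinear_bound mult_left_mono]) (auto simp: \<eta>_def sum_nonneg)
        have bG: "\<bar>?G\<bar> \<le> norm (s v) * norm (s v) * \<eta> z"
          by (rule order_trans[OF bilinear_bound mult_left_mono]) (auto simp: \<eta>_def sum_nonneg)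
        \<comment> \<open>The mixed term is split by \<open>2 x y <= x^2 + y^2\<close> and charged
          to the design part and the error part separately.\<close>
        have "0 \<le> (norm (\<omega> v) - norm (s v))\<^sup>2 * \<eta> z" using \<eta>0 by simp
        then have cross: "2 * (norm (\<omega> v) * norm (s v) * \<eta> z) \<le> norm (\<omega> v) * norm (\<omega> v) * \<eta> z + norm (s v) * norm (s v) * \<eta> z"
          by (simp add: power2_eq_square algebra_simps)
        have sl: "norm (s v) * norm (s v) * \<eta> z \<le> \<eta> z * (l v / \<kappa>)"
          using mult_right_mono[OF s_le[OF v] \<eta>0] by (simp add: power2_eq_square mult.commute)
        have al: "(\<alpha> - 2 * \<eta> z) * (norm (\<omega> v))\<^sup>2 = \<alpha> * (norm (\<omega> v))\<^sup>2 - 2 * (norm (\<omega> v) * norm (\<omega> v) * \<eta> z)"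
          by (simp add: power2_eq_square algebra_simps)
        show ?thesis unfolding eq al using \<alpha>(2)[of "\<omega> v"] bA bB bG cross sl by linarith
      qed
      define \<Omega> where "\<Omega> = (\<Sum>v\<in>B. (norm (\<omega> v))\<^sup>2 / l v)"
      have "(\<alpha> - 2 * \<eta> z) * \<Omega> + (\<sigma>\<^sup>2 * d - 2 * \<eta> z * d / \<kappa>)
        = (\<Sum>v\<in>B. ((\<alpha> - 2 * \<eta> z) * (norm (\<omega> v))\<^sup>2 + \<sigma>\<^sup>2 * l v - 2 * \<eta> z * (l v / \<kappa>)) / l v)"
      proof -
        have "((\<alpha> - 2 * \<eta> z) * (norm (\<omega> v))\<^sup>2 + \<sigma>\<^sup>2 * l v - 2 * \<eta> z * (l v / \<kappa>)) / l v
          = (\<alpha> - 2 * \<eta> z) * ((norm (\<omega> v))\<^sup>2 / l v) + (\<sigma>\<^sup>2 - 2 * \<eta> z / \<kappa>)" if "v \<in> B" for v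
          using l_pos[OF that] by (simp add: diff_divide_distrib add_divide_distrib)
        then have "(\<Sum>v\<in>B. ((\<alpha> - 2 * \<eta> z) * (norm (\<omega> v))\<^sup>2 + \<sigma>\<^sup>2 * l v - 2 * \<eta> z * (l v / \<kappa>)) / l v)
          = (\<Sum>v\<in>B. (\<alpha> - 2 * \<eta> z) * ((norm (\<omega> v))\<^sup>2 / l v) + (\<sigma>\<^sup>2 - 2 * \<eta> z / \<kappa>))"
          by (intro sum.cong refl)
        also have "\<dots> = (\<alpha> - 2 * \<eta> z) * \<Omega> + d * (\<sigma>\<^sup>2 - 2 * \<eta> z / \<kappa>)"
          by (simp add: sum.distrib \<Omega>_def sum_distrib_left B(2) d_def)
        finally show ?thesis by (simp add: algebra_simps)
      qed
      also have "\<dots> \<le> (\<Sum>v\<in>B. mean_upto (fst z) (\<lambda>i. g i * (v \<bullet> (transpose (Zmat X) *v cobs i (snd z)))\<^sup>2) / l v)"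
        using l_pos by (intro sum_mono divide_right_mono per) (auto simp: less_imp_le)
      also have "\<dots> = mean_upto (fst z) (\<lambda>i. g i * (\<Sum>v\<in>B. (v \<bullet> (transpose (Zmat X) *v cobs i (snd z)))\<^sup>2 / l v))"
      proof -
        have "g i * (\<Sum>v\<in>B. (v \<bullet> (transpose (Zmat X) *v cobs i (snd z)))\<^sup>2 / l v)
          = (\<Sum>v\<in>B. (1 / l v) * (g i * (v \<bullet> (transpose (Zmat X) *v cobs i (snd z)))\<^sup>2))" for i
          by (simp add: sum_distrib_left)
        then show ?thesis by (simp only: mean_upto_sum mean_upto_scale) simp
      qed
      also have "\<dots> \<le> Qmean (fst z) X (snd z)"
        unfolding Qmean_def g_def
        by (intro mean_upto_mono qform_lower[OF _ X B(1,3,4,5,6) l_pos])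
      also have "\<dots> \<le> Qmean (fst z) X0 (snd z)" by (rule le)
      finally have main: "(\<alpha> - 2 * \<eta> z) * \<Omega> \<le> (Qmean (fst z) X0 (snd z) - \<sigma>\<^sup>2 * d) + 2 * d * \<eta> z / \<kappa>"
        by (simp add: mult_ac)
      have \<Omega>0: "\<Omega> \<ge> 0" unfolding \<Omega>_def using l_pos by (intro sum_nonneg divide_nonneg_pos) auto
      have "\<alpha> / 2 * \<Omega> \<le> (\<alpha> - 2 * \<eta> z) * \<Omega>" using elim(2) \<Omega>0 by (intro mult_right_mono) auto
      with main have "\<alpha> / 2 * \<Omega> \<le> (Qmean (fst z) X0 (snd z) - \<sigma>\<^sup>2 * d) + 2 * d * \<eta> z / \<kappa>" by linarith
      then have "(2 / \<alpha>) * (\<alpha> / 2 * \<Omega>) \<le> \<theta> z" unfolding \<theta>_def using \<alpha>(1) by (intro mult_left_mono) auto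
      then have \<Omega>\<theta>: "\<Omega> \<le> r\<^sup>2 / L" using elim(1) \<alpha>(1) by simp
      have "norm ((X - X0) *v v) \<le> 2 * r * z0" if v: "v \<in> B" for v
      proof -
        have "(norm (\<omega> v))\<^sup>2 / l v \<le> \<Omega>"
          unfolding \<Omega>_def using B(1) v l_pos by (intro member_le_sum) (auto intro!: divide_nonneg_pos)
        with \<Omega>\<theta> have "(norm (\<omega> v))\<^sup>2 / l v \<le> r\<^sup>2 / L" by linarith
        then have 1: "(norm (\<omega> v))\<^sup>2 \<le> r\<^sup>2 / L * l v" using l_pos[OF v] by (simp add: pos_divide_le_eq)
        have "norm (s v) \<le> norm (Zmat X *v v)" unfolding s_def by (rule norm_subrows_le[OF inj])
        also have "\<dots> \<le> norm (Zmat X0 *v v) + norm (\<omega> v)"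
          unfolding Zmat_diff[of X v X0] \<omega>_def
          using norm_triangle_ineq[of "Zmat X0 *v v" "stack ((X - X0) *v v) 0"] by (simp add: norm_stack_0)
        also have "\<dots> \<le> z0 + norm (\<omega> v)" using z0[OF B(5)[OF v]] by simp
        finally have sz: "norm (s v) \<le> z0 + norm (\<omega> v)" .
        have "l v \<le> L * (norm (s v))\<^sup>2" unfolding l_eq[OF v] by (rule L(2))
        also have "\<dots> \<le> L * (z0 + norm (\<omega> v))\<^sup>2" using L(1) sz by (intro mult_left_mono power_mono) auto
        finally have "r\<^sup>2 / L * l v \<le> r\<^sup>2 / L * (L * (z0 + norm (\<omega> v))\<^sup>2)" using L(1) by (intro mult_left_mono) auto
        also have "\<dots> = (r * (z0 + norm (\<omega> v)))\<^sup>2" using L(1) by (simp add: power_mult_distrib)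
        finally have "(norm (\<omega> v))\<^sup>2 \<le> (r * (z0 + norm (\<omega> v)))\<^sup>2" using 1 by linarith
        then have 2: "norm (\<omega> v) \<le> r * (z0 + norm (\<omega> v))"
          by (rule power2_le_imp_le) (use r z0' in auto)
        have "r * norm (\<omega> v) \<le> 1 / 2 * norm (\<omega> v)" using r by (intro mult_right_mono) auto
        with 2 show ?thesis unfolding \<omega>_def[symmetric] by (simp add: distrib_left)
      qed
      then have "norm (X - X0) \<le> d * (d * (2 * r * z0))" unfolding d_def
        by (intro norm_matrix_le_basis[OF B(1-5)]) (use r z0' in auto)
      with r(3) show "norm (X - X0) \<le> e" by linarith
    qed
  qed
qed

end

section \<open>Existence of the estimator and its rate of convergence\<close>

lemma tendsto_Zmat:
  fixes f :: "'z \<Rightarrow> real^'d::finite^'n::finite"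
  assumes "(f \<longlongrightarrow> X) F"
  shows "((\<lambda>x. Zmat (f x)) \<longlongrightarrow> Zmat X) F"
proof (rule matrix_tendstoI)
  fix p :: "'n + 'd" and k
  show "((\<lambda>x. Zmat (f x) $ p $ k) \<longlongrightarrow> Zmat X $ p $ k) F"
    by (cases p) (auto simp: Zmat_def stack_def intro!: tendsto_intros assms)
qed

lemma tendsto_Mmat:
  assumes "(f \<longlongrightarrow> X) F" "(g \<longlongrightarrow> S) F"
  shows "((\<lambda>x. Mmat (g x) (f x)) \<longlongrightarrow> Mmat S X) F"
  unfolding Mmat_def by (intro tendsto_intros tendsto_Zmat assms)

lemma tendsto_qform:
  assumes f: "(f \<longlongrightarrow> X) F" and inv: "invertible (Mmat S X)"
  shows "((\<lambda>x. qform S (f x) c) \<longlongrightarrow> qform S X c) F"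
  unfolding qform_def
  by (intro tendsto_intros tendsto_Zmat f tendsto_matrix_inv tendsto_Mmat inv)

context eiv
begin

definition minimiser :: "nat \<times> 'w \<Rightarrow> real^'d^'n \<Rightarrow> bool" where
  "minimiser z X \<longleftrightarrow> full X \<and> (\<forall>X'. full X' \<longrightarrow> Qmean (fst z) X (snd z) \<le> Qmean (fst z) X' (snd z))"

text \<open>Minimise over a compact ball inside the full rank set. By consistency, a full rank
  competitor outside this ball is worse than \<open>X0\<close>, which lies inside.\<close>

lemma eventually_minimiser: "\<forall>\<^sub>F z in in_prob M. \<exists>X. minimiser z X"
proof -
  obtain \<gamma> where "\<gamma> > 0" and ev: "\<forall>\<^sub>F X in nhds X0. full X \<and> (\<forall>i\<ge>1. \<forall>t. \<gamma> * (norm t)\<^sup>2 \<le> t \<bullet> (Mmat (S i) X *v t))"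
    by (rule Mmat_low) (rule that; assumption)
  from ev obtain e where e: "e > 0" "\<And>X. dist X X0 < e \<Longrightarrow> full X"
    unfolding eventually_nhds_metric by blast
  have ball: "full X" if "X \<in> cball X0 (e / 2)" for X
    using that e by (intro e(2)) (simp add: dist_commute)
  have "e / 2 > 0" using e by simp
  from consistency[OF this] show ?thesis
  proof eventually_elim
    case (elim z)
    have "continuous_on (cball X0 (e / 2)) (\<lambda>X. Qmean (fst z) X (snd z))"
      unfolding continuous_on_def Qmean_def mean_upto_def
    proof (intro ballI tendsto_intros)
      fix X i assume "X \<in> cball X0 (e / 2)" "i \<in> {1..fst z}"
      then show "((\<lambda>X. qform (S i) X (cobs i (snd z))) \<longlongrightarrow> qform (S i) X (cobs i (snd z))) (at X within cball X0 (e / 2))"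
        by (intro tendsto_qform tendsto_ident_at Mmat_invertible ball) auto
    qed
    moreover have "cball X0 (e / 2) \<noteq> {}" using e by simp
    ultimately obtain X where X: "X \<in> cball X0 (e / 2)"
      "\<And>X'. X' \<in> cball X0 (e / 2) \<Longrightarrow> Qmean (fst z) X (snd z) \<le> Qmean (fst z) X' (snd z)"
      using continuous_attains_inf[OF compact_cball] by blast
    have "Qmean (fst z) X (snd z) \<le> Qmean (fst z) X' (snd z)" if "full X'" for X'
    proof (cases "Qmean (fst z) X' (snd z) \<le> Qmean (fst z) X0 (snd z)")
      case True
      then have "norm (X' - X0) \<le> e / 2" using elim that by blast
      then show ?thesis by (intro X(2)) (simp add: dist_norm norm_minus_commute)
    next
      case False
      have "Qmean (fst z) X (snd z) \<le> Qmean (fst z) X0 (snd z)" using e by (intro X(2)) simp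
      with False show ?thesis by simp
    qed
    then show ?case using ball[OF X(1)] unfolding minimiser_def by blast
  qed
qed

lemma minimiser_tendsto:
  assumes "\<forall>\<^sub>F z in in_prob M. minimiser z (Xh z)"
  shows "(Xh \<longlongrightarrow> X0) (in_prob M)"
proof (rule tendstoI)
  fix e :: real assume e: "e > 0"
  then have "e / 2 > 0" by simp
  from assms consistency[OF this] show "\<forall>\<^sub>F z in in_prob M. dist (Xh z) X0 < e"
  proof eventually_elim
    case (elim z)
    then have "norm (Xh z - X0) \<le> e / 2" using full0 unfolding minimiser_def by blast
    then show ?case using e by (simp add: dist_norm)
  qed
qed

text \<open>The estimator receives the rows as a function restricted to \<open>{1..m}\<close>, and
  the factor \<open>m >= 1\<close> between sum and mean does not affect minimisers.\<close>

lemma solution_iff_minimiser: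
  assumes "m \<ge> 1"
  shows "ewtls_solution \<iota> \<Sigma> m (\<lambda>i\<in>{1..m}. cobs i w) X \<longleftrightarrow> minimiser (m, w) X"
proof -
  have eq: "(\<Sum>i=1..m. qform (S i) X ((\<lambda>i\<in>{1..m}. cobs i w) i)) = real m * Qmean m X w" for X
  proof -
    have "(\<Sum>i=1..m. qform (S i) X ((\<lambda>i\<in>{1..m}. cobs i w) i)) = (\<Sum>i=1..m. qform (S i) X (cobs i w))"
      by (intro sum.cong) auto
    then show ?thesis using assms by (simp add: Qmean_def mean_upto_def)
  qed
  have "ewtls_solution \<iota> \<Sigma> m (\<lambda>i\<in>{1..m}. cobs i w) X \<longleftrightarrow> full X \<and> (\<forall>X'. full X' \<longrightarrow>
      (\<Sum>i=1..m. qform (S i) X ((\<lambda>i\<in>{1..m}. cobs i w) i)) \<le> (\<Sum>i=1..m. qform (S i) X' ((\<lambda>i\<in>{1..m}. cobs i w) i)))"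
    by (rule ewtls_solution_iff[OF inj]) (rule pad \<Sigma>_sym \<Sigma>_pos; assumption)+
  then show ?thesis unfolding eq minimiser_def using assms by simp
qed

section \<open>Rate of convergence of the estimator\<close>

lemma c0_bound: "(c0 i $ p)\<^sup>2 \<le> (1 + (norm (transpose X0))\<^sup>2) * psi i"
proof -
  have "(c0 i $ p)\<^sup>2 \<le> (1 + (norm (transpose X0))\<^sup>2) * (norm (a0 i))\<^sup>2"
  proof (cases p)
    case (Inl k)
    have "(a0 i $ k)\<^sup>2 \<le> (norm (a0 i))\<^sup>2"
      using power_mono[OF component_le_norm_cart[of "a0 i" k], of 2] by simp
    then show ?thesis by (simp add: Inl c0_def stack_def distrib_right add_increasing2)
  next
    case (Inr j)
    have "\<bar>(transpose X0 *v a0 i) $ j\<bar> \<le> norm (transpose X0) * norm (a0 i)"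
      by (rule order_trans[OF component_le_norm_cart norm_matrix_vector_le])
    from power_mono[OF this, of 2] have "((transpose X0 *v a0 i) $ j)\<^sup>2 \<le> (norm (transpose X0))\<^sup>2 * (norm (a0 i))\<^sup>2"
      by (simp add: power_mult_distrib)
    then show ?thesis by (simp add: Inr c0_def stack_def distrib_right add_increasing)
  qed
  also have "\<dots> \<le> (1 + (norm (transpose X0))\<^sup>2) * psi i" by (intro mult_left_mono) (auto simp: psi_def)
  finally show ?thesis .
qed

text \<open>The centred product of two observed entries. Besides the error product it contains the
  cross terms of true entries and errors, and these are why noise bounds carry the factor
  \<open>psi\<close>.\<close>

definition obs_noise :: "'n + 'd \<Rightarrow> 'n + 'd \<Rightarrow> nat \<Rightarrow> 'w \<Rightarrow> real" where
  "obs_noise p q i w = cobs i w $ p * cobs i w $ q - c0 i $ p * c0 i $ q - \<sigma>\<^sup>2 * S i $ p $ q"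

lemma noise_obs: "noise (obs_noise p q)"
proof -
  have "noise (\<lambda>i w. (c0 i $ p * ctil i w $ q + c0 i $ q * ctil i w $ p) + (ctil i w $ p * ctil i w $ q - \<sigma>\<^sup>2 * S i $ p $ q))"
    by (intro noise_add noise_W2 noise_linear[OF c0_bound])
  then show ?thesis by (simp add: obs_noise_def[abs_def] cobs_def algebra_simps)
qed

lemma qform_obs:
  assumes "i \<ge> 1" "full X"
  shows "qform (S i) X (cobs i w) = qform (S i) X (c0 i)
    + (\<Sum>p\<in>UNIV. \<Sum>q\<in>UNIV. Hmat (S i) X $ p $ q * obs_noise p q i w) + \<sigma>\<^sup>2 * real CARD('d)"
proof -
  have "Hmat (S i) X $ p $ q * (cobs i w $ p * cobs i w $ q - \<sigma>\<^sup>2 * S i $ p $ q)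
    = Hmat (S i) X $ p $ q * (c0 i $ p * c0 i $ q) + Hmat (S i) X $ p $ q * obs_noise p q i w" for p q
    by (simp add: obs_noise_def algebra_simps)
  then show ?thesis unfolding qform_split[OF assms, of "cobs i w"] by (simp add: qform_Hmat sum.distrib)
qed

text \<open>The constant \<open>\<sigma>^2 d\<close> cancels and the design part vanishes at
  \<open>X0\<close>. What remains random is weighted by increments of \<open>Hmat\<close>, the
  situation of \<open>taylor2_noise\<close>.\<close>

lemma Qmean_diff:
  assumes "full X"
  shows "Qmean m X w - Qmean m X0 w = mean_upto m (\<lambda>i. qform (S i) X (c0 i))
    + (\<Sum>p\<in>UNIV. \<Sum>q\<in>UNIV. mean_upto m (\<lambda>i. (Hmat (S i) X $ p $ q - Hmat (S i) X0 $ p $ q) * obs_noise p q i w))"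
proof -
  have z: "qform (S i) X0 (c0 i) = 0" for i
  proof -
    have "transpose (Zmat X0) *v c0 i = 0"
      unfolding Zmat_c0 by (simp add: transpose_def matrix_vector_mult_def vec_eq_iff)
    then show ?thesis by (simp add: qform_def)
  qed
  have "Qmean m X w - Qmean m X0 w = mean_upto m (\<lambda>i. qform (S i) X (cobs i w) - qform (S i) X0 (cobs i w))"
    by (simp add: Qmean_def mean_upto_diff)
  also have "\<dots> = mean_upto m (\<lambda>i. qform (S i) X (c0 i) +
      (\<Sum>p\<in>UNIV. \<Sum>q\<in>UNIV. (Hmat (S i) X $ p $ q - Hmat (S i) X0 $ p $ q) * obs_noise p q i w))"
    by (intro mean_upto_cong) (simp add: qform_obs assms full0 z left_diff_distrib sum_subtractf)
  finally show ?thesis by (simp add: mean_upto_add mean_upto_sum)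
qed

text \<open>Half of the coercivity of the limit survives for large \<open>m\<close> in all
  directions simultaneously, since the deviation is controlled by finitely many entries.\<close>

lemma design_lower:
  obtains \<alpha> where "\<alpha> > 0" "\<forall>\<^sub>F m in sequentially. \<forall>x. \<alpha> * (norm x)\<^sup>2 \<le> mean_upto m (\<lambda>i. (x \<bullet> a0 i)\<^sup>2)"
proof -
  obtain \<alpha> where \<alpha>: "\<alpha> > 0" "\<And>x. \<alpha> * (norm x)\<^sup>2 \<le> x \<bullet> (V *v x)" by (rule V_pos) (rule that; assumption)
  define E where "E m p q = mean_upto m (\<lambda>i. 1 * (a0 i $ p * a0 i $ q)) - V $ p $ q" for m p q
  have "(\<lambda>m. \<Sum>p\<in>UNIV. \<Sum>q\<in>UNIV. \<bar>E m p q\<bar>) \<longlonglongrightarrow> (\<Sum>p\<in>(UNIV::'n set). \<Sum>q\<in>(UNIV::'n set). \<bar>V $ p $ q - V $ p $ q\<bar>)"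
    unfolding E_def by (intro tendsto_sum tendsto_rabs tendsto_diff tendsto_const weighted_design_lim)
  then have "\<forall>\<^sub>F m in sequentially. (\<Sum>p\<in>UNIV. \<Sum>q\<in>UNIV. \<bar>E m p q\<bar>) < \<alpha> / 2"
    using \<alpha>(1) by (intro order_tendstoD(2)) auto
  then have "\<forall>\<^sub>F m in sequentially. \<forall>x. \<alpha> / 2 * (norm x)\<^sup>2 \<le> mean_upto m (\<lambda>i. (x \<bullet> a0 i)\<^sup>2)"
  proof eventually_elim
    case (elim m)
    show ?case
    proof
      fix x
      have "mean_upto m (\<lambda>i. (x \<bullet> a0 i)\<^sup>2) = mean_upto m (\<lambda>i. 1 * ((x \<bullet> a0 i) * (x \<bullet> a0 i)))"
        by (simp add: power2_eq_square)
      also have "\<dots> = (\<Sum>p\<in>UNIV. \<Sum>q\<in>UNIV. x $ p * x $ q * (V $ p $ q + E m p q))"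
        unfolding mean_bilinear E_def by simp
      also have "\<dots> = x \<bullet> (V *v x) + (\<Sum>p\<in>UNIV. \<Sum>q\<in>UNIV. x $ p * x $ q * E m p q)"
        unfolding inner_matrix_sum by (simp add: distrib_left sum.distrib mult_ac)
      finally have eq: "mean_upto m (\<lambda>i. (x \<bullet> a0 i)\<^sup>2) = x \<bullet> (V *v x) + (\<Sum>p\<in>UNIV. \<Sum>q\<in>UNIV. x $ p * x $ q * E m p q)" .
      have "norm x * norm x * (\<Sum>p\<in>UNIV. \<Sum>q\<in>UNIV. \<bar>E m p q\<bar>) \<le> norm x * norm x * (\<alpha> / 2)"
        using elim by (intro mult_left_mono) auto
      with bilinear_bound[of x x "E m"] \<alpha>(2)[of x] show "\<alpha> / 2 * (norm x)\<^sup>2 \<le> mean_upto m (\<lambda>i. (x \<bullet> a0 i)\<^sup>2)"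
        unfolding eq power2_eq_square[of "norm x"] by (simp add: algebra_simps)
    qed
  qed
  with \<alpha>(1) that[of "\<alpha> / 2"] show ?thesis by simp
qed

text \<open>The multiplier \<open>y / R\<close> in the lower bound for \<open>qform\<close> replaces
  the inverse of \<open>Mmat\<close> by an upper bound on its norm: twice \<open>|y|^2 / R\<close>
  minus at most \<open>|y|^2 / R\<close>.\<close>

lemma qform_design_lower:
  assumes "i \<ge> 1" "full X" "norm (Mmat (S i) X) \<le> R" "R > 0"
  shows "(norm (transpose (X - X0) *v a0 i))\<^sup>2 / R \<le> qform (S i) X (c0 i)"
proof -
  define y where "y = transpose (X - X0) *v a0 i"
  have y: "transpose (Zmat X) *v c0 i = y" by (simp add: Zmat_c0 y_def)
  have "2 * (((1 / R) *\<^sub>R y) \<bullet> y) - ((1 / R) *\<^sub>R y) \<bullet> (Mmat (S i) X *v ((1 / R) *\<^sub>R y)) \<le> qform (S i) X (c0 i)"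
    unfolding y[symmetric] by (rule qform_ge[OF S_sym[OF assms(1)]]) (rule Mmat_pos[OF assms(1,2)])
  moreover have yMy: "y \<bullet> (Mmat (S i) X *v y) \<le> R * (norm y)\<^sup>2"
  proof -
    have "y \<bullet> (Mmat (S i) X *v y) \<le> norm y * norm (Mmat (S i) X *v y)" by (rule norm_cauchy_schwarz)
    also have "\<dots> \<le> norm y * (norm (Mmat (S i) X) * norm y)" by (intro mult_left_mono norm_matrix_vector_le) auto
    also have "\<dots> \<le> norm y * (R * norm y)" using assms(3) by (intro mult_left_mono mult_right_mono) auto
    finally show ?thesis by (simp add: power2_eq_square mult_ac)
  qed
  have "((1 / R) *\<^sub>R y) \<bullet> (Mmat (S i) X *v ((1 / R) *\<^sub>R y)) \<le> (1 / R\<^sup>2) * (R * (norm y)\<^sup>2)"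
    using mult_left_mono[OF yMy, of "1 / R\<^sup>2"] by (simp add: matrix_vector_mult_scaleR power2_eq_square)
  moreover have "(1 / R\<^sup>2) * (R * (norm y)\<^sup>2) = (norm y)\<^sup>2 / R" using assms(4) by (simp add: power2_eq_square)
  moreover have "2 * (((1 / R) *\<^sub>R y) \<bullet> y) = 2 * ((norm y)\<^sup>2 / R)" by (simp add: power2_norm_eq_inner)
  ultimately show ?thesis unfolding y_def[symmetric] by linarith
qed

text \<open>With \<open>s = b sqrt m\<close> and \<open>D\<close> the distance to \<open>X0\<close>,
  comparison with \<open>X0\<close> gives \<open>s c D^2 <= D Z1 + s D^2 Z2\<close>, where
  \<open>Z1\<close> and \<open>Z2\<close> tend to zero in probability. Once
  \<open>Z2 < c / 2\<close> the last term is absorbed on the left, and dividing by \<open>D\<close>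
  leaves \<open>s D <= 2 |Z1| / c\<close>.\<close>

lemma rate:
  assumes min: "\<forall>\<^sub>F z in in_prob M. minimiser z (Xh z)" and b: "b \<longlonglongrightarrow> (0::real)" "\<And>m. b m \<ge> 0"
  shows "((\<lambda>z. b (fst z) * (sqrt (real (fst z)) * dist (Xh z) X0)) \<longlongrightarrow> 0) (in_prob M)"
proof -
  have Xh: "(Xh \<longlongrightarrow> X0) (in_prob M)" by (rule minimiser_tendsto[OF min])
  obtain \<alpha> where \<alpha>: "\<alpha> > 0" "\<forall>\<^sub>F m in sequentially. \<forall>x. \<alpha> * (norm x)\<^sup>2 \<le> mean_upto m (\<lambda>i. (x \<bullet> a0 i)\<^sup>2)"
    by (rule design_lower) (rule that; assumption)
  obtain R where R: "R > 0" "\<forall>\<^sub>F X in nhds X0. \<forall>i\<ge>1. norm (Mmat (S i) X) \<le> R"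
    by (rule Mmat_bounded) (rule that; assumption)
  define N where "N p q z = mean_upto (fst z) (\<lambda>i. (Hmat (S i) (Xh z) $ p $ q - Hmat (S i) X0 $ p $ q) * obs_noise p q i (snd z))" for p q z
  define sm where "sm z = b (fst z) * sqrt (real (fst z))" for z :: "nat \<times> 'w"
  have "\<forall>p. \<forall>q. \<exists>Y1 Y2. (Y1 \<longlongrightarrow> 0) (in_prob M) \<and> (Y2 \<longlongrightarrow> 0) (in_prob M) \<and> (\<forall>\<^sub>F z in in_prob M.
    sm z * \<bar>N p q z\<bar> \<le> dist (Xh z) X0 * (Y1 z + sm z * dist (Xh z) X0 * Y2 z))"
    using taylor2_noise[OF taylor2_Hmat noise_obs b Xh] unfolding N_def sm_def by (simp add: mult.assoc)
  then obtain Y1 Y2 where Y: "\<And>p q. (Y1 p q \<longlongrightarrow> 0) (in_prob M)" "\<And>p q. (Y2 p q \<longlongrightarrow> 0) (in_prob M)"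
    "\<And>p q. \<forall>\<^sub>F z in in_prob M. sm z * \<bar>N p q z\<bar> \<le> dist (Xh z) X0 * (Y1 p q z + sm z * dist (Xh z) X0 * Y2 p q z)"
    unfolding choice_iff by blast
  define Z1 where "Z1 z = (\<Sum>p\<in>UNIV. \<Sum>q\<in>UNIV. Y1 p q z)" for z
  define Z2 where "Z2 z = (\<Sum>p\<in>UNIV. \<Sum>q\<in>UNIV. Y2 p q z)" for z
  have "(Z1 \<longlongrightarrow> (\<Sum>p\<in>(UNIV::('n+'d) set). \<Sum>q\<in>(UNIV::('n+'d) set). 0)) (in_prob M)"
    "(Z2 \<longlongrightarrow> (\<Sum>p\<in>(UNIV::('n+'d) set). \<Sum>q\<in>(UNIV::('n+'d) set). 0)) (in_prob M)"
    unfolding Z1_def[abs_def] Z2_def[abs_def] by (intro tendsto_sum Y)+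
  then have Z: "(Z1 \<longlongrightarrow> 0) (in_prob M)" "(Z2 \<longlongrightarrow> 0) (in_prob M)" by simp_all
  define c where "c = \<alpha> / R"
  have c: "c > 0" using \<alpha>(1) R(1) by (simp add: c_def)
  have evY: "\<forall>\<^sub>F z in in_prob M. \<forall>p q. sm z * \<bar>N p q z\<bar> \<le> dist (Xh z) X0 * (Y1 p q z + sm z * dist (Xh z) X0 * Y2 p q z)"
    by (intro eventually_all_finite Y(3))
  have evR: "\<forall>\<^sub>F z in in_prob M. \<forall>i\<ge>1. norm (Mmat (S i) (Xh z)) \<le> R"
    using Xh R(2) by (auto simp: filterlim_iff)
  have ev2: "\<forall>\<^sub>F z in in_prob M. Z2 z < c / 2" using c by (intro order_tendstoD(2)[OF Z(2)]) auto
  have "\<forall>\<^sub>F z in in_prob M. norm (sm z * dist (Xh z) X0) \<le> (2 / c) * \<bar>Z1 z\<bar>"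
    using evY evR ev2 min eventually_in_prob_deterministic[OF \<alpha>(2)]
  proof eventually_elim
    case (elim z)
    let ?D = "dist (Xh z) X0"
    have full: "full (Xh z)" and le: "Qmean (fst z) (Xh z) (snd z) \<le> Qmean (fst z) X0 (snd z)"
      using elim(4) full0 by (auto simp: minimiser_def)
    have s0: "sm z \<ge> 0" using b(2) by (simp add: sm_def)
    have "c * ?D\<^sup>2 \<le> mean_upto (fst z) (\<lambda>i. qform (S i) (Xh z) (c0 i))"
    proof -
      let ?A = "Xh z - X0"
      \<comment> \<open>The squared norm of \<open>?A\<close> is the sum over its columns, and the
        design bound is applied to each of them.\<close>
      have "\<alpha> * ?D\<^sup>2 = (\<Sum>k\<in>UNIV. \<alpha> * (norm (?A *v axis k 1))\<^sup>2)"
        by (simp add: dist_norm norm_matrix_sq sum_distrib_left)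
      also have "\<dots> \<le> (\<Sum>k\<in>UNIV. mean_upto (fst z) (\<lambda>i. ((?A *v axis k 1) \<bullet> a0 i)\<^sup>2))"
        using elim(5) by (intro sum_mono) blast
      also have "\<dots> = mean_upto (fst z) (\<lambda>i. (norm (transpose ?A *v a0 i))\<^sup>2)"
      proof -
        have "(?A *v axis k 1) \<bullet> a0 i = (transpose ?A *v a0 i) $ k" for i k
          by (simp add: inner_matrix_mult_left inner_axis')
        moreover have "(norm x)\<^sup>2 = (\<Sum>k\<in>UNIV. (x $ k)\<^sup>2)" for x :: "real^'d"
          unfolding power2_norm_eq_inner inner_vec_def by (simp add: power2_eq_square)
        ultimately show ?thesis by (simp add: mean_upto_sum)
      qed
      finally have "c * ?D\<^sup>2 \<le> mean_upto (fst z) (\<lambda>i. (norm (transpose ?A *v a0 i))\<^sup>2) / R"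
        using R(1) unfolding c_def times_divide_eq_left by (intro divide_right_mono) auto
      also have "\<dots> = mean_upto (fst z) (\<lambda>i. (1 / R) * (norm (transpose ?A *v a0 i))\<^sup>2)"
        unfolding mean_upto_scale by simp
      also have "\<dots> \<le> mean_upto (fst z) (\<lambda>i. qform (S i) (Xh z) (c0 i))"
        using qform_design_lower[OF _ full _ R(1)] elim(2) by (intro mean_upto_mono) simp
      finally show ?thesis .
    qed
    \<comment> \<open>Minimality enters here: the increment of the objective is nonpositive, so the
      noise must outweigh the design part.\<close>
    also have "\<dots> \<le> - (\<Sum>p\<in>UNIV. \<Sum>q\<in>UNIV. N p q z)"
      using Qmean_diff[OF full, of "fst z" "snd z"] le unfolding N_def by linarith
    also have "\<dots> \<le> (\<Sum>p\<in>UNIV. \<Sum>q\<in>UNIV. \<bar>N p q z\<bar>)"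
      unfolding sum_negf[symmetric] by (intro sum_mono) auto
    finally have "sm z * (c * ?D\<^sup>2) \<le> sm z * (\<Sum>p\<in>UNIV. \<Sum>q\<in>UNIV. \<bar>N p q z\<bar>)" using s0 by (rule mult_left_mono)
    also have "\<dots> \<le> (\<Sum>p\<in>UNIV. \<Sum>q\<in>UNIV. ?D * (Y1 p q z + sm z * ?D * Y2 p q z))"
      unfolding sum_distrib_left using elim(1) by (intro sum_mono) blast
    also have "\<dots> = ?D * (Z1 z + sm z * ?D * Z2 z)"
      by (simp add: Z1_def Z2_def sum.distrib sum_distrib_left distrib_left)
    finally have main: "sm z * (c * ?D\<^sup>2) \<le> ?D * (Z1 z + sm z * ?D * Z2 z)" .
    have "sm z * ?D \<le> (2 / c) * \<bar>Z1 z\<bar>"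
    proof (cases "?D = 0")
      case True then show ?thesis using c by simp
    next
      case False
      then have D: "?D > 0" by simp
      have "?D * (sm z * (c * ?D)) \<le> ?D * (Z1 z + sm z * ?D * Z2 z)" using main by (simp add: power2_eq_square mult_ac)
      then have "sm z * (c * ?D) \<le> Z1 z + sm z * ?D * Z2 z" using D by (rule mult_left_le_imp_le)
      moreover have "sm z * ?D * Z2 z \<le> sm z * ?D * (c / 2)" using elim(3) s0 by (intro mult_left_mono) auto
      ultimately have "sm z * ?D * (c / 2) \<le> \<bar>Z1 z\<bar>" by (simp add: algebra_simps)
      then show ?thesis using c by (simp add: field_simps)
    qed
    then show ?case using s0 by simp
  qed
  moreover have "((\<lambda>z. (2 / c) * \<bar>Z1 z\<bar>) \<longlongrightarrow> 0) (in_prob M)"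
    using tendsto_mult_right_zero[OF tendsto_rabs_zero[OF Z(1)]] .
  ultimately have "((\<lambda>z. sm z * dist (Xh z) X0) \<longlongrightarrow> 0) (in_prob M)" by (rule Lim_null_comparison)
  then show ?thesis by (simp add: sm_def mult.assoc)
qed

end

section \<open>The estimating functions\<close>

lemma mean_cauchy_schwarz:
  fixes f g :: "nat \<Rightarrow> real"
  shows "\<bar>mean_upto m (\<lambda>i. f i * g i)\<bar> \<le> sqrt (mean_upto m (\<lambda>i. (f i)\<^sup>2)) * sqrt (mean_upto m (\<lambda>i. (g i)\<^sup>2))"
proof -
  have "(\<Sum>i=1..m. f i * g i)\<^sup>2 \<le> (\<Sum>i=1..m. (f i)\<^sup>2) * (\<Sum>i=1..m. (g i)\<^sup>2)"
    by (rule Cauchy_Schwarz_ineq_sum)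
  then have "(1 / real m)\<^sup>2 * (\<Sum>i=1..m. f i * g i)\<^sup>2 \<le> (1 / real m)\<^sup>2 * ((\<Sum>i=1..m. (f i)\<^sup>2) * (\<Sum>i=1..m. (g i)\<^sup>2))"
    by (rule mult_left_mono) simp
  then have "(mean_upto m (\<lambda>i. f i * g i))\<^sup>2 \<le> mean_upto m (\<lambda>i. (f i)\<^sup>2) * mean_upto m (\<lambda>i. (g i)\<^sup>2)"
    by (simp add: mean_upto_def power_mult_distrib power_divide power2_eq_square)
  then have "sqrt ((mean_upto m (\<lambda>i. f i * g i))\<^sup>2) \<le> sqrt (mean_upto m (\<lambda>i. (f i)\<^sup>2) * mean_upto m (\<lambda>i. (g i)\<^sup>2))"
    by (rule real_sqrt_le_mono)
  then show ?thesis by (simp add: real_sqrt_mult)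
qed

text \<open>The Cauchy-Schwarz inequality applied to
  \<open>f' g' = f g + f (g' - g) + g (f' - f) + (f' - f) (g' - g)\<close>; closeness in mean square
  is all that it asks of the perturbed factors.\<close>

lemma mean_product_perturb:
  fixes f g f' g' :: "nat \<Rightarrow> 'z \<Rightarrow> real" and m :: "'z \<Rightarrow> nat"
  assumes fg: "((\<lambda>z. mean_upto (m z) (\<lambda>i. f i z * g i z)) \<longlongrightarrow> L) F"
    and f: "((\<lambda>z. mean_upto (m z) (\<lambda>i. (f i z)\<^sup>2)) \<longlongrightarrow> A) F"
    and g: "((\<lambda>z. mean_upto (m z) (\<lambda>i. (g i z)\<^sup>2)) \<longlongrightarrow> B) F"
    and r: "((\<lambda>z. mean_upto (m z) (\<lambda>i. (f' i z - f i z)\<^sup>2)) \<longlongrightarrow> 0) F"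
    and s: "((\<lambda>z. mean_upto (m z) (\<lambda>i. (g' i z - g i z)\<^sup>2)) \<longlongrightarrow> 0) F"
  shows "((\<lambda>z. mean_upto (m z) (\<lambda>i. f' i z * g' i z)) \<longlongrightarrow> L) F"
proof -
  have cs: "((\<lambda>z. mean_upto (m z) (\<lambda>i. p i z * q i z)) \<longlongrightarrow> 0) F"
    if "((\<lambda>z. mean_upto (m z) (\<lambda>i. (p i z)\<^sup>2)) \<longlongrightarrow> P) F" "((\<lambda>z. mean_upto (m z) (\<lambda>i. (q i z)\<^sup>2)) \<longlongrightarrow> 0) F"
    for p q :: "nat \<Rightarrow> 'z \<Rightarrow> real" and P
  proof (rule Lim_null_comparison)
    show "\<forall>\<^sub>F z in F. norm (mean_upto (m z) (\<lambda>i. p i z * q i z))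
        \<le> sqrt (mean_upto (m z) (\<lambda>i. (p i z)\<^sup>2)) * sqrt (mean_upto (m z) (\<lambda>i. (q i z)\<^sup>2))"
      by (simp add: mean_cauchy_schwarz)
    show "((\<lambda>z. sqrt (mean_upto (m z) (\<lambda>i. (p i z)\<^sup>2)) * sqrt (mean_upto (m z) (\<lambda>i. (q i z)\<^sup>2))) \<longlongrightarrow> 0) F"
      using tendsto_mult[OF tendsto_real_sqrt[OF that(1)] tendsto_real_sqrt[OF that(2)]] by simp
  qed
  have "((\<lambda>z. mean_upto (m z) (\<lambda>i. f i z * g i z) + (mean_upto (m z) (\<lambda>i. f i z * (g' i z - g i z))
     + (mean_upto (m z) (\<lambda>i. g i z * (f' i z - f i z)) + mean_upto (m z) (\<lambda>i. (f' i z - f i z) * (g' i z - g i z)))))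
     \<longlongrightarrow> L + (0 + (0 + 0))) F"
    by (intro tendsto_add fg cs[OF f s] cs[OF g r] cs[OF r s])
  moreover have "f i z * g i z + (f i z * (g' i z - g i z) + (g i z * (f' i z - f i z) + (f' i z - f i z) * (g' i z - g i z)))
      = f' i z * g' i z" for i z by (simp add: algebra_simps)
  ultimately show ?thesis unfolding mean_upto_add[symmetric] by simp
qed

text \<open>The first \<open>n\<close> rows of \<open>I - S Z M^-1 Z^T\<close>, which for invertible
  \<open>M\<close> is a projection with \<open>S Z\<close> in its kernel. The estimating function
  and the quadratic part of the limit element both factor through it.\<close>

definition Kmat :: "real^('n::finite + 'd::finite)^('n + 'd) \<Rightarrow> real^'d^'n \<Rightarrow> real^('n + 'd)^'n" where
  "Kmat S X = (\<chi> p q. (if q = Inl p then 1 else 0) - (S ** Hmat S X) $ Inl p $ q)"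

lemma upper_matrix_vec: "(upper S *v y) $ p = (S *v y) $ Inl p"
  for S :: "real^'k^('n::finite + 'd::finite)"
  by (simp add: upper_def matrix_vector_mult_def)

lemma Kmat_vec: "(Kmat S X *v y) $ p = y $ Inl p - (S *v (Hmat S X *v y)) $ Inl p"
proof -
  have "(Kmat S X *v y) $ p = (\<Sum>q\<in>UNIV. (if q = Inl p then 1 else 0) * y $ q - (S ** Hmat S X) $ Inl p $ q * y $ q)"
    by (simp add: matrix_vector_mult_def Kmat_def left_diff_distrib)
  also have "\<dots> = y $ Inl p - ((S ** Hmat S X) *v y) $ Inl p"
    by (simp add: sum_subtractf matrix_vector_mult_def[of "S ** _"] if_distrib[of "\<lambda>x. x * _"] cong: if_cong)
  finally show ?thesis by (simp only: matrix_vector_mul_assoc)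
qed

lemma outer_vec: "outer a c *v y = (c \<bullet> y) *\<^sub>R a"
  by (simp add: outer_def matrix_vector_mult_def inner_vec_def vec_eq_iff sum_distrib_left mult_ac)

lemma stack_upper_lower: "stack (upper c) (lower c) = c"
  by (simp add: stack_def upper_def lower_def vec_eq_iff split: sum.split)

text \<open>Applied to \<open>u\<close>, the estimating function splits into the scalar
  \<open>c . Z u\<close> and the vector \<open>K c\<close>, each linear in \<open>c\<close>, so that
  the two can be estimated separately.\<close>

lemma s_tilde_vec:
  "(s_tilde (upper c) (lower c) S X *v u) $ p = (c \<bullet> (Zmat X *v u)) * (Kmat S X *v c) $ p"
proof -
  let ?y = "Zmat X *v u"
  have "s_tilde (upper c) (lower c) S X *v u = outer (upper c) c *v ?y
     - upper S *v (Hmat S X *v (outer c c *v ?y))"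
    unfolding s_tilde_def Let_def stack_upper_lower Hmat_def Mmat_def
    by (simp add: matrix_vector_mult_diff_rdistrib matrix_vector_mul_assoc matrix_mul_assoc)
  then show ?thesis
    by (simp add: outer_vec matrix_vector_mult_scaleR upper_matrix_vec Kmat_vec right_diff_distrib) (simp add: upper_def)
qed

lemma Gamma_at_vec:
  "(Gamma_at S X G *v u) $ p = (fst G *v (Zmat X *v u)) $ p + (Kmat S X *v (snd G *v (Zmat X *v u))) $ p"
proof -
  let ?y = "Zmat X *v u"
  have "Gamma_at S X G *v u = fst G *v ?y + upper (snd G) *v ?y - upper S *v (Hmat S X *v (snd G *v ?y))"
    unfolding Gamma_at_def Let_def Hmat_def Mmat_def
    by (simp add: matrix_vector_mult_diff_rdistrib matrix_vector_mult_add_rdistrib matrix_vector_mul_assoc matrix_mul_assoc)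
  then show ?thesis by (simp add: upper_matrix_vec Kmat_vec)
qed

text \<open>As the estimating function is \<open>K c c^T Z u\<close>, adding a multiple of
  \<open>S\<close> to \<open>c c^T\<close> does not change it. This lets the products of errors be
  centred at no cost.\<close>

lemma Kmat_S_Zmat:
  assumes "invertible (Mmat S X)"
  shows "Kmat S X *v (S *v (Zmat X *v u)) = 0"
proof -
  have "Hmat S X *v (S *v (Zmat X *v u)) = Zmat X *v (matrix_inv (Mmat S X) *v (Mmat S X *v u))"
    by (simp add: Hmat_def Mmat_def matrix_vector_mul_assoc matrix_mul_assoc)
  also have "\<dots> = Zmat X *v u" by (simp add: matrix_vector_mul_assoc[of "matrix_inv _"] matrix_inv_left[OF assms])
  finally show ?thesis by (simp add: vec_eq_iff[of "Kmat S X *v _"] Kmat_vec)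
qed

section \<open>Linear functionals of the summands and of their limit\<close>

context eiv
begin

definition Wnoise :: "nat \<Rightarrow> 'w \<Rightarrow> (real^('n + 'd)^'n) \<times> (real^('n + 'd)^('n + 'd))" where
  "Wnoise i w = (outer (a0 i) (ctil i w), outer (ctil i w) (ctil i w) - \<sigma>\<^sup>2 *\<^sub>R S i)"

text \<open>Uniform integrability lets the second moments of the limit be read off the averages.\<close>

lemma functional_second_moment:
  fixes \<Gamma> :: "'v \<Rightarrow> (real^('n + 'd)^'n) \<times> (real^('n + 'd)^('n + 'd))"
  assumes N: "prob_space N" and \<Gamma>: "\<Gamma> \<in> borel_measurable N"
    and conv: "conv_in_distr M (\<lambda>m w. (1 / sqrt (real m)) *\<^sub>R (\<Sum>i=1..m. Wnoise i w)) N \<Gamma>"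
    and L: "linear (L :: _ \<Rightarrow> real)" and n: "noise (\<lambda>i w. L (Wnoise i w))"
  shows "integrable N (\<lambda>v. (L (\<Gamma> v))\<^sup>2)" "(\<integral>v. L (\<Gamma> v) \<partial>N) = 0"
    "(\<lambda>m. mean_upto m (\<lambda>i. expectation (\<lambda>w. (L (Wnoise i w))\<^sup>2))) \<longlonglongrightarrow> (\<integral>v. (L (\<Gamma> v))\<^sup>2 \<partial>N)"
proof -
  have cont: "continuous_on UNIV L" using L by (simp add: linear_continuous_on linear_conv_bounded_linear)
  have meas: "(\<lambda>v. L (\<Gamma> v)) \<in> borel_measurable N"
    using \<Gamma> borel_measurable_continuous_onI[OF cont] by measurable
  have sums: "(1 / sqrt (real m)) * (\<Sum>i=1..m. L (Wnoise i w)) = L ((1 / sqrt (real m)) *\<^sub>R (\<Sum>i=1..m. Wnoise i w))" for m w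
    by (simp add: linear_cmul[OF L] linear_sum[OF L])
  have c: "(\<lambda>m. expectation (\<lambda>w. f ((1 / sqrt (real m)) * (\<Sum>i=1..m. L (Wnoise i w))))) \<longlonglongrightarrow> (\<integral>v. f (L (\<Gamma> v)) \<partial>N)"
    if f: "continuous_on UNIV f" "bounded (range f)" for f :: "real \<Rightarrow> real"
  proof -
    have "continuous_on UNIV (\<lambda>x. f (L x))" by (rule continuous_on_compose2[OF f(1) cont]) simp
    moreover have "bounded (range (\<lambda>x. f (L x)))" by (rule bounded_subset[OF f(2)]) auto
    ultimately show ?thesis using conv unfolding conv_in_distr_def sums by blast
  qed
  note nlm = noise_limit_moments[OF n N meas c]
  show "integrable N (\<lambda>v. (L (\<Gamma> v))\<^sup>2)" by (rule nlm(1))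
  show "(\<integral>v. L (\<Gamma> v) \<partial>N) = 0" by (rule nlm(2))
  show "(\<lambda>m. mean_upto m (\<lambda>i. expectation (\<lambda>w. (L (Wnoise i w))\<^sup>2))) \<longlonglongrightarrow> (\<integral>v. (L (\<Gamma> v))\<^sup>2 \<partial>N)" by (rule nlm(3))
qed

text \<open>Second moments are available for the functionals \<open>L + K\<close> and
  \<open>L - K\<close>, and polarisation turns them into mixed ones, for the limit as well as for
  the averages.\<close>

lemma functional_product:
  fixes \<Gamma> :: "'v \<Rightarrow> (real^('n + 'd)^'n) \<times> (real^('n + 'd)^('n + 'd))"
  assumes N: "prob_space N" and \<Gamma>: "\<Gamma> \<in> borel_measurable N"
    and conv: "conv_in_distr M (\<lambda>m w. (1 / sqrt (real m)) *\<^sub>R (\<Sum>i=1..m. Wnoise i w)) N \<Gamma>"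
    and L: "linear (L :: _ \<Rightarrow> real)" and n: "noise (\<lambda>i w. L (Wnoise i w))"
    and K: "linear (K :: _ \<Rightarrow> real)" and k: "noise (\<lambda>i w. K (Wnoise i w))"
  shows "integrable N (\<lambda>v. L (\<Gamma> v) * K (\<Gamma> v))"
    "((\<lambda>z. mean_upto (fst z) (\<lambda>i. L (Wnoise i (snd z)) * K (Wnoise i (snd z)))) \<longlongrightarrow> (\<integral>v. L (\<Gamma> v) * K (\<Gamma> v) \<partial>N)) (in_prob M)"
proof -
  have k': "noise (\<lambda>i w. - 1 * K (Wnoise i w))" using k by (rule noise_weight[where g="\<lambda>_. - 1" and B=1]) simp
  have 1: "linear (\<lambda>x. L x + K x)" "noise (\<lambda>i w. L (Wnoise i w) + K (Wnoise i w))"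
    by (rule linear_compose_add[OF L K], rule noise_add[OF n k])
  have 2: "linear (\<lambda>x. L x - K x)" "noise (\<lambda>i w. L (Wnoise i w) - K (Wnoise i w))"
    by (rule linear_compose_sub[OF L K], use noise_add[OF n k'] in simp)
  note f1 = functional_second_moment[OF N \<Gamma> conv 1]
  note f2 = functional_second_moment[OF N \<Gamma> conv 2]
  have pol: "L x * K x = (1 / 4) * ((L x + K x)\<^sup>2 - (L x - K x)\<^sup>2)" for x
    by (simp add: power2_eq_square algebra_simps)
  show "integrable N (\<lambda>v. L (\<Gamma> v) * K (\<Gamma> v))" unfolding pol using f1(1) f2(1) by simp
  have "(\<lambda>m. (1 / 4) * (mean_upto m (\<lambda>i. expectation (\<lambda>w. (L (Wnoise i w) + K (Wnoise i w))\<^sup>2))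
       - mean_upto m (\<lambda>i. expectation (\<lambda>w. (L (Wnoise i w) - K (Wnoise i w))\<^sup>2))))
      \<longlonglongrightarrow> (1 / 4) * ((\<integral>v. (L (\<Gamma> v) + K (\<Gamma> v))\<^sup>2 \<partial>N) - (\<integral>v. (L (\<Gamma> v) - K (\<Gamma> v))\<^sup>2 \<partial>N))"
    by (intro tendsto_intros f1 f2)
  also have "(1 / 4) * ((\<integral>v. (L (\<Gamma> v) + K (\<Gamma> v))\<^sup>2 \<partial>N) - (\<integral>v. (L (\<Gamma> v) - K (\<Gamma> v))\<^sup>2 \<partial>N)) = (\<integral>v. L (\<Gamma> v) * K (\<Gamma> v) \<partial>N)"
    unfolding pol using f1(1) f2(1) by simp
  also have "(\<lambda>m. (1 / 4) * (mean_upto m (\<lambda>i. expectation (\<lambda>w. (L (Wnoise i w) + K (Wnoise i w))\<^sup>2))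
       - mean_upto m (\<lambda>i. expectation (\<lambda>w. (L (Wnoise i w) - K (Wnoise i w))\<^sup>2))))
     = (\<lambda>m. mean_upto m (\<lambda>i. expectation (\<lambda>w. L (Wnoise i w) * K (Wnoise i w))))"
  proof
    fix m
    have "expectation (\<lambda>w. L (Wnoise i w) * K (Wnoise i w)) = (1 / 4) * (expectation (\<lambda>w. (L (Wnoise i w) + K (Wnoise i w))\<^sup>2)
       - expectation (\<lambda>w. (L (Wnoise i w) - K (Wnoise i w))\<^sup>2))" if "i \<ge> 1" for i
      unfolding pol using noise_integrable_sq[OF 1(2) that] noise_integrable_sq[OF 2(2) that] by simp
    then have "mean_upto m (\<lambda>i. expectation (\<lambda>w. L (Wnoise i w) * K (Wnoise i w))) = mean_upto m (\<lambda>i. (1 / 4) *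
       (expectation (\<lambda>w. (L (Wnoise i w) + K (Wnoise i w))\<^sup>2) - expectation (\<lambda>w. (L (Wnoise i w) - K (Wnoise i w))\<^sup>2)))"
      by (intro mean_upto_cong)
    then show "(1 / 4) * (mean_upto m (\<lambda>i. expectation (\<lambda>w. (L (Wnoise i w) + K (Wnoise i w))\<^sup>2))
       - mean_upto m (\<lambda>i. expectation (\<lambda>w. (L (Wnoise i w) - K (Wnoise i w))\<^sup>2)))
     = mean_upto m (\<lambda>i. expectation (\<lambda>w. L (Wnoise i w) * K (Wnoise i w)))"
      unfolding mean_upto_scale mean_upto_diff by simp
  qed
  finally have lim: "(\<lambda>m. mean_upto m (\<lambda>i. expectation (\<lambda>w. L (Wnoise i w) * K (Wnoise i w)))) \<longlonglongrightarrow> (\<integral>v. L (\<Gamma> v) * K (\<Gamma> v) \<partial>N)" .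
  from tendsto_add[OF noise_products[OF n k] tendsto_in_prob_deterministic[OF lim]]
  show "((\<lambda>z. mean_upto (fst z) (\<lambda>i. L (Wnoise i (snd z)) * K (Wnoise i (snd z)))) \<longlongrightarrow> (\<integral>v. L (\<Gamma> v) * K (\<Gamma> v) \<partial>N)) (in_prob M)"
    by simp
qed

definition nlin :: "real^'d \<Rightarrow> 'n \<Rightarrow> nat \<Rightarrow> 'w \<Rightarrow> real" where
  "nlin u p i w = (\<Sum>r\<in>UNIV. (Zmat X0 *v u) $ r * (a0 i $ p * ctil i w $ r))"

definition nquad :: "real^'d \<Rightarrow> 'n + 'd \<Rightarrow> nat \<Rightarrow> 'w \<Rightarrow> real" where
  "nquad u q i w = (\<Sum>r\<in>UNIV. (Zmat X0 *v u) $ r * (ctil i w $ q * ctil i w $ r - \<sigma>\<^sup>2 * S i $ q $ r))"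

lemma noise_nlin: "noise (nlin u p)"
  unfolding nlin_def[abs_def] by (intro noise_sum noise_weight[OF noise_W1]) (rule order_refl)

lemma noise_nquad: "noise (nquad u q)"
  unfolding nquad_def[abs_def] by (intro noise_sum noise_weight[OF noise_W2]) (rule order_refl)

text \<open>A coordinate of the limit map, taken as a functional so that it can be evaluated on the
  summands \<open>Wnoise\<close> and on \<open>\<Gamma>\<close> alike.\<close>

definition Gfun :: "real^'d \<Rightarrow> 'n \<Rightarrow> (real^('n + 'd)^'n) \<times> (real^('n + 'd)^('n + 'd)) \<Rightarrow> real" where
  "Gfun u p G = (Gamma_at Sinf X0 G *v u) $ p"

lemma linear_Gfun: "linear (Gfun u p)"
  unfolding Gfun_def[abs_def] Gamma_at_vec
  by (rule linearI) (simp_all add: matrix_vector_mult_add_rdistrib matrix_vector_right_distrib matrix_vector_mult_scaleR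
      scaleR_matrix_vector_assoc[symmetric] distrib_left)

lemma Wnoise_parts:
  "(fst (Wnoise i w) *v (Zmat X0 *v u)) $ p = nlin u p i w"
  "(snd (Wnoise i w) *v (Zmat X0 *v u)) $ q = nquad u q i w"
  by (simp_all add: Wnoise_def nlin_def nquad_def outer_def matrix_vector_mult_def[of "\<chi> i j. _ i j"]
     matrix_vector_mult_def[of "_ - _"] mult_ac)

lemma Gfun_Wnoise: "Gfun u p (Wnoise i w) = nlin u p i w + (\<Sum>q\<in>UNIV. Kmat Sinf X0 $ p $ q * nquad u q i w)"
  unfolding Gfun_def Gamma_at_vec matrix_vector_mult_def[of "Kmat _ _"] vec_lambda_beta Wnoise_parts ..

lemma noise_Gfun: "noise (\<lambda>i w. Gfun u p (Wnoise i w))"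
  unfolding Gfun_Wnoise by (intro noise_add noise_sum noise_nlin noise_weight[OF noise_nquad]) (rule order_refl)

section \<open>Estimating functions at the true and at the estimated parameter\<close>

definition shat :: "real^'d \<Rightarrow> 'n \<Rightarrow> nat \<Rightarrow> real^'d^'n \<Rightarrow> 'w \<Rightarrow> real" where
  "shat u p i X w = (s_tilde (upper (cobs i w)) (lower (cobs i w)) (S i) X *v u) $ p"

lemma Kmat_c0:
  shows "(Kmat (S i) X0 *v c0 i) $ p = a0 i $ p"
proof -
  have "transpose (Zmat X0) *v c0 i = 0"
    unfolding Zmat_c0 by (simp add: transpose_def matrix_vector_mult_def vec_eq_iff)
  then have "Hmat (S i) X0 *v c0 i = 0" by (simp add: Hmat_def flip: matrix_vector_mul_assoc)
  then show ?thesis by (simp add: Kmat_vec) (simp add: c0_def stack_def)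
qed

lemma cobs_Zmat: "cobs i w \<bullet> (Zmat X *v u) = a0 i \<bullet> ((X - X0) *v u) + ctil i w \<bullet> (Zmat X *v u)"
proof -
  have "cobs i w \<bullet> (Zmat X *v u) = (transpose (Zmat X) *v cobs i w) \<bullet> u"
    by (rule inner_matrix_vector_transpose)
  also have "\<dots> = a0 i \<bullet> ((X - X0) *v u) + ctil i w \<bullet> (Zmat X *v u)"
    unfolding Zmat_cobs inner_add_left by (simp add: inner_matrix_mult_left)
  finally show ?thesis .
qed

text \<open>At \<open>X0\<close> the design part of \<open>c\<close> drops out of
  \<open>c . Z u\<close> and its upper block passes unchanged through \<open>K\<close>, while the
  centring term \<open>\<sigma>^2 S i\<close> is annihilated. The result differs from the limit
  functional only in having \<open>S i\<close> in place of its limit.\<close>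

lemma shat_true:
  assumes i: "i \<ge> 1"
  shows "shat u p i X0 w = nlin u p i w + (\<Sum>q\<in>UNIV. Kmat (S i) X0 $ p $ q * nquad u q i w)"
proof -
  let ?y = "Zmat X0 *v u" and ?c = "ctil i w"
  have cy: "cobs i w \<bullet> ?y = ?c \<bullet> ?y" unfolding cobs_Zmat by simp
  have "shat u p i X0 w = (?c \<bullet> ?y) * (a0 i $ p + (Kmat (S i) X0 *v ?c) $ p)"
    unfolding shat_def s_tilde_vec cy by (simp add: cobs_def matrix_vector_right_distrib Kmat_c0)
  also have "\<dots> = (?c \<bullet> ?y) * a0 i $ p + (\<Sum>q\<in>UNIV. Kmat (S i) X0 $ p $ q * (?c $ q * (?c \<bullet> ?y)))"
    by (simp add: distrib_left matrix_vector_mult_def[of "Kmat _ _"] sum_distrib_left mult_ac)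
  also have "(?c \<bullet> ?y) * a0 i $ p = nlin u p i w"
    by (simp add: nlin_def inner_vec_def sum_distrib_left mult_ac)
  also have "(\<Sum>q\<in>UNIV. Kmat (S i) X0 $ p $ q * (?c $ q * (?c \<bullet> ?y)))
    = (\<Sum>q\<in>UNIV. Kmat (S i) X0 $ p $ q * nquad u q i w) + \<sigma>\<^sup>2 * (Kmat (S i) X0 *v (S i *v ?y)) $ p"
  proof -
    have "?c $ q * (?c \<bullet> ?y) = nquad u q i w + \<sigma>\<^sup>2 * (S i *v ?y) $ q" for q
      by (simp add: nquad_def inner_vec_def matrix_vector_mult_def[of "S i"] sum_distrib_left right_diff_distrib sum_subtractf mult_ac)
    then have "(\<Sum>q\<in>UNIV. Kmat (S i) X0 $ p $ q * (?c $ q * (?c \<bullet> ?y)))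
      = (\<Sum>q\<in>UNIV. Kmat (S i) X0 $ p $ q * nquad u q i w + \<sigma>\<^sup>2 * (Kmat (S i) X0 $ p $ q * (S i *v ?y) $ q))"
      by (simp only: distrib_left mult.left_commute)
    then show ?thesis
      by (simp only: sum.distrib sum_distrib_left[symmetric] matrix_vector_mult_def[of "Kmat _ _"] vec_lambda_beta)
  qed
  also have "(Kmat (S i) X0 *v (S i *v ?y)) $ p = 0"
    by (simp add: Kmat_S_Zmat[OF Mmat_invertible[OF i full0]])
  finally show ?thesis by simp
qed

lemma taylor2_Kmat: "taylor2 X0 (\<lambda>i X. Kmat (S i) X $ p $ q)"
proof -
  have "taylor2 X0 (\<lambda>i X. (if q = Inl p then 1 else 0) + (- 1) * (S i ** Hmat (S i) X) $ Inl p $ q)"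
    by (intro taylor2_add taylor2_cmult taylor2_matrix_mult taylor2_S taylor2_Hmat taylor2_const[where B=1]) auto
  then show ?thesis by (simp add: Kmat_def)
qed

lemma Kmat_lim: "(\<lambda>i. Kmat (S i) X0 $ p $ q) \<longlonglongrightarrow> Kmat Sinf X0 $ p $ q"
proof -
  have "(\<lambda>i. S i ** Hmat (S i) X0) \<longlonglongrightarrow> Sinf ** Hmat Sinf X0"
    unfolding Hmat_def by (intro tendsto_intros tendsto_matrix_inv tendsto_Mmat S_lim Mmat_inf_invertible full0)
  then have "(\<lambda>i. (if q = Inl p then 1 else 0) - (S i ** Hmat (S i) X0) $ Inl p $ q)
     \<longlonglongrightarrow> (if q = Inl p then 1 else 0) - (Sinf ** Hmat Sinf X0) $ Inl p $ q"
    by (intro tendsto_diff tendsto_const tendsto_vec_nth)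
  then show ?thesis by (simp add: Kmat_def)
qed

text \<open>The second moments of noise are at most a multiple of \<open>psi\<close>, so the squared
  null weights act on bounded means.\<close>

lemma null_weight_noise:
  assumes n: "noise n" and h: "h \<longlonglongrightarrow> (0::real)"
  shows "((\<lambda>z. mean_upto (fst z) (\<lambda>i. (h i * n i (snd z))\<^sup>2)) \<longlongrightarrow> 0) (in_prob M)"
proof -
  obtain K where K: "K \<ge> 0" "\<And>i. i \<ge> 1 \<Longrightarrow> expectation (\<lambda>w. (n i w)\<^sup>2) \<le> K * psi i"
    using n by (rule noise_second_moment) (rule that; assumption)
  obtain C where C: "C \<ge> 0" "\<And>m. mean_upto m psi \<le> C" by (rule psi_bound) (rule that; assumption)
  have h2: "(\<lambda>i. K * (h i)\<^sup>2) \<longlonglongrightarrow> 0"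
    using tendsto_mult[OF tendsto_const[of K] tendsto_power[OF h, of 2]] by simp
  have psi0: "\<And>i. i \<ge> 1 \<Longrightarrow> 0 \<le> psi i" using psi_ge1 by (rule order_trans[OF zero_le_one])
  have lim: "(\<lambda>m. mean_upto m (\<lambda>i. \<bar>K * (h i)\<^sup>2\<bar> * psi i)) \<longlonglongrightarrow> 0"
    by (rule mean_upto_null_weights[OF h2 psi0 C(2)])
  have int: "integrable M (\<lambda>w. mean_upto m (\<lambda>i. (h i * n i w)\<^sup>2))" for m
    unfolding mean_upto_def power_mult_distrib
    by (intro integrable_scaleR_right Bochner_Integration.integrable_sum integrable_mult_right noise_integrable_sq n) auto
  show ?thesis
  proof (rule tendsto_in_prob_L1[OF int], rule tendsto_sandwich[OF always_eventually always_eventually tendsto_const lim]; intro allI)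
    fix m
    show "0 \<le> expectation (\<lambda>w. \<bar>mean_upto m (\<lambda>i. (h i * n i w)\<^sup>2)\<bar>)" by simp
    have abs: "\<bar>mean_upto m (\<lambda>i. (h i * n i w)\<^sup>2)\<bar> = mean_upto m (\<lambda>i. (h i * n i w)\<^sup>2)" for w
      by (intro abs_of_nonneg mean_upto_nonneg) auto
    have "expectation (\<lambda>w. \<bar>mean_upto m (\<lambda>i. (h i * n i w)\<^sup>2)\<bar>) = mean_upto m (\<lambda>i. (h i)\<^sup>2 * expectation (\<lambda>w. (n i w)\<^sup>2))"
      unfolding abs using noise_integrable_sq[OF n] by (simp add: mean_upto_def power_mult_distrib)
    also have "\<dots> \<le> mean_upto m (\<lambda>i. \<bar>K * (h i)\<^sup>2\<bar> * psi i)"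
    proof (rule mean_upto_mono)
      fix i :: nat assume "1 \<le> i"
      then have "(h i)\<^sup>2 * expectation (\<lambda>w. (n i w)\<^sup>2) \<le> (h i)\<^sup>2 * (K * psi i)" by (intro mult_left_mono K) auto
      then show "(h i)\<^sup>2 * expectation (\<lambda>w. (n i w)\<^sup>2) \<le> \<bar>K * (h i)\<^sup>2\<bar> * psi i" using K(1) by (simp add: mult_ac)
    qed
    finally show "expectation (\<lambda>w. \<bar>mean_upto m (\<lambda>i. (h i * n i w)\<^sup>2)\<bar>) \<le> mean_upto m (\<lambda>i. \<bar>K * (h i)\<^sup>2\<bar> * psi i)" .
  qed
qed

lemma sum_square_le: "(\<Sum>q\<in>A. x q)\<^sup>2 \<le> real (card A) * (\<Sum>q\<in>A. (x q)\<^sup>2)" for x :: "'q \<Rightarrow> real"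
  using Cauchy_Schwarz_ineq_sum[of "\<lambda>_. 1" x A] by simp

text \<open>The difference carries the weights \<open>Kmat (S i) X0 - Kmat Sinf X0\<close>, which
  tend to zero entry by entry.\<close>

lemma shat_true_approx:
  "((\<lambda>z. mean_upto (fst z) (\<lambda>i. (shat u p i X0 (snd z) - Gfun u p (Wnoise i (snd z)))\<^sup>2)) \<longlongrightarrow> 0) (in_prob M)"
proof -
  let ?h = "\<lambda>q i. Kmat (S i) X0 $ p $ q - Kmat Sinf X0 $ p $ q"
  have h: "?h q \<longlonglongrightarrow> 0" for q using Kmat_lim[of p q] by (rule LIM_zero)
  have "((\<lambda>z. real CARD('n + 'd) * (\<Sum>q\<in>UNIV. mean_upto (fst z) (\<lambda>i. (?h q i * nquad u q i (snd z))\<^sup>2)))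
     \<longlongrightarrow> real CARD('n + 'd) * (\<Sum>q\<in>(UNIV :: ('n + 'd) set). 0)) (in_prob M)"
    by (intro tendsto_mult tendsto_const tendsto_sum null_weight_noise noise_nquad h)
  then have lim: "((\<lambda>z. real CARD('n + 'd) * (\<Sum>q\<in>UNIV. mean_upto (fst z) (\<lambda>i. (?h q i * nquad u q i (snd z))\<^sup>2))) \<longlongrightarrow> 0) (in_prob M)"
    by simp
  show ?thesis
  proof (rule Lim_null_comparison[OF always_eventually lim], rule allI)
    fix z :: "nat \<times> 'w"
    have "norm (mean_upto (fst z) (\<lambda>i. (shat u p i X0 (snd z) - Gfun u p (Wnoise i (snd z)))\<^sup>2))
      = mean_upto (fst z) (\<lambda>i. (shat u p i X0 (snd z) - Gfun u p (Wnoise i (snd z)))\<^sup>2)"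
      unfolding real_norm_def by (intro abs_of_nonneg mean_upto_nonneg) auto
    also have "\<dots> \<le> mean_upto (fst z) (\<lambda>i. real CARD('n + 'd) * (\<Sum>q\<in>UNIV. (?h q i * nquad u q i (snd z))\<^sup>2))"
    proof (rule mean_upto_mono)
      fix i :: nat assume i: "1 \<le> i"
      have "shat u p i X0 (snd z) - Gfun u p (Wnoise i (snd z)) = (\<Sum>q\<in>UNIV. ?h q i * nquad u q i (snd z))"
        unfolding shat_true[OF i] Gfun_Wnoise by (simp add: left_diff_distrib sum_subtractf)
      then show "(shat u p i X0 (snd z) - Gfun u p (Wnoise i (snd z)))\<^sup>2 \<le> real CARD('n + 'd) * (\<Sum>q\<in>UNIV. (?h q i * nquad u q i (snd z))\<^sup>2)"
        by (simp only:) (rule sum_square_le)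
    qed
    also have "\<dots> = real CARD('n + 'd) * (\<Sum>q\<in>UNIV. mean_upto (fst z) (\<lambda>i. (?h q i * nquad u q i (snd z))\<^sup>2))"
      by (simp only: mean_upto_scale mean_upto_sum)
    finally show "norm (mean_upto (fst z) (\<lambda>i. (shat u p i X0 (snd z) - Gfun u p (Wnoise i (snd z)))\<^sup>2))
      \<le> real CARD('n + 'd) * (\<Sum>q\<in>UNIV. mean_upto (fst z) (\<lambda>i. (?h q i * nquad u q i (snd z))\<^sup>2))" .
  qed
qed

lemma norm_cobs_le: obtains C where "C \<ge> 0" "\<And>i w q. \<bar>cobs i w $ q\<bar> \<le> C * (norm (a0 i) + norm (ctil i w))"
proof -
  define C where "C = 1 + norm (transpose X0)"
  have "\<bar>cobs i w $ q\<bar> \<le> C * (norm (a0 i) + norm (ctil i w))" for i w q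
  proof -
    have "\<bar>c0 i $ q\<bar> \<le> C * norm (a0 i)"
    proof (cases q)
      case (Inl k)
      have "\<bar>a0 i $ k\<bar> \<le> norm (a0 i)" by (rule component_le_norm_cart)
      then show ?thesis by (simp add: Inl c0_def stack_def C_def distrib_right add_increasing2)
    next
      case (Inr j)
      have "\<bar>(transpose X0 *v a0 i) $ j\<bar> \<le> norm (transpose X0) * norm (a0 i)"
        by (rule order_trans[OF component_le_norm_cart norm_matrix_vector_le])
      then show ?thesis by (simp add: Inr c0_def stack_def C_def distrib_right add_increasing)
    qed
    moreover have "\<bar>ctil i w $ q\<bar> \<le> C * norm (ctil i w)"
      using component_le_norm_cart[of "ctil i w" q] by (simp add: C_def distrib_right add_increasing2)
    ultimately show ?thesis by (simp add: cobs_def distrib_left)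
  qed
  moreover have "C \<ge> 0" by (simp add: C_def)
  ultimately show ?thesis using that by blast
qed

text \<open>Both factors of the estimating function are linear in \<open>c\<close> with coefficients
  that are Lipschitz at \<open>X0\<close> uniformly in \<open>i\<close>. The price is quadratic
  growth in the norms, whose square is of fourth order in \<open>a0\<close>.\<close>

lemma shat_lipschitz:
  obtains C where "C \<ge> 0" "\<forall>\<^sub>F X in nhds X0. \<forall>i\<ge>1. \<forall>w.
    \<bar>shat u p i X w - shat u p i X0 w\<bar> \<le> C * dist X X0 * (norm (a0 i) + norm (ctil i w))\<^sup>2"
proof -
  obtain A where A: "A \<ge> 0" "\<And>i w q. \<bar>cobs i w $ q\<bar> \<le> A * (norm (a0 i) + norm (ctil i w))"
    by (rule norm_cobs_le) (rule that; assumption)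
  have "\<forall>q. \<exists>B. \<forall>i\<ge>1. \<bar>Kmat (S i) X0 $ p $ q\<bar> \<le> B"
    using taylor2_Kmat[of p] unfolding taylor2_def by blast
  then obtain B where B: "\<And>q i. i \<ge> 1 \<Longrightarrow> \<bar>Kmat (S i) X0 $ p $ q\<bar> \<le> B q" unfolding choice_iff by blast
  have "\<forall>q. \<exists>D. D \<ge> 0 \<and> (\<forall>\<^sub>F X in nhds X0. \<forall>i\<ge>1. \<bar>Kmat (S i) X $ p $ q - Kmat (S i) X0 $ p $ q\<bar> \<le> D * dist X X0)"
    using taylor2_lipschitz[OF taylor2_Kmat] by blast
  then obtain D where D: "\<And>q. D q \<ge> 0"
    "\<And>q. \<forall>\<^sub>F X in nhds X0. \<forall>i\<ge>1. \<bar>Kmat (S i) X $ p $ q - Kmat (S i) X0 $ p $ q\<bar> \<le> D q * dist X X0"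
    unfolding choice_iff by blast
  define b where "b = (\<Sum>q\<in>UNIV. \<bar>B q\<bar>)"
  define d where "d = (\<Sum>q\<in>UNIV. D q)"
  have bd: "b \<ge> 0" "d \<ge> 0" unfolding b_def d_def using D(1) by (auto intro: sum_nonneg)
  define y where "y = norm (Zmat X0 *v u)"
  have y: "y \<ge> 0" by (simp add: y_def)
  define C where "C = norm u * ((b + d) * A) + y * (d * A)"
  have split: "r * k - s * l = (r - s) * k + s * (k - l)" for r s k l :: real by (simp add: algebra_simps)
  have abs_le: "\<bar>r * k + s * l\<bar> \<le> \<bar>r\<bar> * \<bar>k\<bar> + \<bar>s\<bar> * \<bar>l\<bar>" for r s k l :: real
    using abs_triangle_ineq[of "r * k" "s * l"] by (simp only: abs_mult)
  have arith: "(t * (e * N)) * ((b + d) * A * N) + (y * N) * (t * (d * A * N)) = (e * ((b + d) * A) + y * (d * A)) * t * N\<^sup>2"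
    for t e N by (simp add: power2_eq_square algebra_simps)
  have ev: "\<forall>\<^sub>F X in nhds X0. \<forall>q. \<forall>i\<ge>1. \<bar>Kmat (S i) X $ p $ q - Kmat (S i) X0 $ p $ q\<bar> \<le> D q * dist X X0"
    by (intro eventually_all_finite D(2))
  have "\<forall>\<^sub>F X in nhds X0. \<forall>i\<ge>1. \<forall>w. \<bar>shat u p i X w - shat u p i X0 w\<bar> \<le> C * dist X X0 * (norm (a0 i) + norm (ctil i w))\<^sup>2"
    using ev eventually_nhds_dist[of 1 X0, OF zero_less_one]
  proof eventually_elim
    case (elim X)
    show ?case
    proof (intro allI impI)
      fix i :: nat and w assume i: "i \<ge> 1"
      let ?N = "norm (a0 i) + norm (ctil i w)" and ?dist = "dist X X0"
      let ?c = "cobs i w" and ?K = "(Kmat (S i) X *v cobs i w) $ p" and ?L = "(Kmat (S i) X0 *v cobs i w) $ p"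
      have KK: "\<bar>?K - ?L\<bar> \<le> ?dist * (d * A * ?N)"
      proof -
        have "?K - ?L = (\<Sum>q\<in>UNIV. (Kmat (S i) X $ p $ q - Kmat (S i) X0 $ p $ q) * ?c $ q)"
          by (simp add: matrix_vector_mult_def left_diff_distrib sum_subtractf)
        also have "\<bar>\<dots>\<bar> \<le> (\<Sum>q\<in>UNIV. (D q * ?dist) * (A * ?N))"
          by (rule order_trans[OF sum_abs sum_mono]) (use elim(1) i A(2) D(1) in \<open>auto simp: abs_mult intro!: mult_mono\<close>)
        also have "\<dots> = ?dist * (d * A * ?N)" by (simp add: d_def sum_distrib_right sum_distrib_left mult_ac)
        finally show ?thesis .
      qed
      have K0: "\<bar>?L\<bar> \<le> b * A * ?N"
      proof -
        have "\<bar>?L\<bar> \<le> (\<Sum>q\<in>UNIV. \<bar>B q\<bar> * (A * ?N))"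
          unfolding matrix_vector_mult_def vec_lambda_beta
        proof (rule order_trans[OF sum_abs sum_mono])
          fix q
          have "\<bar>Kmat (S i) X0 $ p $ q\<bar> \<le> \<bar>B q\<bar>" by (rule order_trans[OF B[OF i] abs_ge_self])
          then show "\<bar>Kmat (S i) X0 $ p $ q * ?c $ q\<bar> \<le> \<bar>B q\<bar> * (A * ?N)"
            unfolding abs_mult by (intro mult_mono A(2)) auto
        qed
        then show ?thesis by (simp add: b_def sum_distrib_right sum_distrib_left mult_ac)
      qed
      have dA: "0 \<le> d * A * ?N" using bd A(1) by simp
      have "?dist * (d * A * ?N) \<le> 1 * (d * A * ?N)" using elim(2) dA by (intro mult_right_mono) auto
      with KK K0 have K: "\<bar>?K\<bar> \<le> (b + d) * A * ?N" by (simp add: distrib_right)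
      have lin: "\<bar>?c \<bullet> (Zmat X *v u) - ?c \<bullet> (Zmat X0 *v u)\<bar> \<le> ?dist * (norm u * ?N)"
      proof -
        have "?c \<bullet> (Zmat X *v u) - ?c \<bullet> (Zmat X0 *v u) = upper ?c \<bullet> ((X - X0) *v u)"
          unfolding Zmat_diff[of X u X0] inner_add_right
          by (simp add: inner_vec_def[of ?c "stack _ _"] sum_UNIV_plus stack_def upper_def inner_vec_def)
        also have "upper ?c = a0 i + upper (ctil i w)"
          by (simp add: cobs_def c0_def upper_def stack_def vec_eq_iff)
        finally have eq: "?c \<bullet> (Zmat X *v u) - ?c \<bullet> (Zmat X0 *v u) = (a0 i + upper (ctil i w)) \<bullet> ((X - X0) *v u)" .
        have up: "norm (upper (ctil i w)) \<le> norm (ctil i w)"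
          using norm_subrows_le[of "Inl :: 'n \<Rightarrow> 'n + 'd" "ctil i w"] by (simp add: subrows_def upper_def)
        have "\<bar>(a0 i + upper (ctil i w)) \<bullet> ((X - X0) *v u)\<bar> \<le> norm (a0 i + upper (ctil i w)) * norm ((X - X0) *v u)"
          by (rule Cauchy_Schwarz_ineq2)
        also have "\<dots> \<le> ?N * (norm (X - X0) * norm u)"
          using norm_triangle_ineq[of "a0 i" "upper (ctil i w)"] up
          by (intro mult_mono norm_matrix_vector_le) auto
        finally show ?thesis unfolding eq by (simp add: dist_norm mult_ac)
      qed
      have c0y: "\<bar>?c \<bullet> (Zmat X0 *v u)\<bar> \<le> y * ?N"
      proof -
        have "\<bar>ctil i w \<bullet> (Zmat X0 *v u)\<bar> \<le> norm (ctil i w) * y" unfolding y_def by (rule Cauchy_Schwarz_ineq2)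
        also have "\<dots> \<le> ?N * y" using y by (intro mult_right_mono) auto
        finally show ?thesis unfolding cobs_Zmat by (simp add: mult_ac)
      qed
      have "\<bar>shat u p i X w - shat u p i X0 w\<bar>
          = \<bar>(?c \<bullet> (Zmat X *v u) - ?c \<bullet> (Zmat X0 *v u)) * ?K + (?c \<bullet> (Zmat X0 *v u)) * (?K - ?L)\<bar>"
        unfolding shat_def s_tilde_vec by (rule arg_cong[where f=abs, OF split])
      also have "\<dots> \<le> \<bar>?c \<bullet> (Zmat X *v u) - ?c \<bullet> (Zmat X0 *v u)\<bar> * \<bar>?K\<bar> + \<bar>?c \<bullet> (Zmat X0 *v u)\<bar> * \<bar>?K - ?L\<bar>"
        by (rule abs_le)
      also have "\<dots> \<le> (?dist * (norm u * ?N)) * ((b + d) * A * ?N) + (y * ?N) * (?dist * (d * A * ?N))"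
      proof (rule add_mono)
        show "\<bar>?c \<bullet> (Zmat X *v u) - ?c \<bullet> (Zmat X0 *v u)\<bar> * \<bar>?K\<bar> \<le> (?dist * (norm u * ?N)) * ((b + d) * A * ?N)"
          by (rule mult_mono[OF lin K]) simp_all
        show "\<bar>?c \<bullet> (Zmat X0 *v u)\<bar> * \<bar>?K - ?L\<bar> \<le> (y * ?N) * (?dist * (d * A * ?N))"
          by (rule mult_mono[OF c0y KK]) (simp_all add: y)
      qed
      also have "\<dots> = C * ?dist * ?N\<^sup>2" unfolding C_def by (rule arith)
      finally show "\<bar>shat u p i X w - shat u p i X0 w\<bar> \<le> C * ?dist * ?N\<^sup>2" .
    qed
  qed
  moreover have "C \<ge> 0" unfolding C_def using bd A(1) y by (intro add_nonneg_nonneg mult_nonneg_nonneg) auto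
  ultimately show ?thesis using that by blast
qed

lemma shat_approx:
  assumes min: "\<forall>\<^sub>F z in in_prob M. minimiser z (Xh z)"
  shows "((\<lambda>z. mean_upto (fst z) (\<lambda>i. (shat u p i (Xh z) (snd z) - shat u p i X0 (snd z))\<^sup>2)) \<longlongrightarrow> 0) (in_prob M)"
proof -
  have Xh: "(Xh \<longlongrightarrow> X0) (in_prob M)" by (rule minimiser_tendsto[OF min])
  obtain C where C: "C \<ge> 0" "\<forall>\<^sub>F X in nhds X0. \<forall>i\<ge>1. \<forall>w.
    \<bar>shat u p i X w - shat u p i X0 w\<bar> \<le> C * dist X X0 * (norm (a0 i) + norm (ctil i w))\<^sup>2"
    by (rule shat_lipschitz) (rule that; assumption)
  obtain A where A: "\<And>i m. 1 \<le> i \<Longrightarrow> i \<le> m \<Longrightarrow> psi i \<le> A m" "\<And>m. A m \<ge> 0" "(\<lambda>m. A m / real m) \<longlonglongrightarrow> 0"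
    by (rule psi_max) (rule that; assumption)
  obtain P where P: "P \<ge> 0" "\<And>m. mean_upto m psi \<le> P" by (rule psi_bound) (rule that; assumption)
  obtain K where K: "K \<ge> 1" "\<And>i. i \<ge> 1 \<Longrightarrow> expectation (err4 i) \<le> K" by (rule err4_bound) (rule that; assumption)
  \<comment> \<open>Chosen so that \<open>b m * sqrt m\<close> equals \<open>sqrt (A m)\<close>: the
    fourth powers of the norms of \<open>a0 i\<close> are at most \<open>A m * psi i\<close>, and
    the factor \<open>A m\<close> has to be compensated by the squared distance.\<close>
  define b where "b m = sqrt (A m / real m)" for m
  have b: "b \<longlonglongrightarrow> 0" "\<And>m. b m \<ge> 0"
    using tendsto_real_sqrt[OF A(3)] A(2) by (auto simp: b_def[abs_def])
  have r: "((\<lambda>z. b (fst z) * (sqrt (real (fst z)) * dist (Xh z) X0)) \<longlongrightarrow> 0) (in_prob M)"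
    by (rule rate[OF min b])
  have e4: "((\<lambda>z. (dist (Xh z) X0)\<^sup>2 * mean_upto (fst z) (\<lambda>i. err4 i (snd z))) \<longlongrightarrow> 0) (in_prob M)"
  proof (rule tendsto_in_prob_mult_bounded)
    have "((\<lambda>z. (dist (Xh z) X0)\<^sup>2) \<longlongrightarrow> (dist X0 X0)\<^sup>2) (in_prob M)" by (intro tendsto_intros Xh)
    then show "((\<lambda>z. (dist (Xh z) X0)\<^sup>2) \<longlongrightarrow> 0) (in_prob M)" by simp
    show "integrable M (\<lambda>w. mean_upto m (\<lambda>i. err4 i w))" for m
      unfolding mean_upto_def
      by (intro integrable_scaleR_right Bochner_Integration.integrable_sum err4_integrable) auto
    show "expectation (\<lambda>w. \<bar>mean_upto m (\<lambda>i. err4 i w)\<bar>) \<le> K" for m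
    proof -
      have abs: "\<bar>mean_upto m (\<lambda>i. err4 i w)\<bar> = mean_upto m (\<lambda>i. err4 i w)" for w
        by (intro abs_of_nonneg mean_upto_nonneg order_trans[OF zero_le_one err4_ge1])
      have "expectation (\<lambda>w. \<bar>mean_upto m (\<lambda>i. err4 i w)\<bar>) = mean_upto m (\<lambda>i. expectation (err4 i))"
        unfolding abs using err4_integrable by (simp add: mean_upto_def)
      also have "\<dots> \<le> mean_upto m (\<lambda>i. K)" by (intro mean_upto_mono K)
      also have "\<dots> \<le> K" using K(1) by (intro mean_upto_const_le) auto
      finally show ?thesis .
    qed
  qed
  have lim: "((\<lambda>z. C\<^sup>2 * 8 * ((b (fst z) * (sqrt (real (fst z)) * dist (Xh z) X0))\<^sup>2 * P +
     (dist (Xh z) X0)\<^sup>2 * mean_upto (fst z) (\<lambda>i. err4 i (snd z)))) \<longlongrightarrow> 0) (in_prob M)"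
    using tendsto_mult[OF tendsto_const[of "C\<^sup>2 * 8"] tendsto_add[OF tendsto_mult[OF tendsto_power[OF r, of 2] tendsto_const[of P]] e4]]
    by simp
  have evC: "\<forall>\<^sub>F z in in_prob M. \<forall>i\<ge>1. \<forall>w.
    \<bar>shat u p i (Xh z) w - shat u p i X0 w\<bar> \<le> C * dist (Xh z) X0 * (norm (a0 i) + norm (ctil i w))\<^sup>2"
    using Xh C(2) by (auto simp: filterlim_iff)
  show ?thesis
  proof (rule Lim_null_comparison[OF _ lim])
    show "\<forall>\<^sub>F z in in_prob M. norm (mean_upto (fst z) (\<lambda>i. (shat u p i (Xh z) (snd z) - shat u p i X0 (snd z))\<^sup>2))
      \<le> C\<^sup>2 * 8 * ((b (fst z) * (sqrt (real (fst z)) * dist (Xh z) X0))\<^sup>2 * P +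
          (dist (Xh z) X0)\<^sup>2 * mean_upto (fst z) (\<lambda>i. err4 i (snd z)))"
      using evC eventually_in_prob_deterministic[OF eventually_ge_at_top[of 1]]
    proof eventually_elim
      case (elim z)
      let ?D = "dist (Xh z) X0" and ?m = "fst z" and ?w = "snd z"
      have fourth_power: "(x + y) ^ 4 \<le> 8 * (x ^ 4 + y ^ 4)" for x y :: real
      proof -
        have "((x + y)\<^sup>2)\<^sup>2 \<le> (2 * (x\<^sup>2 + y\<^sup>2))\<^sup>2"
        proof (rule power_mono)
          have "0 \<le> (x - y)\<^sup>2" by simp
          then show "(x + y)\<^sup>2 \<le> 2 * (x\<^sup>2 + y\<^sup>2)" unfolding power2_sum power2_diff by (simp add: algebra_simps)
        qed simp
        also have "\<dots> \<le> 8 * ((x\<^sup>2)\<^sup>2 + (y\<^sup>2)\<^sup>2)"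
        proof -
          have "0 \<le> (x\<^sup>2 - y\<^sup>2)\<^sup>2" by simp
          then show ?thesis by (simp add: power2_sum power2_diff power_mult_distrib)
        qed
        finally show ?thesis by simp
      qed
      have pt: "(shat u p i (Xh z) ?w - shat u p i X0 ?w)\<^sup>2 \<le> C\<^sup>2 * 8 * (?D\<^sup>2 * A ?m * psi i + ?D\<^sup>2 * err4 i ?w)"
        if i: "1 \<le> i" "i \<le> ?m" for i
      proof -
        have "(shat u p i (Xh z) ?w - shat u p i X0 ?w)\<^sup>2 \<le> (C * ?D * (norm (a0 i) + norm (ctil i ?w))\<^sup>2)\<^sup>2"
          using elim(1) i(1) by (metis abs_ge_zero power2_abs power_mono)
        also have "\<dots> = C\<^sup>2 * ?D\<^sup>2 * (norm (a0 i) + norm (ctil i ?w)) ^ 4"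
          by (simp add: power_mult_distrib)
        also have "\<dots> \<le> C\<^sup>2 * ?D\<^sup>2 * (8 * (norm (a0 i) ^ 4 + norm (ctil i ?w) ^ 4))"
          by (intro mult_left_mono fourth_power) auto
        also have "\<dots> \<le> C\<^sup>2 * ?D\<^sup>2 * (8 * (A ?m * psi i + err4 i ?w))"
        proof -
          have "norm (a0 i) ^ 4 = (norm (a0 i))\<^sup>2 * (norm (a0 i))\<^sup>2" by (simp add: power4_eq_xxxx power2_eq_square)
          also have "\<dots> \<le> psi i * psi i" by (intro mult_mono) (auto simp: psi_def)
          also have "\<dots> \<le> A ?m * psi i" using A(1)[OF i] psi_ge1[of i] by (intro mult_right_mono) auto
          finally have "norm (a0 i) ^ 4 \<le> A ?m * psi i" .
          then show ?thesis by (intro mult_left_mono add_mono) (auto simp: err4_def)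
        qed
        finally show ?thesis by (simp add: algebra_simps)
      qed
      have "mean_upto ?m (\<lambda>i. (shat u p i (Xh z) ?w - shat u p i X0 ?w)\<^sup>2)
         \<le> mean_upto ?m (\<lambda>i. C\<^sup>2 * 8 * (?D\<^sup>2 * A ?m * psi i + ?D\<^sup>2 * err4 i ?w))"
        by (rule mean_upto_mono) (rule pt)
      also have "\<dots> = C\<^sup>2 * 8 * (?D\<^sup>2 * A ?m * mean_upto ?m psi + ?D\<^sup>2 * mean_upto ?m (\<lambda>i. err4 i ?w))"
        by (simp only: mean_upto_scale mean_upto_add)
      also have "\<dots> \<le> C\<^sup>2 * 8 * (?D\<^sup>2 * A ?m * P + ?D\<^sup>2 * mean_upto ?m (\<lambda>i. err4 i ?w))"
        using A(2)[of ?m] P(2) by (intro mult_left_mono add_right_mono) auto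
      also have "?D\<^sup>2 * A ?m = (b ?m * (sqrt (real ?m) * ?D))\<^sup>2"
        using A(2)[of ?m] elim(2) by (simp add: b_def power_mult_distrib)
      finally have "mean_upto ?m (\<lambda>i. (shat u p i (Xh z) ?w - shat u p i X0 ?w)\<^sup>2)
        \<le> C\<^sup>2 * 8 * ((b ?m * (sqrt (real ?m) * ?D))\<^sup>2 * P + ?D\<^sup>2 * mean_upto ?m (\<lambda>i. err4 i ?w))" .
      moreover have "0 \<le> mean_upto ?m (\<lambda>i. (shat u p i (Xh z) ?w - shat u p i X0 ?w)\<^sup>2)"
        by (rule mean_upto_nonneg) simp
      ultimately show ?case by simp
    qed
  qed
qed

end

section \<open>Limits of the nuisance estimators and of the sandwich matrix\<close>

lemma matrix_mult_outer: "A ** outer x y = outer (A *v x) y" for A :: "real^'n^'m"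
  by (simp add: outer_def matrix_matrix_mult_def matrix_vector_mult_def vec_eq_iff sum_distrib_left mult_ac)

lemma outer_mult_matrix: "outer x y ** A = outer x (transpose A *v y)" for A :: "real^'n^'m"
  by (simp add: outer_def matrix_matrix_mult_def matrix_vector_mult_def transpose_def vec_eq_iff
      sum_distrib_left mult_ac)

lemma linear_matrix_mult_left: "linear (\<lambda>A. A ** B)" for B :: "real^'n^'m"
  by (rule linearI)
    (simp_all add: vec_eq_iff matrix_matrix_mult_def sum.distrib algebra_simps sum_distrib_left)

lemma linear_upper_left: "linear (upper_left :: real^('n::finite + 'd::finite)^('n + 'd) \<Rightarrow> real^'n^'n)"
  by (rule linearI) (simp_all add: upper_left_def vec_eq_iff)

lemma tendsto_upper_left:
  fixes f :: "'z \<Rightarrow> real^('n::finite + 'd::finite)^('n + 'd)"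
  shows "(f \<longlongrightarrow> A) F \<Longrightarrow> ((\<lambda>x. upper_left (f x)) \<longlongrightarrow> upper_left A) F"
  unfolding upper_left_def by (intro tendsto_intros)

lemma cov_mat_linear_image:
  fixes f :: "'v \<Rightarrow> real^'n" and A :: "real^'n^'m"
  assumes f: "\<And>p. integrable N (\<lambda>v. f v $ p)" "\<And>p. (\<integral>v. f v $ p \<partial>N) = 0"
    and ff: "\<And>p q. integrable N (\<lambda>v. f v $ p * f v $ q)"
  shows "cov_mat N (\<lambda>v. A *v f v) = A ** (\<chi> p q. \<integral>v. f v $ p * f v $ q \<partial>N) ** transpose A"
proof -
  have mean: "(\<integral>v. (A *v f v) $ j \<partial>N) = 0" for j
    using f by (simp add: matrix_vector_mult_def)
  have "(\<integral>v. (A *v f v) $ j * (A *v f v) $ k \<partial>N)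
      = (A ** (\<chi> p q. \<integral>v. f v $ p * f v $ q \<partial>N) ** transpose A) $ j $ k" for j k
  proof -
    have "(A *v f v) $ j * (A *v f v) $ k = (\<Sum>q\<in>UNIV. \<Sum>p\<in>UNIV. A $ j $ p * A $ k $ q * (f v $ p * f v $ q))" for v
      unfolding matrix_vector_mult_def vec_lambda_beta sum_product by (subst sum.swap) (simp only: mult_ac)
    then have "(\<integral>v. (A *v f v) $ j * (A *v f v) $ k \<partial>N)
        = (\<Sum>q\<in>UNIV. \<Sum>p\<in>UNIV. A $ j $ p * A $ k $ q * (\<integral>v. f v $ p * f v $ q \<partial>N))"
      using ff by simp
    also have "\<dots> = (A ** (\<chi> p q. \<integral>v. f v $ p * f v $ q \<partial>N) ** transpose A) $ j $ k"
      by (simp add: matrix_matrix_mult_def transpose_def sum_distrib_left sum_distrib_right mult_ac)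
    finally show ?thesis .
  qed
  then show ?thesis unfolding cov_mat_def mean by (simp add: vec_eq_iff)
qed

context eiv
begin

text \<open>Every entry of \<open>c0\<close> is a fixed linear form \<open>xv p\<close> in
  \<open>a0\<close>, so the limit consists of the values of the form of \<open>V\<close> at these
  vectors. The kernel relation holds for each finite average and passes to the limit.\<close>

lemma design_lim:
  obtains C where "(\<lambda>m. mean_upto m (\<lambda>i. outer (c0 i) (c0 i))) \<longlonglongrightarrow> C" "upper_left C = V" "C ** Zmat X0 = 0"
proof -
  define xv :: "'n + 'd \<Rightarrow> real^'n" where
    "xv p = (case p of Inl k \<Rightarrow> axis k 1 | Inr j \<Rightarrow> column j X0)" for p
  have c0: "c0 i $ p = xv p \<bullet> a0 i" for i p
  proof (cases p)
    case (Inl k)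
    then show ?thesis by (simp add: c0_def stack_def xv_def inner_axis')
  next
    case (Inr j)
    then show ?thesis
      by (simp add: c0_def stack_def xv_def matrix_vector_mult_def transpose_def column_def inner_vec_def)
  qed
  define C where "C = (\<chi> p q. xv p \<bullet> (V *v xv q))"
  have lim: "(\<lambda>m. mean_upto m (\<lambda>i. outer (c0 i) (c0 i))) \<longlonglongrightarrow> C"
    by (rule matrix_tendstoI) (simp add: mean_upto_nth outer_def c0 C_def V_form)
  have ul: "upper_left C = V"
    by (simp add: vec_eq_iff upper_left_def C_def xv_def inner_axis' matrix_vector_mult_basis column_def)
  have "mean_upto m (\<lambda>i. outer (c0 i) (c0 i)) ** Zmat X0 = 0" for m
  proof -
    have "mean_upto m (\<lambda>i. outer (c0 i) (c0 i)) ** Zmat X0 = mean_upto m (\<lambda>i. outer (c0 i) (c0 i) ** Zmat X0)"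
      by (rule mean_upto_linear[OF linear_matrix_mult_left, symmetric])
    also have "(\<lambda>i. outer (c0 i) (c0 i) ** Zmat X0) = (\<lambda>i. 0)"
      unfolding outer_mult_matrix Zmat_c0 by (simp add: fun_eq_iff outer_def vec_eq_iff transpose_def matrix_vector_mult_def)
    finally show ?thesis by (simp add: mean_upto_def)
  qed
  with tendsto_matrix_mult[OF lim tendsto_const[of "Zmat X0"]] have "C ** Zmat X0 = 0"
    by (simp add: LIMSEQ_const_iff)
  with that lim ul show ?thesis by blast
qed

lemma moment_matrix_lim:
  assumes C: "(\<lambda>m. mean_upto m (\<lambda>i. outer (c0 i) (c0 i))) \<longlonglongrightarrow> C"
  shows "((\<lambda>z. mean_upto (fst z) (\<lambda>i. outer (cobs i (snd z)) (cobs i (snd z)))) \<longlongrightarrow> C + \<sigma>\<^sup>2 *\<^sub>R Sinf) (in_prob M)"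
proof (rule matrix_tendstoI)
  fix p q
  have Cpq: "(\<lambda>m. mean_upto m (\<lambda>i. c0 i $ p * c0 i $ q)) \<longlonglongrightarrow> C $ p $ q"
    using tendsto_vec_nth[OF tendsto_vec_nth[OF C, of p], of q] by (simp add: mean_upto_nth outer_def)
  have Spq: "(\<lambda>m. mean_upto m (\<lambda>i. \<sigma>\<^sup>2 * S i $ p $ q)) \<longlonglongrightarrow> \<sigma>\<^sup>2 * Sinf $ p $ q"
    by (intro mean_upto_tendsto tendsto_intros S_lim)
  have "((\<lambda>z. mean_upto (fst z) (\<lambda>i. c0 i $ p * c0 i $ q) + mean_upto (fst z) (\<lambda>i. \<sigma>\<^sup>2 * S i $ p $ q)
      + mean_upto (fst z) (\<lambda>i. obs_noise p q i (snd z))) \<longlongrightarrow> C $ p $ q + \<sigma>\<^sup>2 * Sinf $ p $ q + 0) (in_prob M)"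
    by (intro tendsto_add noise_avg noise_obs tendsto_in_prob_deterministic Cpq Spq)
  then show "((\<lambda>z. mean_upto (fst z) (\<lambda>i. outer (cobs i (snd z)) (cobs i (snd z))) $ p $ q)
      \<longlongrightarrow> (C + \<sigma>\<^sup>2 *\<^sub>R Sinf) $ p $ q) (in_prob M)"
    by (simp add: mean_upto_nth outer_def obs_noise_def mean_upto_diff)
qed

lemma mean_S_lim: "((\<lambda>z. mean_upto (fst z) S) \<longlongrightarrow> Sinf) (in_prob M)"
  by (rule tendsto_in_prob_deterministic[OF mean_upto_tendsto[OF S_lim]])

text \<open>The design part of the moment matrix is annihilated by \<open>Z_0\<close>, so only
  \<open>\<sigma>^2\<close> times the limit of \<open>Mmat\<close> survives, and the trace counts
  the dimension.\<close>

lemma sigma2_hat_lim: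
  assumes Xh: "(Xh \<longlongrightarrow> X0) (in_prob M)"
  shows "((\<lambda>z. sigma2_hat (fst z) (\<lambda>i. cobs i (snd z)) S (Xh z)) \<longlongrightarrow> \<sigma>\<^sup>2) (in_prob M)"
proof -
  obtain C where C: "(\<lambda>m. mean_upto m (\<lambda>i. outer (c0 i) (c0 i))) \<longlonglongrightarrow> C" "C ** Zmat X0 = 0"
    by (rule design_lim) (rule that; assumption)
  let ?L = "C + \<sigma>\<^sup>2 *\<^sub>R Sinf"
  have inv: "invertible (Mmat Sinf X0)" by (rule Mmat_inf_invertible[OF full0])
  have "transpose (Zmat X0) ** ?L ** Zmat X0 = transpose (Zmat X0) ** (C ** Zmat X0 + \<sigma>\<^sup>2 *\<^sub>R (Sinf ** Zmat X0))"
    by (simp only: matrix_mul_assoc[symmetric] linear_add[OF linear_matrix_mult_left] linear_cmul[OF linear_matrix_mult_left])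
  also have "\<dots> = \<sigma>\<^sup>2 *\<^sub>R Mmat Sinf X0"
    by (simp add: C(2) Mmat_def matrix_scalar_ac flip: matrix_mul_assoc scalar_matrix_assoc)
  finally have L: "transpose (Zmat X0) ** ?L ** Zmat X0 ** matrix_inv (Mmat Sinf X0) = \<sigma>\<^sup>2 *\<^sub>R mat 1"
    by (simp add: linear_cmul[OF linear_matrix_mult_left] matrix_inv_right[OF inv])
  have "((\<lambda>z. sigma2_hat (fst z) (\<lambda>i. cobs i (snd z)) S (Xh z)) \<longlongrightarrow>
      1 / real CARD('d) * trace (transpose (Zmat X0) ** ?L ** Zmat X0 ** matrix_inv (Mmat Sinf X0))) (in_prob M)"
    unfolding sigma2_hat_def Let_def Mmat_def
    by (intro tendsto_intros tendsto_trace tendsto_matrix_inv tendsto_Zmat Xh mean_S_lim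
        moment_matrix_lim[OF C(1)] inv[unfolded Mmat_def])
  moreover have "trace (\<sigma>\<^sup>2 *\<^sub>R (mat 1 :: real^'d^'d)) = \<sigma>\<^sup>2 * real CARD('d)"
    by (simp add: trace_def mat_def)
  ultimately show ?thesis unfolding L by simp
qed

text \<open>Errors in the regressors inflate their second moments by \<open>\<sigma>^2\<close> times
  a block of the limit of \<open>S\<close>; the subtracted term is a consistent estimate of exactly
  this excess.\<close>

lemma V_hat_lim:
  assumes Xh: "(Xh \<longlongrightarrow> X0) (in_prob M)"
  shows "((\<lambda>z. V_hat (fst z) (\<lambda>i. cobs i (snd z)) S (Xh z)) \<longlongrightarrow> V) (in_prob M)"
proof -
  obtain C where C: "(\<lambda>m. mean_upto m (\<lambda>i. outer (c0 i) (c0 i))) \<longlonglongrightarrow> C" "upper_left C = V"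
    by (rule design_lim) (rule that; assumption)
  have ul: "mean_upto m (\<lambda>i. outer (upper (x i)) (upper (x i))) = upper_left (mean_upto m (\<lambda>i. outer (x i) (x i)))"
    for m and x :: "nat \<Rightarrow> real^('n + 'd)"
  proof -
    have "(\<lambda>i. outer (upper (x i)) (upper (x i))) = (\<lambda>i. upper_left (outer (x i) (x i)))"
      by (simp add: fun_eq_iff outer_def upper_def upper_left_def vec_eq_iff)
    then show ?thesis by (simp only: mean_upto_linear[OF linear_upper_left])
  qed
  have "((\<lambda>z. V_hat (fst z) (\<lambda>i. cobs i (snd z)) S (Xh z)) \<longlongrightarrow>
      upper_left (C + \<sigma>\<^sup>2 *\<^sub>R Sinf) - \<sigma>\<^sup>2 *\<^sub>R upper_left Sinf) (in_prob M)"
    unfolding V_hat_def ul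
    by (intro tendsto_intros tendsto_upper_left sigma2_hat_lim[OF Xh] mean_S_lim moment_matrix_lim[OF C(1)])
  then show ?thesis by (simp add: linear_add[OF linear_upper_left] linear_cmul[OF linear_upper_left] C(2))
qed

text \<open>Two approximations in mean square are chained: from the estimated to the true parameter,
  and from \<open>S i\<close> to its limit.\<close>

lemma score_product_lim:
  fixes \<Gamma> :: "'v \<Rightarrow> (real^('n + 'd)^'n) \<times> (real^('n + 'd)^('n + 'd))"
  assumes N: "prob_space N" and \<Gamma>: "\<Gamma> \<in> borel_measurable N"
    and conv: "conv_in_distr M (\<lambda>m w. (1 / sqrt (real m)) *\<^sub>R (\<Sum>i=1..m. Wnoise i w)) N \<Gamma>"
    and min: "\<forall>\<^sub>F z in in_prob M. minimiser z (Xh z)"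
  shows "((\<lambda>z. mean_upto (fst z) (\<lambda>i. shat u p i (Xh z) (snd z) * shat u q i (Xh z) (snd z))) \<longlongrightarrow>
    (\<integral>v. Gfun u p (\<Gamma> v) * Gfun u q (\<Gamma> v) \<partial>N)) (in_prob M)"
proof -
  note prod = functional_product(2)[OF N \<Gamma> conv linear_Gfun noise_Gfun linear_Gfun noise_Gfun]
  have sq: "((\<lambda>z. mean_upto (fst z) (\<lambda>i. (Gfun u k (Wnoise i (snd z)))\<^sup>2)) \<longlongrightarrow>
    (\<integral>v. Gfun u k (\<Gamma> v) * Gfun u k (\<Gamma> v) \<partial>N)) (in_prob M)" for k
    unfolding power2_eq_square by (rule prod)
  have r: "((\<lambda>z. mean_upto (fst z) (\<lambda>i. (shat u k i (Xh z) (snd z) - Gfun u k (Wnoise i (snd z)))\<^sup>2)) \<longlongrightarrow> 0) (in_prob M)" for k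
  proof (rule Lim_null_comparison)
    show "((\<lambda>z. 2 * mean_upto (fst z) (\<lambda>i. (shat u k i (Xh z) (snd z) - shat u k i X0 (snd z))\<^sup>2)
       + 2 * mean_upto (fst z) (\<lambda>i. (shat u k i X0 (snd z) - Gfun u k (Wnoise i (snd z)))\<^sup>2)) \<longlongrightarrow> 0) (in_prob M)"
      using tendsto_add[OF tendsto_mult[OF tendsto_const[of 2] shat_approx[OF min]]
          tendsto_mult[OF tendsto_const[of 2] shat_true_approx]] by simp
    have sq_sum: "(x - y)\<^sup>2 \<le> 2 * (x - t)\<^sup>2 + 2 * (t - y)\<^sup>2" for x y t :: real
    proof -
      have "0 \<le> ((x - t) - (t - y))\<^sup>2" by simp
      then show ?thesis by (simp add: power2_eq_square algebra_simps)
    qed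
    show "\<forall>\<^sub>F z in in_prob M. norm (mean_upto (fst z) (\<lambda>i. (shat u k i (Xh z) (snd z) - Gfun u k (Wnoise i (snd z)))\<^sup>2)) \<le>
       2 * mean_upto (fst z) (\<lambda>i. (shat u k i (Xh z) (snd z) - shat u k i X0 (snd z))\<^sup>2)
       + 2 * mean_upto (fst z) (\<lambda>i. (shat u k i X0 (snd z) - Gfun u k (Wnoise i (snd z)))\<^sup>2)"
    proof (rule always_eventually, rule allI)
      fix z
      have "mean_upto (fst z) (\<lambda>i. (shat u k i (Xh z) (snd z) - Gfun u k (Wnoise i (snd z)))\<^sup>2) \<ge> 0"
        by (rule mean_upto_nonneg) simp
      then have "norm (mean_upto (fst z) (\<lambda>i. (shat u k i (Xh z) (snd z) - Gfun u k (Wnoise i (snd z)))\<^sup>2))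
         = mean_upto (fst z) (\<lambda>i. (shat u k i (Xh z) (snd z) - Gfun u k (Wnoise i (snd z)))\<^sup>2)" by simp
      also have "\<dots> \<le> mean_upto (fst z) (\<lambda>i. 2 * (shat u k i (Xh z) (snd z) - shat u k i X0 (snd z))\<^sup>2
         + 2 * (shat u k i X0 (snd z) - Gfun u k (Wnoise i (snd z)))\<^sup>2)"
        by (rule mean_upto_mono) (rule sq_sum)
      finally show "norm (mean_upto (fst z) (\<lambda>i. (shat u k i (Xh z) (snd z) - Gfun u k (Wnoise i (snd z)))\<^sup>2)) \<le>
         2 * mean_upto (fst z) (\<lambda>i. (shat u k i (Xh z) (snd z) - shat u k i X0 (snd z))\<^sup>2)
         + 2 * mean_upto (fst z) (\<lambda>i. (shat u k i X0 (snd z) - Gfun u k (Wnoise i (snd z)))\<^sup>2)"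
        by (simp only: mean_upto_scale mean_upto_add)
    qed
  qed
  show ?thesis by (rule mean_product_perturb[OF prod sq sq r r])
qed

text \<open>Since \<open>s u u^T s^T\<close> is the outer product of \<open>s u\<close> with itself,
  the middle factor converges entry by entry.\<close>

lemma S_hat_lim:
  fixes \<Gamma> :: "'v \<Rightarrow> (real^('n + 'd)^'n) \<times> (real^('n + 'd)^('n + 'd))"
  assumes N: "prob_space N" and \<Gamma>: "\<Gamma> \<in> borel_measurable N"
    and conv: "conv_in_distr M (\<lambda>m w. (1 / sqrt (real m)) *\<^sub>R (\<Sum>i=1..m. Wnoise i w)) N \<Gamma>"
    and min: "\<forall>\<^sub>F z in in_prob M. minimiser z (Xh z)"
  shows "((\<lambda>z. S_hat (fst z) (\<lambda>i. cobs i (snd z)) S u (Xh z)) \<longlongrightarrow>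
    matrix_inv V ** (\<chi> p q. \<integral>v. Gfun u p (\<Gamma> v) * Gfun u q (\<Gamma> v) \<partial>N) ** matrix_inv V) (in_prob M)"
proof -
  have Vh: "((\<lambda>z. V_hat (fst z) (\<lambda>i. cobs i (snd z)) S (Xh z)) \<longlongrightarrow> V) (in_prob M)"
    by (rule V_hat_lim[OF minimiser_tendsto[OF min]])
  have mid: "((\<lambda>z. mean_upto (fst z) (\<lambda>i. outer (s_tilde (upper (cobs i (snd z))) (lower (cobs i (snd z))) (S i) (Xh z) *v u)
     (s_tilde (upper (cobs i (snd z))) (lower (cobs i (snd z))) (S i) (Xh z) *v u)))
     \<longlongrightarrow> (\<chi> p q. \<integral>v. Gfun u p (\<Gamma> v) * Gfun u q (\<Gamma> v) \<partial>N)) (in_prob M)"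
    by (rule matrix_tendstoI)
      (use score_product_lim[OF N \<Gamma> conv min, of u] in \<open>simp add: mean_upto_nth outer_def shat_def\<close>)
  show ?thesis
    unfolding S_hat_def Let_def matrix_mult_outer outer_mult_matrix transpose_transpose
    by (intro tendsto_intros tendsto_matrix_inv[OF Vh V_inv] mid)
qed

lemma cov_mat_limit:
  fixes \<Gamma> :: "'v \<Rightarrow> (real^('n + 'd)^'n) \<times> (real^('n + 'd)^('n + 'd))"
  assumes N: "prob_space N" and \<Gamma>: "\<Gamma> \<in> borel_measurable N"
    and conv: "conv_in_distr M (\<lambda>m w. (1 / sqrt (real m)) *\<^sub>R (\<Sum>i=1..m. Wnoise i w)) N \<Gamma>"
  shows "cov_mat N (\<lambda>v. matrix_inv V *v (Gamma_at Sinf X0 (\<Gamma> v) *v u))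
    = matrix_inv V ** (\<chi> p q. \<integral>v. Gfun u p (\<Gamma> v) * Gfun u q (\<Gamma> v) \<partial>N) ** matrix_inv V"
proof -
  interpret N: prob_space N by (rule N)
  have meas: "(\<lambda>v. Gfun u p (\<Gamma> v)) \<in> borel_measurable N" for p
    by (rule measurable_compose[OF \<Gamma>])
      (intro borel_measurable_continuous_onI linear_continuous_on linear_conv_bounded_linear[THEN iffD1] linear_Gfun)
  have "cov_mat N (\<lambda>v. matrix_inv V *v (Gamma_at Sinf X0 (\<Gamma> v) *v u))
    = matrix_inv V ** (\<chi> p q. \<integral>v. Gfun u p (\<Gamma> v) * Gfun u q (\<Gamma> v) \<partial>N) ** transpose (matrix_inv V)"
    unfolding Gfun_def
  proof (rule cov_mat_linear_image; unfold Gfun_def[symmetric])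
    fix p q
    show "integrable N (\<lambda>v. Gfun u p (\<Gamma> v))"
      by (rule N.square_integrable_imp_integrable[OF meas functional_second_moment(1)[OF N \<Gamma> conv linear_Gfun noise_Gfun]])
    show "(\<integral>v. Gfun u p (\<Gamma> v) \<partial>N) = 0"
      by (rule functional_second_moment(2)[OF N \<Gamma> conv linear_Gfun noise_Gfun])
    show "integrable N (\<lambda>v. Gfun u p (\<Gamma> v) * Gfun u q (\<Gamma> v))"
      by (rule functional_product(1)[OF N \<Gamma> conv linear_Gfun noise_Gfun linear_Gfun noise_Gfun])
  qed
  then show ?thesis by (simp add: transpose_matrix_inv[OF V_inv] V_sym)
qed

lemma S_hat_consistent:
  fixes \<Gamma> :: "'v \<Rightarrow> (real^('n + 'd)^'n) \<times> (real^('n + 'd)^('n + 'd))" and Shat :: "nat \<Rightarrow> 'w \<Rightarrow> real^'n^'n"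
  assumes est: "ewtls_estimator \<iota> \<Sigma> est"
    and N: "prob_space N" and \<Gamma>: "\<Gamma> \<in> borel_measurable N"
    and conv: "conv_in_distr M (\<lambda>m w. (1 / sqrt (real m)) *\<^sub>R (\<Sum>i=1..m. Wnoise i w)) N \<Gamma>"
    and Shat_rv: "\<And>m. m \<ge> 1 \<Longrightarrow> Shat m \<in> borel_measurable M"
    and Shat: "\<And>m w X. m \<ge> 1 \<Longrightarrow> w \<in> space M \<Longrightarrow> est m (\<lambda>i\<in>{1..m}. cobs i w) = Some X \<Longrightarrow>
          invertible (V_hat m (\<lambda>i. cobs i w) S X) \<Longrightarrow> Shat m w = S_hat m (\<lambda>i. cobs i w) S u X"
  shows "conv_in_prob M Shat (cov_mat N (\<lambda>v. matrix_inv V *v (Gamma_at Sinf X0 (\<Gamma> v) *v u)))"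
proof (rule conv_in_prob_if_tendsto[OF Shat_rv])
  \<comment> \<open>Where the estimator is infinite, \<open>X0\<close> serves as a dummy value;
    eventually along the filter a minimiser exists and this case does not occur.\<close>
  define Xh where "Xh z = (case est (fst z) (\<lambda>i\<in>{1..fst z}. cobs i (snd z)) of Some X \<Rightarrow> X | None \<Rightarrow> X0)" for z
  have m1: "\<forall>\<^sub>F z in in_prob M. fst z \<ge> 1"
    by (rule eventually_in_prob_deterministic[OF eventually_ge_at_top])
  have ev: "\<forall>\<^sub>F z in in_prob M. est (fst z) (\<lambda>i\<in>{1..fst z}. cobs i (snd z)) = Some (Xh z) \<and> minimiser z (Xh z)"
    using eventually_minimiser m1
  proof eventually_elim
    case (elim z)
    let ?C = "\<lambda>i\<in>{1..fst z}. cobs i (snd z)"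
    have "?C \<in> space (PiM {1..fst z} (\<lambda>_. borel))" by (simp add: space_PiM)
    then have *: "case est (fst z) ?C of Some X \<Rightarrow> ewtls_solution \<iota> \<Sigma> (fst z) ?C X
        | None \<Rightarrow> \<not> (\<exists>X. ewtls_solution \<iota> \<Sigma> (fst z) ?C X)"
      using est elim(2) unfolding ewtls_estimator_def by blast
    have sol: "ewtls_solution \<iota> \<Sigma> (fst z) ?C X \<longleftrightarrow> minimiser z X" for X
      using solution_iff_minimiser[OF elim(2), of "snd z" X] by simp
    show ?case using * elim(1) unfolding sol by (auto simp: Xh_def split: option.splits)
  qed
  then have min: "\<forall>\<^sub>F z in in_prob M. minimiser z (Xh z)" by eventually_elim simp
  have inv: "\<forall>\<^sub>F z in in_prob M. invertible (V_hat (fst z) (\<lambda>i. cobs i (snd z)) S (Xh z))"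
    by (rule eventually_invertible[OF V_hat_lim[OF minimiser_tendsto[OF min]] V_inv])
  have eq: "\<forall>\<^sub>F z in in_prob M. S_hat (fst z) (\<lambda>i. cobs i (snd z)) S u (Xh z) = Shat (fst z) (snd z)"
    using ev inv m1 eventually_in_prob_space by eventually_elim (use Shat in auto)
  show "((\<lambda>z. Shat (fst z) (snd z)) \<longlongrightarrow> cov_mat N (\<lambda>v. matrix_inv V *v (Gamma_at Sinf X0 (\<Gamma> v) *v u))) (in_prob M)"
    unfolding cov_mat_limit[OF N \<Gamma> conv]
    by (rule Lim_transform_eventually[OF S_hat_lim[OF N \<Gamma> conv min] eq])
qed

end

section \<open>From moment bounds to uniform integrability\<close>

lemma norm_powr_le_sum:
  fixes x :: "real^'k"
  assumes "r \<ge> 0"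
  shows "norm x powr r \<le> real CARD('k) powr r * (\<Sum>p\<in>UNIV. \<bar>x $ p\<bar> powr r)"
proof -
  have "Max (range (\<lambda>q. \<bar>x $ q\<bar>)) \<in> range (\<lambda>q. \<bar>x $ q\<bar>)" by (rule Max_in) auto
  then obtain p where p: "Max (range (\<lambda>q. \<bar>x $ q\<bar>)) = \<bar>x $ p\<bar>" by (rule rangeE)
  have "\<bar>x $ q\<bar> \<le> \<bar>x $ p\<bar>" for q unfolding p[symmetric] by (rule Max_ge) auto
  then have "norm x \<le> real CARD('k) * \<bar>x $ p\<bar>"
    using order_trans[OF norm_le_l1_cart sum_bounded_above[of UNIV "\<lambda>q. \<bar>x $ q\<bar>" "\<bar>x $ p\<bar>"]] by simp
  then have "norm x powr r \<le> (real CARD('k) * \<bar>x $ p\<bar>) powr r"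
    by (intro powr_mono2 assms) auto
  also have "\<dots> = real CARD('k) powr r * \<bar>x $ p\<bar> powr r" by (simp add: powr_mult)
  also have "\<dots> \<le> real CARD('k) powr r * (\<Sum>p\<in>UNIV. \<bar>x $ p\<bar> powr r)"
    by (intro mult_left_mono member_le_sum) auto
  finally show ?thesis .
qed

lemma fourth_power_le_powr:
  fixes y :: real
  assumes "y \<ge> 0" "\<delta> > 0"
  shows "y ^ 4 \<le> 1 + y powr (4 + 2 * \<delta>)"
proof (cases "y \<le> 1")
  case True
  then have "y ^ 4 \<le> 1" using assms(1) by (simp add: power_le_one)
  then show ?thesis by (simp add: add_increasing2)
next
  case False
  then have "y ^ 4 = y powr 4" by (simp add: powr_numeral)
  also have "\<dots> \<le> y powr (4 + 2 * \<delta>)" using False assms(2) by (intro powr_mono) auto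
  finally show ?thesis by simp
qed

text \<open>The surplus moment is spent on the tail: \<open>y^(2 \<delta>)\<close> is
  \<open>(y^4)^(\<delta> / 2)\<close>, which is at least \<open>t^(\<delta> / 2)\<close>
  there.\<close>

lemma fourth_power_tail_le:
  fixes y t :: real
  assumes y: "y \<ge> 0" "y ^ 4 > t" and \<delta>: "\<delta> > 0" and t: "t > 0"
  shows "y ^ 4 \<le> t powr (- (\<delta> / 2)) * y powr (4 + 2 * \<delta>)"
proof -
  have y0: "y > 0" using y t by (cases "y = 0") auto
  have y4: "y ^ 4 = y powr 4" using y0 by (simp add: powr_numeral)
  have "(y ^ 4) powr (\<delta> / 2) = y powr (2 * \<delta>)" unfolding y4 powr_powr by simp
  then have eq: "y powr (4 + 2 * \<delta>) = y ^ 4 * (y ^ 4) powr (\<delta> / 2)"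
    unfolding powr_add y4[symmetric] by simp
  have "t powr (\<delta> / 2) \<le> (y ^ 4) powr (\<delta> / 2)" using y(2) t \<delta> by (intro powr_mono2) auto
  then have "y ^ 4 * t powr (\<delta> / 2) \<le> y powr (4 + 2 * \<delta>)"
    unfolding eq by (rule mult_left_mono) simp
  then have "y ^ 4 \<le> y powr (4 + 2 * \<delta>) / t powr (\<delta> / 2)" using t by (simp add: pos_le_divide_eq)
  then show ?thesis by (simp only: powr_minus divide_inverse mult.commute)
qed

context prob_space
begin

lemma square_zero_AE:
  fixes X :: "'a \<Rightarrow> real"
  assumes "integrable M (\<lambda>w. (X w)\<^sup>2)" "expectation (\<lambda>w. (X w)\<^sup>2) = 0"
  shows "AE w in M. X w = 0"
  using integral_nonneg_eq_0_iff_AE[OF assms(1)] assms(2) by simp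

text \<open>The bounds are put in terms of nonnegative integrals because integrability is part of
  what has to be concluded from them.\<close>

lemma uniform_fourth_moments:
  fixes X :: "nat \<Rightarrow> 'a \<Rightarrow> real^'k"
  assumes X: "\<And>i. i \<ge> 1 \<Longrightarrow> X i \<in> borel_measurable M" and \<delta>: "\<delta> > 0"
    and K: "\<And>i p. i \<ge> 1 \<Longrightarrow> (\<integral>\<^sup>+w. ennreal (\<bar>X i w $ p\<bar> powr (4 + 2 * \<delta>)) \<partial>M) \<le> ennreal K" "K \<ge> 0"
  shows "i \<ge> 1 \<Longrightarrow> integrable M (\<lambda>w. norm (X i w) ^ 4)"
    and "e > 0 \<Longrightarrow> \<exists>t. \<forall>i\<ge>1. expectation (\<lambda>w. norm (X i w) ^ 4 * indicator {w. norm (X i w) ^ 4 > t} w) \<le> e"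
proof -
  define r where "r = 4 + 2 * \<delta>"
  define C where "C = real CARD('k) powr r * (real CARD('k) * K)"
  have bound: "(\<integral>\<^sup>+w. ennreal (norm (X i w) powr r) \<partial>M) \<le> ennreal C" if i: "i \<ge> 1" for i
  proof -
    note [measurable] = X[OF i]
    have "(\<integral>\<^sup>+w. ennreal (norm (X i w) powr r) \<partial>M)
        \<le> (\<integral>\<^sup>+w. ennreal (real CARD('k) powr r) * (\<Sum>p\<in>UNIV. ennreal (\<bar>X i w $ p\<bar> powr r)) \<partial>M)"
    proof (rule nn_integral_mono)
      fix w
      have "norm (X i w) powr r \<le> real CARD('k) powr r * (\<Sum>p\<in>UNIV. \<bar>X i w $ p\<bar> powr r)"
        by (rule norm_powr_le_sum) (use \<delta> in \<open>simp add: r_def\<close>)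
      then show "ennreal (norm (X i w) powr r)
          \<le> ennreal (real CARD('k) powr r) * (\<Sum>p\<in>UNIV. ennreal (\<bar>X i w $ p\<bar> powr r))"
        by (simp add: ennreal_leI sum_nonneg flip: ennreal_mult)
    qed
    also have "\<dots> = ennreal (real CARD('k) powr r) * (\<Sum>p\<in>UNIV. \<integral>\<^sup>+w. ennreal (\<bar>X i w $ p\<bar> powr r) \<partial>M)"
      by (subst nn_integral_cmult, measurable, subst nn_integral_sum) auto
    also have "\<dots> \<le> ennreal (real CARD('k) powr r) * (\<Sum>p\<in>(UNIV :: 'k set). ennreal K)"
      unfolding r_def by (intro mult_left_mono sum_mono K i) auto
    also have "\<dots> = ennreal C" using K(2) by (simp add: C_def ennreal_mult ennreal_of_nat_eq_real_of_nat)
    finally show ?thesis .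
  qed
  have int: "integrable M (\<lambda>w. norm (X i w) powr r)" if i: "i \<ge> 1" for i
  proof (rule integrableI_nonneg)
    show "(\<lambda>w. norm (X i w) powr r) \<in> borel_measurable M" using X[OF i] by measurable
    show "(\<integral>\<^sup>+w. ennreal (norm (X i w) powr r) \<partial>M) < \<infinity>"
      by (rule le_less_trans[OF bound[OF i]]) simp
  qed simp
  have C0: "C \<ge> 0" by (simp add: C_def K(2))
  have E: "expectation (\<lambda>w. norm (X i w) powr r) \<le> C" if i: "i \<ge> 1" for i
    using bound[OF i] by (simp add: nn_integral_eq_integral[OF int[OF i]] C0)
  show i4: "integrable M (\<lambda>w. norm (X i w) ^ 4)" if i: "i \<ge> 1" for i
  proof (rule Bochner_Integration.integrable_bound)
    show "integrable M (\<lambda>w. 1 + norm (X i w) powr r)" using int[OF i] by simp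
    show "(\<lambda>w. norm (X i w) ^ 4) \<in> borel_measurable M" using X[OF i] by measurable
    show "AE w in M. norm (norm (X i w) ^ 4) \<le> norm (1 + norm (X i w) powr r)"
    proof (rule AE_I2)
      fix w
      show "norm (norm (X i w) ^ 4) \<le> norm (1 + norm (X i w) powr r)"
        using fourth_power_le_powr[OF norm_ge_zero[of "X i w"] \<delta>] by (simp add: r_def)
    qed
  qed
  show "\<exists>t. \<forall>i\<ge>1. expectation (\<lambda>w. norm (X i w) ^ 4 * indicator {w. norm (X i w) ^ 4 > t} w) \<le> e" if e: "e > 0"
  proof -
    have "((\<lambda>t. t powr (- (\<delta> / 2)) * C) \<longlongrightarrow> 0 * C) at_top"
      using \<delta> by (intro tendsto_mult tendsto_const tendsto_neg_powr filterlim_ident) auto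
    then have "\<forall>\<^sub>F t in at_top. t powr (- (\<delta> / 2)) * C < e" using e by (auto dest: order_tendstoD)
    then have "\<forall>\<^sub>F t in at_top. t powr (- (\<delta> / 2)) * C < e \<and> t > 0"
      using eventually_gt_at_top[of 0] by eventually_elim simp
    then have "\<exists>t. t powr (- (\<delta> / 2)) * C < e \<and> t > 0"
      by (rule eventually_happens'[OF trivial_limit_at_top_linorder])
    then obtain t where t: "t powr (- (\<delta> / 2)) * C < e" "t > 0" by (elim exE conjE)
    have "expectation (\<lambda>w. norm (X i w) ^ 4 * indicator {w. norm (X i w) ^ 4 > t} w) \<le> e" if i: "i \<ge> 1" for i
    proof -
      note [measurable] = X[OF i]
      have "expectation (\<lambda>w. norm (X i w) ^ 4 * indicator {w. norm (X i w) ^ 4 > t} w)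
          \<le> expectation (\<lambda>w. t powr (- (\<delta> / 2)) * norm (X i w) powr r)"
      proof (rule integral_mono)
        show "integrable M (\<lambda>w. norm (X i w) ^ 4 * indicator {w. norm (X i w) ^ 4 > t} w)"
          by (rule Bochner_Integration.integrable_bound[OF i4[OF i]]) (auto simp: indicator_def)
        show "integrable M (\<lambda>w. t powr (- (\<delta> / 2)) * norm (X i w) powr r)" using int[OF i] by simp
        show "norm (X i w) ^ 4 * indicator {w. norm (X i w) ^ 4 > t} w \<le> t powr (- (\<delta> / 2)) * norm (X i w) powr r" for w
          using fourth_power_tail_le[OF norm_ge_zero _ \<delta> t(2), of "X i w"] by (simp add: r_def indicator_def)
      qed
      also have "\<dots> \<le> t powr (- (\<delta> / 2)) * C" using E[OF i] by (simp add: mult_left_mono)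
      finally show ?thesis using t(1) by simp
    qed
    then show ?thesis by (intro exI[of _ t]) simp
  qed
qed

end

section \<open>The hypotheses as an instance of the errors-in-variables model\<close>

theorem lemma9:
  fixes M :: "'w measure"
    and X0 :: "real^'d::finite^'n::finite"
    and a0 :: "nat \<Rightarrow> real^'n"
    and ctil c :: "nat \<Rightarrow> 'w \<Rightarrow> real^('n + 'd)"
    and J :: "('n + 'd) set" and \<iota> :: "'j::finite \<Rightarrow> 'n + 'd"
    and \<sigma> :: real and \<Sigma> :: "nat \<Rightarrow> real^'j^'j" and \<Sigma>inf :: "real^'j^'j"
    and S :: "nat \<Rightarrow> real^('n + 'd)^('n + 'd)"
    and V\<^sub>A :: "real^'n^'n"
    and \<mu>4 :: "'n + 'd \<Rightarrow> 'n + 'd \<Rightarrow> 'n + 'd \<Rightarrow> 'n + 'd \<Rightarrow> real"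
    and est :: "nat \<Rightarrow> (nat \<Rightarrow> real^('n + 'd)) \<Rightarrow> (real^'d^'n) option"
    and N :: "'v measure"
    and \<Gamma> :: "'v \<Rightarrow> (real^('n + 'd)^'n) \<times> (real^('n + 'd)^('n + 'd))"
    and u :: "real^'d"
    and Shat :: "nat \<Rightarrow> 'w \<Rightarrow> real^'n^'n"
  assumes M: "prob_space M"
    and c: "\<And>i w. c i w = stack (a0 i) (transpose X0 *v a0 i) + ctil i w"
    and S: "\<And>i. S i = (1 / \<sigma>\<^sup>2) *\<^sub>R cov_mat M (ctil i)"
    and J: "bij_betw \<iota> UNIV J"
    and indep: "prob_space.indep_vars M (\<lambda>_. borel) ctil {1..}"
    and second_moment: "\<And>i. i \<ge> 1 \<Longrightarrow> integrable M (\<lambda>w. (norm (ctil i w))\<^sup>2)"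
    and mean_zero: "\<And>i. i \<ge> 1 \<Longrightarrow> (\<integral>w. ctil i w \<partial>M) = 0"
    and error_free: "\<And>i j. i \<ge> 1 \<Longrightarrow> j \<notin> J \<Longrightarrow> (\<integral>w. (ctil i w $ j)\<^sup>2 \<partial>M) = 0"
    and \<sigma>: "\<sigma> > 0"
    and cov: "\<And>i. i \<ge> 1 \<Longrightarrow> cov_mat M (\<lambda>w. subrows \<iota> (ctil i w)) = \<sigma>\<^sup>2 *\<^sub>R \<Sigma> i"
    and eig: "\<exists>\<kappa>>0. \<forall>i\<ge>1. lambda_min (\<Sigma> i) \<ge> \<kappa>\<^sup>2"
    and rank_Z0: "rank (subrows \<iota> (Zmat X0)) = CARD('d)"
    and moments_r: "\<exists>r::real. r \<ge> 2 \<and>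
          r > real CARD('d) * (real (card J) - (real CARD('d) + 1) / 2) \<and>
          (SUP i\<in>{1..}. SUP j\<in>J. \<integral>\<^sup>+w. ennreal (\<bar>ctil i w $ j\<bar> powr (2 * r)) \<partial>M) < \<infinity>"
    and moments_\<delta>: "\<exists>\<delta>::real. \<delta> > 0 \<and>
          (SUP i\<in>{1..}. SUP j\<in>J. \<integral>\<^sup>+w. ennreal (\<bar>ctil i w $ j\<bar> powr (4 + 2 * \<delta>)) \<partial>M) < \<infinity> \<and>
          (\<lambda>m. 1 / (real m powr (1 + \<delta> / 2)) * (\<Sum>i=1..m. norm (a0 i) powr (2 + \<delta>))) \<longlonglongrightarrow> 0"
    and V\<^sub>A: "(\<lambda>m. mean_upto m (\<lambda>i. outer (a0 i) (a0 i))) \<longlonglongrightarrow> V\<^sub>A" "invertible V\<^sub>A"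
    and \<Sigma>inf: "\<Sigma> \<longlonglongrightarrow> \<Sigma>inf"
    and third: "\<And>i p q r. i \<ge> 1 \<Longrightarrow> p \<in> J \<Longrightarrow> q \<in> J \<Longrightarrow> r \<in> J \<Longrightarrow>
          (\<integral>w. ctil i w $ p * ctil i w $ q * ctil i w $ r \<partial>M) = 0"
    and fourth: "\<And>p q r v. p \<in> J \<Longrightarrow> q \<in> J \<Longrightarrow> r \<in> J \<Longrightarrow> v \<in> J \<Longrightarrow>
          (\<lambda>m. mean_upto m (\<lambda>i. \<integral>w. ctil i w $ p * ctil i w $ q * ctil i w $ r * ctil i w $ v \<partial>M))
            \<longlonglongrightarrow> \<mu>4 p q r v"
    \<comment> \<open>the estimator\<close>
    and est: "ewtls_estimator \<iota> \<Sigma> est"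
    \<comment> \<open>the limit in distribution of the normalized sums; the convergence determines its law\<close>
    and N: "prob_space N" and \<Gamma>_rv: "\<Gamma> \<in> borel_measurable N"
    and \<Gamma>: "conv_in_distr M
          (\<lambda>m w. (1 / sqrt (real m)) *\<^sub>R
             (\<Sum>i=1..m. (outer (a0 i) (ctil i w),
                         outer (ctil i w) (ctil i w) - \<sigma>\<^sup>2 *\<^sub>R S i)))
          N \<Gamma>"
    and u: "u \<noteq> 0"
    \<comment> \<open>arbitrary values where the estimator is infinite or \<open>V_hat\<close> is singular\<close>
    and Shat_rv: "\<And>m. m \<ge> 1 \<Longrightarrow> Shat m \<in> borel_measurable M"
    and Shat: "\<And>m w X. m \<ge> 1 \<Longrightarrow> w \<in> space M \<Longrightarrow>
          est m (\<lambda>i\<in>{1..m}. c i w) = Some X \<Longrightarrow>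
          invertible (V_hat m (\<lambda>i. c i w) S X) \<Longrightarrow>
          Shat m w = S_hat m (\<lambda>i. c i w) S u X"
  shows "conv_in_prob M Shat
          (cov_mat N (\<lambda>v. matrix_inv V\<^sub>A *v (Gamma_at (lim S) X0 (\<Gamma> v) *v u)))"
proof -
  interpret prob_space M by (rule M)
  have inj: "inj \<iota>" and range: "range \<iota> = J" using J by (auto simp: bij_betw_def)
  have meas: "ctil i \<in> borel_measurable M" if "i \<ge> 1" for i
    using indep that by (auto simp: indep_vars_def)
  have measp [measurable]: "(\<lambda>w. ctil i w $ p) \<in> borel_measurable M" if "i \<ge> 1" for i p
    by (rule measurable_compose[OF meas[OF that]]) auto
  have sq: "integrable M (\<lambda>w. (ctil i w $ p)\<^sup>2)" if i: "i \<ge> 1" for i p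
  proof (rule Bochner_Integration.integrable_bound[OF second_moment[OF i]])
    show "(\<lambda>w. (ctil i w $ p)\<^sup>2) \<in> borel_measurable M" using i by measurable
    have "(ctil i w $ p)\<^sup>2 \<le> (norm (ctil i w))\<^sup>2" for w
      unfolding abs_le_square_iff[symmetric] using component_le_norm_cart[of "ctil i w" p] by simp
    then show "AE w in M. norm ((ctil i w $ p)\<^sup>2) \<le> norm ((norm (ctil i w))\<^sup>2)" by simp
  qed
  have mean0: "expectation (\<lambda>w. ctil i w $ p) = 0" if i: "i \<ge> 1" for i p
  proof -
    have "integrable M (\<lambda>w. norm (ctil i w))"
      by (rule square_integrable_imp_integrable) (use meas[OF i] second_moment[OF i] in auto)
    then have "integrable M (ctil i)" using meas[OF i] by (simp add: integrable_norm_iff)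
    from integral_bounded_linear[OF bounded_linear_vec_nth[of p] this] show ?thesis
      by (simp add: mean_zero[OF i])
  qed
  have second: "expectation (\<lambda>w. ctil i w $ p * ctil i w $ q) = \<sigma>\<^sup>2 * S i $ p $ q" if i: "i \<ge> 1" for i p q
    using \<sigma> by (simp add: S cov_mat_def mean0[OF i])
  have outside: "AE w in M. ctil i w $ p = 0" if i: "i \<ge> 1" and p: "p \<notin> range \<iota>" for i p
    by (rule square_zero_AE[OF sq[OF i]]) (use error_free[OF i, of p] p range in simp)
  \<comment> \<open>Centred errors turn both covariance matrices into second moment matrices, so
    dividing by \<open>\<sigma>^2\<close> identifies \<open>\<Sigma> i\<close> with a block of
    \<open>S i\<close>.\<close>
  have S_in: "S i $ \<iota> k $ \<iota> l = \<Sigma> i $ k $ l" if i: "i \<ge> 1" for i k l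
  proof -
    have "cov_mat M (\<lambda>w. subrows \<iota> (ctil i w)) $ k $ l = \<sigma>\<^sup>2 * S i $ \<iota> k $ \<iota> l"
      by (simp add: cov_mat_def subrows_def mean0[OF i] second[OF i])
    then show ?thesis using \<sigma> by (simp add: cov[OF i])
  qed
  have S_sym: "S i $ p $ q = S i $ q $ p" if i: "i \<ge> 1" for i p q
    using second[OF i, of p q] second[OF i, of q p] \<sigma> by (simp add: mult.commute)
  have S_out: "S i $ p $ q = 0" if i: "i \<ge> 1" and p: "p \<notin> range \<iota>" for i p q
  proof -
    have "expectation (\<lambda>w. ctil i w $ p * ctil i w $ q) = expectation (\<lambda>w. 0)"
      by (rule integral_cong_AE) (use outside[OF i p] i in auto)
    then show ?thesis using second[OF i, of p q] \<sigma> by simp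
  qed
  have pad: "padded \<iota> (\<Sigma> i) (S i)" if i: "i \<ge> 1" for i
    unfolding padded_def
  proof (intro conjI allI impI)
    show "S i $ \<iota> k $ \<iota> l = \<Sigma> i $ k $ l" for k l by (rule S_in[OF i])
    show "S i $ p $ q = 0" if "p \<notin> range \<iota> \<or> q \<notin> range \<iota>" for p q
      using that S_out[OF i, of p q] S_out[OF i, of q p] S_sym[OF i, of p q] by auto
  qed
  have \<Sigma>_sym: "transpose (\<Sigma> i) = \<Sigma> i" if i: "i \<ge> 1" for i
    using S_sym[OF i] by (simp add: vec_eq_iff transpose_def flip: S_in[OF i])
  obtain \<kappa> where \<kappa>: "\<kappa> > 0" "\<And>i. i \<ge> 1 \<Longrightarrow> lambda_min (\<Sigma> i) \<ge> \<kappa>\<^sup>2" using eig by blast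
  have low: "\<kappa>\<^sup>2 * (norm x)\<^sup>2 \<le> x \<bullet> (\<Sigma> i *v x)" if i: "i \<ge> 1" for i x
    by (rule order_trans[OF mult_right_mono[OF \<kappa>(2)[OF i]] lambda_min_le[OF \<Sigma>_sym[OF i]]]) simp
  \<comment> \<open>The limit is written down explicitly, by padding \<open>\<Sigma>inf\<close> with
    zeros, because convergence of \<open>S\<close> has to be derived from that of
    \<open>\<Sigma>\<close>.\<close>
  define Sinf where "Sinf = (\<chi> p q. if p \<in> range \<iota> \<and> q \<in> range \<iota>
    then \<Sigma>inf $ inv \<iota> p $ inv \<iota> q else 0)"
  have S_lim: "S \<longlonglongrightarrow> Sinf"
  proof (rule matrix_tendstoI)
    fix p q
    have "(\<lambda>i. if p \<in> range \<iota> \<and> q \<in> range \<iota> then \<Sigma> i $ inv \<iota> p $ inv \<iota> q else 0) \<longlonglongrightarrow> Sinf $ p $ q"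
      by (auto simp: Sinf_def intro!: tendsto_intros \<Sigma>inf)
    moreover have "\<forall>\<^sub>F i in sequentially. (if p \<in> range \<iota> \<and> q \<in> range \<iota> then \<Sigma> i $ inv \<iota> p $ inv \<iota> q else 0) = S i $ p $ q"
      using eventually_ge_at_top[of 1]
    proof eventually_elim
      case (elim i)
      show ?case
      proof (cases "p \<in> range \<iota> \<and> q \<in> range \<iota>")
        case True
        then show ?thesis using S_in[OF elim, of "inv \<iota> p" "inv \<iota> q"] by (simp add: f_inv_into_f)
      next
        case False
        then have "S i $ p $ q = 0" using S_out[OF elim, of p q] S_out[OF elim, of q p] S_sym[OF elim, of p q] by auto
        then show ?thesis using False by auto
      qed
    qed
    ultimately show "(\<lambda>i. S i $ p $ q) \<longlonglongrightarrow> Sinf $ p $ q" by (rule Lim_transform_eventually)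
  qed
  obtain \<delta> where \<delta>: "\<delta> > 0"
    and sup: "(SUP i\<in>{1..}. SUP j\<in>J. \<integral>\<^sup>+w. ennreal (\<bar>ctil i w $ j\<bar> powr (4 + 2 * \<delta>)) \<partial>M) < \<infinity>"
    using moments_\<delta> by blast
  define K where "K = enn2real (SUP i\<in>{1..}. SUP j\<in>J. \<integral>\<^sup>+w. ennreal (\<bar>ctil i w $ j\<bar> powr (4 + 2 * \<delta>)) \<partial>M)"
  \<comment> \<open>The supremum covers the coordinates in \<open>J\<close>; the others vanish
    almost surely, so one constant serves all coordinates.\<close>
  have K: "(\<integral>\<^sup>+w. ennreal (\<bar>ctil i w $ p\<bar> powr (4 + 2 * \<delta>)) \<partial>M) \<le> ennreal K" if i: "i \<ge> 1" for i p
  proof (cases "p \<in> J")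
    case True
    have "(\<integral>\<^sup>+w. ennreal (\<bar>ctil i w $ p\<bar> powr (4 + 2 * \<delta>)) \<partial>M)
        \<le> (SUP i\<in>{1..}. SUP j\<in>J. \<integral>\<^sup>+w. ennreal (\<bar>ctil i w $ j\<bar> powr (4 + 2 * \<delta>)) \<partial>M)"
      by (rule SUP_upper2[of i], use i in simp, rule SUP_upper2[OF True order_refl])
    then show ?thesis using sup by (simp add: K_def)
  next
    case False
    have "(\<integral>\<^sup>+w. ennreal (\<bar>ctil i w $ p\<bar> powr (4 + 2 * \<delta>)) \<partial>M) = (\<integral>\<^sup>+w. 0 \<partial>M)"
      by (rule nn_integral_cong_AE) (use outside[OF i, of p] False range in auto)
    then show ?thesis by simp
  qed
  have K0: "K \<ge> 0" by (simp add: K_def)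
  interpret eiv M X0 a0 ctil \<iota> \<sigma> "\<kappa>\<^sup>2" \<Sigma> \<Sigma>inf S Sinf V\<^sub>A
  proof
    show "i \<ge> 1 \<Longrightarrow> integrable M (\<lambda>w. norm (ctil i w) ^ 4)" for i
      by (rule uniform_fourth_moments(1)[OF meas \<delta> K K0])
    show "e > 0 \<Longrightarrow> \<exists>t. \<forall>i\<ge>1. expectation (\<lambda>w. norm (ctil i w) ^ 4 *
          indicator {w. norm (ctil i w) ^ 4 > t} w) \<le> e" for e
      by (rule uniform_fourth_moments(2)[OF meas \<delta> K K0])
    show "\<kappa>\<^sup>2 > 0" using \<kappa>(1) by simp
    show "AE w in M. ctil i w $ p = 0" if "i \<ge> 1" "p \<notin> range \<iota>" for i p by (rule outside[OF that])
    show "padded \<iota> (\<Sigma> i) (S i)" if "i \<ge> 1" for i by (rule pad[OF that])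
  qed (rule inj indep mean0 second \<sigma> \<Sigma>_sym low \<Sigma>inf S_lim rank_Z0 V\<^sub>A; assumption?)+
  have cobs: "c i w = cobs i w" for i w by (simp add: c cobs_def c0_def)
  have "conv_in_prob M Shat (cov_mat N (\<lambda>v. matrix_inv V\<^sub>A *v (Gamma_at Sinf X0 (\<Gamma> v) *v u)))"
  proof (rule S_hat_consistent[OF est N \<Gamma>_rv \<Gamma>[folded Wnoise_def] Shat_rv])
    show "Shat m w = S_hat m (\<lambda>i. cobs i w) S u X"
      if "m \<ge> 1" "w \<in> space M" "est m (\<lambda>i\<in>{1..m}. cobs i w) = Some X"
        "invertible (V_hat m (\<lambda>i. cobs i w) S X)" for m w X
      using Shat[OF that(1,2), unfolded cobs, OF that(3,4)] .
  qed
  then show ?thesis by (simp only: limI[OF S_lim])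
qed

end
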